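(* Let $n\geq1$ and $q\in(0,1)$. For the labelled space $(E_n,\mathcal{L},\mathcal{B})$ described in the context, the $C^*$-algebra $C^*(E_n,\mathcal{L},\mathcal{B})$ is isomorphic to the $C^*$-algebra $C(S^{2n}_{q,\beta})$ of the $2n$-dimensional mirror quantum sphere.
   Context: Labelled spaces. A labelled graph $(E,\mathcal{L})$ over an alphabet $\mathcal{A}$ is a directed graph $E=(E^0,E^1,r,s)$ with a map $\mathcal{L}:E^1\to\mathcal{A}$. Paths are $e_1e_2\cdots e_m$ with $r(e_i)=s(e_{i+1})$; labelled paths are the words $\mathcal{L}(e_1)\cdots\mathcal{L}(e_m)$, and $\mathcal{L}^*(E)$ is the set of all of them ($m\ge1$). For $A\subset E^0$ and a labelled path $\alpha$, $r(A,\alpha)=\{r(\lambda):\mathcal{L}(\lambda)=\alpha,\ s(\lambda)\in A\}$, $r(\alpha)=r(E^0,\alpha)$, $s(\alpha)=\{s(\lambda):\mathcal{L}(\lambda)=\alpha\}$. $\mathcal{B}\subset2^{E^0}$ is accommodating if it is closed under $A\mapsto r(A,\alpha)$, contains all $r(\alpha)$, contains $\{v\}$ for every sink $v$, and is closed under finite unions and intersections; then $(E,\mathcal{L},\mathcal{B})$ is a labelled space, and it is weakly left-resolving if $r(A,\alpha)\cap r(B,\alpha)=r(A\cap B,\alpha)$ for all $A,B\in\mathcal{B}$ and $\alpha\in\mathcal{L}^*(E)$. For a weakly left-resolving labelled space, $C^*(E,\mathcal{L},\mathcal{B})$ is the universal $C^*$-algebra generated by projections $\{p_A:A\in\mathcal{B}\}$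 and partial isometries $\{s_a:a\in\mathcal{L}(E^1)\}$ such that: (1) $p_Ap_B=p_{A\cap B}$, $p_{A\cup B}=p_A+p_B-p_{A\cap B}$, $p_\emptyset=0$; (2) $p_As_a=s_ap_{r(A,a)}$; (3) $s_a^*s_a=p_{r(a)}$, and $s_a^*s_b=0$ unless $a=b$; (4) with $L^1(A)=\{a\in\mathcal{L}(E^1):s(a)\cap A\neq\emptyset\}$, if $L^1(A)$ is finite and non-empty then $p_A=\sum_{a\in L^1(A)}s_ap_{r(A,a)}s_a^*+\sum_{v\in A,\ v\text{ a sink}}p_{\{v\}}$. The labelled space $(E_n,\mathcal{L},\mathcal{B})$. $E_n^0=\{u_i:1\le i\le n-1\}\cup\{v_i:i\ge1\}\cup\{w_1,w_2\}$ and $E_n^1=\{e_{i,j}:1\le i\le j\le n-1\}\cup\{f_{i,j}:1\le i\le n-1,\ j\ge1\}\cup\{g_i,h_i:i\ge1\}$, with $s(e_{i,j})=u_i$, $r(e_{i,j})=u_j$; $s(f_{i,j})=u_i$, $r(f_{i,1})=w_1$, $r(f_{i,2})=w_2$, $r(f_{i,j})=v_{j-2}$ for $j\ge3$; $s(g_1)=w_2$, $s(g_i)=v_{i-1}$ for $i\ge2$, $r(g_i)=v_i$; $s(h_i)=v_i$, $r(h_i)=w_1$. The alphabet is $\{e_{i,j}:1\le i\le j\le n-1\}\cup\{f_i:1\le i\le n-1\}\cup\{g,h\}$, and $\mathcal{L}(e_{i,j})=e_{i,j}$, $\mathcal{L}(f_{i,j})=f_i$, $\mathcal{L}(g_i)=g$,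 $\mathcal{L}(h_i)=h$. Put $A_i=\{v_j:j\ge i\}$; $\mathcal{B}$ is the closure under finite unions and intersections of $\{\{u_i\}:1\le i\le n-1\}\cup\{\{w_1\}\}\cup\{A_i:i\ge1\}\cup\{A_1\cup\{w_2\}\}$. The mirror quantum sphere. For a finite directed graph, the graph $C^*$-algebra is universal for mutually orthogonal projections $P_v$ and partial isometries $S_e$ with $S_e^*S_e=P_{r(e)}$ and $P_v=\sum_{s(e)=v}S_eS_e^*$ for each vertex $v$ emitting at least one edge. Let $M_n$ be the graph with vertices $v_1,\dots,v_{n+1}$ and one edge $e_{i,j}$ from $v_i$ to $v_j$ for each $1\le i\le n$, $i\le j\le n+1$, and let $N_n$ be its full subgraph on $v_1,\dots,v_n$. The quantum disc and sphere algebras are identified as $C(\mathbb{D}^{2n}_q)=C^*(M_n)$ and $C(S^{2n-1}_q)=C^*(N_n)$ (independent of $q$ up to isomorphism). The natural surjection $\pi:C(\mathbb{D}_q^{2n})\to C(S_q^{2n-1})$ sends $P_{v_{n+1}}$ and all $S_{e_{i,n+1}}$ to $0$ and each other generator to the generator of the same name. The flip $\beta\in\operatorname{Aut}(C(S_q^{2n-1}))$ satisfies $\beta(S_{e_{n,n}})=S_{e_{n,n}}^*$ and fixes all $P_{v_i}$ and all other $S_{e_{i,j}}$. Then $C(S^{2n}_{q,\beta})=\{(x,y)\in C(\mathbb{D}^{2n}_q)\oplus C(\mathbb{D}^{2n}_q):\pi(x)=\beta(\pi(y))\}$. *)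

theory Defs
  imports Complex_Main "HOL-Library.Poly_Mapping" "Graph_Theory.Digraph_Component"
begin

section \<open>C*-algebras\<close>

record 'a cstar_struct =
  car :: "'a set"
  czero :: 'a
  cadd :: "'a \<Rightarrow> 'a \<Rightarrow> 'a"
  cscale :: "complex \<Rightarrow> 'a \<Rightarrow> 'a"
  cmult :: "'a \<Rightarrow> 'a \<Rightarrow> 'a"
  cadj :: "'a \<Rightarrow> 'a"
  cnorm :: "'a \<Rightarrow> real"

definition cdiff :: "'a cstar_struct \<Rightarrow> 'a \<Rightarrow> 'a \<Rightarrow> 'a" where
  "cdiff A x y = cadd A x (cscale A (- 1) y)"

text \<open>A unit is not required.\<close>

locale cstar_algebra =
  fixes A :: "'a cstar_struct"
  assumes zero_closed: "czero A \<in> car A"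
    and add_closed: "\<lbrakk>x \<in> car A; y \<in> car A\<rbrakk> \<Longrightarrow> cadd A x y \<in> car A"
    and scale_closed: "x \<in> car A \<Longrightarrow> cscale A c x \<in> car A"
    and mult_closed: "\<lbrakk>x \<in> car A; y \<in> car A\<rbrakk> \<Longrightarrow> cmult A x y \<in> car A"
    and adj_closed: "x \<in> car A \<Longrightarrow> cadj A x \<in> car A"
    and add_assoc: "\<lbrakk>x \<in> car A; y \<in> car A; z \<in> car A\<rbrakk> \<Longrightarrow>
      cadd A (cadd A x y) z = cadd A x (cadd A y z)"
    and add_commute: "\<lbrakk>x \<in> car A; y \<in> car A\<rbrakk> \<Longrightarrow> cadd A x y = cadd A y x"
    and add_zero: "x \<in> car A \<Longrightarrow> cadd A x (czero A) = x"
    and add_inverse: "x \<in> car A \<Longrightarrow> cdiff A x x = czero A"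
    and scale_add_right: "\<lbrakk>x \<in> car A; y \<in> car A\<rbrakk> \<Longrightarrow>
      cscale A c (cadd A x y) = cadd A (cscale A c x) (cscale A c y)"
    and scale_add_left: "x \<in> car A \<Longrightarrow>
      cscale A (c + d) x = cadd A (cscale A c x) (cscale A d x)"
    and scale_scale: "x \<in> car A \<Longrightarrow> cscale A c (cscale A d x) = cscale A (c * d) x"
    and scale_one: "x \<in> car A \<Longrightarrow> cscale A 1 x = x"
    and mult_assoc: "\<lbrakk>x \<in> car A; y \<in> car A; z \<in> car A\<rbrakk> \<Longrightarrow>
      cmult A (cmult A x y) z = cmult A x (cmult A y z)"
    and mult_add_left: "\<lbrakk>x \<in> car A; y \<in> car A; z \<in> car A\<rbrakk> \<Longrightarrow>
      cmult A (cadd A x y) z = cadd A (cmult A x z) (cmult A y z)"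
    and mult_add_right: "\<lbrakk>x \<in> car A; y \<in> car A; z \<in> car A\<rbrakk> \<Longrightarrow>
      cmult A x (cadd A y z) = cadd A (cmult A x y) (cmult A x z)"
    and mult_scale_left: "\<lbrakk>x \<in> car A; y \<in> car A\<rbrakk> \<Longrightarrow>
      cmult A (cscale A c x) y = cscale A c (cmult A x y)"
    and mult_scale_right: "\<lbrakk>x \<in> car A; y \<in> car A\<rbrakk> \<Longrightarrow>
      cmult A x (cscale A c y) = cscale A c (cmult A x y)"
    and adj_adj: "x \<in> car A \<Longrightarrow> cadj A (cadj A x) = x"
    and adj_add: "\<lbrakk>x \<in> car A; y \<in> car A\<rbrakk> \<Longrightarrow>
      cadj A (cadd A x y) = cadd A (cadj A x) (cadj A y)"
    and adj_scale: "x \<in> car A \<Longrightarrow> cadj A (cscale A c x) = cscale A (cnj c) (cadj A x)"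
    and adj_mult: "\<lbrakk>x \<in> car A; y \<in> car A\<rbrakk> \<Longrightarrow>
      cadj A (cmult A x y) = cmult A (cadj A y) (cadj A x)"
    and norm_nonneg: "x \<in> car A \<Longrightarrow> 0 \<le> cnorm A x"
    and norm_eq_zero: "x \<in> car A \<Longrightarrow> cnorm A x = 0 \<longleftrightarrow> x = czero A"
    and norm_triangle: "\<lbrakk>x \<in> car A; y \<in> car A\<rbrakk> \<Longrightarrow>
      cnorm A (cadd A x y) \<le> cnorm A x + cnorm A y"
    and norm_scale: "x \<in> car A \<Longrightarrow> cnorm A (cscale A c x) = cmod c * cnorm A x"
    and norm_mult: "\<lbrakk>x \<in> car A; y \<in> car A\<rbrakk> \<Longrightarrow>
      cnorm A (cmult A x y) \<le> cnorm A x * cnorm A y"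
    and norm_cstar: "x \<in> car A \<Longrightarrow> cnorm A (cmult A (cadj A x) x) = (cnorm A x)\<^sup>2"
    and norm_complete: "\<lbrakk>\<And>k. X k \<in> car A;
        \<And>e. e > 0 \<Longrightarrow> \<exists>M. \<forall>m\<ge>M. \<forall>k\<ge>M. cnorm A (cdiff A (X m) (X k)) < e\<rbrakk> \<Longrightarrow>
      \<exists>x\<in>car A. (\<lambda>k. cnorm A (cdiff A (X k) x)) \<longlonglongrightarrow> 0"

definition star_hom :: "'a cstar_struct \<Rightarrow> 'b cstar_struct \<Rightarrow> ('a \<Rightarrow> 'b) \<Rightarrow> bool" where
  "star_hom A B f \<longleftrightarrow>
     (\<forall>x\<in>car A. f x \<in> car B) \<and>
     (\<forall>x\<in>car A. \<forall>y\<in>car A. f (cadd A x y) = cadd B (f x) (f y)) \<and>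
     (\<forall>c. \<forall>x\<in>car A. f (cscale A c x) = cscale B c (f x)) \<and>
     (\<forall>x\<in>car A. \<forall>y\<in>car A. f (cmult A x y) = cmult B (f x) (f y)) \<and>
     (\<forall>x\<in>car A. f (cadj A x) = cadj B (f x))"

definition star_iso :: "'a cstar_struct \<Rightarrow> 'b cstar_struct \<Rightarrow> ('a \<Rightarrow> 'b) \<Rightarrow> bool" where
  "star_iso A B f \<longleftrightarrow> star_hom A B f \<and> bij_betw f (car A) (car B)"

definition cstar_isomorphic :: "'a cstar_struct \<Rightarrow> 'b cstar_struct \<Rightarrow> bool" (infix "\<cong>\<^sub>C\<^sub>*" 50)
  where "A \<cong>\<^sub>C\<^sub>* B \<longleftrightarrow> (\<exists>f. star_iso A B f)"

definition contractive :: "'a cstar_struct \<Rightarrow> 'b cstar_struct \<Rightarrow> ('a \<Rightarrow> 'b) \<Rightarrow> bool" where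
  "contractive A B f \<longleftrightarrow> (\<forall>x\<in>car A. cnorm B (f x) \<le> cnorm A x)"

definition direct_sum :: "'a cstar_struct \<Rightarrow> 'b cstar_struct \<Rightarrow> ('a \<times> 'b) cstar_struct" where
  "direct_sum A B = \<lparr>
     car = car A \<times> car B,
     czero = (czero A, czero B),
     cadd = (\<lambda>(x, y) (x', y'). (cadd A x x', cadd B y y')),
     cscale = (\<lambda>c (x, y). (cscale A c x, cscale B c y)),
     cmult = (\<lambda>(x, y) (x', y'). (cmult A x x', cmult B y y')),
     cadj = (\<lambda>(x, y). (cadj A x, cadj B y)),
     cnorm = (\<lambda>(x, y). max (cnorm A x) (cnorm B y)) \<rparr>"

section \<open>Non-commutative *-polynomials\<close>

text \<open>A letter \<open>(g, False)\<close> stands for the generator \<open>g\<close>, and \<open>(g, True)\<close> for its adjoint.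
  Words are added by concatenation, so that the convolution product of
  finitely supported functions on words is the product of *-polynomials.\<close>

datatype 'g word = Word (letters: "('g \<times> bool) list")

instantiation word :: (type) monoid_add
begin

definition zero_word :: "'a word" where "0 = Word []"
definition plus_word :: "'a word \<Rightarrow> 'a word \<Rightarrow> 'a word" where
  "u + v = Word (letters u @ letters v)"

instance
  by standard (auto simp: zero_word_def plus_word_def)

end

type_synonym 'g star_poly = "'g word \<Rightarrow>\<^sub>0 complex"

definition gen :: "'g \<Rightarrow> 'g star_poly" where
  "gen g = Poly_Mapping.single (Word [(g, False)]) 1"

definition scale :: "complex \<Rightarrow> 'g star_poly \<Rightarrow> 'g star_poly" where
  "scale c x = Poly_Mapping.single 0 c * x"

definition adj_word :: "'g word \<Rightarrow> 'g word" where
  "adj_word w = Word (rev (map (\<lambda>(g, b). (g, \<not> b)) (letters w)))"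

definition adj :: "'g star_poly \<Rightarrow> 'g star_poly" where
  "adj x = (\<Sum>w\<in>Poly_Mapping.keys x.
     Poly_Mapping.single (adj_word w) (cnj (Poly_Mapping.lookup x w)))"

text \<open>The free complex *-algebra on \<open>X\<close>. It has no unit: the empty word is excluded.\<close>

definition free_star :: "'g set \<Rightarrow> 'g star_poly set" where
  "free_star X = {x. \<forall>w\<in>Poly_Mapping.keys x. w \<noteq> 0 \<and> fst ` set (letters w) \<subseteq> X}"

section \<open>Universal C*-algebras\<close>

definition cstar_seminorm :: "'g set \<Rightarrow> ('g star_poly \<Rightarrow> real) \<Rightarrow> bool" where
  "cstar_seminorm X p \<longleftrightarrow>
     (\<forall>x\<in>free_star X. 0 \<le> p x) \<and>
     (\<forall>x\<in>free_star X. \<forall>y\<in>free_star X. p (x + y) \<le> p x + p y) \<and>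
     (\<forall>c. \<forall>x\<in>free_star X. p (scale c x) = cmod c * p x) \<and>
     (\<forall>x\<in>free_star X. \<forall>y\<in>free_star X. p (x * y) \<le> p x * p y) \<and>
     (\<forall>x\<in>free_star X. p (adj x * x) = (p x)\<^sup>2)"

text \<open>The C*-seminorms on a *-algebra are exactly the seminorms \<open>x \<mapsto> \<parallel>\<rho> x\<parallel>\<close> for the
  *-homomorphisms \<open>\<rho>\<close> into C*-algebras. An element \<open>r\<close> of \<open>R\<close> encodes the relation
  \<open>r = 0\<close>. The universal C*-algebra generated by \<open>X\<close> subject to \<open>R\<close> is the Hausdorff
  completion of the free *-algebra in the largest C*-seminorm that vanishes on \<open>R\<close>;
  this makes sense when the supremum is finite, as it is for relations making every
  generator a partial isometry.\<close>

definition admissible :: "'g set \<Rightarrow> 'g star_poly set \<Rightarrow> ('g star_poly \<Rightarrow> real) set" where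
  "admissible X R = {p. cstar_seminorm X p \<and> (\<forall>r\<in>R. p r = 0)}"

definition univ_norm :: "'g set \<Rightarrow> 'g star_poly set \<Rightarrow> 'g star_poly \<Rightarrow> real" where
  "univ_norm X R x = (SUP p\<in>admissible X R. p x)"

definition cauchy_seqs ::
    "'g star_poly set \<Rightarrow> ('g star_poly \<Rightarrow> real) \<Rightarrow> (nat \<Rightarrow> 'g star_poly) set" where
  "cauchy_seqs F N = {x. (\<forall>k. x k \<in> F) \<and>
     (\<forall>e>0. \<exists>M. \<forall>m\<ge>M. \<forall>k\<ge>M. N (x m - x k) < e)}"

definition null_rel ::
    "'g star_poly set \<Rightarrow> ('g star_poly \<Rightarrow> real) \<Rightarrow> ((nat \<Rightarrow> 'g star_poly) \<times> (nat \<Rightarrow> 'g star_poly)) set"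
  where "null_rel F N = {(x, y). x \<in> cauchy_seqs F N \<and> y \<in> cauchy_seqs F N \<and>
     (\<lambda>k. N (x k - y k)) \<longlonglongrightarrow> 0}"

definition rep :: "(nat \<Rightarrow> 'g star_poly) set \<Rightarrow> nat \<Rightarrow> 'g star_poly" where
  "rep a = (SOME x. x \<in> a)"

definition completion ::
    "'g star_poly set \<Rightarrow> ('g star_poly \<Rightarrow> real) \<Rightarrow> (nat \<Rightarrow> 'g star_poly) set cstar_struct" where
  "completion F N = \<lparr>
     car = cauchy_seqs F N // null_rel F N,
     czero = null_rel F N `` {\<lambda>k. 0},
     cadd = (\<lambda>a b. null_rel F N `` {\<lambda>k. rep a k + rep b k}),
     cscale = (\<lambda>c a. null_rel F N `` {\<lambda>k. scale c (rep a k)}),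
     cmult = (\<lambda>a b. null_rel F N `` {\<lambda>k. rep a k * rep b k}),
     cadj = (\<lambda>a. null_rel F N `` {\<lambda>k. adj (rep a k)}),
     cnorm = (\<lambda>a. lim (\<lambda>k. N (rep a k))) \<rparr>"

definition univ_cstar ::
    "'g set \<Rightarrow> 'g star_poly set \<Rightarrow> (nat \<Rightarrow> 'g star_poly) set cstar_struct" where
  "univ_cstar X R = completion (free_star X) (univ_norm X R)"

definition univ_elem ::
    "'g set \<Rightarrow> 'g star_poly set \<Rightarrow> 'g star_poly \<Rightarrow> (nat \<Rightarrow> 'g star_poly) set" where
  "univ_elem X R x = null_rel (free_star X) (univ_norm X R) `` {\<lambda>k. x}"

section \<open>Labelled spaces and their C*-algebras\<close>

text \<open>A labelled graph is a graph \<open>G\<close> with a labelling \<open>L\<close> of its arcs, over the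
  alphabet \<open>L ` arcs G\<close>.\<close>

definition labelled_path ::
    "('v, 'e) pre_digraph \<Rightarrow> ('e \<Rightarrow> 'l) \<Rightarrow> 'v \<Rightarrow> 'l list \<Rightarrow> 'v \<Rightarrow> bool" where
  "labelled_path G L u \<alpha> v \<longleftrightarrow> (\<exists>p. p \<noteq> [] \<and> pre_digraph.awalk G u p v \<and> map L p = \<alpha>)"

definition labelled_paths :: "('v, 'e) pre_digraph \<Rightarrow> ('e \<Rightarrow> 'l) \<Rightarrow> 'l list set" where
  "labelled_paths G L = {\<alpha>. \<exists>u v. labelled_path G L u \<alpha> v}"

definition rel_range ::
    "('v, 'e) pre_digraph \<Rightarrow> ('e \<Rightarrow> 'l) \<Rightarrow> 'v set \<Rightarrow> 'l list \<Rightarrow> 'v set" where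
  "rel_range G L A \<alpha> = {v. \<exists>u\<in>A. labelled_path G L u \<alpha> v}"

definition path_range :: "('v, 'e) pre_digraph \<Rightarrow> ('e \<Rightarrow> 'l) \<Rightarrow> 'l list \<Rightarrow> 'v set" where
  "path_range G L \<alpha> = rel_range G L (verts G) \<alpha>"

definition path_source :: "('v, 'e) pre_digraph \<Rightarrow> ('e \<Rightarrow> 'l) \<Rightarrow> 'l list \<Rightarrow> 'v set" where
  "path_source G L \<alpha> = {u. \<exists>v. labelled_path G L u \<alpha> v}"

definition is_sink :: "('v, 'e) pre_digraph \<Rightarrow> 'v \<Rightarrow> bool" where
  "is_sink G v \<longleftrightarrow> v \<in> verts G \<and> out_arcs G v = {}"

definition accommodating ::
    "('v, 'e) pre_digraph \<Rightarrow> ('e \<Rightarrow> 'l) \<Rightarrow> 'v set set \<Rightarrow> bool" where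
  "accommodating G L \<B> \<longleftrightarrow>
     \<B> \<subseteq> Pow (verts G) \<and>
     (\<forall>A\<in>\<B>. \<forall>\<alpha>\<in>labelled_paths G L. rel_range G L A \<alpha> \<in> \<B>) \<and>
     (\<forall>\<alpha>\<in>labelled_paths G L. path_range G L \<alpha> \<in> \<B>) \<and>
     (\<forall>v. is_sink G v \<longrightarrow> {v} \<in> \<B>) \<and>
     (\<forall>A\<in>\<B>. \<forall>B\<in>\<B>. A \<union> B \<in> \<B> \<and> A \<inter> B \<in> \<B>)"

definition weakly_left_resolving ::
    "('v, 'e) pre_digraph \<Rightarrow> ('e \<Rightarrow> 'l) \<Rightarrow> 'v set set \<Rightarrow> bool" where
  "weakly_left_resolving G L \<B> \<longleftrightarrow>
     (\<forall>A\<in>\<B>. \<forall>B\<in>\<B>. \<forall>\<alpha>\<in>labelled_paths G L.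
        rel_range G L A \<alpha> \<inter> rel_range G L B \<alpha> = rel_range G L (A \<inter> B) \<alpha>)"

definition emitted_labels ::
    "('v, 'e) pre_digraph \<Rightarrow> ('e \<Rightarrow> 'l) \<Rightarrow> 'v set \<Rightarrow> 'l set" where
  "emitted_labels G L A = {a \<in> L ` arcs G. path_source G L [a] \<inter> A \<noteq> {}}"

datatype ('v, 'l) lgen = LProj "'v set" | LIso 'l

abbreviation lp :: "'v set \<Rightarrow> ('v, 'l) lgen star_poly" where "lp A \<equiv> gen (LProj A)"
abbreviation ls :: "'l \<Rightarrow> ('v, 'l) lgen star_poly" where "ls a \<equiv> gen (LIso a)"

definition labelled_gens ::
    "('v, 'e) pre_digraph \<Rightarrow> ('e \<Rightarrow> 'l) \<Rightarrow> 'v set set \<Rightarrow> ('v, 'l) lgen set" where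
  "labelled_gens G L \<B> = LProj ` \<B> \<union> LIso ` L ` arcs G"

text \<open>In the last relation the sum over the sinks in \<open>A\<close> is meaningful when there are finitely
  many of them; the graph considered below has only one sink.\<close>

definition labelled_rels ::
    "('v, 'e) pre_digraph \<Rightarrow> ('e \<Rightarrow> 'l) \<Rightarrow> 'v set set \<Rightarrow> ('v, 'l) lgen star_poly set" where
  "labelled_rels G L \<B> =
     {adj (lp A) - lp A |A. A \<in> \<B>} \<union>
     {lp A * lp A - lp A |A. A \<in> \<B>} \<union>
     {ls a * adj (ls a) * ls a - ls a |a. a \<in> L ` arcs G} \<union>
     {lp A * lp B - lp (A \<inter> B) |A B. A \<in> \<B> \<and> B \<in> \<B>} \<union>
     {lp (A \<union> B) - (lp A + lp B - lp (A \<inter> B)) |A B. A \<in> \<B> \<and> B \<in> \<B>} \<union>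
     {lp {}} \<union>
     {lp A * ls a - ls a * lp (rel_range G L A [a]) |A a. A \<in> \<B> \<and> a \<in> L ` arcs G} \<union>
     {adj (ls a) * ls a - lp (path_range G L [a]) |a. a \<in> L ` arcs G} \<union>
     {adj (ls a) * ls b |a b. a \<in> L ` arcs G \<and> b \<in> L ` arcs G \<and> a \<noteq> b} \<union>
     {lp A - ((\<Sum>a\<in>emitted_labels G L A. ls a * lp (rel_range G L A [a]) * adj (ls a)) +
              (\<Sum>v\<in>{v \<in> A. is_sink G v}. lp {v}))
        |A. A \<in> \<B> \<and> finite (emitted_labels G L A) \<and> emitted_labels G L A \<noteq> {}}"

definition labelled_cstar ::
    "('v, 'e) pre_digraph \<Rightarrow> ('e \<Rightarrow> 'l) \<Rightarrow> 'v set set \<Rightarrow>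
      (nat \<Rightarrow> ('v, 'l) lgen star_poly) set cstar_struct" where
  "labelled_cstar G L \<B> = univ_cstar (labelled_gens G L \<B>) (labelled_rels G L \<B>)"

section \<open>Graph C*-algebras of finite graphs\<close>

datatype ('v, 'e) ggen = GProj 'v | GIso 'e

abbreviation gp :: "'v \<Rightarrow> ('v, 'e) ggen star_poly" where "gp v \<equiv> gen (GProj v)"
abbreviation gs :: "'e \<Rightarrow> ('v, 'e) ggen star_poly" where "gs e \<equiv> gen (GIso e)"

definition graph_gens :: "('v, 'e) pre_digraph \<Rightarrow> ('v, 'e) ggen set" where
  "graph_gens G = GProj ` verts G \<union> GIso ` arcs G"

definition graph_rels :: "('v, 'e) pre_digraph \<Rightarrow> ('v, 'e) ggen star_poly set" where
  "graph_rels G =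
     {adj (gp v) - gp v |v. v \<in> verts G} \<union>
     {gp v * gp v - gp v |v. v \<in> verts G} \<union>
     {gp v * gp w |v w. v \<in> verts G \<and> w \<in> verts G \<and> v \<noteq> w} \<union>
     {gs e * adj (gs e) * gs e - gs e |e. e \<in> arcs G} \<union>
     {adj (gs e) * gs e - gp (head G e) |e. e \<in> arcs G} \<union>
     {gp v - (\<Sum>e\<in>out_arcs G v. gs e * adj (gs e)) |v. v \<in> verts G \<and> out_arcs G v \<noteq> {}}"

definition graph_cstar ::
    "('v, 'e) pre_digraph \<Rightarrow> (nat \<Rightarrow> ('v, 'e) ggen star_poly) set cstar_struct" where
  "graph_cstar G = univ_cstar (graph_gens G) (graph_rels G)"

section \<open>The labelled space of the mirror quantum sphere\<close>

datatype vert = VU nat | VV nat | VW1 | VW2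
datatype edge = EE nat nat | EF nat nat | EG nat | EH nat
datatype label = LE nat nat | LF nat | LG | LH

definition mirror_graph :: "nat \<Rightarrow> (vert, edge) pre_digraph" where
  "mirror_graph n = \<lparr>
     verts = VU ` {1..n - 1} \<union> VV ` {1..} \<union> {VW1, VW2},
     arcs = {EE i j |i j. 1 \<le> i \<and> i \<le> j \<and> j \<le> n - 1} \<union>
            {EF i j |i j. 1 \<le> i \<and> i \<le> n - 1 \<and> 1 \<le> j} \<union> EG ` {1..} \<union> EH ` {1..},
     tail = (\<lambda>e. case e of EE i j \<Rightarrow> VU i | EF i j \<Rightarrow> VU i
               | EG i \<Rightarrow> (if i = 1 then VW2 else VV (i - 1)) | EH i \<Rightarrow> VV i),
     head = (\<lambda>e. case e of EE i j \<Rightarrow> VU j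
               | EF i j \<Rightarrow> (if j = 1 then VW1 else if j = 2 then VW2 else VV (j - 2))
               | EG i \<Rightarrow> VV i | EH i \<Rightarrow> VW1) \<rparr>"

fun mirror_label :: "edge \<Rightarrow> label" where
  "mirror_label (EE i j) = LE i j"
| "mirror_label (EF i j) = LF i"
| "mirror_label (EG i) = LG"
| "mirror_label (EH i) = LH"

definition V_from :: "nat \<Rightarrow> vert set" where
  "V_from i = VV ` {i..}"

inductive_set mirror_sets :: "nat \<Rightarrow> vert set set" for n :: nat where
  "1 \<le> i \<Longrightarrow> i \<le> n - 1 \<Longrightarrow> {VU i} \<in> mirror_sets n"
| "{VW1} \<in> mirror_sets n"
| "1 \<le> i \<Longrightarrow> V_from i \<in> mirror_sets n"
| "V_from 1 \<union> {VW2} \<in> mirror_sets n"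
| "A \<in> mirror_sets n \<Longrightarrow> B \<in> mirror_sets n \<Longrightarrow> A \<union> B \<in> mirror_sets n"
| "A \<in> mirror_sets n \<Longrightarrow> B \<in> mirror_sets n \<Longrightarrow> A \<inter> B \<in> mirror_sets n"

section \<open>The mirror quantum sphere\<close>

text \<open>The vertex \<open>v\<^sub>i\<close> is the number \<open>i\<close>, and the edge \<open>e\<^sub>i\<^sub>,\<^sub>j\<close> is the pair \<open>(i, j)\<close>.\<close>

definition disc_graph :: "nat \<Rightarrow> (nat, nat \<times> nat) pre_digraph" where
  "disc_graph n = \<lparr> verts = {1..n + 1},
     arcs = {(i, j). 1 \<le> i \<and> i \<le> n \<and> i \<le> j \<and> j \<le> n + 1}, tail = fst, head = snd \<rparr>"

definition sphere_graph :: "nat \<Rightarrow> (nat, nat \<times> nat) pre_digraph" where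
  "sphere_graph n = disc_graph n \<restriction> {1..n}"

type_synonym qelem = "(nat \<Rightarrow> (nat, nat \<times> nat) ggen star_poly) set"

text \<open>The deformation parameter \<open>q\<close> does not enter the graph descriptions of the quantum
  disc of dimension \<open>2 n\<close> and the quantum sphere of dimension \<open>2 n - 1\<close>.\<close>

definition quantum_disc :: "real \<Rightarrow> nat \<Rightarrow> qelem cstar_struct" where
  "quantum_disc q n = graph_cstar (disc_graph n)"

definition quantum_sphere :: "real \<Rightarrow> nat \<Rightarrow> qelem cstar_struct" where
  "quantum_sphere q n = graph_cstar (sphere_graph n)"

definition disc_elem :: "nat \<Rightarrow> (nat, nat \<times> nat) ggen star_poly \<Rightarrow> qelem" where
  "disc_elem n = univ_elem (graph_gens (disc_graph n)) (graph_rels (disc_graph n))"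

definition sphere_elem :: "nat \<Rightarrow> (nat, nat \<times> nat) ggen star_poly \<Rightarrow> qelem" where
  "sphere_elem n = univ_elem (graph_gens (sphere_graph n)) (graph_rels (sphere_graph n))"

text \<open>In both definitions the map is determined on generators. A *-homomorphism of
  C*-algebras is automatically contractive; the clause is there to make the uniqueness
  of the map immediate.\<close>

definition is_disc_to_sphere :: "real \<Rightarrow> nat \<Rightarrow> (qelem \<Rightarrow> qelem) \<Rightarrow> bool" where
  "is_disc_to_sphere q n \<pi> \<longleftrightarrow>
     star_hom (quantum_disc q n) (quantum_sphere q n) \<pi> \<and>
     contractive (quantum_disc q n) (quantum_sphere q n) \<pi> \<and>
     \<pi> (disc_elem n (gp (n + 1))) = czero (quantum_sphere q n) \<and>
     (\<forall>i\<in>{1..n}. \<pi> (disc_elem n (gs (i, n + 1))) = czero (quantum_sphere q n)) \<and>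
     (\<forall>i\<in>{1..n}. \<pi> (disc_elem n (gp i)) = sphere_elem n (gp i)) \<and>
     (\<forall>j\<in>{1..n}. \<forall>i\<in>{1..j}. \<pi> (disc_elem n (gs (i, j))) = sphere_elem n (gs (i, j)))"

definition disc_to_sphere :: "real \<Rightarrow> nat \<Rightarrow> qelem \<Rightarrow> qelem" where
  "disc_to_sphere q n = (SOME \<pi>. is_disc_to_sphere q n \<pi>)"

definition is_flip :: "real \<Rightarrow> nat \<Rightarrow> (qelem \<Rightarrow> qelem) \<Rightarrow> bool" where
  "is_flip q n \<beta> \<longleftrightarrow>
     star_iso (quantum_sphere q n) (quantum_sphere q n) \<beta> \<and>
     contractive (quantum_sphere q n) (quantum_sphere q n) \<beta> \<and>
     \<beta> (sphere_elem n (gs (n, n))) = cadj (quantum_sphere q n) (sphere_elem n (gs (n, n))) \<and>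
     (\<forall>i\<in>{1..n}. \<beta> (sphere_elem n (gp i)) = sphere_elem n (gp i)) \<and>
     (\<forall>j\<in>{1..n}. \<forall>i\<in>{1..j}. (i, j) \<noteq> (n, n) \<longrightarrow>
        \<beta> (sphere_elem n (gs (i, j))) = sphere_elem n (gs (i, j)))"

definition flip :: "real \<Rightarrow> nat \<Rightarrow> qelem \<Rightarrow> qelem" where
  "flip q n = (SOME \<beta>. is_flip q n \<beta>)"

definition mirror_sphere :: "real \<Rightarrow> nat \<Rightarrow> (qelem \<times> qelem) cstar_struct" where
  "mirror_sphere q n = (direct_sum (quantum_disc q n) (quantum_disc q n))
     \<lparr>car := {(x, y). x \<in> car (quantum_disc q n) \<and> y \<in> car (quantum_disc q n) \<and>
        disc_to_sphere q n x = flip q n (disc_to_sphere q n y)}\<rparr>"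

section \<open>Well-definedness\<close>

text \<open>The remaining results certify the definitions: \<open>univ_cstar\<close> is a C*-algebra and has the
  universal property with respect to C*-algebras of every type, the maps chosen in
  \<open>disc_to_sphere\<close> and \<open>flip\<close> exist, and the labelled space is an accommodating and
  weakly left-resolving one.\<close>

subsection \<open>Arithmetic of *-polynomials\<close>

lemma lookup_adj: "Poly_Mapping.lookup (adj x) w = cnj (Poly_Mapping.lookup x (adj_word w))"
proof -
  have inv: "adj_word (adj_word v) = v" for v :: "'a word"
    by (cases v) (auto simp: adj_word_def rev_map comp_def case_prod_beta)
  have "Poly_Mapping.lookup (adj x) w =
      (\<Sum>v\<in>Poly_Mapping.keys x. if v = adj_word w then cnj (Poly_Mapping.lookup x v) else 0)"
    unfolding adj_def lookup_sum lookup_single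
    by (rule sum.cong) (auto simp: when_def inv)
  also have "\<dots> = cnj (Poly_Mapping.lookup x (adj_word w))"
    by (simp add: not_in_keys_iff_lookup_eq_zero sum.delta')
  finally show ?thesis .
qed

lemma adj_word_adj_word [simp]: "adj_word (adj_word v) = v"
  by (cases v) (auto simp: adj_word_def rev_map comp_def case_prod_beta)

lemma adj_word_0 [simp]: "adj_word 0 = 0"
  by (simp add: adj_word_def zero_word_def)

lemma adj_word_add: "adj_word (u + v) = adj_word v + adj_word u"
  by (simp add: adj_word_def plus_word_def)

lemma adj_word_eq_0 [simp]: "adj_word v = 0 \<longleftrightarrow> v = 0"
  by (cases v) (simp add: adj_word_def zero_word_def)

lemma adj_word_gens: "fst ` set (letters (adj_word v)) = fst ` set (letters v)"
  by (force simp: adj_word_def image_image case_prod_beta)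

lemma star_poly_induct [case_names zero single add]:
  fixes x :: "'g star_poly"
  assumes "P 0" "\<And>w c. P (Poly_Mapping.single w c)" "\<And>x y. P x \<Longrightarrow> P y \<Longrightarrow> P (x + y)"
  shows "P x"
proof -
  have eq: "x = (\<Sum>w\<in>Poly_Mapping.keys x. Poly_Mapping.single w (Poly_Mapping.lookup x w))"
    by (rule poly_mapping_eqI)
      (simp add: lookup_sum lookup_single when_def sum.delta not_in_keys_iff_lookup_eq_zero)
  have "P (\<Sum>w\<in>S. Poly_Mapping.single w (Poly_Mapping.lookup x w))" if "finite S" for S
    using that by induction (auto intro: assms)
  thus ?thesis using eq by (metis finite_keys)
qed

lemma adj_add [simp]: "adj (x + y) = adj x + adj y"
  by (rule poly_mapping_eqI) (simp add: lookup_adj lookup_add)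

lemma adj_uminus [simp]: "adj (- x) = - adj x"
  by (rule poly_mapping_eqI) (simp add: lookup_adj)

lemma adj_diff [simp]: "adj (x - y) = adj x - adj y"
  by (rule poly_mapping_eqI) (simp add: lookup_adj lookup_minus)

lemma adj_0 [simp]: "adj 0 = 0"
  by (rule poly_mapping_eqI) (simp add: lookup_adj)

lemma adj_sum: "adj (sum f S) = (\<Sum>i\<in>S. adj (f i))"
  by (induction S rule: infinite_finite_induct) auto

lemma adj_adj [simp]: "adj (adj x) = x"
  by (rule poly_mapping_eqI) (simp add: lookup_adj)

lemma adj_single: "adj (Poly_Mapping.single w c) = Poly_Mapping.single (adj_word w) (cnj c)"
  by (rule poly_mapping_eqI) (auto simp add: lookup_adj lookup_single when_def)

lemma adj_mult [simp]: "adj (x * y) = adj y * adj x"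
proof (induction x rule: star_poly_induct)
  case (single w c)
  show ?case
    by (induction y rule: star_poly_induct)
      (simp_all add: adj_single mult_single adj_word_add algebra_simps)
qed (simp_all add: algebra_simps)

lemma single_0_commute:
  fixes x :: "'g star_poly"
  shows "x * Poly_Mapping.single 0 c = Poly_Mapping.single 0 c * x"
  by (induction x rule: star_poly_induct) (simp_all add: mult_single algebra_simps)

lemma adj_scale [simp]: "adj (scale c x) = scale (cnj c) (adj x)"
  by (simp add: scale_def adj_single single_0_commute)

lemma lookup_scale: "Poly_Mapping.lookup (scale c x) w = c * Poly_Mapping.lookup x w"
proof (induction x rule: star_poly_induct)
  case (single v d)
  show ?case by (auto simp: scale_def mult_single lookup_single when_def)
qed (simp_all add: scale_def algebra_simps lookup_add)

lemma pscale_add_right: "scale c (x + y) = scale c x + scale c y"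
  and pscale_add_left: "scale (c + d) x = scale c x + scale d x"
  and pscale_scale: "scale c (scale d x) = scale (c * d) x"
  and pscale_one: "scale 1 x = x"
  and pscale_minus_one: "scale (- 1) x = - x"
  and pscale_zero: "scale c 0 = 0"
  and pscale_zero_left: "scale 0 x = 0"
  and pscale_diff: "scale c (x - y) = scale c x - scale c y"
  by (rule poly_mapping_eqI; simp add: lookup_scale lookup_add lookup_minus algebra_simps)+

lemma pmult_scale_left: "scale c x * y = scale c (x * y)"
  and pmult_scale_right: "x * scale c y = scale c (x * y)"
  unfolding scale_def by (simp_all add: mult.assoc flip: single_0_commute)

lemma free_star_0 [simp]: "0 \<in> free_star X"
  by (simp add: free_star_def)

lemma free_star_add [simp]: "x \<in> free_star X \<Longrightarrow> y \<in> free_star X \<Longrightarrow> x + y \<in> free_star X"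
  using keys_add[of x y] by (auto simp: free_star_def)

lemma free_star_scale [simp]: "x \<in> free_star X \<Longrightarrow> scale c x \<in> free_star X"
  by (auto simp: free_star_def in_keys_iff lookup_scale)

lemma free_star_uminus [simp]: "x \<in> free_star X \<Longrightarrow> - x \<in> free_star X"
  by (auto simp: free_star_def in_keys_iff)

lemma free_star_diff [simp]: "x \<in> free_star X \<Longrightarrow> y \<in> free_star X \<Longrightarrow> x - y \<in> free_star X"
  using free_star_add[of x X "- y"] by simp

lemma free_star_mult [simp]:
  assumes "x \<in> free_star X" "y \<in> free_star X" shows "x * y \<in> free_star X"
proof -
  have "w \<noteq> 0 \<and> fst ` set (letters w) \<subseteq> X" if "w \<in> Poly_Mapping.keys (x * y)" for w
  proof -
    obtain a b where ab: "w = a + b" "a \<in> Poly_Mapping.keys x" "b \<in> Poly_Mapping.keys y"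
      using keys_mult[of x y] \<open>w \<in> Poly_Mapping.keys (x * y)\<close> by blast
    with assms have "a \<noteq> 0" "fst ` set (letters a) \<subseteq> X" "fst ` set (letters b) \<subseteq> X"
      by (auto simp: free_star_def)
    thus ?thesis using ab(1) by (cases a) (auto simp: plus_word_def zero_word_def)
  qed
  thus ?thesis by (simp add: free_star_def)
qed

lemma free_star_adj [simp]: "x \<in> free_star X \<Longrightarrow> adj x \<in> free_star X"
proof -
  assume x: "x \<in> free_star X"
  have "w \<noteq> 0 \<and> fst ` set (letters w) \<subseteq> X" if "w \<in> Poly_Mapping.keys (adj x)" for w
  proof -
    have "adj_word w \<in> Poly_Mapping.keys x" using that by (simp add: in_keys_iff lookup_adj)
    with x have "adj_word w \<noteq> 0 \<and> fst ` set (letters (adj_word w)) \<subseteq> X"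
      unfolding free_star_def by blast
    thus ?thesis by (simp add: adj_word_gens)
  qed
  thus ?thesis by (simp add: free_star_def)
qed

lemma free_star_gen [simp]: "gen g \<in> free_star X \<longleftrightarrow> g \<in> X"
  by (simp add: free_star_def gen_def zero_word_def)

lemma free_star_sum [simp]: "(\<And>i. i \<in> S \<Longrightarrow> f i \<in> free_star X) \<Longrightarrow> sum f S \<in> free_star X"
  by (induction S rule: infinite_finite_induct) auto

text \<open>Induction over the free *-algebra.\<close>

lemma free_star_induct [consumes 1, case_names gen zero add scale mult adj]:
  assumes "x \<in> free_star X"
    and gen: "\<And>g. g \<in> X \<Longrightarrow> P (gen g)" and zero: "P 0"
    and add: "\<And>x y. \<lbrakk>x \<in> free_star X; y \<in> free_star X; P x; P y\<rbrakk> \<Longrightarrow> P (x + y)"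
    and scale: "\<And>c x. \<lbrakk>x \<in> free_star X; P x\<rbrakk> \<Longrightarrow> P (scale c x)"
    and mult: "\<And>x y. \<lbrakk>x \<in> free_star X; y \<in> free_star X; P x; P y\<rbrakk> \<Longrightarrow> P (x * y)"
    and adj: "\<And>x. \<lbrakk>x \<in> free_star X; P x\<rbrakk> \<Longrightarrow> P (adj x)"
  shows "P x"
proof -
  have letter: "P (Poly_Mapping.single (Word [(g, b)]) 1) \<and> Poly_Mapping.single (Word [(g, b)]) 1 \<in> free_star X"
    if "g \<in> X" for g b
  proof (cases b)
    case True
    have "Poly_Mapping.single (Word [(g, b)]) 1 = adj (gen g)"
      using True by (simp add: gen_def adj_single adj_word_def)
    thus ?thesis using that adj gen by simp
  next
    case False
    hence "Poly_Mapping.single (Word [(g, b)]) 1 = gen g" by (simp add: gen_def)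
    thus ?thesis using that gen by simp
  qed
  have word: "P (Poly_Mapping.single (Word xs) 1) \<and> Poly_Mapping.single (Word xs) 1 \<in> free_star X"
    if "xs \<noteq> []" "fst ` set xs \<subseteq> X" for xs
    using that
  proof (induction xs rule: list_nonempty_induct)
    case (single a) thus ?case using letter[of "fst a" "snd a"] by simp
  next
    case (cons a xs)
    have "Poly_Mapping.single (Word (a # xs)) 1 =
        Poly_Mapping.single (Word [(fst a, snd a)]) 1 * Poly_Mapping.single (Word xs) (1::complex)"
      by (simp add: mult_single plus_word_def)
    thus ?case using letter[of "fst a" "snd a"] cons by (auto intro: mult)
  qed
  have mono: "P (Poly_Mapping.single w c) \<and> Poly_Mapping.single w c \<in> free_star X"
    if "w \<noteq> 0" "fst ` set (letters w) \<subseteq> X" for w c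
  proof -
    have w: "w = Word (letters w)" "letters w \<noteq> []" using that by (cases w; auto simp: zero_word_def)+
    have "Poly_Mapping.single w c = scale c (Poly_Mapping.single (Word (letters w)) 1)"
      using w by (simp add: scale_def mult_single)
    thus ?thesis using word[of "letters w"] w that scale by auto
  qed
  have eq: "x = (\<Sum>w\<in>Poly_Mapping.keys x. Poly_Mapping.single w (Poly_Mapping.lookup x w))"
    by (rule poly_mapping_eqI)
      (simp add: lookup_sum lookup_single when_def sum.delta not_in_keys_iff_lookup_eq_zero)
  have "P (\<Sum>w\<in>S. Poly_Mapping.single w (Poly_Mapping.lookup x w)) \<and>
      (\<Sum>w\<in>S. Poly_Mapping.single w (Poly_Mapping.lookup x w)) \<in> free_star X"
    if "finite S" "S \<subseteq> Poly_Mapping.keys x" for S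
    using that
  proof (induction S)
    case (insert w S)
    have "w \<noteq> 0" "fst ` set (letters w) \<subseteq> X" using insert assms(1) by (auto simp: free_star_def)
    thus ?case using insert mono by (auto intro: add)
  qed (simp add: zero)
  thus ?thesis using eq by (metis finite_keys order_refl)
qed

subsection \<open>Completions\<close>

locale star_seminorm =
  fixes X :: "'g set" and N :: "'g star_poly \<Rightarrow> real"
  assumes seminorm: "cstar_seminorm X N"
begin

abbreviation "FX \<equiv> free_star X"

lemma nonneg: "x \<in> FX \<Longrightarrow> 0 \<le> N x"
  and triangle: "x \<in> FX \<Longrightarrow> y \<in> FX \<Longrightarrow> N (x + y) \<le> N x + N y"
  and N_scale: "x \<in> FX \<Longrightarrow> N (scale c x) = cmod c * N x"
  and N_mult: "x \<in> FX \<Longrightarrow> y \<in> FX \<Longrightarrow> N (x * y) \<le> N x * N y"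
  and N_cstar: "x \<in> FX \<Longrightarrow> N (adj x * x) = (N x)\<^sup>2"
  using seminorm by (auto simp: cstar_seminorm_def)

lemma N_zero [simp]: "N 0 = 0"
  using N_scale[of 0 0] by (simp add: pscale_zero)

lemma N_uminus [simp]: "x \<in> FX \<Longrightarrow> N (- x) = N x"
  using N_scale[of x "- 1"] by (simp add: pscale_minus_one)

lemma N_diff: "x \<in> FX \<Longrightarrow> y \<in> FX \<Longrightarrow> N (x - y) \<le> N x + N y"
  using triangle[of x "- y"] by simp

lemma N_commute: "x \<in> FX \<Longrightarrow> y \<in> FX \<Longrightarrow> N (x - y) = N (y - x)"
  using N_uminus[of "x - y"] by simp

lemma N_adj: assumes "x \<in> FX" shows "N (adj x) = N x"
proof -
  have le: "N y \<le> N (adj y)" if "y \<in> FX" for y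
  proof (cases "N y = 0")
    case True thus ?thesis using nonneg[of "adj y"] that by simp
  next
    case False
    have "N y * N y \<le> N (adj y) * N y"
      using N_cstar[of y] N_mult[of "adj y" y] that by (simp add: power2_eq_square)
    thus ?thesis using False nonneg[OF that] by simp
  qed
  show ?thesis using le[of x] le[of "adj x"] assms by simp
qed

lemma N_abs_diff: assumes "x \<in> FX" "y \<in> FX" shows "\<bar>N x - N y\<bar> \<le> N (x - y)"
  using triangle[of "x - y" y] triangle[of "y - x" x] N_commute[of x y] assms by simp

lemma N_diff_trans: "x \<in> FX \<Longrightarrow> y \<in> FX \<Longrightarrow> z \<in> FX \<Longrightarrow> N (x - z) \<le> N (x - y) + N (y - z)"
  using triangle[of "x - y" "y - z"] by simp

lemma N_mult_diff:
  assumes "x \<in> FX" "y \<in> FX" "x' \<in> FX" "y' \<in> FX"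
  shows "N (x * y - x' * y') \<le> N (x - x') * N y + N x' * N (y - y')"
proof -
  have "x * y - x' * y' = (x - x') * y + x' * (y - y')" by (simp add: algebra_simps)
  thus ?thesis
    using triangle[of "(x - x') * y" "x' * (y - y')"] N_mult[of "x - x'" y] N_mult[of x' "y - y'"] assms
    by simp
qed

lemma N_sum_zero: "(\<And>i. i \<in> S \<Longrightarrow> f i \<in> FX \<and> N (f i) = 0) \<Longrightarrow> N (sum f S) = 0"
proof (induction S rule: infinite_finite_induct)
  case (insert i S)
  hence "N (sum f S) = 0" "N (f i) = 0" "f i \<in> FX" "sum f S \<in> FX" by auto
  thus ?case using insert triangle[of "f i" "sum f S"] nonneg[of "f i + sum f S"] by simp
qed auto

abbreviation "CS \<equiv> cauchy_seqs FX N"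
abbreviation "NR \<equiv> null_rel FX N"
abbreviation "C \<equiv> completion FX N"

lemma CS_F: "x \<in> CS \<Longrightarrow> x k \<in> FX"
  by (simp add: cauchy_seqs_def)

lemma CS_E: assumes "x \<in> CS" "e > 0" obtains M where "\<And>m k. m \<ge> M \<Longrightarrow> k \<ge> M \<Longrightarrow> N (x m - x k) < e"
  using assms unfolding cauchy_seqs_def by blast

lemma CS_I:
  assumes "\<And>k. x k \<in> FX" "\<And>e. e > 0 \<Longrightarrow> \<exists>M. \<forall>m\<ge>M. \<forall>k\<ge>M. N (x m - x k) < e"
  shows "x \<in> CS"
  using assms by (simp add: cauchy_seqs_def)

lemma CS_const [simp]: "x \<in> FX \<Longrightarrow> (\<lambda>k. x) \<in> CS"
  by (simp add: cauchy_seqs_def)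

lemma CS_dominated:
  assumes "x \<in> CS" "\<And>k. y k \<in> FX" "\<And>m k. N (y m - y k) \<le> K * N (x m - x k)"
  shows "y \<in> CS"
proof (rule CS_I)
  fix e :: real assume "e > 0"
  define K' where "K' = \<bar>K\<bar> + 1"
  have K': "K' > 0" "K \<le> K'" by (auto simp: K'_def)
  obtain M where M: "\<And>m k. m \<ge> M \<Longrightarrow> k \<ge> M \<Longrightarrow> N (x m - x k) < e / K'"
    using CS_E[OF assms(1), of "e / K'"] \<open>e > 0\<close> K' by auto
  have "N (y m - y k) < e" if "m \<ge> M" "k \<ge> M" for m k
  proof -
    have "N (y m - y k) \<le> K' * N (x m - x k)"
      using assms(3)[of m k] K' nonneg[of "x m - x k"] CS_F[OF assms(1)]
      by (smt (verit) free_star_diff mult_right_mono)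
    also have "\<dots> < e" using M[OF that] K' by (simp add: field_simps)
    finally show ?thesis .
  qed
  thus "\<exists>M. \<forall>m\<ge>M. \<forall>k\<ge>M. N (y m - y k) < e" by blast
qed (use assms in auto)

lemma CS_add: assumes "x \<in> CS" "y \<in> CS" shows "(\<lambda>k. x k + y k) \<in> CS"
proof (rule CS_I)
  fix e :: real assume "e > 0"
  obtain M1 where M1: "\<And>m k. m \<ge> M1 \<Longrightarrow> k \<ge> M1 \<Longrightarrow> N (x m - x k) < e / 2"
    using CS_E[OF assms(1), of "e / 2"] \<open>e > 0\<close> by auto
  obtain M2 where M2: "\<And>m k. m \<ge> M2 \<Longrightarrow> k \<ge> M2 \<Longrightarrow> N (y m - y k) < e / 2"
    using CS_E[OF assms(2), of "e / 2"] \<open>e > 0\<close> by auto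
  have "N (x m + y m - (x k + y k)) < e" if "m \<ge> max M1 M2" "k \<ge> max M1 M2" for m k
    using M1[of m k] M2[of m k] that triangle[of "x m - x k" "y m - y k"] CS_F[OF assms(1)] CS_F[OF assms(2)]
    by (simp add: algebra_simps)
  thus "\<exists>M. \<forall>m\<ge>M. \<forall>k\<ge>M. N (x m + y m - (x k + y k)) < e" by blast
qed (use assms CS_F in auto)

lemma CS_scale: assumes "x \<in> CS" shows "(\<lambda>k. scale c (x k)) \<in> CS"
  by (rule CS_dominated[OF assms, where K = "cmod c"])
    (use assms CS_F in \<open>auto simp: N_scale simp flip: pscale_diff\<close>)

lemma CS_adj: assumes "x \<in> CS" shows "(\<lambda>k. adj (x k)) \<in> CS"
  by (rule CS_dominated[OF assms, where K = 1])
    (use assms CS_F in \<open>auto simp: N_adj simp flip: adj_diff\<close>)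

lemma CS_convergent: assumes "x \<in> CS" shows "convergent (\<lambda>k. N (x k))"
proof (rule Cauchy_convergent, rule CauchyI)
  fix e :: real assume "e > 0"
  then obtain M where M: "\<And>m k. m \<ge> M \<Longrightarrow> k \<ge> M \<Longrightarrow> N (x m - x k) < e"
    using CS_E[OF assms] by blast
  show "\<exists>M. \<forall>m\<ge>M. \<forall>n\<ge>M. norm (N (x m) - N (x n)) < e"
    using M N_abs_diff CS_F[OF assms] by (metis le_less_trans real_norm_def)
qed

lemma CS_bounded: assumes "x \<in> CS" obtains K where "K > 0" "\<And>k. N (x k) \<le> K"
proof -
  have "Bseq (\<lambda>k. N (x k))" using CS_convergent[OF assms] by (rule convergent_imp_Bseq)
  then obtain K where "K > 0" "\<And>k. norm (N (x k)) \<le> K" by (auto elim: BseqE)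
  thus ?thesis using that[of K] by (auto simp: abs_le_iff)
qed

lemma CS_mult: assumes "x \<in> CS" "y \<in> CS" shows "(\<lambda>k. x k * y k) \<in> CS"
proof (rule CS_I)
  fix e :: real assume "e > 0"
  obtain K1 where K1: "K1 > 0" "\<And>k. N (x k) \<le> K1" using CS_bounded[OF assms(1)] by blast
  obtain K2 where K2: "K2 > 0" "\<And>k. N (y k) \<le> K2" using CS_bounded[OF assms(2)] by blast
  obtain M1 where M1: "\<And>m k. m \<ge> M1 \<Longrightarrow> k \<ge> M1 \<Longrightarrow> N (x m - x k) < e / 2 / K2"
    using CS_E[OF assms(1), of "e / 2 / K2"] \<open>e > 0\<close> K2 by auto
  obtain M2 where M2: "\<And>m k. m \<ge> M2 \<Longrightarrow> k \<ge> M2 \<Longrightarrow> N (y m - y k) < e / 2 / K1"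
    using CS_E[OF assms(2), of "e / 2 / K1"] \<open>e > 0\<close> K1 by auto
  have "N (x m * y m - x k * y k) < e" if "m \<ge> max M1 M2" "k \<ge> max M1 M2" for m k
  proof -
    note F = CS_F[OF assms(1)] CS_F[OF assms(2)]
    have "N (x m * y m - x k * y k) \<le> N (x m - x k) * N (y m) + N (x k) * N (y m - y k)"
      by (rule N_mult_diff) (use F in auto)
    also have "\<dots> \<le> N (x m - x k) * K2 + K1 * N (y m - y k)"
      using K1 K2 F by (intro add_mono mult_mono nonneg) (auto intro: nonneg)
    also have "\<dots> < e / 2 / K2 * K2 + K1 * (e / 2 / K1)"
      using M1[of m k] M2[of m k] that K1 K2 by (intro add_strict_mono mult_strict_right_mono mult_strict_left_mono) auto
    also have "\<dots> = e" using K1 K2 by simp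
    finally show ?thesis .
  qed
  thus "\<exists>M. \<forall>m\<ge>M. \<forall>k\<ge>M. N (x m * y m - x k * y k) < e" by blast
qed (use assms CS_F in auto)

lemma NR_iff: "(x, y) \<in> NR \<longleftrightarrow> x \<in> CS \<and> y \<in> CS \<and> (\<lambda>k. N (x k - y k)) \<longlonglongrightarrow> 0"
  by (simp add: null_rel_def)

lemma NR_I:
  assumes "x \<in> CS" "y \<in> CS" "\<And>k. N (x k - y k) \<le> f k" "f \<longlonglongrightarrow> 0"
  shows "(x, y) \<in> NR"
proof -
  have "(\<lambda>k. N (x k - y k)) \<longlonglongrightarrow> 0"
    by (rule tendsto_sandwich[OF _ _ tendsto_const assms(4)])
      (use assms CS_F nonneg in auto)
  thus ?thesis using assms by (simp add: NR_iff)
qed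

lemma equiv_NR: "equiv CS NR"
proof (rule equivI)
  show "NR \<subseteq> CS \<times> CS" by (auto simp: null_rel_def)
  show "refl_on CS NR" by (auto simp: refl_on_def null_rel_def)
  show "sym NR"
  proof (rule symI)
    fix x y assume xy: "(x, y) \<in> NR"
    have "(\<lambda>k. N (y k - x k)) = (\<lambda>k. N (x k - y k))"
      using xy CS_F N_commute by (auto simp: NR_iff)
    thus "(y, x) \<in> NR" using xy by (simp add: NR_iff)
  qed
  show "trans NR"
  proof (rule transI)
    fix x y z assume a: "(x, y) \<in> NR" "(y, z) \<in> NR"
    show "(x, z) \<in> NR"
    proof (rule NR_I)
      show "N (x k - z k) \<le> N (x k - y k) + N (y k - z k)" for k
        using a CS_F N_diff_trans by (auto simp: NR_iff)
      show "(\<lambda>k. N (x k - y k) + N (y k - z k)) \<longlonglongrightarrow> 0"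
        using a by (auto simp: NR_iff intro: tendsto_add_zero)
    qed (use a in \<open>auto simp: NR_iff\<close>)
  qed
qed

definition cls :: "(nat \<Rightarrow> 'g star_poly) \<Rightarrow> (nat \<Rightarrow> 'g star_poly) set" where
  "cls x = NR `` {x}"

lemma cls_eq_iff: "x \<in> CS \<Longrightarrow> y \<in> CS \<Longrightarrow> cls x = cls y \<longleftrightarrow> (x, y) \<in> NR"
  unfolding cls_def using equiv_NR by (simp add: eq_equiv_class_iff)

lemma cls_in_car [simp]: "x \<in> CS \<Longrightarrow> cls x \<in> car C"
  by (simp add: completion_def cls_def quotientI)

lemma car_cases: assumes "a \<in> car C" obtains x where "x \<in> CS" "a = cls x"
  using assms by (auto simp: completion_def cls_def elim: quotientE)

lemma rep_cls: assumes "x \<in> CS" shows "rep (cls x) \<in> CS" "(x, rep (cls x)) \<in> NR"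
proof -
  have "x \<in> cls x" using equiv_class_self[OF equiv_NR assms] by (simp add: cls_def)
  hence "rep (cls x) \<in> cls x" unfolding rep_def by (rule someI[of "\<lambda>y. y \<in> cls x"])
  thus "(x, rep (cls x)) \<in> NR" by (simp add: cls_def)
  thus "rep (cls x) \<in> CS" by (simp add: NR_iff)
qed

lemma C_zero: "czero C = cls (\<lambda>k. 0)"
  by (simp add: completion_def cls_def)

lemma C_add: assumes "x \<in> CS" "y \<in> CS" shows "cadd C (cls x) (cls y) = cls (\<lambda>k. x k + y k)"
proof -
  note r = rep_cls[OF assms(1)] rep_cls[OF assms(2)]
  have "((\<lambda>k. rep (cls x) k + rep (cls y) k), (\<lambda>k. x k + y k)) \<in> NR"
  proof (rule NR_I)
    show "N (rep (cls x) k + rep (cls y) k - (x k + y k)) \<le>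
        N (x k - rep (cls x) k) + N (y k - rep (cls y) k)" for k
      using triangle[of "rep (cls x) k - x k" "rep (cls y) k - y k"]
        N_commute[of "rep (cls x) k" "x k"] N_commute[of "rep (cls y) k" "y k"]
        CS_F[OF assms(1)] CS_F[OF assms(2)] CS_F[OF r(1)] CS_F[OF r(3)]
      by (simp add: algebra_simps)
    show "(\<lambda>k. N (x k - rep (cls x) k) + N (y k - rep (cls y) k)) \<longlonglongrightarrow> 0"
      using r by (auto simp: NR_iff intro: tendsto_add_zero)
  qed (use assms r in \<open>auto intro: CS_add\<close>)
  thus ?thesis using cls_eq_iff CS_add assms r
    by (simp add: completion_def flip: cls_def)
qed

lemma C_scale: assumes "x \<in> CS" shows "cscale C c (cls x) = cls (\<lambda>k. scale c (x k))"
proof -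
  note r = rep_cls[OF assms]
  have "((\<lambda>k. scale c (rep (cls x) k)), (\<lambda>k. scale c (x k))) \<in> NR"
  proof (rule NR_I)
    show "N (scale c (rep (cls x) k) - scale c (x k)) \<le> cmod c * N (x k - rep (cls x) k)" for k
      using N_commute[of "rep (cls x) k" "x k"] CS_F[OF assms] CS_F[OF r(1)]
      by (simp add: N_scale flip: pscale_diff)
    show "(\<lambda>k. cmod c * N (x k - rep (cls x) k)) \<longlonglongrightarrow> 0"
      using r by (auto simp: NR_iff intro: tendsto_mult_right_zero)
  qed (use assms r in \<open>auto intro: CS_scale\<close>)
  thus ?thesis using cls_eq_iff CS_scale assms r
    by (simp add: completion_def flip: cls_def)
qed

lemma C_adj: assumes "x \<in> CS" shows "cadj C (cls x) = cls (\<lambda>k. adj (x k))"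
proof -
  note r = rep_cls[OF assms]
  have "((\<lambda>k. adj (rep (cls x) k)), (\<lambda>k. adj (x k))) \<in> NR"
  proof (rule NR_I)
    show "N (adj (rep (cls x) k) - adj (x k)) \<le> N (x k - rep (cls x) k)" for k
      using N_commute[of "rep (cls x) k" "x k"] CS_F[OF assms] CS_F[OF r(1)]
      by (simp add: N_adj flip: adj_diff)
    show "(\<lambda>k. N (x k - rep (cls x) k)) \<longlonglongrightarrow> 0"
      using r by (auto simp: NR_iff)
  qed (use assms r in \<open>auto intro: CS_adj\<close>)
  thus ?thesis using cls_eq_iff CS_adj assms r
    by (simp add: completion_def flip: cls_def)
qed

lemma C_mult: assumes "x \<in> CS" "y \<in> CS" shows "cmult C (cls x) (cls y) = cls (\<lambda>k. x k * y k)"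
proof -
  note r = rep_cls[OF assms(1)] rep_cls[OF assms(2)]
  obtain K1 where K1: "K1 > 0" "\<And>k. N (x k) \<le> K1" using CS_bounded[OF assms(1)] by blast
  obtain K2 where K2: "K2 > 0" "\<And>k. N (rep (cls y) k) \<le> K2" using CS_bounded[OF r(3)] by blast
  note F = CS_F[OF assms(1)] CS_F[OF assms(2)] CS_F[OF r(1)] CS_F[OF r(3)]
  have "((\<lambda>k. rep (cls x) k * rep (cls y) k), (\<lambda>k. x k * y k)) \<in> NR"
  proof (rule NR_I)
    show "N (rep (cls x) k * rep (cls y) k - x k * y k) \<le>
        N (x k - rep (cls x) k) * K2 + K1 * N (y k - rep (cls y) k)" for k
    proof -
      have "N (rep (cls x) k * rep (cls y) k - x k * y k) \<le>
          N (rep (cls x) k - x k) * N (rep (cls y) k) + N (x k) * N (rep (cls y) k - y k)"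
        by (rule N_mult_diff) (use F in auto)
      also have "\<dots> \<le> N (rep (cls x) k - x k) * K2 + K1 * N (rep (cls y) k - y k)"
        using K1 K2 F by (intro add_mono mult_mono nonneg) (auto intro: nonneg)
      finally show ?thesis using F N_commute by simp
    qed
    show "(\<lambda>k. N (x k - rep (cls x) k) * K2 + K1 * N (y k - rep (cls y) k)) \<longlonglongrightarrow> 0"
      using r by (auto simp: NR_iff intro!: tendsto_add_zero tendsto_mult_right_zero tendsto_mult_left_zero)
  qed (use assms r in \<open>auto intro: CS_mult\<close>)
  thus ?thesis using cls_eq_iff CS_mult assms r
    by (simp add: completion_def flip: cls_def)
qed

lemma C_norm: assumes "x \<in> CS" shows "(\<lambda>k. N (x k)) \<longlonglongrightarrow> cnorm C (cls x)"
proof -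
  note r = rep_cls[OF assms]
  have 1: "(\<lambda>k. N (rep (cls x) k)) \<longlonglongrightarrow> cnorm C (cls x)"
    using CS_convergent[OF r(1)] by (simp add: completion_def convergent_LIMSEQ_iff)
  have "(\<lambda>k. N (x k) - N (rep (cls x) k)) \<longlonglongrightarrow> 0"
  proof (rule tendsto_0_le[where K = 1])
    show "(\<lambda>k. N (x k - rep (cls x) k)) \<longlonglongrightarrow> 0" using r by (simp add: NR_iff)
    show "\<forall>\<^sub>F k in sequentially. norm (N (x k) - N (rep (cls x) k)) \<le> norm (N (x k - rep (cls x) k)) * 1"
    proof (intro always_eventually allI)
      fix k
      show "norm (N (x k) - N (rep (cls x) k)) \<le> norm (N (x k - rep (cls x) k)) * 1"
        using N_abs_diff[OF CS_F[OF assms, of k] CS_F[OF r(1), of k]] by simp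
    qed
  qed
  from tendsto_add[OF this 1] show ?thesis by simp
qed

lemma CS_uminus: "x \<in> CS \<Longrightarrow> (\<lambda>k. - x k) \<in> CS"
  using CS_scale[of x "- 1"] by (simp add: pscale_minus_one)

lemma C_diff: assumes "x \<in> CS" "y \<in> CS" shows "cdiff C (cls x) (cls y) = cls (\<lambda>k. x k - y k)"
  using assms by (simp add: cdiff_def C_scale C_add CS_uminus pscale_minus_one)

lemma CS_diff: "x \<in> CS \<Longrightarrow> y \<in> CS \<Longrightarrow> (\<lambda>k. x k - y k) \<in> CS"
  using CS_add[of x "\<lambda>k. scale (- 1) (y k)"] CS_scale[of y "- 1"] by (simp add: pscale_minus_one)

lemma C_norm_const: assumes "x \<in> FX" shows "cnorm C (cls (\<lambda>k. x)) = N x"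
  using C_norm[of "\<lambda>k. x"] assms LIMSEQ_unique[OF tendsto_const] by fastforce

lemma C_dense:
  assumes "a \<in> car C" "e > 0"
  obtains x where "x \<in> FX" "cnorm C (cdiff C a (cls (\<lambda>k. x))) < e"
proof -
  obtain y where y: "y \<in> CS" "a = cls y" using car_cases[OF assms(1)] by blast
  obtain M where M: "\<And>m k. m \<ge> M \<Longrightarrow> k \<ge> M \<Longrightarrow> N (y m - y k) < e / 2"
    using CS_E[OF y(1), of "e / 2"] assms by auto
  have "(\<lambda>k. N (y k - y M)) \<longlonglongrightarrow> cnorm C (cls (\<lambda>k. y k - y M))"
    using y CS_F by (intro C_norm CS_diff CS_const) auto
  moreover have "\<forall>\<^sub>F k in sequentially. N (y k - y M) \<le> e / 2"
    using M by (intro eventually_sequentiallyI[of M]) (auto intro: less_imp_le)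
  ultimately have "cnorm C (cls (\<lambda>k. y k - y M)) \<le> e / 2"
    by (rule tendsto_upperbound) simp
  hence "cnorm C (cdiff C a (cls (\<lambda>k. y M))) < e"
    using y CS_F assms(2) by (simp add: C_diff)
  thus ?thesis using that CS_F y by blast
qed

end

context star_seminorm begin
lemma C_complete:
  assumes A: "\<And>k. a k \<in> car C"
    and cauchy: "\<And>e. e > 0 \<Longrightarrow> \<exists>M. \<forall>m\<ge>M. \<forall>k\<ge>M. cnorm C (cdiff C (a m) (a k)) < e"
  shows "\<exists>b\<in>car C. (\<lambda>k. cnorm C (cdiff C (a k) b)) \<longlonglongrightarrow> 0"
proof -
  have "\<exists>x. x \<in> FX \<and> cnorm C (cdiff C (a k) (cls (\<lambda>_. x))) < inverse (Suc k)" for k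
    using C_dense[OF A[of k], of "inverse (Suc k)"] by auto
  then obtain x where x: "\<And>k. x k \<in> FX"
      "\<And>k. cnorm C (cdiff C (a k) (cls (\<lambda>_. x k))) < inverse (Suc k)"
    by metis
  have "\<exists>y. y \<in> CS \<and> a k = cls y" for k using car_cases[OF A[of k]] by blast
  then obtain y where y: "\<And>k. y k \<in> CS" "\<And>k. a k = cls (y k)"
    by metis
  have tri: "cnorm C (cls (\<lambda>j. u j - w j)) \<le> cnorm C (cls (\<lambda>j. u j - v j)) + cnorm C (cls (\<lambda>j. v j - w j))"
    if "u \<in> CS" "v \<in> CS" "w \<in> CS" for u v w
  proof (rule LIMSEQ_le)
    show "(\<lambda>j. N (u j - w j)) \<longlonglongrightarrow> cnorm C (cls (\<lambda>j. u j - w j))"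
      by (intro C_norm CS_diff that)
    show "(\<lambda>j. N (u j - v j) + N (v j - w j)) \<longlonglongrightarrow>
        cnorm C (cls (\<lambda>j. u j - v j)) + cnorm C (cls (\<lambda>j. v j - w j))"
      by (intro tendsto_add C_norm CS_diff that)
    show "\<exists>M. \<forall>j\<ge>M. N (u j - w j) \<le> N (u j - v j) + N (v j - w j)"
      using N_diff_trans CS_F that by blast
  qed
  have comm: "cnorm C (cls (\<lambda>j. u j - v j)) = cnorm C (cls (\<lambda>j. v j - u j))"
    if "u \<in> CS" "v \<in> CS" for u v
  proof -
    have "(\<lambda>j. N (v j - u j)) = (\<lambda>j. N (u j - v j))" using that CS_F N_commute by auto
    hence "(\<lambda>j. N (u j - v j)) \<longlonglongrightarrow> cnorm C (cls (\<lambda>j. v j - u j))"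
      using C_norm[OF CS_diff[OF that(2,1)]] by simp
    thus ?thesis using C_norm[OF CS_diff[OF that]] LIMSEQ_unique by blast
  qed
  have x': "cnorm C (cls (\<lambda>j. y k j - x k)) < inverse (Suc k)" for k
    using x(2)[of k] y x(1) by (simp add: C_diff)
  have bound: "N (x m - x k) < inverse (Suc m) + cnorm C (cdiff C (a m) (a k)) + inverse (Suc k)" for m k
  proof -
    have "N (x m - x k) = cnorm C (cls (\<lambda>j. x m - x k))"
      using x(1) by (simp add: C_norm_const)
    also have "\<dots> \<le> cnorm C (cls (\<lambda>j. x m - y m j)) + cnorm C (cls (\<lambda>j. y m j - x k))"
      using tri[of "\<lambda>j. x m" "y m" "\<lambda>j. x k"] x(1) y by simp
    also have "\<dots> \<le> cnorm C (cls (\<lambda>j. x m - y m j)) +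
        (cnorm C (cls (\<lambda>j. y m j - y k j)) + cnorm C (cls (\<lambda>j. y k j - x k)))"
      using tri[of "y m" "y k" "\<lambda>j. x k"] x(1) y by simp
    also have "\<dots> < inverse (Suc m) + (cnorm C (cdiff C (a m) (a k)) + inverse (Suc k))"
      using x'[of m] x'[of k] comm[of "\<lambda>j. x m" "y m"] x(1) y by (simp add: C_diff)
    finally show ?thesis by simp
  qed
  have xCS: "x \<in> CS"
  proof (rule CS_I)
    fix e :: real assume "e > 0"
    obtain M1 where M1: "\<And>m k. m \<ge> M1 \<Longrightarrow> k \<ge> M1 \<Longrightarrow> cnorm C (cdiff C (a m) (a k)) < e / 3"
      using cauchy[of "e / 3"] \<open>e > 0\<close> by auto
    obtain M2 where M2: "inverse (real (Suc M2)) < e / 3"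
      using reals_Archimedean[of "e / 3"] \<open>e > 0\<close> by auto
    have inv: "inverse (real (Suc m)) < e / 3" if "m \<ge> M2" for m
      using M2 that le_imp_inverse_le[of "real (Suc M2)" "real (Suc m)"] by linarith
    have "N (x m - x k) < e" if "m \<ge> max M1 M2" "k \<ge> max M1 M2" for m k
      using bound[of m k] M1[of m k] inv[of m] inv[of k] that by simp
    thus "\<exists>M. \<forall>m\<ge>M. \<forall>k\<ge>M. N (x m - x k) < e" by blast
  qed (use x in auto)
  have "(\<lambda>k. cnorm C (cdiff C (a k) (cls x))) \<longlonglongrightarrow> 0"
  proof (rule LIMSEQ_I)
    fix e :: real assume "e > 0"
    obtain M1 where M1: "\<And>m k. m \<ge> M1 \<Longrightarrow> k \<ge> M1 \<Longrightarrow> N (x m - x k) < e / 3"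
      using CS_E[OF xCS, of "e / 3"] \<open>e > 0\<close> by auto
    obtain M2 where M2: "inverse (real (Suc M2)) < e / 3"
      using reals_Archimedean[of "e / 3"] \<open>e > 0\<close> by auto
    have inv: "inverse (real (Suc m)) < e / 3" if "m \<ge> M2" for m
      using M2 that le_imp_inverse_le[of "real (Suc M2)" "real (Suc m)"] by linarith
    have "norm (cnorm C (cdiff C (a k) (cls x)) - 0) < e" if "k \<ge> max M1 M2" for k
    proof -
      have "(\<lambda>j. N (x k - x j)) \<longlonglongrightarrow> cnorm C (cls (\<lambda>j. x k - x j))"
        using x(1) xCS by (intro C_norm CS_diff CS_const) auto
      moreover have "\<forall>\<^sub>F j in sequentially. N (x k - x j) \<le> e / 3"
        using M1 that by (intro eventually_sequentiallyI[of M1]) (auto intro: less_imp_le)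
      ultimately have 1: "cnorm C (cls (\<lambda>j. x k - x j)) \<le> e / 3"
        by (rule tendsto_upperbound) simp
      have "cnorm C (cls (\<lambda>j. y k j - x j)) \<le> inverse (Suc k) + e / 3"
        using tri[of "y k" "\<lambda>j. x k" x] x'[of k] 1 x(1) xCS y by simp
      moreover have "0 \<le> cnorm C (cls (\<lambda>j. y k j - x j))"
        using C_norm[OF CS_diff[OF y(1)[of k] xCS]] nonneg CS_F[OF y(1)] x(1)
        by (intro LIMSEQ_le_const) auto
      ultimately show ?thesis using inv[of k] that y xCS \<open>e > 0\<close> by (simp add: C_diff)
    qed
    thus "\<exists>no. \<forall>k\<ge>no. norm (cnorm C (cdiff C (a k) (cls x)) - 0) < e" by blast
  qed
  thus ?thesis using xCS by (intro bexI[of _ "cls x"]) auto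
qed

end

context star_seminorm begin
lemma completion_cstar_algebra: "cstar_algebra C"
proof -
  note ops = C_zero C_add C_scale C_mult C_adj C_diff CS_add CS_scale CS_mult CS_adj CS_diff
  have nonneg': "0 \<le> cnorm C (cls x)" if "x \<in> CS" for x
    using C_norm[OF that] nonneg CS_F[OF that] by (intro LIMSEQ_le_const) auto
  have zero_iff: "cnorm C (cls x) = 0 \<longleftrightarrow> cls x = czero C" if "x \<in> CS" for x
  proof -
    have "cls x = czero C \<longleftrightarrow> (\<lambda>k. N (x k)) \<longlonglongrightarrow> 0"
      using that by (simp add: C_zero cls_eq_iff NR_iff)
    thus ?thesis using C_norm[OF that] LIMSEQ_unique by metis
  qed
  show ?thesis
  proof (unfold_locales, goal_cases)
    case (25 a b)
    then obtain x y where xy: "x \<in> CS" "a = cls x" "y \<in> CS" "b = cls y" by (blast elim: car_cases)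
    have "cnorm C (cls (\<lambda>k. x k + y k)) \<le> cnorm C (cls x) + cnorm C (cls y)"
    proof (rule LIMSEQ_le[OF C_norm[OF CS_add[OF xy(1,3)]] tendsto_add[OF C_norm[OF xy(1)] C_norm[OF xy(3)]]])
      show "\<exists>M. \<forall>k\<ge>M. N (x k + y k) \<le> N (x k) + N (y k)" using triangle CS_F xy by blast
    qed
    thus ?case using xy by (simp add: C_add)
  next
    case (26 a c)
    then obtain x where x: "x \<in> CS" "a = cls x" by (blast elim: car_cases)
    have "(\<lambda>k. N (scale c (x k))) \<longlonglongrightarrow> cmod c * cnorm C (cls x)"
      using tendsto_mult_left[OF C_norm[OF x(1)], of "cmod c"] N_scale CS_F[OF x(1)] by simp
    thus ?case using x C_norm[OF CS_scale[OF x(1)], of c] LIMSEQ_unique by (simp add: C_scale) blast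
  next
    case (27 a b)
    then obtain x y where xy: "x \<in> CS" "a = cls x" "y \<in> CS" "b = cls y" by (blast elim: car_cases)
    have "cnorm C (cls (\<lambda>k. x k * y k)) \<le> cnorm C (cls x) * cnorm C (cls y)"
    proof (rule LIMSEQ_le[OF C_norm[OF CS_mult[OF xy(1,3)]] tendsto_mult[OF C_norm[OF xy(1)] C_norm[OF xy(3)]]])
      show "\<exists>M. \<forall>k\<ge>M. N (x k * y k) \<le> N (x k) * N (y k)" using N_mult CS_F xy by blast
    qed
    thus ?case using xy by (simp add: C_mult)
  next
    case (28 a)
    then obtain x where x: "x \<in> CS" "a = cls x" by (blast elim: car_cases)
    have "(\<lambda>k. N (adj (x k) * x k)) \<longlonglongrightarrow> (cnorm C (cls x))\<^sup>2"
      using tendsto_power[OF C_norm[OF x(1)], of 2] N_cstar CS_F[OF x(1)] by simp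
    thus ?case using x C_norm[OF CS_mult[OF CS_adj[OF x(1)] x(1)]] LIMSEQ_unique
      by (simp add: C_adj C_mult CS_adj) blast
  next
    case (29 a) thus ?case by (rule C_complete)
  qed (auto elim!: car_cases simp: ops algebra_simps zero_iff nonneg' pscale_add_right
      pscale_add_left pscale_scale pscale_one pmult_scale_left pmult_scale_right)
qed

end

context cstar_algebra
begin

lemma scale_zero_left: assumes "x \<in> car A" shows "cscale A 0 x = czero A"
  using add_inverse[OF assms] scale_add_left[OF assms, of 1 "- 1"] scale_one[OF assms]
  by (simp add: cdiff_def)

lemma scale_zero: "cscale A c (czero A) = czero A"
  using scale_scale[OF zero_closed, of c 0] scale_zero_left[OF zero_closed] by simp

lemma diff_closed: "x \<in> car A \<Longrightarrow> y \<in> car A \<Longrightarrow> cdiff A x y \<in> car A"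
  by (simp add: cdiff_def add_closed scale_closed)

lemmas closed = zero_closed add_closed scale_closed mult_closed adj_closed diff_closed

lemma add_left_commute:
  "\<lbrakk>x \<in> car A; y \<in> car A; z \<in> car A\<rbrakk> \<Longrightarrow> cadd A x (cadd A y z) = cadd A y (cadd A x z)"
  by (metis add_assoc add_commute)

lemmas add_ac' = add_assoc add_commute add_left_commute

lemma zero_add: "x \<in> car A \<Longrightarrow> cadd A (czero A) x = x"
  using add_zero add_commute zero_closed by metis

lemma diff_add: "\<lbrakk>x \<in> car A; y \<in> car A; x' \<in> car A; y' \<in> car A\<rbrakk> \<Longrightarrow>
    cdiff A (cadd A x y) (cadd A x' y') = cadd A (cdiff A x x') (cdiff A y y')"
  by (simp add: cdiff_def scale_add_right add_ac' closed)

lemma diff_scale: "\<lbrakk>x \<in> car A; y \<in> car A\<rbrakk> \<Longrightarrow>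
    cdiff A (cscale A c x) (cscale A c y) = cscale A c (cdiff A x y)"
  by (simp add: cdiff_def scale_add_right scale_scale closed)

lemma diff_adj: "\<lbrakk>x \<in> car A; y \<in> car A\<rbrakk> \<Longrightarrow>
    cdiff A (cadj A x) (cadj A y) = cadj A (cdiff A x y)"
  by (simp add: cdiff_def adj_add adj_scale closed)

lemma diff_trans: assumes "x \<in> car A" "y \<in> car A" "z \<in> car A"
  shows "cdiff A x z = cadd A (cdiff A x y) (cdiff A y z)"
proof -
  let ?m = "cscale A (- 1)"
  have "cadd A (cdiff A x y) (cdiff A y z) = cadd A x (cadd A (?m z) (cadd A y (?m y)))"
    using assms by (simp add: cdiff_def closed add_ac')
  also have "cadd A y (?m y) = czero A" using add_inverse[OF assms(2)] by (simp add: cdiff_def)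
  finally show ?thesis using assms by (simp add: cdiff_def closed add_zero)
qed

lemma diff_zero: "x \<in> car A \<Longrightarrow> cdiff A x (czero A) = x"
  by (simp add: cdiff_def scale_zero add_zero)

lemma diff_eq_zero: assumes "x \<in> car A" "y \<in> car A" "cdiff A x y = czero A" shows "x = y"
  using diff_trans[of x y "czero A"] assms by (simp add: diff_zero zero_add closed)

lemma diff_mult: assumes "x \<in> car A" "y \<in> car A" "x' \<in> car A" "y' \<in> car A"
  shows "cdiff A (cmult A x y) (cmult A x' y') =
    cadd A (cmult A (cdiff A x x') y) (cmult A x' (cdiff A y y'))"
  using diff_trans[of "cmult A x y" "cmult A x' y" "cmult A x' y'"] assms
  by (simp add: cdiff_def mult_add_left mult_add_right mult_scale_left mult_scale_right closed)

lemma norm_neg: "x \<in> car A \<Longrightarrow> cnorm A (cscale A (- 1) x) = cnorm A x"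
  by (simp add: norm_scale)

lemma norm_diff_commute: assumes "x \<in> car A" "y \<in> car A"
  shows "cnorm A (cdiff A x y) = cnorm A (cdiff A y x)"
proof -
  have "cdiff A x y = cscale A (- 1) (cdiff A y x)"
    using assms by (simp add: cdiff_def scale_add_right scale_scale scale_one closed add_commute)
  thus ?thesis using assms by (simp add: norm_neg closed)
qed

lemma norm_adj: assumes "x \<in> car A" shows "cnorm A (cadj A x) = cnorm A x"
proof -
  have le: "cnorm A y \<le> cnorm A (cadj A y)" if "y \<in> car A" for y
  proof (cases "cnorm A y = 0")
    case True thus ?thesis using norm_nonneg[of "cadj A y"] that by (simp add: closed)
  next
    case False
    have "cnorm A y * cnorm A y \<le> cnorm A (cadj A y) * cnorm A y"
      using norm_cstar[of y] norm_mult[of "cadj A y" y] that by (simp add: power2_eq_square closed)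
    thus ?thesis using False norm_nonneg[OF that] by simp
  qed
  show ?thesis using le[of x] le[of "cadj A x"] assms by (simp add: adj_adj closed)
qed

lemma norm_zero: "cnorm A (czero A) = 0"
  using norm_eq_zero zero_closed by blast

end

context cstar_algebra begin
definition lims :: "(nat \<Rightarrow> 'a) \<Rightarrow> 'a \<Rightarrow> bool" where
  "lims x a \<longleftrightarrow> (\<forall>k. x k \<in> car A) \<and> a \<in> car A \<and> (\<lambda>k. cnorm A (cdiff A (x k) a)) \<longlonglongrightarrow> 0"

lemma lims_I:
  assumes "\<And>k. x k \<in> car A" "a \<in> car A" "\<And>k. cnorm A (cdiff A (x k) a) \<le> f k" "f \<longlonglongrightarrow> 0"
  shows "lims x a"
proof -
  have "(\<lambda>k. cnorm A (cdiff A (x k) a)) \<longlonglongrightarrow> 0"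
    by (rule tendsto_sandwich[OF _ _ tendsto_const assms(4)])
      (use assms norm_nonneg diff_closed in auto)
  thus ?thesis using assms by (simp add: lims_def)
qed

lemma lims_const: "a \<in> car A \<Longrightarrow> lims (\<lambda>k. a) a"
  by (simp add: lims_def add_inverse norm_zero)

lemma lims_unique: assumes "lims x a" "lims x b" shows "a = b"
proof -
  have c: "a \<in> car A" "b \<in> car A" "\<And>k. x k \<in> car A" using assms by (auto simp: lims_def)
  have "cnorm A (cdiff A a b) \<le> 0"
  proof (rule LIMSEQ_le_const)
    show "(\<lambda>k. cnorm A (cdiff A (x k) a) + cnorm A (cdiff A (x k) b)) \<longlonglongrightarrow> 0"
      using assms by (auto simp: lims_def intro: tendsto_add_zero)
    have "cnorm A (cdiff A a b) \<le> cnorm A (cdiff A (x k) a) + cnorm A (cdiff A (x k) b)" for k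
      using norm_triangle[of "cdiff A a (x k)" "cdiff A (x k) b"] diff_trans[of a "x k" b]
        norm_diff_commute[of a "x k"] c by (simp add: closed)
    thus "\<exists>N. \<forall>k\<ge>N. cnorm A (cdiff A a b) \<le> cnorm A (cdiff A (x k) a) + cnorm A (cdiff A (x k) b)"
      by blast
  qed
  hence "cnorm A (cdiff A a b) = 0" using norm_nonneg[of "cdiff A a b"] c by (simp add: closed)
  hence "cdiff A a b = czero A" using c norm_eq_zero diff_closed by blast
  thus ?thesis by (rule diff_eq_zero[OF c(1,2)])
qed

lemma lims_add: assumes "lims x a" "lims y b" shows "lims (\<lambda>k. cadd A (x k) (y k)) (cadd A a b)"
proof (rule lims_I)
  show "cnorm A (cdiff A (cadd A (x k) (y k)) (cadd A a b)) \<le>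
      cnorm A (cdiff A (x k) a) + cnorm A (cdiff A (y k) b)" for k
    using assms by (auto simp: lims_def diff_add closed intro!: norm_triangle)
  show "(\<lambda>k. cnorm A (cdiff A (x k) a) + cnorm A (cdiff A (y k) b)) \<longlonglongrightarrow> 0"
    using assms by (auto simp: lims_def intro: tendsto_add_zero)
qed (use assms in \<open>auto simp: lims_def closed\<close>)

lemma lims_scale: assumes "lims x a" shows "lims (\<lambda>k. cscale A c (x k)) (cscale A c a)"
proof (rule lims_I)
  show "cnorm A (cdiff A (cscale A c (x k)) (cscale A c a)) \<le> cmod c * cnorm A (cdiff A (x k) a)" for k
    using assms by (auto simp: lims_def diff_scale norm_scale closed)
  show "(\<lambda>k. cmod c * cnorm A (cdiff A (x k) a)) \<longlonglongrightarrow> 0"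
    using assms by (auto simp: lims_def intro: tendsto_mult_right_zero)
qed (use assms in \<open>auto simp: lims_def closed\<close>)

lemma lims_adj: assumes "lims x a" shows "lims (\<lambda>k. cadj A (x k)) (cadj A a)"
proof (rule lims_I)
  show "cnorm A (cdiff A (cadj A (x k)) (cadj A a)) \<le> cnorm A (cdiff A (x k) a)" for k
    using assms by (auto simp: lims_def diff_adj norm_adj closed)
qed (use assms in \<open>auto simp: lims_def closed\<close>)

lemma lims_norm: assumes "lims x a" shows "(\<lambda>k. cnorm A (x k)) \<longlonglongrightarrow> cnorm A a"
proof -
  have c: "a \<in> car A" "\<And>k. x k \<in> car A" using assms by (auto simp: lims_def)
  have eq: "u = cadd A (cdiff A u v) v" if "u \<in> car A" "v \<in> car A" for u v
    using diff_trans[of u v "czero A"] that by (simp add: diff_zero closed)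
  have "\<bar>cnorm A (x k) - cnorm A a\<bar> \<le> cnorm A (cdiff A (x k) a)" for k
    using norm_triangle[of "cdiff A (x k) a" a] norm_triangle[of "cdiff A a (x k)" "x k"]
      norm_diff_commute[of a "x k"] c by (simp add: closed flip: eq)
  hence le: "norm (cnorm A (x k) - cnorm A a) \<le> norm (cnorm A (cdiff A (x k) a)) * 1" for k
    by (metis abs_of_nonneg c diff_closed mult.right_neutral norm_nonneg real_norm_def)
  have "(\<lambda>k. cnorm A (x k) - cnorm A a) \<longlonglongrightarrow> 0"
  proof (rule tendsto_0_le)
    show "(\<lambda>k. cnorm A (cdiff A (x k) a)) \<longlonglongrightarrow> 0" using assms by (simp add: lims_def)
    show "\<forall>\<^sub>F k in sequentially. norm (cnorm A (x k) - cnorm A a) \<le> norm (cnorm A (cdiff A (x k) a)) * 1"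
      using le by (rule always_eventually[OF allI])
  qed
  from tendsto_add[OF this tendsto_const[of "cnorm A a"]] show ?thesis by simp
qed

lemma lims_mult: assumes "lims x a" "lims y b" shows "lims (\<lambda>k. cmult A (x k) (y k)) (cmult A a b)"
proof (rule lims_I)
  have c: "a \<in> car A" "b \<in> car A" "\<And>k. x k \<in> car A" "\<And>k. y k \<in> car A"
    using assms by (auto simp: lims_def)
  show "cnorm A (cdiff A (cmult A (x k) (y k)) (cmult A a b)) \<le>
      cnorm A (cdiff A (x k) a) * cnorm A (y k) + cnorm A a * cnorm A (cdiff A (y k) b)" for k
    using norm_triangle[of "cmult A (cdiff A (x k) a) (y k)" "cmult A a (cdiff A (y k) b)"]
      norm_mult[of "cdiff A (x k) a" "y k"] norm_mult[of a "cdiff A (y k) b"] c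
    by (simp add: diff_mult closed)
  have "(\<lambda>k. cnorm A (cdiff A (x k) a) * cnorm A (y k) + cnorm A a * cnorm A (cdiff A (y k) b)) \<longlonglongrightarrow>
      0 * cnorm A b + cnorm A a * 0"
    using assms lims_norm[OF assms(2)] by (intro tendsto_intros) (auto simp: lims_def)
  thus "(\<lambda>k. cnorm A (cdiff A (x k) a) * cnorm A (y k) + cnorm A a * cnorm A (cdiff A (y k) b)) \<longlonglongrightarrow> 0"
    by simp
qed (use assms in \<open>auto simp: lims_def closed\<close>)

end

subsection \<open>The universal property\<close>

definition poly_hom :: "'g set \<Rightarrow> 'b cstar_struct \<Rightarrow> ('g star_poly \<Rightarrow> 'b) \<Rightarrow> bool" where
  "poly_hom X B h \<longleftrightarrow>
     (\<forall>x\<in>free_star X. h x \<in> car B) \<and>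
     (\<forall>x\<in>free_star X. \<forall>y\<in>free_star X. h (x + y) = cadd B (h x) (h y)) \<and>
     (\<forall>c. \<forall>x\<in>free_star X. h (scale c x) = cscale B c (h x)) \<and>
     (\<forall>x\<in>free_star X. \<forall>y\<in>free_star X. h (x * y) = cmult B (h x) (h y)) \<and>
     (\<forall>x\<in>free_star X. h (adj x) = cadj B (h x))"

lemma poly_hom_seminorm:
  assumes "cstar_algebra B" "poly_hom X B h"
  shows "cstar_seminorm X (\<lambda>x. cnorm B (h x))"
proof -
  interpret cstar_algebra B by fact
  show ?thesis using assms(2)
    by (auto simp: cstar_seminorm_def poly_hom_def norm_nonneg norm_triangle norm_scale norm_mult
        norm_cstar)
qed

lemma poly_hom_zero:
  assumes "cstar_algebra B" "poly_hom X B h" shows "h 0 = czero B"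
proof -
  interpret cstar_algebra B by fact
  have "h (scale 0 0) = cscale B 0 (h 0)" "h 0 \<in> car B"
    using assms(2) by (auto simp: poly_hom_def)
  thus ?thesis using scale_zero_left by (simp add: pscale_zero)
qed

lemma poly_hom_diff:
  assumes "poly_hom X B h" "x \<in> free_star X" "y \<in> free_star X"
  shows "h (x - y) = cdiff B (h x) (h y)"
proof -
  have eq: "x - y = x + scale (- 1) y" by (simp add: pscale_minus_one)
  show ?thesis unfolding eq using assms by (simp add: poly_hom_def cdiff_def)
qed

locale univ_rels =
  fixes X :: "'g set" and R :: "'g star_poly set"
  assumes bounded: "g \<in> X \<Longrightarrow> \<exists>K. \<forall>p\<in>admissible X R. p (gen g) \<le> K"
    and R_free: "R \<subseteq> free_star X"
begin

lemma admissible_bounded: assumes "x \<in> free_star X" shows "\<exists>K. \<forall>p\<in>admissible X R. p x \<le> K"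
proof -
  have sn: "star_seminorm X p" if "p \<in> admissible X R" for p
    using that by (simp add: admissible_def star_seminorm_def)
  show ?thesis using assms
  proof (induction x rule: free_star_induct)
    case (gen g) thus ?case by (rule bounded)
  next
    case zero thus ?case by (intro exI[of _ 0] ballI) (simp add: star_seminorm.N_zero[OF sn])
  next
    case (add x y)
    then obtain K L where "\<forall>p\<in>admissible X R. p x \<le> K" "\<forall>p\<in>admissible X R. p y \<le> L" by blast
    hence "p (x + y) \<le> K + L" if "p \<in> admissible X R" for p
      using star_seminorm.triangle[OF sn[OF that] add(1,2)] that by fastforce
    thus ?case by blast
  next
    case (scale c x)
    then obtain K where "\<forall>p\<in>admissible X R. p x \<le> K" by blast
    hence "p (scale c x) \<le> cmod c * K" if "p \<in> admissible X R" for p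
      using star_seminorm.N_scale[OF sn[OF that] scale(1), of c] that by (simp add: mult_left_mono)
    thus ?case by blast
  next
    case (mult x y)
    then obtain K L where KL: "\<forall>p\<in>admissible X R. p x \<le> K" "\<forall>p\<in>admissible X R. p y \<le> L" by blast
    show ?case
    proof (intro exI[of _ "\<bar>K\<bar> * \<bar>L\<bar>"] ballI)
      fix p assume p: "p \<in> admissible X R"
      have "p (x * y) \<le> p x * p y" using star_seminorm.N_mult[OF sn[OF p]] mult by blast
      also have "\<dots> \<le> \<bar>K\<bar> * \<bar>L\<bar>"
      proof (rule mult_mono)
        show "p x \<le> \<bar>K\<bar>" "p y \<le> \<bar>L\<bar>" using KL p by force+
        show "0 \<le> p y" using star_seminorm.nonneg[OF sn[OF p] mult(2)] .
      qed simp
      finally show "p (x * y) \<le> \<bar>K\<bar> * \<bar>L\<bar>" .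
    qed
  next
    case (adj x) thus ?case by (simp add: star_seminorm.N_adj[OF sn])
  qed
qed

lemma admissible_zero: "(\<lambda>_. 0) \<in> admissible X R"
  by (simp add: admissible_def cstar_seminorm_def)

lemma admissible_le: assumes "p \<in> admissible X R" "x \<in> free_star X" shows "p x \<le> univ_norm X R x"
  unfolding univ_norm_def using admissible_bounded[OF assms(2)] assms(1)
  by (intro cSUP_upper) (auto simp: bdd_above_def)

lemma univ_norm_least: assumes "\<And>p. p \<in> admissible X R \<Longrightarrow> p x \<le> K" shows "univ_norm X R x \<le> K"
  unfolding univ_norm_def using admissible_zero assms by (intro cSUP_least) auto

lemma univ_norm_seminorm: "cstar_seminorm X (univ_norm X R)"
proof -
  let ?N = "univ_norm X R"
  have sn: "star_seminorm X p" if "p \<in> admissible X R" for p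
    using that by (simp add: admissible_def star_seminorm_def)
  have nonneg: "0 \<le> ?N x" if "x \<in> free_star X" for x
    using admissible_le[OF admissible_zero that] .
  have tri: "?N (x + y) \<le> ?N x + ?N y" if "x \<in> free_star X" "y \<in> free_star X" for x y
  proof (rule univ_norm_least)
    fix p assume p: "p \<in> admissible X R"
    show "p (x + y) \<le> ?N x + ?N y"
      using star_seminorm.triangle[OF sn[OF p] that] admissible_le[OF p that(1)]
        admissible_le[OF p that(2)] by simp
  qed
  have sc: "?N (scale c x) \<le> cmod c * ?N x" if "x \<in> free_star X" for x c
  proof (rule univ_norm_least)
    fix p assume p: "p \<in> admissible X R"
    show "p (scale c x) \<le> cmod c * ?N x"
      using star_seminorm.N_scale[OF sn[OF p] that, of c] admissible_le[OF p that]
      by (simp add: mult_left_mono)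
  qed
  have sc': "?N (scale c x) = cmod c * ?N x" if "x \<in> free_star X" for x c
  proof (cases "c = 0")
    case True thus ?thesis using sc[OF that, of 0] nonneg[of "scale 0 x"] that by simp
  next
    case False
    have "?N x = ?N (scale (1 / c) (scale c x))"
      using False by (simp add: pscale_scale pscale_one)
    also have "\<dots> \<le> cmod (1 / c) * ?N (scale c x)" using sc that by simp
    finally have "cmod c * ?N x \<le> ?N (scale c x)" using False by (simp add: field_simps norm_divide)
    thus ?thesis using sc[OF that, of c] by simp
  qed
  have mult: "?N (x * y) \<le> ?N x * ?N y" if "x \<in> free_star X" "y \<in> free_star X" for x y
  proof (rule univ_norm_least)
    fix p assume p: "p \<in> admissible X R"
    have "p (x * y) \<le> p x * p y" using star_seminorm.N_mult[OF sn[OF p]] that by blast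
    also have "\<dots> \<le> ?N x * ?N y"
      using admissible_le[OF p] star_seminorm.nonneg[OF sn[OF p]] that nonneg by (intro mult_mono) auto
    finally show "p (x * y) \<le> ?N x * ?N y" .
  qed
  have cstar: "?N (adj x * x) = (?N x)\<^sup>2" if "x \<in> free_star X" for x
  proof (rule antisym)
    show "?N (adj x * x) \<le> (?N x)\<^sup>2"
    proof (rule univ_norm_least)
      fix p assume p: "p \<in> admissible X R"
      thus "p (adj x * x) \<le> (?N x)\<^sup>2"
        using star_seminorm.N_cstar[OF sn[OF p] that] admissible_le[OF p that]
          star_seminorm.nonneg[OF sn[OF p] that] by (simp add: power_mono)
    qed
    have "?N x \<le> sqrt (?N (adj x * x))"
    proof (rule univ_norm_least)
      fix p assume p: "p \<in> admissible X R"
      have "(p x)\<^sup>2 \<le> ?N (adj x * x)"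
        using star_seminorm.N_cstar[OF sn[OF p] that] admissible_le[OF p, of "adj x * x"] that by simp
      thus "p x \<le> sqrt (?N (adj x * x))" by (rule real_le_rsqrt)
    qed
    from power_mono[OF this nonneg[OF that], of 2]
    show "(?N x)\<^sup>2 \<le> ?N (adj x * x)"
      using nonneg[of "adj x * x"] that by simp
  qed
  show ?thesis unfolding cstar_seminorm_def by (simp add: nonneg tri sc' mult cstar)
qed

sublocale star_seminorm X "univ_norm X R"
  by unfold_locales (rule univ_norm_seminorm)

lemma C_univ: "C = univ_cstar X R"
  by (simp add: univ_cstar_def)

lemma univ_elem_cls: "univ_elem X R x = cls (\<lambda>k. x)"
  by (simp add: univ_elem_def cls_def)

lemma univ_norm_R: "r \<in> R \<Longrightarrow> univ_norm X R r = 0"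
  using univ_norm_least[of r 0] nonneg[of r] R_free by (force simp: admissible_def)

theorem univ_cstar_algebra: "cstar_algebra (univ_cstar X R)"
  using completion_cstar_algebra by (simp add: C_univ)

lemma univ_elem_hom: "poly_hom X (univ_cstar X R) (univ_elem X R)"
  by (simp add: poly_hom_def univ_elem_cls C_add C_scale C_mult C_adj flip: C_univ)

lemma univ_elem_norm: "x \<in> free_star X \<Longrightarrow> cnorm (univ_cstar X R) (univ_elem X R x) = univ_norm X R x"
  using C_norm_const by (simp add: univ_elem_cls flip: C_univ)

lemma univ_elem_R: "r \<in> R \<Longrightarrow> univ_elem X R r = czero (univ_cstar X R)"
  using univ_elem_norm[of r] univ_norm_R[of r] R_free univ_elem_hom
    cstar_algebra.norm_eq_zero[OF univ_cstar_algebra, of "univ_elem X R r"]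
  by (auto simp: poly_hom_def)

text \<open>The universal property, for C*-algebras of arbitrary type.\<close>

theorem univ_cstar_exists:
  assumes B: "cstar_algebra B" and h: "poly_hom X B h" and hR: "\<And>r. r \<in> R \<Longrightarrow> h r = czero B"
  shows "\<exists>f. star_hom (univ_cstar X R) B f \<and> contractive (univ_cstar X R) B f \<and>
    (\<forall>x\<in>free_star X. f (univ_elem X R x) = h x)"
proof -
  interpret B: cstar_algebra B by fact
  have hc: "h x \<in> car B" if "x \<in> free_star X" for x using h that by (auto simp: poly_hom_def)
  have le: "cnorm B (h x) \<le> univ_norm X R x" if "x \<in> free_star X" for x
    using admissible_le[OF _ that, of "\<lambda>x. cnorm B (h x)"] poly_hom_seminorm[OF B h] hR
    by (simp add: admissible_def B.norm_zero)
  have ex: "\<exists>b. B.lims (\<lambda>k. h (x k)) b" if x: "x \<in> CS" for x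
  proof -
    have "\<exists>b\<in>car B. (\<lambda>k. cnorm B (cdiff B (h (x k)) b)) \<longlonglongrightarrow> 0"
    proof (rule B.norm_complete)
      fix e :: real assume "e > 0"
      then obtain M where M: "\<And>m k. m \<ge> M \<Longrightarrow> k \<ge> M \<Longrightarrow> univ_norm X R (x m - x k) < e"
        using CS_E[OF x] by blast
      have "cnorm B (cdiff B (h (x m)) (h (x k))) < e" if "m \<ge> M" "k \<ge> M" for m k
        using M[OF that] le[of "x m - x k"] CS_F[OF x] by (simp add: poly_hom_diff[OF h])
      thus "\<exists>M. \<forall>m\<ge>M. \<forall>k\<ge>M. cnorm B (cdiff B (h (x m)) (h (x k))) < e" by blast
    qed (use hc CS_F[OF x] in auto)
    thus ?thesis using hc CS_F[OF x] by (auto simp: B.lims_def)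
  qed
  define f where "f a = (SOME b. B.lims (\<lambda>k. h (rep a k)) b)" for a
  have f: "B.lims (\<lambda>k. h (x k)) (f (cls x))" if x: "x \<in> CS" for x
  proof -
    note r = rep_cls[OF x]
    have L: "B.lims (\<lambda>k. h (rep (cls x) k)) (f (cls x))"
      unfolding f_def using ex[OF r(1)] by (rule someI_ex)
    have "B.lims (\<lambda>k. h (x k)) (f (cls x))"
    proof (rule B.lims_I)
      show "cnorm B (cdiff B (h (x k)) (f (cls x))) \<le>
          univ_norm X R (x k - rep (cls x) k) + cnorm B (cdiff B (h (rep (cls x) k)) (f (cls x)))" for k
      proof -
        have c: "h (x k) \<in> car B" "h (rep (cls x) k) \<in> car B" "f (cls x) \<in> car B"
          using hc CS_F x r L by (auto simp: B.lims_def)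
        have "cnorm B (cdiff B (h (x k)) (h (rep (cls x) k))) \<le> univ_norm X R (x k - rep (cls x) k)"
          using le[of "x k - rep (cls x) k"] CS_F[OF x] CS_F[OF r(1)] by (simp add: poly_hom_diff[OF h])
        thus ?thesis using B.diff_trans[OF c] B.norm_triangle[OF B.diff_closed[OF c(1,2)] B.diff_closed[OF c(2,3)]]
          by simp
      qed
      show "(\<lambda>k. univ_norm X R (x k - rep (cls x) k) + cnorm B (cdiff B (h (rep (cls x) k)) (f (cls x)))) \<longlonglongrightarrow> 0"
        using r L by (auto simp: NR_iff B.lims_def intro: tendsto_add_zero)
    qed (use hc CS_F[OF x] L in \<open>auto simp: B.lims_def\<close>)
    thus ?thesis .
  qed
  have fc: "f (cls x) \<in> car B" if "x \<in> CS" for x using f[OF that] by (simp add: B.lims_def)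
  have hom2: "h (x + y) = cadd B (h x) (h y)" "h (x * y) = cmult B (h x) (h y)"
    if "x \<in> free_star X" "y \<in> free_star X" for x y
    using h that by (auto simp: poly_hom_def)
  have hom1: "h (scale c x) = cscale B c (h x)" "h (adj x) = cadj B (h x)"
    if "x \<in> free_star X" for x c
    using h that by (auto simp: poly_hom_def)
  note hom = hom1 hom2
  have "star_hom C B f"
    unfolding star_hom_def
  proof (intro conjI ballI allI)
    fix a assume "a \<in> car C"
    then obtain x where x: "x \<in> CS" "a = cls x" by (blast elim: car_cases)
    show "f a \<in> car B" using x fc by simp
    show "f (cscale C c a) = cscale B c (f a)" for c
      using B.lims_unique[OF f[OF CS_scale[OF x(1), of c]], of "cscale B c (f a)"]
        B.lims_scale[OF f[OF x(1)], of c] x CS_F[OF x(1)] by (simp add: C_scale hom)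
    show "f (cadj C a) = cadj B (f a)"
      using B.lims_unique[OF f[OF CS_adj[OF x(1)]], of "cadj B (f a)"]
        B.lims_adj[OF f[OF x(1)]] x CS_F[OF x(1)] by (simp add: C_adj hom)
    fix b assume "b \<in> car C"
    then obtain y where y: "y \<in> CS" "b = cls y" by (blast elim: car_cases)
    show "f (cadd C a b) = cadd B (f a) (f b)"
      using B.lims_unique[OF f[OF CS_add[OF x(1) y(1)]], of "cadd B (f a) (f b)"]
        B.lims_add[OF f[OF x(1)] f[OF y(1)]] x y CS_F[OF x(1)] CS_F[OF y(1)] by (simp add: C_add hom)
    show "f (cmult C a b) = cmult B (f a) (f b)"
      using B.lims_unique[OF f[OF CS_mult[OF x(1) y(1)]], of "cmult B (f a) (f b)"]
        B.lims_mult[OF f[OF x(1)] f[OF y(1)]] x y CS_F[OF x(1)] CS_F[OF y(1)] by (simp add: C_mult hom)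
  qed
  moreover have "contractive C B f"
    unfolding contractive_def
  proof
    fix a assume "a \<in> car C"
    then obtain x where x: "x \<in> CS" "a = cls x" by (blast elim: car_cases)
    show "cnorm B (f a) \<le> cnorm C a"
      unfolding x(2)
    proof (rule LIMSEQ_le[OF B.lims_norm[OF f[OF x(1)]] C_norm[OF x(1)]])
      show "\<exists>N. \<forall>k\<ge>N. cnorm B (h (x k)) \<le> univ_norm X R (x k)" using le CS_F[OF x(1)] by blast
    qed
  qed
  moreover have "f (univ_elem X R x) = h x" if "x \<in> free_star X" for x
    using B.lims_unique[OF f[OF CS_const[OF that]] B.lims_const[OF hc[OF that]]]
    by (simp add: univ_elem_cls)
  ultimately show ?thesis by (auto simp: C_univ)
qed

theorem univ_cstar_unique:
  assumes B: "cstar_algebra B"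
    and f: "star_hom (univ_cstar X R) B f" "contractive (univ_cstar X R) B f"
    and g: "star_hom (univ_cstar X R) B g" "contractive (univ_cstar X R) B g"
    and eq: "\<And>t. t \<in> X \<Longrightarrow> f (univ_elem X R (gen t)) = g (univ_elem X R (gen t))"
    and a: "a \<in> car (univ_cstar X R)"
  shows "f a = g a"
proof -
  interpret B: cstar_algebra B by fact
  interpret A: cstar_algebra "univ_cstar X R" by (rule univ_cstar_algebra)
  let ?A = "univ_cstar X R"
  note f' = f(1)[unfolded star_hom_def] and g' = g(1)[unfolded star_hom_def]
  have hom_zero: "k (czero ?A) = czero B" if "star_hom ?A B k" for k
    using that A.scale_zero_left[OF A.zero_closed] B.scale_zero_left A.zero_closed
    unfolding star_hom_def by metis
  have ec: "univ_elem X R x \<in> car ?A" if "x \<in> free_star X" for x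
    using univ_elem_hom that by (auto simp: poly_hom_def)
  have eqF: "f (univ_elem X R x) = g (univ_elem X R x)" if "x \<in> free_star X" for x
    using that
  proof (induction x rule: free_star_induct)
    case zero
    show ?case using poly_hom_zero[OF univ_cstar_algebra univ_elem_hom] hom_zero[OF f(1)] hom_zero[OF g(1)] by simp
  qed (use univ_elem_hom f' g' ec eq in \<open>simp_all add: poly_hom_def\<close>)
  have lims_hom: "B.lims (\<lambda>k. u (x k)) (u a)"
    if u: "star_hom ?A B u" "contractive ?A B u" and x: "A.lims x a" for u x
  proof (rule B.lims_I)
    have c: "x k \<in> car ?A" for k using x by (simp add: A.lims_def)
    have "u (cdiff ?A (x k) a) = cdiff B (u (x k)) (u a)" for k
      using u(1) c a by (simp add: star_hom_def cdiff_def A.closed)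
    thus "cnorm B (cdiff B (u (x k)) (u a)) \<le> cnorm ?A (cdiff ?A (x k) a)" for k
      using u(2) A.diff_closed[OF c a] unfolding contractive_def by metis
  qed (use u x in \<open>auto simp: A.lims_def star_hom_def\<close>)
  have "\<exists>x. x \<in> free_star X \<and> cnorm ?A (cdiff ?A a (univ_elem X R x)) < inverse (Suc k)" for k
    using C_dense[of a "inverse (Suc k)"] a by (auto simp: C_univ univ_elem_cls)
  then obtain x where x: "\<And>k. x k \<in> free_star X"
      "\<And>k. cnorm ?A (cdiff ?A a (univ_elem X R (x k))) < inverse (Suc k)"
    by metis
  have L: "A.lims (\<lambda>k. univ_elem X R (x k)) a"
  proof (rule A.lims_I)
    show "cnorm ?A (cdiff ?A (univ_elem X R (x k)) a) \<le> inverse (Suc k)" for k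
      using x(2)[of k] A.norm_diff_commute[OF a ec[OF x(1)[of k]]] by simp
  qed (use ec x(1) a LIMSEQ_inverse_real_of_nat in auto)
  show ?thesis
    using B.lims_unique[OF lims_hom[OF f L]] lims_hom[OF g L] eqF x(1) by simp
qed

end

lemma admissible_gen_le_1:
  assumes p: "p \<in> admissible X R" and g: "g \<in> X"
    and r: "gen g * adj (gen g) * gen g - gen g \<in> R"
  shows "p (gen g) \<le> 1"
proof -
  interpret star_seminorm X p using p by (simp add: admissible_def star_seminorm_def)
  let ?g = "gen g" and ?q = "adj (gen g) * gen g"
  have F: "?g \<in> FX" using g by simp
  have q: "p (?q * ?q - ?q) = 0"
  proof -
    have "?q * ?q - ?q = adj ?g * (?g * adj ?g * ?g - ?g)" by (simp add: algebra_simps)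
    thus ?thesis using N_mult[of "adj ?g" "?g * adj ?g * ?g - ?g"] nonneg[of "?q * ?q - ?q"] p r F
      by (simp add: admissible_def)
  qed
  have "p (?q * ?q) = p ?q" using N_abs_diff[of "?q * ?q" ?q] q F by simp
  moreover have "p (?q * ?q) = (p ?q)\<^sup>2" using N_cstar[of ?q] F by simp
  ultimately have "p ?q = 0 \<or> p ?q = 1" by (simp add: power2_eq_square)
  hence "(p ?g)\<^sup>2 \<le> 1\<^sup>2" using N_cstar[OF F] by auto
  thus ?thesis by (rule power2_le_imp_le) simp
qed

lemma admissible_proj_le_1:
  assumes p: "p \<in> admissible X R" and g: "g \<in> X"
    and r: "adj (gen g) - gen g \<in> R" "gen g * gen g - gen g \<in> R"
  shows "p (gen g) \<le> 1"
proof -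
  interpret star_seminorm X p using p by (simp add: admissible_def star_seminorm_def)
  let ?g = "gen g"
  have F: "?g \<in> FX" using g by simp
  have "p (adj ?g * ?g - ?g * ?g) = 0"
    using N_mult[of "adj ?g - ?g" ?g] nonneg[of "adj ?g * ?g - ?g * ?g"] p r F
    by (simp add: admissible_def algebra_simps)
  hence "p (adj ?g * ?g) = p (?g * ?g)" using N_abs_diff[of "adj ?g * ?g" "?g * ?g"] F by simp
  moreover have "p (?g * ?g) = p ?g"
    using N_abs_diff[of "?g * ?g" ?g] p r F by (simp add: admissible_def)
  ultimately have "p ?g * p ?g = p ?g" using N_cstar[OF F] by (simp add: power2_eq_square)
  thus ?thesis by (cases "p ?g = 0") auto
qed

lemma graph_gens_iff [simp]:
  "GProj v \<in> graph_gens H \<longleftrightarrow> v \<in> verts H" "GIso e \<in> graph_gens H \<longleftrightarrow> e \<in> arcs H"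
  by (auto simp: graph_gens_def)

lemma graph_relsI:
  shows "v \<in> verts H \<Longrightarrow> adj (gp v) - gp v \<in> graph_rels H"
  and "v \<in> verts H \<Longrightarrow> gp v * gp v - gp v \<in> graph_rels H"
  and "v \<in> verts H \<Longrightarrow> w \<in> verts H \<Longrightarrow> v \<noteq> w \<Longrightarrow> gp v * gp w \<in> graph_rels H"
  and "e \<in> arcs H \<Longrightarrow> gs e * adj (gs e) * gs e - gs e \<in> graph_rels H"
  and "e \<in> arcs H \<Longrightarrow> adj (gs e) * gs e - gp (head H e) \<in> graph_rels H"
  and "v \<in> verts H \<Longrightarrow> out_arcs H v \<noteq> {} \<Longrightarrow> gp v - (\<Sum>e\<in>out_arcs H v. gs e * adj (gs e)) \<in> graph_rels H"
  unfolding graph_rels_def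
  subgoal by (rule UnI1, rule UnI1, rule UnI1, rule UnI1, rule UnI1, blast)
  subgoal by (rule UnI1, rule UnI1, rule UnI1, rule UnI1, rule UnI2, blast)
  subgoal by (rule UnI1, rule UnI1, rule UnI1, rule UnI2, blast)
  subgoal by (rule UnI1, rule UnI1, rule UnI2, blast)
  subgoal by (rule UnI1, rule UnI2, blast)
  subgoal by (rule UnI2, blast)
  done

lemma labelled_relsI:
  shows "A \<in> \<B> \<Longrightarrow> adj (lp A) - lp A \<in> labelled_rels H L \<B>"
  and "A \<in> \<B> \<Longrightarrow> lp A * lp A - lp A \<in> labelled_rels H L \<B>"
  and "a \<in> L ` arcs H \<Longrightarrow> ls a * adj (ls a) * ls a - ls a \<in> labelled_rels H L \<B>"
  unfolding labelled_rels_def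
  subgoal by (rule UnI1, rule UnI1, rule UnI1, rule UnI1, rule UnI1, rule UnI1, rule UnI1, rule UnI1, rule UnI1, blast)
  subgoal by (rule UnI1, rule UnI1, rule UnI1, rule UnI1, rule UnI1, rule UnI1, rule UnI1, rule UnI1, rule UnI2, blast)
  subgoal by (rule UnI1, rule UnI1, rule UnI1, rule UnI1, rule UnI1, rule UnI1, rule UnI1, rule UnI2, blast)
  done

lemma graph_univ_rels: assumes "wf_digraph H" shows "univ_rels (graph_gens H) (graph_rels H)"
proof
  fix g assume g: "g \<in> graph_gens H"
  show "\<exists>K. \<forall>p\<in>admissible (graph_gens H) (graph_rels H). p (gen g) \<le> K"
  proof (cases g)
    case (GProj v)
    hence "v \<in> verts H" using g by (auto simp: graph_gens_def)
    hence "adj (gen g) - gen g \<in> graph_rels H" "gen g * gen g - gen g \<in> graph_rels H"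
      unfolding GProj by (simp_all add: graph_relsI)
    thus ?thesis using admissible_proj_le_1[OF _ g] by (intro exI[of _ 1]) simp
  next
    case (GIso e)
    hence "e \<in> arcs H" using g by (auto simp: graph_gens_def)
    hence "gen g * adj (gen g) * gen g - gen g \<in> graph_rels H"
      unfolding GIso by (simp add: graph_relsI)
    thus ?thesis using admissible_gen_le_1[OF _ g] by (intro exI[of _ 1]) simp
  qed
next
  have [simp]: "head H e \<in> verts H" if "e \<in> arcs H" for e
    using wf_digraph.head_in_verts[OF assms that] .
  show "graph_rels H \<subseteq> free_star (graph_gens H)"
    by (auto simp: graph_rels_def graph_gens_def intro!: free_star_diff free_star_sum)
qed

lemma rel_range_verts: "wf_digraph H \<Longrightarrow> rel_range H L A \<alpha> \<subseteq> verts H"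
  by (auto simp: rel_range_def labelled_path_def dest: wf_digraph.awalk_last_in_verts)

lemma labelled_paths_letter:
  assumes "wf_digraph H" "a \<in> L ` arcs H" shows "[a] \<in> labelled_paths H L"
proof -
  obtain e where e: "e \<in> arcs H" "a = L e" using assms by blast
  hence "pre_digraph.awalk H (tail H e) [e] (head H e)"
    using assms(1) by (simp add: pre_digraph.awalk_def pre_digraph.cas.simps wf_digraph.tail_in_verts)
  thus ?thesis using e unfolding labelled_paths_def labelled_path_def by force
qed

lemma labelled_univ_rels:
  assumes "wf_digraph H" "accommodating H L \<B>" "{} \<in> \<B>"
  shows "univ_rels (labelled_gens H L \<B>) (labelled_rels H L \<B>)"
proof
  fix g assume g: "g \<in> labelled_gens H L \<B>"
  show "\<exists>K. \<forall>p\<in>admissible (labelled_gens H L \<B>) (labelled_rels H L \<B>). p (gen g) \<le> K"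
  proof (cases g)
    case (LProj A)
    hence "A \<in> \<B>" using g by (auto simp: labelled_gens_def)
    hence "adj (gen g) - gen g \<in> labelled_rels H L \<B>" "gen g * gen g - gen g \<in> labelled_rels H L \<B>"
      unfolding LProj by (simp_all add: labelled_relsI)
    thus ?thesis using admissible_proj_le_1[OF _ g] by (intro exI[of _ 1]) simp
  next
    case (LIso a)
    hence "a \<in> L ` arcs H" using g by (auto simp: labelled_gens_def)
    hence "gen g * adj (gen g) * gen g - gen g \<in> labelled_rels H L \<B>"
      unfolding LIso by (simp add: labelled_relsI)
    thus ?thesis using admissible_gen_le_1[OF _ g] by (intro exI[of _ 1]) simp
  qed
next
  let ?X = "labelled_gens H L \<B>"
  have P: "lp A \<in> free_star ?X \<longleftrightarrow> A \<in> \<B>" for A by (auto simp: labelled_gens_def)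
  have S: "ls a \<in> free_star ?X \<longleftrightarrow> a \<in> L ` arcs H" for a by (auto simp: labelled_gens_def)
  have B: "A \<union> B \<in> \<B>" "A \<inter> B \<in> \<B>" if "A \<in> \<B>" "B \<in> \<B>" for A B
    using assms(2) that by (auto simp: accommodating_def)
  have r: "rel_range H L A [a] \<in> \<B>" "path_range H L [a] \<in> \<B>"
    if "A \<in> \<B>" "a \<in> L ` arcs H" for A a
    using assms labelled_paths_letter[OF assms(1) that(2)] that by (auto simp: accommodating_def)
  have s: "{v} \<in> \<B>" if "is_sink H v" for v using assms(2) that by (auto simp: accommodating_def)
  have e: "a \<in> L ` arcs H" if "a \<in> emitted_labels H L A" for a A
    using that by (auto simp: emitted_labels_def)
  show "labelled_rels H L \<B> \<subseteq> free_star ?X"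
    unfolding labelled_rels_def
    by (auto simp del: free_star_gen image_iff simp: P S B r r(2)[OF assms(3)] s assms(3) dest: e
        intro!: free_star_add free_star_diff free_star_mult free_star_adj free_star_sum)
qed



definition subst_word :: "('g \<Rightarrow> 'h star_poly) \<Rightarrow> 'g word \<Rightarrow> 'h star_poly" where
  "subst_word \<theta> w = prod_list (map (\<lambda>(g, b). if b then adj (\<theta> g) else \<theta> g) (letters w))"

definition poly_subst :: "('g \<Rightarrow> 'h star_poly) \<Rightarrow> 'g star_poly \<Rightarrow> 'h star_poly" where
  "poly_subst \<theta> x = (\<Sum>w\<in>Poly_Mapping.keys x. scale (Poly_Mapping.lookup x w) (subst_word \<theta> w))"

lemma poly_subst_superset:
  assumes "finite S" "Poly_Mapping.keys x \<subseteq> S"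
  shows "poly_subst \<theta> x = (\<Sum>w\<in>S. scale (Poly_Mapping.lookup x w) (subst_word \<theta> w))"
  unfolding poly_subst_def
  by (rule sum.mono_neutral_left) (use assms in \<open>auto simp: in_keys_iff pscale_zero_left\<close>)

lemma poly_subst_add [simp]: "poly_subst \<theta> (x + y) = poly_subst \<theta> x + poly_subst \<theta> y"
proof -
  let ?S = "Poly_Mapping.keys x \<union> Poly_Mapping.keys y"
  show ?thesis
    using poly_subst_superset[of ?S x \<theta>] poly_subst_superset[of ?S y \<theta>]
      poly_subst_superset[of ?S "x + y" \<theta>] keys_add[of x y]
    by (simp add: lookup_add pscale_add_left sum.distrib)
qed

lemma poly_subst_0 [simp]: "poly_subst \<theta> 0 = 0"
  by (simp add: poly_subst_def)

lemma poly_subst_single: "poly_subst \<theta> (Poly_Mapping.single w c) = scale c (subst_word \<theta> w)"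
  by (simp add: poly_subst_def pscale_zero_left)

lemma poly_subst_scale [simp]: "poly_subst \<theta> (scale c x) = scale c (poly_subst \<theta> x)"
proof (induction x rule: star_poly_induct)
  case (single w d)
  have "scale c (Poly_Mapping.single w d) = Poly_Mapping.single w (c * d)"
    by (simp add: scale_def mult_single)
  thus ?case by (simp add: poly_subst_single pscale_scale)
qed (simp_all add: pscale_add_right pscale_zero)

lemma poly_subst_uminus [simp]: "poly_subst \<theta> (- x) = - poly_subst \<theta> x"
  using poly_subst_scale[of \<theta> "- 1" x] by (simp only: pscale_minus_one)

lemma poly_subst_diff [simp]: "poly_subst \<theta> (x - y) = poly_subst \<theta> x - poly_subst \<theta> y"
  using poly_subst_add[of \<theta> x "- y"] by simp

lemma poly_subst_sum: "poly_subst \<theta> (sum f S) = (\<Sum>i\<in>S. poly_subst \<theta> (f i))"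
  by (induction S rule: infinite_finite_induct) auto

lemma subst_word_add: "subst_word \<theta> (u + v) = subst_word \<theta> u * subst_word \<theta> v"
  by (simp add: subst_word_def plus_word_def)

lemma poly_subst_mult [simp]: "poly_subst \<theta> (x * y) = poly_subst \<theta> x * poly_subst \<theta> y"
proof (induction x rule: star_poly_induct)
  case (single w c)
  show ?case
    by (induction y rule: star_poly_induct)
      (simp_all add: poly_subst_single mult_single subst_word_add pmult_scale_left pmult_scale_right
        pscale_scale algebra_simps)
qed (simp_all add: algebra_simps)

lemma adj_one [simp]: "adj 1 = 1"
  using adj_single[of 0 1] by simp

lemma subst_word_adj: "subst_word \<theta> (adj_word w) = adj (subst_word \<theta> w)"
proof -
  have "prod_list (map (\<lambda>(g, b). if b then adj (\<theta> g) else \<theta> g) (rev (map (\<lambda>(g, b). (g, \<not> b)) xs))) =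
      adj (prod_list (map (\<lambda>(g, b). if b then adj (\<theta> g) else \<theta> g) xs))" for xs
    by (induction xs) auto
  thus ?thesis by (simp add: subst_word_def adj_word_def)
qed

lemma poly_subst_adj [simp]: "poly_subst \<theta> (adj x) = adj (poly_subst \<theta> x)"
  by (induction x rule: star_poly_induct) (simp_all add: adj_single poly_subst_single subst_word_adj)

lemma poly_subst_gen [simp]: "poly_subst \<theta> (gen g) = \<theta> g"
  by (simp add: gen_def poly_subst_single subst_word_def pscale_one)

lemma poly_subst_free:
  assumes "\<And>g. g \<in> X \<Longrightarrow> \<theta> g \<in> free_star Y" "x \<in> free_star X"
  shows "poly_subst \<theta> x \<in> free_star Y"
  using assms(2) by (induction x rule: free_star_induct) (auto intro: assms(1))

lemma poly_hom_subst:
  assumes "\<And>g. g \<in> X \<Longrightarrow> \<theta> g \<in> free_star Y" "poly_hom Y B h"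
  shows "poly_hom X B (\<lambda>x. h (poly_subst \<theta> x))"
proof -
  have "poly_subst \<theta> x \<in> free_star Y" if "x \<in> free_star X" for x
    by (rule poly_subst_free[OF assms(1) that])
  thus ?thesis using assms(2) by (simp add: poly_hom_def)
qed

lemma univ_cstar_map:
  assumes "univ_rels X R" "univ_rels Y Q" "\<And>g. g \<in> X \<Longrightarrow> \<theta> g \<in> free_star Y"
    and rels: "\<And>r. r \<in> R \<Longrightarrow> univ_norm Y Q (poly_subst \<theta> r) = 0"
  shows "\<exists>f. star_hom (univ_cstar X R) (univ_cstar Y Q) f \<and>
    contractive (univ_cstar X R) (univ_cstar Y Q) f \<and>
    (\<forall>x\<in>free_star X. f (univ_elem X R x) = univ_elem Y Q (poly_subst \<theta> x))"
proof -
  interpret X: univ_rels X R by fact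
  interpret Y: univ_rels Y Q by fact
  show ?thesis
  proof (rule X.univ_cstar_exists)
    show "cstar_algebra (univ_cstar Y Q)" by (rule Y.univ_cstar_algebra)
    show "poly_hom X (univ_cstar Y Q) (\<lambda>x. univ_elem Y Q (poly_subst \<theta> x))"
      by (rule poly_hom_subst[OF assms(3) Y.univ_elem_hom])
    fix r assume r: "r \<in> R"
    have F: "poly_subst \<theta> r \<in> free_star Y"
      by (rule poly_subst_free[OF assms(3)]) (use r X.R_free in auto)
    hence "univ_elem Y Q (poly_subst \<theta> r) \<in> car (univ_cstar Y Q)"
      using Y.univ_elem_hom by (simp add: poly_hom_def)
    thus "univ_elem Y Q (poly_subst \<theta> r) = czero (univ_cstar Y Q)"
      using Y.univ_elem_norm[OF F] rels[OF r] cstar_algebra.norm_eq_zero[OF Y.univ_cstar_algebra] by metis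
  qed
qed

subsection \<open>Existence of the quotient map and of the flip\<close>

lemma wf_disc: "wf_digraph (disc_graph n)"
  by standard (auto simp: disc_graph_def)

lemma wf_sphere: "wf_digraph (sphere_graph n)"
  unfolding sphere_graph_def by (rule wf_digraph.wellformed_induce_subgraph[OF wf_disc])

lemma sphere_sel: "verts (sphere_graph n) = {1..n}"
    "arcs (sphere_graph n) = {(i, j). 1 \<le> i \<and> i \<le> j \<and> j \<le> n}"
    "tail (sphere_graph n) = fst" "head (sphere_graph n) = snd"
  by (auto simp: sphere_graph_def disc_graph_def)

lemma disc_sel: "verts (disc_graph n) = {1..n + 1}"
    "arcs (disc_graph n) = {(i, j). 1 \<le> i \<and> i \<le> n \<and> i \<le> j \<and> j \<le> n + 1}"
    "tail (disc_graph n) = fst" "head (disc_graph n) = snd"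
  by (auto simp: disc_graph_def)

lemma out_arcs_disc: "v \<in> {1..n} \<Longrightarrow> out_arcs (disc_graph n) v = Pair v ` {v..n + 1}"
  and out_arcs_disc_last: "out_arcs (disc_graph n) (n + 1) = {}"
  and out_arcs_sphere: "v \<in> {1..n} \<Longrightarrow> out_arcs (sphere_graph n) v = Pair v ` {v..n}"
  by (auto simp: out_arcs_def disc_sel sphere_sel)

lemma disc_to_sphere_exists: "\<exists>\<pi>. is_disc_to_sphere q n \<pi>"
proof -
  let ?X = "graph_gens (disc_graph n)" and ?R = "graph_rels (disc_graph n)"
  let ?Y = "graph_gens (sphere_graph n)" and ?Q = "graph_rels (sphere_graph n)"
  interpret S: univ_rels ?Y ?Q by (rule graph_univ_rels[OF wf_sphere])
  define \<theta> :: "(nat, nat \<times> nat) ggen \<Rightarrow> (nat, nat \<times> nat) ggen star_poly" where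
    "\<theta> g = (case g of GProj v \<Rightarrow> if v \<le> n then gp v else 0
       | GIso e \<Rightarrow> if snd e \<le> n then gs e else 0)" for g
  have F: "\<theta> g \<in> free_star ?Y" if "g \<in> ?X" for g
    using that by (auto simp: \<theta>_def graph_gens_def disc_sel sphere_sel)
  have th: "poly_subst \<theta> (gp v) = (if v \<le> n then gp v else 0)"
      "poly_subst \<theta> (gs e) = (if snd e \<le> n then gs e else 0)" for v e
    by (auto simp: \<theta>_def)
  have "poly_subst \<theta> r \<in> insert 0 ?Q" if "r \<in> ?R" for r
    using that[unfolded graph_rels_def]
  proof (elim UnE)
    assume "r \<in> {gp v - (\<Sum>e\<in>out_arcs (disc_graph n) v. gs e * adj (gs e)) |v.
        v \<in> verts (disc_graph n) \<and> out_arcs (disc_graph n) v \<noteq> {}}"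
    then obtain v where v: "r = gp v - (\<Sum>e\<in>out_arcs (disc_graph n) v. gs e * adj (gs e))"
        "v \<in> verts (disc_graph n)" "out_arcs (disc_graph n) v \<noteq> {}" by blast
    have vn: "v \<in> {1..n}" using v(2,3) out_arcs_disc_last[of n] by (cases "v = n + 1") (auto simp: disc_sel)
    have "{v..n + 1} = insert (n + 1) {v..n}" using vn by auto
    hence "poly_subst \<theta> r = gp v - (\<Sum>j\<in>{v..n}. gs (v, j) * adj (gs (v, j)))"
      using vn by (simp add: v(1) out_arcs_disc th poly_subst_sum sum.reindex inj_on_def
          del: poly_subst_gen image_insert)
    also have "\<dots> = gp v - (\<Sum>e\<in>out_arcs (sphere_graph n) v. gs e * adj (gs e))"
      using vn by (simp add: out_arcs_sphere sum.reindex inj_on_def)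
    also have "\<dots> \<in> ?Q"
    proof -
      have "v \<in> verts (sphere_graph n)" "out_arcs (sphere_graph n) v \<noteq> {}"
        using vn by (auto simp: out_arcs_sphere sphere_sel)
      thus ?thesis by (rule graph_relsI)
    qed
    finally show ?thesis by simp
  next
    assume "r \<in> {gp v * gp w |v w. v \<in> verts (disc_graph n) \<and> w \<in> verts (disc_graph n) \<and> v \<noteq> w}"
    then obtain v w where "r = gp v * gp w" "v \<noteq> w" "v \<ge> 1" "w \<ge> 1" by (auto simp: disc_sel)
    thus ?thesis using graph_relsI(3)[of v "sphere_graph n" w]
      by (cases "v \<le> n \<and> w \<le> n") (auto simp: sphere_sel th simp del: poly_subst_gen)
  next
    assume "r \<in> {adj (gs e) * gs e - gp (head (disc_graph n) e) |e. e \<in> arcs (disc_graph n)}"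
    then obtain i j where "r = adj (gs (i, j)) * gs (i, j) - gp j" "(i, j) \<in> arcs (disc_graph n)"
      by (auto simp: disc_sel)
    thus ?thesis using graph_relsI(5)[of "(i, j)" "sphere_graph n"]
      by (cases "j \<le> n") (auto simp: sphere_sel disc_sel th simp del: poly_subst_gen)
  next
    assume "r \<in> {gs e * adj (gs e) * gs e - gs e |e. e \<in> arcs (disc_graph n)}"
    then obtain i j where "r = gs (i, j) * adj (gs (i, j)) * gs (i, j) - gs (i, j)" "(i, j) \<in> arcs (disc_graph n)"
      by auto
    thus ?thesis using graph_relsI(4)[of "(i, j)" "sphere_graph n"]
      by (cases "j \<le> n") (auto simp: sphere_sel disc_sel th simp del: poly_subst_gen)
  next
    assume "r \<in> {adj (gp v) - gp v |v. v \<in> verts (disc_graph n)}"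
    then obtain v where "r = adj (gp v) - gp v" "v \<ge> 1" by (auto simp: disc_sel)
    thus ?thesis using graph_relsI(1)[of v "sphere_graph n"]
      by (cases "v \<le> n") (simp_all add: sphere_sel th del: poly_subst_gen)
  next
    assume "r \<in> {gp v * gp v - gp v |v. v \<in> verts (disc_graph n)}"
    then obtain v where "r = gp v * gp v - gp v" "v \<ge> 1" by (auto simp: disc_sel)
    thus ?thesis using graph_relsI(2)[of v "sphere_graph n"]
      by (cases "v \<le> n") (simp_all add: sphere_sel th del: poly_subst_gen)
  qed
  hence rels: "univ_norm ?Y ?Q (poly_subst \<theta> r) = 0" if "r \<in> ?R" for r
    using that S.univ_norm_R by (metis S.N_zero insert_iff)
  obtain \<pi> where p: "star_hom (univ_cstar ?X ?R) (univ_cstar ?Y ?Q) \<pi> \<and>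
      contractive (univ_cstar ?X ?R) (univ_cstar ?Y ?Q) \<pi> \<and>
      (\<forall>x\<in>free_star ?X. \<pi> (univ_elem ?X ?R x) = univ_elem ?Y ?Q (poly_subst \<theta> x))"
    using univ_cstar_map[where \<theta> = \<theta>, OF graph_univ_rels[OF wf_disc] graph_univ_rels[OF wf_sphere] F rels] by (rule exE)
  note \<pi> = p[THEN conjunct1] p[THEN conjunct2, THEN conjunct1]
    p[THEN conjunct2, THEN conjunct2, rule_format]
  have zero: "univ_elem ?Y ?Q 0 = czero (univ_cstar ?Y ?Q)"
    by (rule poly_hom_zero[OF S.univ_cstar_algebra S.univ_elem_hom])
  have "is_disc_to_sphere q n \<pi>"
    unfolding is_disc_to_sphere_def quantum_disc_def quantum_sphere_def graph_cstar_def
      disc_elem_def sphere_elem_def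
    using \<pi>(1,2) by (intro conjI ballI) (simp_all add: \<pi>(3) disc_sel th zero del: poly_subst_gen)
  thus ?thesis by blast
qed

lemma flip_exists: assumes "n \<ge> 1" shows "\<exists>\<beta>. is_flip q n \<beta>"
proof -
  let ?Y = "graph_gens (sphere_graph n)" and ?Q = "graph_rels (sphere_graph n)"
  let ?S = "univ_cstar ?Y ?Q"
  interpret S: univ_rels ?Y ?Q by (rule graph_univ_rels[OF wf_sphere])
  interpret A: cstar_algebra ?S by (rule S.univ_cstar_algebra)
  let ?N = "univ_norm ?Y ?Q"
  define \<theta> :: "(nat, nat \<times> nat) ggen \<Rightarrow> (nat, nat \<times> nat) ggen star_poly" where
    "\<theta> g = (if g = GIso (n, n) then adj (gen g) else gen g)" for g
  have F: "\<theta> g \<in> free_star ?Y" if "g \<in> ?Y" for g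
    using that by (auto simp: \<theta>_def)
  have th: "poly_subst \<theta> (gp v) = gp v"
      "poly_subst \<theta> (gs e) = (if e = (n, n) then adj (gs e) else gs e)" for v e
    by (auto simp: \<theta>_def)
  let ?s = "gs (n, n)"
  have r1: "gp n - ?s * adj ?s \<in> ?Q"
  proof -
    have "n \<in> verts (sphere_graph n)" "out_arcs (sphere_graph n) n = {(n, n)}"
      using assms by (auto simp: out_arcs_sphere sphere_sel)
    moreover from this have "gp n - ?s * adj ?s = gp n - (\<Sum>e\<in>out_arcs (sphere_graph n) n. gs e * adj (gs e))"
      by simp
    ultimately show ?thesis using graph_relsI(6)[of n "sphere_graph n"] by simp
  qed
  have nn: "(n, n) \<in> arcs (sphere_graph n)" using assms by (auto simp: sphere_sel)
  have r2: "adj ?s * ?s - gp n \<in> ?Q"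
    using graph_relsI(5)[OF nn] by (simp add: sphere_sel)
  have r3: "?s * adj ?s * ?s - ?s \<in> ?Q"
    using graph_relsI(4)[OF nn] .
  have N: "?N (- r) = 0" "?N (adj r) = 0" if "r \<in> ?Q" for r
    using S.univ_norm_R[OF that] S.R_free that by (auto simp: S.N_adj subset_iff)
  have rels: "?N (poly_subst \<theta> r) = 0" if r: "r \<in> ?Q" for r
    using r[unfolded graph_rels_def]
  proof (elim UnE)
    assume "r \<in> {gp v - (\<Sum>e\<in>out_arcs (sphere_graph n) v. gs e * adj (gs e)) |v.
        v \<in> verts (sphere_graph n) \<and> out_arcs (sphere_graph n) v \<noteq> {}}"
    then obtain v where v: "r = gp v - (\<Sum>e\<in>out_arcs (sphere_graph n) v. gs e * adj (gs e))"
        "v \<in> {1..n}" by (auto simp: sphere_sel)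
    show ?thesis
    proof (cases "v = n")
      case True
      have "r = gp n - ?s * adj ?s" using v True assms by (simp add: out_arcs_sphere)
      hence "poly_subst \<theta> r = - (adj ?s * ?s - gp n)" by (simp add: th del: poly_subst_gen)
      thus ?thesis using N(1)[OF r2] by simp
    next
      case False
      have "poly_subst \<theta> r = r"
        using v False by (auto simp: out_arcs_sphere th poly_subst_sum simp del: poly_subst_gen intro!: sum.cong)
      thus ?thesis using r S.univ_norm_R by simp
    qed
  next
    assume "r \<in> {adj (gs e) * gs e - gp (head (sphere_graph n) e) |e. e \<in> arcs (sphere_graph n)}"
    then obtain e where e: "r = adj (gs e) * gs e - gp (snd e)" by (auto simp: sphere_sel)
    show ?thesis
    proof (cases "e = (n, n)")
      case True
      hence "poly_subst \<theta> r = - (gp n - ?s * adj ?s)" using e by (simp add: th del: poly_subst_gen)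
      thus ?thesis using N(1)[OF r1] by simp
    next
      case False
      thus ?thesis using r S.univ_norm_R e by (simp add: th del: poly_subst_gen)
    qed
  next
    assume "r \<in> {gs e * adj (gs e) * gs e - gs e |e. e \<in> arcs (sphere_graph n)}"
    then obtain e where e: "r = gs e * adj (gs e) * gs e - gs e" by auto
    show ?thesis
    proof (cases "e = (n, n)")
      case True
      hence "poly_subst \<theta> r = adj (?s * adj ?s * ?s - ?s)"
        using e by (simp add: th mult.assoc del: poly_subst_gen)
      thus ?thesis using N(2)[OF r3] by simp
    next
      case False
      thus ?thesis using r S.univ_norm_R e by (simp add: th del: poly_subst_gen)
    qed
  next
    assume "r \<in> {gp v * gp w |v w. v \<in> verts (sphere_graph n) \<and> w \<in> verts (sphere_graph n) \<and> v \<noteq> w}"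
    then obtain v w where "r = gp v * gp w" by auto
    thus ?thesis using r S.univ_norm_R by (simp add: th del: poly_subst_gen)
  next
    assume "r \<in> {adj (gp v) - gp v |v. v \<in> verts (sphere_graph n)}"
    then obtain v where "r = adj (gp v) - gp v" by auto
    thus ?thesis using r S.univ_norm_R by (simp add: th del: poly_subst_gen)
  next
    assume "r \<in> {gp v * gp v - gp v |v. v \<in> verts (sphere_graph n)}"
    then obtain v where "r = gp v * gp v - gp v" by auto
    thus ?thesis using r S.univ_norm_R by (simp add: th del: poly_subst_gen)
  qed
  obtain \<beta> where b: "star_hom ?S ?S \<beta> \<and> contractive ?S ?S \<beta> \<and>
      (\<forall>x\<in>free_star ?Y. \<beta> (univ_elem ?Y ?Q x) = univ_elem ?Y ?Q (poly_subst \<theta> x))"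
    using univ_cstar_map[where \<theta> = \<theta>, OF graph_univ_rels[OF wf_sphere] graph_univ_rels[OF wf_sphere] F rels] by (rule exE)
  note \<beta> = b[THEN conjunct1] b[THEN conjunct2, THEN conjunct1]
    b[THEN conjunct2, THEN conjunct2, rule_format]
  have closed: "\<beta> a \<in> car ?S" if "a \<in> car ?S" for a using \<beta>(1) that by (simp add: star_hom_def)
  have inv: "\<beta> (\<beta> a) = a" if "a \<in> car ?S" for a
  proof (rule S.univ_cstar_unique[OF S.univ_cstar_algebra _ _ _ _ _ that, where f = "\<lambda>a. \<beta> (\<beta> a)" and g = "\<lambda>a. a"])
    show "star_hom ?S ?S (\<lambda>a. \<beta> (\<beta> a))" using \<beta>(1) by (simp add: star_hom_def)
    show "contractive ?S ?S (\<lambda>a. \<beta> (\<beta> a))"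
      unfolding contractive_def
    proof
      fix a assume a: "a \<in> car ?S"
      have "cnorm ?S (\<beta> (\<beta> a)) \<le> cnorm ?S (\<beta> a)" "cnorm ?S (\<beta> a) \<le> cnorm ?S a"
        using \<beta>(2) a closed[OF a] by (auto simp: contractive_def)
      thus "cnorm ?S (\<beta> (\<beta> a)) \<le> cnorm ?S a" by simp
    qed
    show "star_hom ?S ?S (\<lambda>a. a)" by (simp add: star_hom_def)
    show "contractive ?S ?S (\<lambda>a. a)" by (simp add: contractive_def)
    show "\<beta> (\<beta> (univ_elem ?Y ?Q (gen t))) = univ_elem ?Y ?Q (gen t)" if "t \<in> ?Y" for t
      using that F[OF that] by (simp add: \<beta>(3) \<theta>_def)
  qed
  have bij: "bij_betw \<beta> (car ?S) (car ?S)"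
    by (rule bij_betw_byWitness[where f' = \<beta>]) (simp_all add: inv closed image_subset_iff)
  have adj: "univ_elem ?Y ?Q (adj ?s) = cadj ?S (univ_elem ?Y ?Q ?s)"
    using S.univ_elem_hom nn by (simp add: poly_hom_def)
  have "is_flip q n \<beta>"
    unfolding is_flip_def star_iso_def quantum_disc_def quantum_sphere_def graph_cstar_def sphere_elem_def
    using \<beta>(1,2) bij assms
    by (intro conjI ballI impI) (simp_all add: \<beta>(3) sphere_sel th adj del: poly_subst_gen)
  thus ?thesis by blast
qed

subsection \<open>The labelled space\<close>

lemma labelled_path_Cons:
  assumes "wf_digraph H"
  shows "labelled_path H L u (a # \<alpha>) v \<longleftrightarrow>
    (\<exists>e\<in>arcs H. tail H e = u \<and> L e = a \<and>
      (if \<alpha> = [] then head H e = v else labelled_path H L (head H e) \<alpha> v))"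
proof
  interpret wf_digraph H by fact
  assume "labelled_path H L u (a # \<alpha>) v"
  then obtain e p where p: "awalk u (e # p) v" "L e = a" "map L p = \<alpha>"
    unfolding labelled_path_def by (metis Cons_eq_map_conv)
  thus "\<exists>e\<in>arcs H. tail H e = u \<and> L e = a \<and>
      (if \<alpha> = [] then head H e = v else labelled_path H L (head H e) \<alpha> v)"
    by (intro bexI[of _ e]) (auto simp: awalk_def labelled_path_def)
next
  interpret wf_digraph H by fact
  assume "\<exists>e\<in>arcs H. tail H e = u \<and> L e = a \<and>
      (if \<alpha> = [] then head H e = v else labelled_path H L (head H e) \<alpha> v)"
  then obtain e where e: "e \<in> arcs H" "tail H e = u" "L e = a"
      "if \<alpha> = [] then head H e = v else labelled_path H L (head H e) \<alpha> v" by blast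
  then obtain p where "awalk (head H e) p v" "map L p = \<alpha>"
    by (cases "\<alpha> = []") (auto simp: labelled_path_def awalk_def)
  hence "awalk u (e # p) v" "map L (e # p) = a # \<alpha>"
    using e by (auto simp: awalk_def)
  thus "labelled_path H L u (a # \<alpha>) v"
    unfolding labelled_path_def by (intro exI[of _ "e # p"]) simp
qed

lemma rel_range_single:
  assumes "wf_digraph H"
  shows "rel_range H L A [a] = {head H e |e. e \<in> arcs H \<and> tail H e \<in> A \<and> L e = a}"
  by (auto simp: rel_range_def labelled_path_Cons[OF assms])

lemma rel_range_Cons:
  assumes "wf_digraph H" "\<alpha> \<noteq> []"
  shows "rel_range H L A (a # \<alpha>) = rel_range H L (rel_range H L A [a]) \<alpha>"
  using assms(2) by (auto simp: rel_range_def labelled_path_Cons[OF assms(1)])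

lemma labelled_paths_letters:
  assumes "wf_digraph H" "\<alpha> \<in> labelled_paths H L"
  shows "\<alpha> \<noteq> []" "set \<alpha> \<subseteq> L ` arcs H"
proof -
  obtain p where "p \<noteq> []" "set p \<subseteq> arcs H" "\<alpha> = map L p"
    using assms(2) by (auto simp: labelled_paths_def labelled_path_def pre_digraph.awalk_def)
  thus "\<alpha> \<noteq> []" "set \<alpha> \<subseteq> L ` arcs H" by auto
qed

lemma rel_range_closed:
  assumes "wf_digraph H"
    and closed: "\<And>A a. A \<in> \<B> \<Longrightarrow> a \<in> L ` arcs H \<Longrightarrow> rel_range H L A [a] \<in> \<B>"
  shows "\<alpha> \<noteq> [] \<Longrightarrow> set \<alpha> \<subseteq> L ` arcs H \<Longrightarrow> A \<in> \<B> \<Longrightarrow> rel_range H L A \<alpha> \<in> \<B>"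
proof (induction \<alpha> arbitrary: A)
  case (Cons a \<alpha>)
  thus ?case using closed[of A a] by (cases "\<alpha> = []") (simp_all add: rel_range_Cons[OF assms(1)])
qed simp

lemma rel_range_Int:
  assumes "wf_digraph H"
    and closed: "\<And>A a. A \<in> \<B> \<Longrightarrow> a \<in> L ` arcs H \<Longrightarrow> rel_range H L A [a] \<in> \<B>"
    and Int: "\<And>A B a. A \<in> \<B> \<Longrightarrow> B \<in> \<B> \<Longrightarrow> a \<in> L ` arcs H \<Longrightarrow>
      rel_range H L A [a] \<inter> rel_range H L B [a] = rel_range H L (A \<inter> B) [a]"
  shows "\<alpha> \<noteq> [] \<Longrightarrow> set \<alpha> \<subseteq> L ` arcs H \<Longrightarrow> A \<in> \<B> \<Longrightarrow> B \<in> \<B> \<Longrightarrow>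
    rel_range H L A \<alpha> \<inter> rel_range H L B \<alpha> = rel_range H L (A \<inter> B) \<alpha>"
proof (induction \<alpha> arbitrary: A B)
  case (Cons a \<alpha>)
  thus ?case using closed[of A a] closed[of B a] Int[of A B a]
    by (cases "\<alpha> = []") (simp_all add: rel_range_Cons[OF assms(1)])
qed simp

lemma wf_mirror: "wf_digraph (mirror_graph n)"
  by standard (auto simp: mirror_graph_def)

lemma mirror_sel:
  "verts (mirror_graph n) = VU ` {1..n - 1} \<union> VV ` {1..} \<union> {VW1, VW2}"
  "arcs (mirror_graph n) = {EE i j |i j. 1 \<le> i \<and> i \<le> j \<and> j \<le> n - 1} \<union>
            {EF i j |i j. 1 \<le> i \<and> i \<le> n - 1 \<and> 1 \<le> j} \<union> EG ` {1..} \<union> EH ` {1..}"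
  "tail (mirror_graph n) (EE i j) = VU i" "tail (mirror_graph n) (EF i j) = VU i"
  "tail (mirror_graph n) (EG i) = (if i = 1 then VW2 else VV (i - 1))"
  "tail (mirror_graph n) (EH i) = VV i"
  "head (mirror_graph n) (EE i j) = VU j"
  "head (mirror_graph n) (EF i j) = (if j = 1 then VW1 else if j = 2 then VW2 else VV (j - 2))"
  "head (mirror_graph n) (EG i) = VV i" "head (mirror_graph n) (EH i) = VW1"
  by (simp_all add: mirror_graph_def)

lemma mirror_sink: "is_sink (mirror_graph n) v \<longleftrightarrow> v = VW1"
proof (cases v)
  case (VU i)
  have "EF i 1 \<in> out_arcs (mirror_graph n) (VU i)" if "i \<in> {1..n - 1}"
    using that by (auto simp: out_arcs_def mirror_sel)
  thus ?thesis using VU unfolding is_sink_def by (fastforce simp: mirror_sel(1))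
next
  case (VV i)
  have "EH i \<in> out_arcs (mirror_graph n) (VV i)" if "i \<ge> 1"
    using that by (auto simp: out_arcs_def mirror_sel)
  thus ?thesis using VV unfolding is_sink_def by (fastforce simp: mirror_sel(1))
next
  case VW1
  have "out_arcs (mirror_graph n) VW1 = {}"
    by (auto simp: out_arcs_def mirror_sel split: if_splits)
  thus ?thesis using VW1 unfolding is_sink_def by (simp add: mirror_sel(1))
next
  case VW2
  have "EG 1 \<in> out_arcs (mirror_graph n) VW2" by (auto simp: out_arcs_def mirror_sel)
  thus ?thesis using VW2 unfolding is_sink_def by auto
qed

definition mirror_tails :: "vert set set" where
  "mirror_tails = {{}, V_from 1 \<union> {VW2}} \<union> V_from ` {1..}"

lemma mirror_tails_chain: "A \<in> mirror_tails \<Longrightarrow> B \<in> mirror_tails \<Longrightarrow> A \<subseteq> B \<or> B \<subseteq> A"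
proof -
  have "V_from i \<subseteq> V_from j \<or> V_from j \<subseteq> V_from i" for i j
    by (cases "i \<le> j") (auto simp: V_from_def)
  moreover have "V_from i \<subseteq> V_from 1 \<union> {VW2}" if "i \<ge> 1" for i
    using that by (auto simp: V_from_def)
  moreover assume "A \<in> mirror_tails" "B \<in> mirror_tails"
  ultimately show ?thesis unfolding mirror_tails_def
    by (elim UnE insertE emptyE imageE) (simp_all del: One_nat_def)
qed

lemma mirror_sets_tail:
  assumes "A \<in> mirror_sets n" shows "A \<inter> (VV ` {1..} \<union> {VW2}) \<in> mirror_tails"
  using assms
proof induction
  case (3 i)
  hence "V_from i \<inter> (VV ` {1..} \<union> {VW2}) = V_from i" by (auto simp: V_from_def)
  thus ?case using 3 by (auto simp: mirror_tails_def)
next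
  case 4
  have "(V_from 1 \<union> {VW2}) \<inter> (VV ` {1..} \<union> {VW2}) = V_from 1 \<union> {VW2}" by (auto simp: V_from_def)
  thus ?case by (auto simp: mirror_tails_def)
next
  case (5 A B)
  thus ?case using mirror_tails_chain[OF 5(3,4)] by (metis Int_Un_distrib2 sup.absorb1 sup.absorb2)
next
  case (6 A B)
  have "A \<inter> B \<inter> (VV ` {1..} \<union> {VW2}) = (A \<inter> (VV ` {1..} \<union> {VW2})) \<inter> (B \<inter> (VV ` {1..} \<union> {VW2}))"
    by blast
  thus ?case using 6 mirror_tails_chain[OF 6(3,4)] by (metis inf.absorb1 inf.absorb2)
qed (auto simp: mirror_tails_def)

lemma mirror_sets_verts: "A \<in> mirror_sets n \<Longrightarrow> A \<subseteq> verts (mirror_graph n)"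
  by (induction rule: mirror_sets.induct) (auto simp: mirror_sel V_from_def)

lemma mirror_sets_empty: "{} \<in> mirror_sets n"
proof -
  have "{VW1} \<inter> V_from 1 \<in> mirror_sets n" by (intro mirror_sets.intros) simp
  moreover have "{VW1} \<inter> V_from 1 = {}" by (auto simp: V_from_def)
  ultimately show ?thesis by simp
qed

lemma mirror_sets_all: "verts (mirror_graph n) \<in> mirror_sets n"
proof -
  have "VU ` S \<in> mirror_sets n" if "finite S" "S \<subseteq> {1..n - 1}" for S
    using that
  proof (induction S)
    case (insert i S)
    hence "{VU i} \<in> mirror_sets n" "VU ` S \<in> mirror_sets n" by (auto intro: mirror_sets.intros(1))
    from mirror_sets.intros(5)[OF this] have "{VU i} \<union> VU ` S \<in> mirror_sets n" .
    thus ?case by simp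
  qed (simp add: mirror_sets_empty)
  hence "VU ` {1..n - 1} \<union> ({VW1} \<union> (V_from 1 \<union> {VW2})) \<in> mirror_sets n"
    by (rule mirror_sets.intros(5)[OF _ mirror_sets.intros(5)[OF mirror_sets.intros(2,4)]]) auto
  moreover have "VU ` {1..n - 1} \<union> ({VW1} \<union> (V_from 1 \<union> {VW2})) = verts (mirror_graph n)"
    by (auto simp: mirror_sel V_from_def)
  ultimately show ?thesis by simp
qed

lemma mirror_range_LE: "1 \<le> i \<Longrightarrow> i \<le> j \<Longrightarrow> j \<le> n - 1 \<Longrightarrow>
    rel_range (mirror_graph n) mirror_label A [LE i j] = (if VU i \<in> A then {VU j} else {})"
  by (auto simp: rel_range_single[OF wf_mirror] mirror_sel intro!: exI[of _ "EE i j"])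

lemma mirror_range_LF:
  assumes "1 \<le> i" "i \<le> n - 1"
  shows "rel_range (mirror_graph n) mirror_label A [LF i] =
    (if VU i \<in> A then {VW1} \<union> (V_from 1 \<union> {VW2}) else {})"
proof -
  have 1: "rel_range (mirror_graph n) mirror_label A [LF i] =
      {head (mirror_graph n) (EF i j) |j. 1 \<le> j \<and> VU i \<in> A}"
  proof -
    have "e \<in> arcs (mirror_graph n) \<and> tail (mirror_graph n) e \<in> A \<and> mirror_label e = LF i \<longleftrightarrow>
        (\<exists>j\<ge>1. e = EF i j \<and> VU i \<in> A)" for e
      using assms by (cases e) (auto simp: mirror_sel)
    thus ?thesis unfolding rel_range_single[OF wf_mirror] by auto
  qed
  have "{head (mirror_graph n) (EF i j) |j. 1 \<le> j} = {VW1} \<union> (V_from 1 \<union> {VW2})"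
  proof (intro equalityI subsetI)
    fix v assume "v \<in> {VW1} \<union> (V_from 1 \<union> {VW2})"
    then consider "v = VW1" | "v = VW2" | k where "v = VV k" "k \<ge> 1" by (auto simp: V_from_def)
    thus "v \<in> {head (mirror_graph n) (EF i j) |j. 1 \<le> j}"
    proof cases
      case 1 thus ?thesis by (auto simp: mirror_sel intro!: exI[of _ 1])
    next
      case 2 thus ?thesis by (auto simp: mirror_sel intro!: exI[of _ 2])
    next
      case 3 thus ?thesis by (auto simp: mirror_sel intro!: exI[of _ "k + 2"])
    qed
  next
    fix v assume "v \<in> {head (mirror_graph n) (EF i j) |j. 1 \<le> j}"
    then obtain j where "v = head (mirror_graph n) (EF i j)" "1 \<le> j" by blast
    thus "v \<in> {VW1} \<union> (V_from 1 \<union> {VW2})" by (simp add: mirror_sel V_from_def)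
  qed
  thus ?thesis using 1 by auto
qed

lemma mirror_range_LG:
  "rel_range (mirror_graph n) mirror_label A [LG] =
     {VV i |i. 1 \<le> i \<and> (if i = 1 then VW2 else VV (i - 1)) \<in> A}"
proof -
  have "e \<in> arcs (mirror_graph n) \<and> tail (mirror_graph n) e \<in> A \<and> mirror_label e = LG \<longleftrightarrow>
      (\<exists>i\<ge>1. e = EG i \<and> (if i = 1 then VW2 else VV (i - 1)) \<in> A)" for e
    by (cases e) (auto simp: mirror_sel)
  hence "rel_range (mirror_graph n) mirror_label A [LG] =
      {head (mirror_graph n) (EG i) |i. 1 \<le> i \<and> (if i = 1 then VW2 else VV (i - 1)) \<in> A}"
    unfolding rel_range_single[OF wf_mirror] by auto
  thus ?thesis by (simp only: mirror_sel)
qed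

lemma mirror_range_LH:
  "rel_range (mirror_graph n) mirror_label A [LH] = {VW1 |i. 1 \<le> i \<and> VV i \<in> A}"
proof -
  have "e \<in> arcs (mirror_graph n) \<and> tail (mirror_graph n) e \<in> A \<and> mirror_label e = LH \<longleftrightarrow>
      (\<exists>i\<ge>1. e = EH i \<and> VV i \<in> A)" for e
    by (cases e) (auto simp: mirror_sel)
  hence "rel_range (mirror_graph n) mirror_label A [LH] =
      {head (mirror_graph n) (EH i) |i. 1 \<le> i \<and> VV i \<in> A}"
    unfolding rel_range_single[OF wf_mirror] by auto
  thus ?thesis by (simp only: mirror_sel)
qed

lemma mirror_labels:
  assumes "a \<in> mirror_label ` arcs (mirror_graph n)"
  obtains i j where "a = LE i j" "1 \<le> i" "i \<le> j" "j \<le> n - 1"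
  | i where "a = LF i" "1 \<le> i" "i \<le> n - 1" | "a = LG" | "a = LH"
  using assms by (auto simp: mirror_sel)

lemma mirror_range_closed:
  assumes "A \<in> mirror_sets n" "a \<in> mirror_label ` arcs (mirror_graph n)"
  shows "rel_range (mirror_graph n) mirror_label A [a] \<in> mirror_sets n"
  using assms(2)
proof (cases rule: mirror_labels)
  case (1 i j) thus ?thesis by (auto simp: mirror_range_LE mirror_sets_empty intro: mirror_sets.intros)
next
  case (2 i)
  have "{VW1} \<union> (V_from 1 \<union> {VW2}) \<in> mirror_sets n" by (intro mirror_sets.intros)
  thus ?thesis using 2 by (simp add: mirror_range_LF mirror_sets_empty)
next
  case 3
  let ?T = "A \<inter> (VV ` {1..} \<union> {VW2})"
  have eq: "rel_range (mirror_graph n) mirror_label A [a] =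
      {VV i |i. 1 \<le> i \<and> (if i = 1 then VW2 else VV (i - 1)) \<in> ?T}"
  proof -
    have "1 \<le> i \<and> (if i = 1 then VW2 else VV (i - 1)) \<in> ?T \<longleftrightarrow>
        1 \<le> i \<and> (if i = 1 then VW2 else VV (i - 1)) \<in> A" for i
      by (cases "i = 1") auto
    thus ?thesis unfolding 3 mirror_range_LG by simp
  qed
  consider "?T = {}" | "?T = V_from 1 \<union> {VW2}" | k where "?T = V_from k" "k \<ge> 1"
    using mirror_sets_tail[OF assms(1)] by (auto simp: mirror_tails_def)
  thus ?thesis
  proof cases
    case 1 thus ?thesis unfolding eq by (simp add: mirror_sets_empty)
  next
    case 2
    have mem: "1 \<le> i \<and> (if i = 1 then VW2 else VV (i - 1)) \<in> V_from 1 \<union> {VW2} \<longleftrightarrow> 1 \<le> i" for i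
      by (cases "i = 1") (auto simp: V_from_def)
    have "rel_range (mirror_graph n) mirror_label A [a] = V_from 1"
      unfolding eq 2 mem by (auto simp: V_from_def)
    thus ?thesis by (simp add: mirror_sets.intros)
  next
    case (3 k)
    have "VV i \<in> V_from (k + 1) \<longleftrightarrow> 1 \<le> i \<and> (if i = 1 then VW2 else VV (i - 1)) \<in> V_from k" for i
      using 3(2) by (auto simp: V_from_def)
    moreover have "v \<in> V_from (k + 1) \<Longrightarrow> \<exists>i. v = VV i" for v by (auto simp: V_from_def)
    ultimately have "rel_range (mirror_graph n) mirror_label A [a] = V_from (k + 1)"
      unfolding eq 3(1) by blast
    thus ?thesis using mirror_sets.intros(3)[of "k + 1"] by simp
  qed
next
  case 4
  hence "rel_range (mirror_graph n) mirror_label A [a] \<in> {{}, {VW1}}" by (auto simp: mirror_range_LH)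
  thus ?thesis using mirror_sets_empty mirror_sets.intros(2) by auto
qed

lemma mirror_range_Int:
  assumes "A \<in> mirror_sets n" "B \<in> mirror_sets n" "a \<in> mirror_label ` arcs (mirror_graph n)"
  shows "rel_range (mirror_graph n) mirror_label A [a] \<inter> rel_range (mirror_graph n) mirror_label B [a] =
    rel_range (mirror_graph n) mirror_label (A \<inter> B) [a]"
  using assms(3)
proof (cases rule: mirror_labels)
  case (1 i j) thus ?thesis by (simp add: mirror_range_LE)
next
  case (2 i) thus ?thesis by (simp add: mirror_range_LF)
next
  case 3 thus ?thesis by (auto simp: mirror_range_LG)
next
  case 4
  have "\<exists>i\<ge>1. VV i \<in> A \<inter> B" if ij: "VV i \<in> A" "i \<ge> 1" "VV j \<in> B" "j \<ge> 1" for i j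
  proof -
    have up: "VV (max i j) \<in> C" if C: "C \<in> mirror_sets n" and k: "VV k \<in> C" "1 \<le> k" "k \<le> max i j" for C k
    proof -
      have tails: "VV (max i j) \<in> T" if "T \<in> mirror_tails" "VV k \<in> T" for T
        using that k by (auto simp: mirror_tails_def V_from_def)
      have "VV k \<in> C \<inter> (VV ` {1..} \<union> {VW2})" using k by auto
      from tails[OF mirror_sets_tail[OF C] this] show ?thesis by blast
    qed
    have "VV (max i j) \<in> A \<inter> B" using up[OF assms(1), of i] up[OF assms(2), of j] ij by simp
    thus ?thesis using ij by (intro exI[of _ "max i j"]) simp
  qed
  hence "(\<exists>i\<ge>1. VV i \<in> A) \<and> (\<exists>i\<ge>1. VV i \<in> B) \<longleftrightarrow> (\<exists>i\<ge>1. VV i \<in> A \<inter> B)" by blast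
  thus ?thesis using 4 by (simp add: mirror_range_LH) blast
qed

theorem mirror_accommodating: "accommodating (mirror_graph n) mirror_label (mirror_sets n)"
  unfolding accommodating_def path_range_def
proof (intro conjI ballI allI impI)
  fix \<alpha> assume \<alpha>: "\<alpha> \<in> labelled_paths (mirror_graph n) mirror_label"
  note cl = rel_range_closed[OF wf_mirror mirror_range_closed labelled_paths_letters[OF wf_mirror \<alpha>]]
  show "rel_range (mirror_graph n) mirror_label (verts (mirror_graph n)) \<alpha> \<in> mirror_sets n"
    by (rule cl[OF _ _ mirror_sets_all])
  show "rel_range (mirror_graph n) mirror_label A \<alpha> \<in> mirror_sets n" if "A \<in> mirror_sets n" for A
    by (rule cl[OF _ _ that])
next
  show "mirror_sets n \<subseteq> Pow (verts (mirror_graph n))" using mirror_sets_verts by blast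
  show "{v} \<in> mirror_sets n" if "is_sink (mirror_graph n) v" for v
    using that by (simp add: mirror_sink mirror_sets.intros)
qed (auto intro: mirror_sets.intros)

theorem mirror_weakly_left_resolving:
  "weakly_left_resolving (mirror_graph n) mirror_label (mirror_sets n)"
  unfolding weakly_left_resolving_def
proof (intro ballI)
  fix A B \<alpha>
  assume AB: "A \<in> mirror_sets n" "B \<in> mirror_sets n"
    and \<alpha>: "\<alpha> \<in> labelled_paths (mirror_graph n) mirror_label"
  show "rel_range (mirror_graph n) mirror_label A \<alpha> \<inter> rel_range (mirror_graph n) mirror_label B \<alpha> =
      rel_range (mirror_graph n) mirror_label (A \<inter> B) \<alpha>"
    by (rule rel_range_Int[OF wf_mirror mirror_range_closed mirror_range_Int
          labelled_paths_letters[OF wf_mirror \<alpha>] AB])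
qed

theorem mirror_univ_rels:
  "univ_rels (labelled_gens (mirror_graph n) mirror_label (mirror_sets n))
     (labelled_rels (mirror_graph n) mirror_label (mirror_sets n))"
  by (rule labelled_univ_rels[OF wf_mirror mirror_accommodating mirror_sets_empty])

end

theory Submission
  imports Defs
begin

text \<open>The algebra \<open>A\<close> of the labelled space has two ideals: \<open>I\<close>, generated by
  \<open>p_{tail_set 0} - p_{tail_set 1}\<close>, which stands in for the missing projection of \<open>{w_2}\<close>, and \<open>J\<close>,
  generated by the projection of \<open>{w_1}\<close>. Sums of \<open>s_w b s_w^*\<close> over words \<open>w\<close> and minimal
  projections \<open>b\<close> are increasing projections \<open>e_k\<close> and \<open>f_k\<close> that form approximate units of \<open>I\<close> and
  \<open>J\<close>, and \<open>e_j f_k = 0\<close>; hence \<open>I \<inter> J = 0\<close> and \<open>a \<mapsto> (a + I, a + J)\<close> is injective. Modulo \<open>I\<close> and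
  modulo \<open>J\<close> the generators satisfy, up to invertible substitutions, the relations of the quantum
  disc, the generator of the label \<open>g\<close> becoming \<open>S_{n,n}\<close> in the first and the adjoint of the isometry
  \<open>S_{n,n} + S_{n,n+1}\<close> in the second case, whence the flip; modulo \<open>I + J\<close> they satisfy those of the
  sphere. So \<open>A\<close> is the pullback of \<open>A/I\<close> and \<open>A/J\<close> over \<open>A/(I + J)\<close>. The quotient norm by an ideal with
  such an approximate unit is the limit of \<open>\<parallel>x - x e_k\<parallel>\<close>, so that everything is proved from
  universal properties and norm estimates, without representations.\<close>

section \<open>Rings with involution\<close>

text \<open>The algebra is the completion of a free algebra in a supremum of seminorms, so a
  relation is never an equation of polynomials but a statement \<open>N r = 0\<close>. Each such
  quotient is mapped into a ring with involution, where relations become equations, and every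
  substitution is checked for an abstract family in such a ring.

  Why the quotients look like discs: \<open>S_g S_g^* + S_h S_h^* = U_0\<close> and
  \<open>S_g^* S_g = U_1\<close>, where \<open>U_0 >= U_1 >= ...\<close> are the projections of the
  tails. Killing \<open>U_0 - U_1\<close> identifies all tails, so \<open>g\<close> becomes an
  isometry with defect \<open>S_h S_h^*\<close>. Killing the projection of \<open>{w_1}\<close>
  kills \<open>S_h\<close>, so \<open>g\<close> becomes a coisometry with defect
  \<open>U_0 - U_1\<close>. Killing both leaves a unitary.

  The kernel of each map to the disc is controlled by pulling the quotient seminorm back along a
  substitution in the opposite direction: the result is admissible for the relations of the disc,
  hence at most its universal norm. The pullback is then reached because the combined map is bounded
  below and has dense range in it.\<close>

class star_ring = ring +
  fixes star :: "'a \<Rightarrow> 'a"  ("_\<^sup>\<star>" [999] 999)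
  assumes star_add [simp]: "(x + y)\<^sup>\<star> = x\<^sup>\<star> + y\<^sup>\<star>"
    and star_mult [simp]: "(x * y)\<^sup>\<star> = y\<^sup>\<star> * x\<^sup>\<star>"
    and star_star [simp]: "x\<^sup>\<star>\<^sup>\<star> = x"
begin

lemma star_zero [simp]: "0\<^sup>\<star> = 0"
  using star_add[of 0 0] by simp

lemma star_uminus [simp]: "(- x)\<^sup>\<star> = - x\<^sup>\<star>"
  using star_add[of x "- x"] by (simp add: eq_neg_iff_add_eq_0 add.commute)

lemma star_diff [simp]: "(x - y)\<^sup>\<star> = x\<^sup>\<star> - y\<^sup>\<star>"
  using star_add[of x "- y"] by simp

lemma star_sum: "(sum f S)\<^sup>\<star> = (\<Sum>i\<in>S. (f i)\<^sup>\<star>)"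
  by (induction S rule: infinite_finite_induct) auto

end

lemma cstar_seminorm_zero: "cstar_seminorm X N \<Longrightarrow> N 0 = 0"
  by (rule star_seminorm.N_zero[OF star_seminorm.intro])

text \<open>The seminorm laws hold only on \<open>free_star X\<close>. Reading everything outside as
  0 keeps the operations on families of arbitrary polynomials total.\<close>

definition clip :: "'g set \<Rightarrow> 'g star_poly \<Rightarrow> 'g star_poly" where
  "clip X x = (if x \<in> free_star X then x else 0)"

lemma clip_in [simp]: "clip X x \<in> free_star X"
  and clip_id [simp]: "x \<in> free_star X \<Longrightarrow> clip X x = x"
  by (simp_all add: clip_def)

text \<open>All pairs of a generating set \<open>X\<close> and a C*-seminorm \<open>N\<close> are treated at once: an element of
  \<open>sq\<close> is a family, indexed by these pairs, of elements of the quotients of \<open>free_star X\<close> by the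
  null ideal of \<open>N\<close>. Thus every such quotient embeds into one and the same type, and computations
  modulo \<open>N\<close> become computations in a ring with involution.\<close>

quotient_type 'g sq = "'g set \<times> ('g star_poly \<Rightarrow> real) \<Rightarrow> 'g star_poly" /
  "\<lambda>f g. \<forall>X N. cstar_seminorm X N \<longrightarrow> N (clip X (f (X, N)) - clip X (g (X, N))) = 0"
proof (rule equivpI)
  let ?R = "\<lambda>f g :: 'g set \<times> ('g star_poly \<Rightarrow> real) \<Rightarrow> 'g star_poly. \<forall>X N. cstar_seminorm X N \<longrightarrow>
     N (clip X (f (X, N)) - clip X (g (X, N))) = 0"
  show "reflp ?R"
    by (auto simp: reflp_def dest: cstar_seminorm_zero)
  show "symp ?R"
    by (auto simp: symp_def) (metis star_seminorm.N_commute star_seminorm.intro clip_in)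
  show "transp ?R"
  proof (rule transpI, intro allI impI)
    fix f g h :: "'g set \<times> ('g star_poly \<Rightarrow> real) \<Rightarrow> 'g star_poly" and X :: "'g set" and N
    assume fg: "?R f g" and gh: "?R g h" and N: "cstar_seminorm X N"
    interpret star_seminorm X N by unfold_locales (rule N)
    have "N (clip X (f (X, N)) - clip X (g (X, N))) = 0" "N (clip X (g (X, N)) - clip X (h (X, N))) = 0"
      using fg gh N by auto
    thus "N (clip X (f (X, N)) - clip X (h (X, N))) = 0"
      using N_diff_trans[of "clip X (f (X, N))" "clip X (g (X, N))" "clip X (h (X, N))"]
        nonneg[of "clip X (f (X, N)) - clip X (h (X, N))"] by simp
  qed
qed

lemma
  assumes "cstar_seminorm X N" "a \<in> free_star X" "a' \<in> free_star X" "b \<in> free_star X" "b' \<in> free_star X"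
    and z: "N (a - a') = 0" "N (b - b') = 0"
  shows seminorm_diff_add: "N (a + b - (a' + b')) = 0"
    and seminorm_diff_mult: "N (a * b - a' * b') = 0"
proof -
  interpret star_seminorm X N by unfold_locales fact
  have eq: "a + b - (a' + b') = (a - a') + (b - b')" by simp
  show "N (a + b - (a' + b')) = 0"
    unfolding eq using triangle[of "a - a'" "b - b'"] nonneg[of "(a - a') + (b - b')"] assms by simp
  show "N (a * b - a' * b') = 0"
    using N_mult_diff[of a b a' b'] nonneg[of "a * b - a' * b'"] assms by simp
qed

lemma rep_abs_sq: "cstar_seminorm X N \<Longrightarrow> N (clip X (rep_sq (abs_sq f) (X, N)) - clip X (f (X, N))) = 0"
  using Quotient_rep_abs[OF Quotient_sq, of f] by (simp add: cstar_seminorm_zero)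

lemma abs_sq_surj: "\<exists>f. a = abs_sq f"
  by (induction a rule: sq.abs_induct) blast

instantiation sq :: (type) star_ring
begin

definition zero_sq :: "'a sq" where
  "zero_sq = abs_sq (\<lambda>_. 0)"
definition plus_sq :: "'a sq \<Rightarrow> 'a sq \<Rightarrow> 'a sq" where
  "plus_sq x y = abs_sq (\<lambda>i. clip (fst i) (rep_sq x i) + clip (fst i) (rep_sq y i))"
definition uminus_sq :: "'a sq \<Rightarrow> 'a sq" where
  "uminus_sq x = abs_sq (\<lambda>i. - clip (fst i) (rep_sq x i))"
definition minus_sq :: "'a sq \<Rightarrow> 'a sq \<Rightarrow> 'a sq" where
  "minus_sq x y = x + - y"
definition times_sq :: "'a sq \<Rightarrow> 'a sq \<Rightarrow> 'a sq" where
  "times_sq x y = abs_sq (\<lambda>i. clip (fst i) (rep_sq x i) * clip (fst i) (rep_sq y i))"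
definition star_sq :: "'a sq \<Rightarrow> 'a sq" where
  "star_sq x = abs_sq (\<lambda>i. adj (clip (fst i) (rep_sq x i)))"

lemma abs_sq_plus: "abs_sq f + abs_sq g = abs_sq (\<lambda>i. clip (fst i) (f i) + clip (fst i) (g i))"
  unfolding plus_sq_def sq.abs_eq_iff by (simp add: seminorm_diff_add rep_abs_sq)

lemma abs_sq_times: "abs_sq f * abs_sq g = abs_sq (\<lambda>i. clip (fst i) (f i) * clip (fst i) (g i))"
  unfolding times_sq_def sq.abs_eq_iff by (simp add: seminorm_diff_mult rep_abs_sq)

lemma abs_sq_uminus: "- abs_sq f = abs_sq (\<lambda>i. - clip (fst i) (f i))"
  unfolding uminus_sq_def sq.abs_eq_iff
  by (simp add: rep_abs_sq star_seminorm.N_commute[OF star_seminorm.intro, of _ _ "clip _ (f _)"])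

lemma abs_sq_star: "(abs_sq f)\<^sup>\<star> = abs_sq (\<lambda>i. adj (clip (fst i) (f i)))"
  unfolding star_sq_def sq.abs_eq_iff
  by (simp add: rep_abs_sq star_seminorm.N_adj[OF star_seminorm.intro] flip: adj_diff)

lemmas abs_sq_ops = zero_sq_def abs_sq_plus abs_sq_times abs_sq_uminus abs_sq_star

instance
proof
  fix a b c :: "'a sq"
  obtain f g h where abc: "a = abs_sq f" "b = abs_sq g" "c = abs_sq h"
    using abs_sq_surj by metis
  show "a + b + c = a + (b + c)" "a + b = b + a" "0 + a = a" "- a + a = 0" "a * b * c = a * (b * c)"
    "(a + b) * c = a * c + b * c" "a * (b + c) = a * b + a * c"
    "(a + b)\<^sup>\<star> = a\<^sup>\<star> + b\<^sup>\<star>" "(a * b)\<^sup>\<star> = b\<^sup>\<star> * a\<^sup>\<star>" "a\<^sup>\<star>\<^sup>\<star> = a"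
    by (simp_all add: abc abs_sq_ops sq.abs_eq_iff cstar_seminorm_zero algebra_simps)
  show "a - b = a + - b" by (rule minus_sq_def)
qed

end

section \<open>The embedding of one seminorm quotient into the ring\<close>

context star_seminorm
begin

text \<open>The family is supported at the single index \<open>(X, N)\<close>, so on
  \<open>FX\<close> exactly the null ideal of \<open>N\<close> is lost. A polynomial outside
  \<open>FX\<close> is clipped to 0, which is why the rules below carry membership
  hypotheses.\<close>

definition \<iota> :: "'g star_poly \<Rightarrow> 'g sq" where
  "\<iota> x = abs_sq (\<lambda>i. if i = (X, N) then x else 0)"

lemmas \<iota>_unfold = \<iota>_def sq.abs_eq_iff cstar_seminorm_zero abs_sq_ops

lemma \<iota>_eq_iff: "x \<in> FX \<Longrightarrow> y \<in> FX \<Longrightarrow> \<iota> x = \<iota> y \<longleftrightarrow> N (x - y) = 0"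
  using seminorm by (auto simp: \<iota>_unfold)

lemma \<iota>_zero [simp]: "\<iota> 0 = 0"
  by (auto simp: \<iota>_unfold)

lemma \<iota>_eq_0_iff: "x \<in> FX \<Longrightarrow> \<iota> x = 0 \<longleftrightarrow> N x = 0"
  using \<iota>_eq_iff[of x 0] by simp

lemma \<iota>_add: "x \<in> FX \<Longrightarrow> y \<in> FX \<Longrightarrow> \<iota> (x + y) = \<iota> x + \<iota> y"
  and \<iota>_uminus: "x \<in> FX \<Longrightarrow> \<iota> (- x) = - \<iota> x"
  and \<iota>_mult: "x \<in> FX \<Longrightarrow> y \<in> FX \<Longrightarrow> \<iota> (x * y) = \<iota> x * \<iota> y"
  and \<iota>_adj: "x \<in> FX \<Longrightarrow> \<iota> (adj x) = (\<iota> x)\<^sup>\<star>"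
  by (auto simp: \<iota>_unfold)

lemma \<iota>_diff: "x \<in> FX \<Longrightarrow> y \<in> FX \<Longrightarrow> \<iota> (x - y) = \<iota> x - \<iota> y"
  using \<iota>_add[of x "- y"] by (simp add: \<iota>_uminus)

lemma \<iota>_sum: "(\<And>i. i \<in> S \<Longrightarrow> f i \<in> FX) \<Longrightarrow> \<iota> (sum f S) = (\<Sum>i\<in>S. \<iota> (f i))"
  by (induction S rule: infinite_finite_induct) (simp_all add: \<iota>_add)

lemmas \<iota>_simps = \<iota>_add \<iota>_uminus \<iota>_diff \<iota>_mult \<iota>_adj \<iota>_sum

text \<open>The ring \<open>sq\<close> has no complex scalars; scaling stays on the side of the
  polynomials, and equations are carried through it by this rule.\<close>

lemma \<iota>_scale_cong: "x \<in> FX \<Longrightarrow> y \<in> FX \<Longrightarrow> \<iota> x = \<iota> y \<Longrightarrow> \<iota> (scale c x) = \<iota> (scale c y)"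
  by (simp add: \<iota>_eq_iff N_scale flip: pscale_diff)

lemma N_cong: "x \<in> FX \<Longrightarrow> y \<in> FX \<Longrightarrow> \<iota> x = \<iota> y \<Longrightarrow> N x = N y"
  using N_abs_diff[of x y] by (simp add: \<iota>_eq_iff)

end

definition (in star_ring) proj :: "'a \<Rightarrow> bool" where
  "proj x \<longleftrightarrow> x\<^sup>\<star> = x \<and> x * x = x"

text \<open>The form in which a product rule rewrites inside right-associated products.\<close>

lemma (in star_ring) mult_ext: "x * y = z \<Longrightarrow> x * (y * t) = z * t"
  by (metis mult.assoc)

lemma (in star_ring) projD:
  assumes "proj x" shows "x\<^sup>\<star> = x" "x * x = x" "x * (x * y) = x * y"
  using assms by (auto simp: proj_def intro: mult_ext)

section \<open>Projections whose sum is a projection\<close>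

text \<open>The defining relations do not say that the partial isometries at a vertex have orthogonal
  ranges; this follows because their range projections add up to a projection. The argument must
  avoid the order structure of C*-algebras, which is not available for a bare C*-seminorm.\<close>

lemma (in star_ring) dilate_identities:
  assumes P: "P * P = P" "P * A = A" "A * P = A" "P * B = B" "B * P = B" and AB: "A * B = B * A"
    and BB: "B * B = - (A * A + A * A + A * A + A * A)"
    and st: "P\<^sup>\<star> = P" "A\<^sup>\<star> = A" "B\<^sup>\<star> = - B"
    and Z: "Z = P + P + P + A + A + B" and W: "W = (P + A) * (P + A)" and Y: "Y = P + P + P + A + A + A + A"
  shows "Z\<^sup>\<star> * Z = W + W + W + W + W + W + W + (P - A) * (P - A) + P"
    and "Z * Z + Z\<^sup>\<star> * Z\<^sup>\<star> = Y + Y + Y + Y + Y + Y"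
proof -
  define C where "C = P + P + P + A + A"
  have ZC: "Z = C + B" "Z\<^sup>\<star> = C - B" by (simp_all add: Z C_def st)
  have CB: "C * B = B * C" by (simp add: C_def P AB distrib_left distrib_right)
  have CC: "C * C = P + P + P + P + P + P + P + P + P + A + A + A + A + A + A + A + A + A + A + A + A +
     A * A + A * A + A * A + A * A"
    by (simp add: C_def P distrib_left distrib_right ac_simps)
  have W': "W = P + A + A + A * A" "(P - A) * (P - A) = P - A - A + A * A"
    by (simp_all add: W P algebra_simps)
  have "Z\<^sup>\<star> * Z = C * C - B * B" unfolding ZC(2) unfolding ZC(1) by (simp add: CB algebra_simps)
  also have "\<dots> = C * C + (A * A + A * A + A * A + A * A)" by (simp add: BB algebra_simps)
  also have "\<dots> = W + W + W + W + W + W + W + (P - A) * (P - A) + P"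
    unfolding CC W' by (simp add: algebra_simps)
  finally show "Z\<^sup>\<star> * Z = W + W + W + W + W + W + W + (P - A) * (P - A) + P" .
  have "Z * Z + Z\<^sup>\<star> * Z\<^sup>\<star> = (C * C + B * B) + (C * C + B * B)"
    unfolding ZC(2) unfolding ZC(1) by (simp add: CB algebra_simps)
  also have "C * C + B * B = Y + Y + Y" unfolding CC BB Y by (simp add: algebra_simps)
  finally show "Z * Z + Z\<^sup>\<star> * Z\<^sup>\<star> = Y + Y + Y + Y + Y + Y" by (simp add: add.assoc)
qed

context star_seminorm
begin

lemma N_proj_le_1: assumes "p \<in> FX" "proj (\<iota> p)" shows "N p \<le> 1"
proof -
  have "N (adj p * p) = N p"
    using assms by (intro N_cong) (auto simp: \<iota>_simps proj_def)
  hence "N p = N p * N p" using N_cstar[OF assms(1)] by (simp add: power2_eq_square)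
  thus ?thesis using mult_cancel_left1 by force
qed

text \<open>For \<open>y = x - x p\<close> one has \<open>y y^* = y x^*\<close>, hence the square of
  the norm of \<open>y\<close> is at most the product of the norms of \<open>y\<close> and
  \<open>x\<close>. This replaces the estimate by a complement \<open>1 - p\<close> of norm at most
  1.\<close>

lemma N_compl_proj: assumes "x \<in> FX" "p \<in> FX" "proj (\<iota> p)" shows "N (x - x * p) \<le> N x"
proof -
  let ?y = "x - x * p"
  have F: "?y \<in> FX" using assms by simp
  have "N (adj (adj ?y) * adj ?y) = N (?y * adj x)"
    using assms by (intro N_cong) (auto simp: \<iota>_simps projD[OF assms(3)] algebra_simps)
  hence "N ?y * N ?y \<le> N ?y * N x"
    using N_cstar[of "adj ?y"] N_adj[OF F] N_adj[OF assms(1)] N_mult[of ?y "adj x"] F assms(1)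
    by (simp add: power2_eq_square del: adj_diff)
  thus ?thesis using nonneg[OF F] nonneg[OF assms(1)] by (cases "N ?y = 0") auto
qed

text \<open>The element is \<open>y y^*\<close> for \<open>y = p - p q\<close>.\<close>

lemma N_compress_proj:
  assumes "p \<in> FX" "q \<in> FX" "proj (\<iota> p)" "proj (\<iota> q)" shows "N (p - p * q * p) \<le> 1"
proof -
  let ?y = "p - p * q"
  have "N (p - p * q * p) = N (adj (adj ?y) * adj ?y)"
    using assms by (intro N_cong) (auto simp: \<iota>_simps projD[OF assms(3)] projD[OF assms(4)] algebra_simps)
  also have "\<dots> = (N ?y)\<^sup>2" using N_cstar[of "adj ?y"] N_adj[of ?y] assms by (simp del: adj_diff)
  also have "\<dots> \<le> 1\<^sup>2"
    using N_compl_proj[of p q] N_proj_le_1[of p] nonneg[of ?y] assms by (intro power_mono) auto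
  finally show ?thesis by simp
qed

text \<open>With \<open>z = 3 p + 2 a + 2 \<i> a\<close> one has \<open>z\<^sup>* z = 7 (p + a)\<^sup>2 + (p - a)\<^sup>2 + p\<close>, hence \<open>\<parallel>z\<parallel> \<le> 3\<close>, and
  \<open>z\<^sup>2 + (z\<^sup>*)\<^sup>2 = 6 (3 p + 4 a)\<close>, which gives the factor \<open>4/3\<close>. Iterating it forces \<open>a\<close> to vanish.\<close>

lemma dilate_step:
  assumes F: "p \<in> FX" "a \<in> FX" and p: "proj (\<iota> p)" and a: "(\<iota> a)\<^sup>\<star> = \<iota> a" "\<iota> p * \<iota> a = \<iota> a"
    and le: "N (p + a) \<le> 1" "N (p - a) \<le> 1"
  shows "N (p + scale (4/3) a) \<le> 1"
proof -
  define b where "b = scale (2 * \<i>) a"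
  define z where "z = p + p + p + a + a + b"
  define y where "y = p + p + p + a + a + a + a"
  have F': "b \<in> FX" "z \<in> FX" "y \<in> FX" using F by (simp_all add: b_def z_def y_def)
  have P: "(\<iota> p)\<^sup>\<star> = \<iota> p" "\<iota> p * \<iota> p = \<iota> p" using p by (auto simp: proj_def)
  have pa: "\<iota> a * \<iota> p = \<iota> a" using arg_cong[OF a(2), of star] by (simp add: a(1) P(1))
  have b: "\<iota> p * \<iota> b = \<iota> b" "\<iota> b * \<iota> p = \<iota> b"
  proof -
    have "p * b = scale (2 * \<i>) (p * a)" "b * p = scale (2 * \<i>) (a * p)"
      by (simp_all add: b_def pmult_scale_left pmult_scale_right)
    hence "\<iota> p * \<iota> b = \<iota> (scale (2 * \<i>) (p * a))" "\<iota> b * \<iota> p = \<iota> (scale (2 * \<i>) (a * p))"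
      using F F' \<iota>_mult by metis+
    moreover have "\<iota> (scale (2 * \<i>) (p * a)) = \<iota> (scale (2 * \<i>) a)"
      "\<iota> (scale (2 * \<i>) (a * p)) = \<iota> (scale (2 * \<i>) a)"
      using F a(2) pa by (auto intro!: \<iota>_scale_cong simp: \<iota>_simps)
    ultimately show "\<iota> p * \<iota> b = \<iota> b" "\<iota> b * \<iota> p = \<iota> b" by (simp_all add: b_def)
  qed
  have bs: "(\<iota> b)\<^sup>\<star> = - \<iota> b"
  proof -
    have "(\<iota> b)\<^sup>\<star> = \<iota> (scale (- (2 * \<i>)) (adj a))" using F by (simp add: b_def flip: \<iota>_adj)
    also have "\<dots> = \<iota> (scale (- (2 * \<i>)) a)" using F a by (intro \<iota>_scale_cong) (auto simp: \<iota>_adj)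
    also have "scale (- (2 * \<i>)) a = - b"
      by (simp add: b_def pscale_scale flip: pscale_minus_one)
    finally show ?thesis using F' by (simp add: \<iota>_uminus)
  qed
  have bb: "\<iota> b * \<iota> b = - (\<iota> a * \<iota> a + \<iota> a * \<iota> a + \<iota> a * \<iota> a + \<iota> a * \<iota> a)"
  proof -
    have "b * b = - (a * a + a * a + a * a + a * a)"
      by (rule poly_mapping_eqI)
        (simp add: b_def pmult_scale_left pmult_scale_right pscale_scale lookup_scale lookup_add lookup_minus lookup_uminus)
    thus ?thesis using F F' by (metis \<iota>_add \<iota>_mult \<iota>_uminus free_star_add free_star_mult)
  qed
  have ab: "\<iota> a * \<iota> b = \<iota> b * \<iota> a"
    using F F' by (simp add: b_def pmult_scale_left pmult_scale_right flip: \<iota>_mult)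
  let ?w = "(p + a) * (p + a)"
  let ?v = "?w + ?w + ?w + ?w + ?w + ?w + ?w + (p - a) * (p - a) + p"
  note ids = dilate_identities[OF P(2) a(2) pa b ab bb P(1) a(1) bs, of "\<iota> z" _ "\<iota> y", OF _ refl]
  have \<iota>zy: "\<iota> z = \<iota> p + \<iota> p + \<iota> p + \<iota> a + \<iota> a + \<iota> b"
    "\<iota> y = \<iota> p + \<iota> p + \<iota> p + \<iota> a + \<iota> a + \<iota> a + \<iota> a"
    using F F' by (simp_all add: z_def y_def \<iota>_simps)
  note ids = ids[OF \<iota>zy]
  have w: "N ?w \<le> 1" "N ((p - a) * (p - a)) \<le> 1"
    using N_mult[of "p + a" "p + a"] N_mult[of "p - a" "p - a"] F le nonneg[of "p + a"] nonneg[of "p - a"]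
    by (auto intro: order_trans mult_le_one)
  have "N (adj z * z) = N ?v"
    using F F' ids(1) by (intro N_cong) (simp_all add: \<iota>_simps)
  also have "\<dots> \<le> N ?w + N ?w + N ?w + N ?w + N ?w + N ?w + N ?w + N ((p - a) * (p - a)) + N p"
    using F by (intro order_trans[OF triangle] add_mono order_refl) auto
  also have "\<dots> \<le> 9" using w N_proj_le_1[OF F(1) p] by simp
  finally have "(N z)\<^sup>2 \<le> 3\<^sup>2" using N_cstar[OF F'(2)] by simp
  hence z: "N z \<le> 3" by (rule power2_le_imp_le) simp
  have zz: "N (z * z) \<le> 9" "N (adj z * adj z) \<le> 9"
    using N_mult[of z z] N_mult[of "adj z" "adj z"] N_adj[of z] F' z nonneg[of z]
      mult_mono[OF z z] by auto
  have "N (scale 6 y) = N (y + y + y + y + y + y)"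
    by (rule arg_cong[of _ _ N], rule poly_mapping_eqI) (simp add: lookup_scale lookup_add)
  also have "\<dots> = N (z * z + adj z * adj z)"
    using F F' ids(2) by (intro N_cong) (simp_all add: \<iota>_simps)
  also have "\<dots> \<le> 18" using zz triangle[of "z * z" "adj z * adj z"] F' by simp
  finally have "N y \<le> 3" using N_scale[OF F'(3), of 6] by simp
  moreover have "y = scale 3 (p + scale (4/3) a)"
    by (rule poly_mapping_eqI) (simp add: y_def lookup_scale lookup_add)
  ultimately show ?thesis using N_scale[of "p + scale (4/3) a" 3] F by simp
qed

text \<open>A projection is an extreme point of the unit ball, here in self-adjoint directions below
  it: by repeated dilation \<open>p\<close> plus or minus \<open>(4/3)^k a\<close> keeps norm at
  most 1 for every \<open>k\<close>, and half the difference of the two is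
  \<open>(4/3)^k a\<close>.\<close>

lemma proj_extreme:
  assumes F: "p \<in> FX" "a \<in> FX" and p: "proj (\<iota> p)" and a: "(\<iota> a)\<^sup>\<star> = \<iota> a" "\<iota> p * \<iota> a = \<iota> a"
    and le: "N (p + a) \<le> 1" "N (p - a) \<le> 1"
  shows "N a = 0"
proof -
  have scaled: "(\<iota> (scale (of_real c) a))\<^sup>\<star> = \<iota> (scale (of_real c) a)"
    "\<iota> p * \<iota> (scale (of_real c) a) = \<iota> (scale (of_real c) a)" for c
  proof -
    have "(\<iota> (scale (of_real c) a))\<^sup>\<star> = \<iota> (scale (of_real c) (adj a))"
      using F by (simp flip: \<iota>_adj)
    also have "\<dots> = \<iota> (scale (of_real c) a)" using F a by (intro \<iota>_scale_cong) (auto simp: \<iota>_adj)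
    finally show "(\<iota> (scale (of_real c) a))\<^sup>\<star> = \<iota> (scale (of_real c) a)" .
    have "\<iota> p * \<iota> (scale (of_real c) a) = \<iota> (scale (of_real c) (p * a))"
      using F by (simp add: pmult_scale_right flip: \<iota>_mult)
    also have "\<dots> = \<iota> (scale (of_real c) a)" using F a by (intro \<iota>_scale_cong) (auto simp: \<iota>_mult)
    finally show "\<iota> p * \<iota> (scale (of_real c) a) = \<iota> (scale (of_real c) a)" .
  qed
  have iter: "N (p + scale (of_real ((4/3) ^ k)) a) \<le> 1 \<and> N (p - scale (of_real ((4/3) ^ k)) a) \<le> 1" for k
  proof (induction k)
    case 0 thus ?case using le by (simp add: pscale_one)
  next
    case (Suc k)
    let ?c = "of_real ((4/3) ^ k) :: complex"
    have eq: "scale (4/3) (scale ?c a) = scale (of_real ((4/3) ^ Suc k)) a"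
      "scale (4/3) (- scale ?c a) = - scale (of_real ((4/3) ^ Suc k)) a"
      by (rule poly_mapping_eqI; simp add: lookup_scale)+
    have "N (p + scale (4/3) (scale ?c a)) \<le> 1"
      by (rule dilate_step) (use F p scaled[of "(4/3) ^ k", simplified] Suc in auto)
    moreover have "N (p + scale (4/3) (- scale ?c a)) \<le> 1"
      by (rule dilate_step) (use F p scaled[of "(4/3) ^ k", simplified] Suc in \<open>auto simp: \<iota>_uminus\<close>)
    ultimately show ?case by (simp only: eq) simp
  qed
  have "(4/3) ^ k * N a \<le> 1" for k
  proof -
    let ?b = "scale (of_real ((4/3) ^ k)) a"
    have "N (scale 2 ?b) = N ((p + ?b) - (p - ?b))"
      by (rule arg_cong[of _ _ N], rule poly_mapping_eqI) (simp add: lookup_scale lookup_add)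
    also have "\<dots> \<le> 2" using N_diff[of "p + ?b" "p - ?b"] iter[of k] F by simp
    finally show ?thesis using F by (simp add: N_scale norm_power)
  qed
  moreover have "\<exists>k. (4/3) ^ k * N a > 1" if "N a > 0"
    using real_arch_pow[of "4/3" "1 / N a"] that by (auto simp: field_simps)
  ultimately have "\<not> N a > 0" by (meson leD)
  thus ?thesis using nonneg[OF F(2)] by simp
qed

text \<open>Let \<open>b = p_i p_j p_i\<close>, let \<open>M\<close> be the remaining indices and
  \<open>m = card M + 1\<close>. Compressing the sum by \<open>p_i\<close> gives
  \<open>m p_i + b = (SUM k:M. p_i - p_i p_k p_i) + p_i r p_i\<close>, which has norm at most
  \<open>m\<close>; \<open>m p_i - b\<close> is bounded by \<open>m\<close> term by term. So
  \<open>p_i\<close> plus or minus \<open>b / m\<close> has norm at most 1, extremality gives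
  \<open>b = 0\<close>, and \<open>b\<close> is \<open>y^* y\<close> for
  \<open>y = p_j p_i\<close>.\<close>

lemma sum_proj_orthogonal:
  assumes fin: "finite I" and F: "\<And>i. i \<in> I \<Longrightarrow> p i \<in> FX" "r \<in> FX"
    and proj: "\<And>i. i \<in> I \<Longrightarrow> proj (\<iota> (p i))" "proj (\<iota> r)"
    and sum: "(\<Sum>i\<in>I. \<iota> (p i)) = \<iota> r" and ij: "i \<in> I" "j \<in> I" "i \<noteq> j"
  shows "\<iota> (p i) * \<iota> (p j) = 0"
proof -
  define M where "M = I - {i, j}"
  define m where "m = real (card M) + 1"
  define b where "b = p i * p j * p i"
  define a where "a = scale (of_real (1 / m)) b"
  have m: "m > 0" by (simp add: m_def)
  have I: "I = insert i (insert j M)" "i \<notin> M" "j \<notin> M" "finite M" using ij fin by (auto simp: M_def)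
  have Fi: "p i \<in> FX" "p j \<in> FX" "a \<in> FX" "b \<in> FX" and FM: "\<And>k. k \<in> M \<Longrightarrow> p k \<in> FX"
    using F ij by (auto simp: M_def a_def b_def)
  have P: "proj (\<iota> (p i))" "proj (\<iota> (p j))" "\<And>k. k \<in> M \<Longrightarrow> proj (\<iota> (p k))"
    using proj ij by (auto simp: M_def)
  have Pi: "(\<iota> (p i))\<^sup>\<star> = \<iota> (p i)" "\<iota> (p i) * \<iota> (p i) = \<iota> (p i)" "\<iota> (p i) * (\<iota> (p i) * x) = \<iota> (p i) * x" for x
    using P(1) by (auto simp: proj_def simp flip: mult.assoc)
  let ?w = "(\<Sum>k\<in>M. p i - p i * p k * p i) + p i * r * p i"
  let ?v = "(\<Sum>k\<in>M. p i) + p i + b"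
  have R: "\<iota> r = \<iota> (p i) + \<iota> (p j) + (\<Sum>k\<in>M. \<iota> (p k))"
    using sum I ij(3) by (simp add: add.assoc)
  have "\<iota> ?v = \<iota> ?w"
  proof -
    have "\<iota> ?v = (\<Sum>k\<in>M. \<iota> (p i)) + \<iota> (p i) + \<iota> (p i) * \<iota> (p j) * \<iota> (p i)"
      using Fi by (simp add: \<iota>_simps b_def del: sum_constant)
    moreover have "\<iota> ?w = (\<Sum>k\<in>M. \<iota> (p i) - \<iota> (p i) * \<iota> (p k) * \<iota> (p i)) + \<iota> (p i) * \<iota> r * \<iota> (p i)"
      using Fi FM F(2) by (simp add: \<iota>_simps del: sum_subtractf)
    moreover have "\<iota> (p i) * \<iota> r * \<iota> (p i) = \<iota> (p i) + \<iota> (p i) * \<iota> (p j) * \<iota> (p i) +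
        (\<Sum>k\<in>M. \<iota> (p i) * \<iota> (p k) * \<iota> (p i))"
      by (simp add: R distrib_left distrib_right sum_distrib_left sum_distrib_right Pi mult.assoc)
    ultimately show ?thesis by (simp add: sum_subtractf del: sum_constant)
  qed
  hence "N ?v = N ?w" using Fi FM F(2) by (intro N_cong) (auto simp del: sum_constant)
  also have "\<dots> \<le> m"
  proof -
    have 1: "N (\<Sum>k\<in>S. p i - p i * p k * p i) \<le> card S" if "S \<subseteq> M" "finite S" for S
      using that(2,1)
    proof (induction S)
      case (insert k S)
      hence "N ((p i - p i * p k * p i) + (\<Sum>k\<in>S. p i - p i * p k * p i)) \<le> 1 + card S"
        using N_compress_proj[of "p i" "p k"] Fi FM P
          triangle[of "p i - p i * p k * p i" "\<Sum>k\<in>S. p i - p i * p k * p i"]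
        by (auto intro!: order_trans[OF triangle] add_mono free_star_sum free_star_diff free_star_mult)
      thus ?case using insert by simp
    qed simp
    have "N (p i * r * p i) \<le> N (p i) * N r * N (p i)"
      using N_mult[of "p i * r" "p i"] N_mult[of "p i" r] Fi F nonneg
      by (meson free_star_mult mult_right_mono order_trans)
    also have "\<dots> \<le> 1"
      using N_proj_le_1 Fi F proj(2) P(1) nonneg by (intro mult_le_one mult_nonneg_nonneg) auto
    finally have 2: "N (p i * r * p i) \<le> 1" .
    have "N ?w \<le> N (\<Sum>k\<in>M. p i - p i * p k * p i) + N (p i * r * p i)"
      using Fi FM F(2) by (intro triangle free_star_sum) auto
    thus ?thesis using 1[of M] 2 I(4) by (simp add: m_def)
  qed
  finally have v: "N ?v \<le> m" .
  have nz: "1 + complex_of_nat (card M) \<noteq> 0" by (metis of_nat_Suc of_nat_neq_0)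
  have const: "poly_mapping.lookup (\<Sum>k\<in>M. p i) w = of_nat (card M) * poly_mapping.lookup (p i) w" for w
    by (subst lookup_sum) simp
  have "?v = scale (of_real m) (p i + a)"
    using nz by (intro poly_mapping_eqI)
      (simp add: a_def lookup_scale lookup_add const m_def field_simps del: sum_constant)
  hence "m * N (p i + a) \<le> m" using v N_scale[of "p i + a" "of_real m"] Fi m by simp
  hence le1: "N (p i + a) \<le> 1" using m by simp
  let ?u = "(\<Sum>k\<in>M. p i) + (p i - b)"
  have "N ?u \<le> m"
  proof -
    have "N (\<Sum>k\<in>S. p i) \<le> card S" if "finite S" for S
      using that
    proof (induction S)
      case (insert k S)
      thus ?case using N_proj_le_1[OF Fi(1) P(1)] Fi triangle[of "p i" "\<Sum>k\<in>S. p i"]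
        by (simp del: sum_constant)
    qed simp
    from this[OF I(4)] show ?thesis
      using triangle[of "\<Sum>k\<in>M. p i" "p i - b"] N_compress_proj[of "p i" "p j"] Fi P
      by (simp add: m_def b_def del: sum_constant)
  qed
  moreover have "?u = scale (of_real m) (p i - a)"
    using nz by (intro poly_mapping_eqI)
      (simp add: a_def lookup_scale lookup_add lookup_minus const m_def field_simps del: sum_constant)
  ultimately have "m * N (p i - a) \<le> m" using N_scale[of "p i - a" "of_real m"] Fi m by simp
  hence le2: "N (p i - a) \<le> 1" using m by simp
  have "N a = 0"
  proof (rule proj_extreme[OF Fi(1,3) P(1) _ _ le1 le2])
    have "(\<iota> a)\<^sup>\<star> = \<iota> (scale (of_real (1 / m)) (adj b))" using Fi by (simp add: a_def flip: \<iota>_adj)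
    also have "\<dots> = \<iota> a" unfolding a_def
      using Fi P(2) by (intro \<iota>_scale_cong) (auto simp: \<iota>_simps b_def Pi proj_def mult.assoc)
    finally show "(\<iota> a)\<^sup>\<star> = \<iota> a" .
    have "\<iota> (p i) * \<iota> a = \<iota> (scale (of_real (1 / m)) (p i * b))"
      using Fi by (simp add: a_def pmult_scale_right flip: \<iota>_mult)
    also have "\<dots> = \<iota> a" unfolding a_def
      using Fi by (intro \<iota>_scale_cong) (auto simp: \<iota>_simps b_def Pi mult.assoc)
    finally show "\<iota> (p i) * \<iota> a = \<iota> a" .
  qed
  hence "N b = 0" using m Fi by (simp add: a_def N_scale)
  moreover have "N (adj (p j * p i) * (p j * p i)) = N b"
    using Fi P(2) by (intro N_cong) (auto simp: \<iota>_simps b_def Pi proj_def mult.assoc simp flip: mult.assoc[of "\<iota> (p j)"])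
  ultimately have "N (p j * p i) = 0" using N_cstar[of "p j * p i"] Fi by simp
  hence "\<iota> (p j) * \<iota> (p i) = 0" using Fi by (simp add: \<iota>_eq_0_iff flip: \<iota>_mult)
  from arg_cong[OF this, of star] show ?thesis using P by (simp add: proj_def)
qed

end

section \<open>The seminorm modulo an ideal with an approximate unit of projections\<close>

text \<open>The elements \<open>x * e k\<close> form a left ideal. The two absorption rules make it
  two-sided: modulo \<open>N\<close>, the product of \<open>x * e j\<close> with a generator or its
  adjoint is again of the form \<open>y * e k\<close>.\<close>

locale approx_unit = star_seminorm X N for X :: "'g set" and N :: "'g star_poly \<Rightarrow> real" +
  fixes e :: "nat \<Rightarrow> 'g star_poly"
  assumes e_free [simp]: "e k \<in> FX"
    and e_proj: "proj (\<iota> (e k))"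
    and e_mono: "j \<le> k \<Longrightarrow> \<iota> (e j) * \<iota> (e k) = \<iota> (e j)"
    and absorb: "\<And>g j. g \<in> X \<Longrightarrow> \<exists>k. \<iota> (e j) * \<iota> (gen g) = \<iota> (e j) * \<iota> (gen g) * \<iota> (e k)"
    and absorb_adj: "\<And>g j. g \<in> X \<Longrightarrow> \<exists>k. \<iota> (e j) * (\<iota> (gen g))\<^sup>\<star> = \<iota> (e j) * (\<iota> (gen g))\<^sup>\<star> * \<iota> (e k)"
begin

text \<open>Asking for all large \<open>m\<close> lets two polynomials share one index.\<close>

definition absorbed :: "'g star_poly \<Rightarrow> bool" where
  "absorbed y \<longleftrightarrow> (\<forall>j. \<exists>k. \<forall>m\<ge>k. \<iota> (e j) * \<iota> y * \<iota> (e m) = \<iota> (e j) * \<iota> y)"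

lemma absorbedI:
  assumes "\<And>j. \<exists>k. \<iota> (e j) * \<iota> y = \<iota> (e j) * \<iota> y * \<iota> (e k)" shows "absorbed y"
  unfolding absorbed_def
proof
  fix j
  obtain k where k: "\<iota> (e j) * \<iota> y = \<iota> (e j) * \<iota> y * \<iota> (e k)" using assms by blast
  have "\<iota> (e j) * \<iota> y * \<iota> (e m) = \<iota> (e j) * \<iota> y" if "m \<ge> k" for m
    using k e_mono[OF that] by (metis mult.assoc)
  thus "\<exists>k. \<forall>m\<ge>k. \<iota> (e j) * \<iota> y * \<iota> (e m) = \<iota> (e j) * \<iota> y" by blast
qed

lemma absorbed: assumes "y \<in> FX" shows "absorbed y"
proof -
  \<comment> \<open>Absorption is not visibly stable under adjoints, so the induction carries
    \<open>y\<close> and \<open>adj y\<close> together.\<close>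
  have "absorbed y \<and> absorbed (adj y)" using assms
  proof (induction y rule: free_star_induct)
    case (gen g)
    thus ?case using absorb absorb_adj by (auto simp: \<iota>_adj intro!: absorbedI)
  next
    case zero
    show ?case by (simp add: absorbed_def)
  next
    case (add x y)
    have *: "absorbed (x + y)" if F: "x \<in> FX" "y \<in> FX" and "absorbed x" "absorbed y" for x y
      unfolding absorbed_def
    proof
      fix j
      obtain k l where "\<forall>m\<ge>k. \<iota> (e j) * \<iota> x * \<iota> (e m) = \<iota> (e j) * \<iota> x"
        "\<forall>m\<ge>l. \<iota> (e j) * \<iota> y * \<iota> (e m) = \<iota> (e j) * \<iota> y"
        using \<open>absorbed x\<close> \<open>absorbed y\<close> unfolding absorbed_def by blast
      thus "\<exists>k. \<forall>m\<ge>k. \<iota> (e j) * \<iota> (x + y) * \<iota> (e m) = \<iota> (e j) * \<iota> (x + y)"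
        using F by (intro exI[of _ "max k l"]) (simp add: \<iota>_add distrib_left distrib_right)
    qed
    show ?case using *[of x y] *[of "adj x" "adj y"] add by simp
  next
    case (scale c x)
    have *: "absorbed (scale c x)" if F: "x \<in> FX" and "absorbed x" for c x
    proof (rule absorbedI)
      fix j
      obtain k where k: "\<iota> (e j) * \<iota> x * \<iota> (e k) = \<iota> (e j) * \<iota> x"
        using \<open>absorbed x\<close> unfolding absorbed_def by blast
      have "\<iota> (scale c (e j * x)) = \<iota> (scale c (e j * x * e k))"
        using F k by (intro \<iota>_scale_cong) (auto simp: \<iota>_mult)
      moreover have "\<iota> (e j) * \<iota> (scale c x) = \<iota> (scale c (e j * x))"
        "\<iota> (e j) * \<iota> (scale c x) * \<iota> (e k) = \<iota> (scale c (e j * x * e k))"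
        using F by (simp_all add: pmult_scale_right pmult_scale_left flip: \<iota>_mult)
      ultimately show "\<exists>k. \<iota> (e j) * \<iota> (scale c x) = \<iota> (e j) * \<iota> (scale c x) * \<iota> (e k)"
        by (intro exI[of _ k]) simp
    qed
    show ?case using *[of x c] *[of "adj x" "cnj c"] scale by simp
  next
    case (mult x y)
    have *: "absorbed (x * y)" if F: "x \<in> FX" "y \<in> FX" and "absorbed x" "absorbed y" for x y
    proof (rule absorbedI)
      fix j
      obtain k where k: "\<iota> (e j) * \<iota> x * \<iota> (e k) = \<iota> (e j) * \<iota> x"
        using \<open>absorbed x\<close> unfolding absorbed_def by blast
      obtain l where l: "\<iota> (e k) * \<iota> y * \<iota> (e l) = \<iota> (e k) * \<iota> y"
        using \<open>absorbed y\<close> unfolding absorbed_def by blast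
      have "\<iota> (e j) * \<iota> (x * y) = \<iota> (e j) * \<iota> x * \<iota> (e k) * \<iota> y"
        using F k by (simp add: \<iota>_mult mult.assoc)
      also have "\<dots> = \<iota> (e j) * \<iota> x * (\<iota> (e k) * \<iota> y * \<iota> (e l))" by (simp only: mult.assoc l[unfolded mult.assoc])
      also have "\<dots> = (\<iota> (e j) * \<iota> x * \<iota> (e k)) * \<iota> y * \<iota> (e l)" by (simp only: mult.assoc)
      also have "\<dots> = \<iota> (e j) * \<iota> (x * y) * \<iota> (e l)" using F k by (simp add: \<iota>_mult mult.assoc)
      finally show "\<exists>k. \<iota> (e j) * \<iota> (x * y) = \<iota> (e j) * \<iota> (x * y) * \<iota> (e k)" by blast
    qed
    show ?case using *[of x y] *[of "adj y" "adj x"] mult by simp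
  next
    case (adj x)
    thus ?case by simp
  qed
  thus ?thesis by simp
qed

definition quot_norm :: "'g star_poly \<Rightarrow> real" where
  "quot_norm x = lim (\<lambda>k. N (x - x * e k))"

text \<open>For \<open>j\<close> at most \<open>k\<close>, cutting \<open>x - x e_j\<close> once
  more by \<open>e_k\<close> yields \<open>x - x e_k\<close>.\<close>

lemma compl_antimono: assumes "x \<in> FX" "j \<le> k" shows "N (x - x * e k) \<le> N (x - x * e j)"
proof -
  have "N (x - x * e k) = N ((x - x * e j) - (x - x * e j) * e k)"
    using assms e_mono[OF assms(2)] by (intro N_cong) (auto simp: \<iota>_simps algebra_simps)
  also have "\<dots> \<le> N (x - x * e j)" using assms e_proj by (intro N_compl_proj) auto
  finally show ?thesis .
qed

lemma quot_norm_lim: assumes "x \<in> FX" shows "(\<lambda>k. N (x - x * e k)) \<longlonglongrightarrow> quot_norm x"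
proof -
  have "decseq (\<lambda>k. N (x - x * e k))" using compl_antimono[OF assms] by (auto simp: decseq_def)
  moreover have "\<forall>k. 0 \<le> N (x - x * e k)" using assms by (auto intro: nonneg)
  ultimately obtain L where "(\<lambda>k. N (x - x * e k)) \<longlonglongrightarrow> L" by (rule decseq_convergent)
  hence "convergent (\<lambda>k. N (x - x * e k))" by (rule convergentI)
  thus ?thesis by (simp add: quot_norm_def convergent_LIMSEQ_iff)
qed

lemma quot_norm_less:
  assumes "x \<in> FX" "quot_norm x < c" obtains k where "\<And>m. m \<ge> k \<Longrightarrow> N (x - x * e m) < c"
  using order_tendstoD(2)[OF quot_norm_lim[OF assms(1)] assms(2)] by (auto simp: eventually_sequentially)

lemma quot_norm_eq_0: assumes "x \<in> FX" "\<iota> x * \<iota> (e k) = \<iota> x" shows "quot_norm x = 0"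
proof (rule LIMSEQ_unique[OF quot_norm_lim[OF assms(1)]])
  have "N (x - x * e m) = 0" if "m \<ge> k" for m
  proof -
    have "\<iota> x * \<iota> (e m) = \<iota> x" using assms(2) e_mono[OF that] by (metis mult.assoc)
    thus ?thesis using assms(1) by (simp add: \<iota>_simps flip: \<iota>_eq_0_iff)
  qed
  thus "(\<lambda>k. N (x - x * e k)) \<longlonglongrightarrow> 0"
    by (intro tendsto_eventually) (auto simp: eventually_sequentially)
qed

lemma quot_norm_le: assumes "x \<in> FX" shows "quot_norm x \<le> N x"
  using N_compl_proj[OF assms e_free e_proj] by (intro LIMSEQ_le_const2[OF quot_norm_lim[OF assms]]) auto

lemma quot_norm_nonneg: assumes "x \<in> FX" shows "0 \<le> quot_norm x"
  using nonneg assms by (intro LIMSEQ_le_const[OF quot_norm_lim[OF assms]]) auto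

text \<open>Modulo \<open>N\<close>, the product of \<open>x - x e_j\<close> and
  \<open>y - y e_m\<close> equals \<open>x y - x y e_m\<close> as soon as \<open>e_m\<close> absorbs
  \<open>e_j y\<close>. The limit is taken in \<open>m\<close> first, then in
  \<open>j\<close>.\<close>

lemma quot_norm_mult: assumes "x \<in> FX" "y \<in> FX" shows "quot_norm (x * y) \<le> quot_norm x * quot_norm y"
proof -
  have "quot_norm (x * y) \<le> N (x - x * e j) * quot_norm y" for j
  proof (rule LIMSEQ_le[OF quot_norm_lim tendsto_mult_left[OF quot_norm_lim]])
    obtain k where k: "\<And>m. m \<ge> k \<Longrightarrow> \<iota> (e j) * \<iota> y * \<iota> (e m) = \<iota> (e j) * \<iota> y"
      using absorbed[OF assms(2)] unfolding absorbed_def by blast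
    have "N (x * y - x * y * e m) \<le> N (x - x * e j) * N (y - y * e m)" if "m \<ge> k" for m
    proof -
      have "\<iota> (e j) * \<iota> y * \<iota> (e m) = \<iota> (e j) * \<iota> y" using k[OF that] .
      hence eq: "\<iota> (e j) * (\<iota> y * \<iota> (e m)) = \<iota> (e j) * \<iota> y" by (simp add: mult.assoc)
      have "N (x * y - x * y * e m) = N ((x - x * e j) * (y - y * e m))"
        using assms eq by (intro N_cong) (auto simp: \<iota>_simps algebra_simps)
      thus ?thesis using N_mult[of "x - x * e j" "y - y * e m"] assms by simp
    qed
    thus "\<exists>k. \<forall>m\<ge>k. N (x * y - x * y * e m) \<le> N (x - x * e j) * N (y - y * e m)" by blast
  qed (use assms in auto)
  thus ?thesis
    by (intro LIMSEQ_le_const[OF tendsto_mult_right[OF quot_norm_lim[OF assms(1)]]]) auto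
qed

theorem quot_seminorm: "cstar_seminorm X quot_norm"
proof -
  \<comment> \<open>With \<open>y = x^* x - x^* x e_k\<close>, the element
    \<open>y^* - y^* e_k\<close> is \<open>z^* z\<close> for \<open>z = x - x e_k\<close>, and this
    cut does not increase the norm of \<open>y^*\<close>. The reverse inequality follows from
    submultiplicativity once invariance under \<open>adj\<close> is known, which is itself drawn
    from this half.\<close>
  have sq: "(quot_norm x)\<^sup>2 \<le> quot_norm (adj x * x)" if x: "x \<in> FX" for x
  proof (rule LIMSEQ_le[OF tendsto_power[OF quot_norm_lim[OF x]] quot_norm_lim])
    have "(N (x - x * e k))\<^sup>2 \<le> N (adj x * x - adj x * x * e k)" for k
    proof -
      let ?y = "adj x * x - adj x * x * e k"
      have F: "?y \<in> FX" "adj ?y \<in> FX" using x by (simp_all del: adj_diff)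
      have "(N (x - x * e k))\<^sup>2 = N (adj (x - x * e k) * (x - x * e k))" using N_cstar[of "x - x * e k"] x by (simp del: adj_diff adj_mult)
      also have "\<dots> = N (adj ?y - adj ?y * e k)"
        using x projD[OF e_proj] by (intro N_cong) (auto simp: \<iota>_simps algebra_simps)
      also have "\<dots> \<le> N (adj ?y)" using F e_proj by (intro N_compl_proj) auto
      also have "\<dots> = N ?y" by (rule N_adj[OF F(1)])
      finally show ?thesis .
    qed
    thus "\<exists>k. \<forall>m\<ge>k. (N (x - x * e m))\<^sup>2 \<le> N (adj x * x - adj x * x * e m)" by blast
  qed (use x in auto)
  have adj_le: "quot_norm x \<le> quot_norm (adj x)" if x: "x \<in> FX" for x
  proof (cases "quot_norm x = 0")
    case True thus ?thesis using quot_norm_nonneg[of "adj x"] x by simp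
  next
    case False
    have "quot_norm x * quot_norm x \<le> quot_norm (adj x) * quot_norm x"
      using sq[OF x] quot_norm_mult[of "adj x" x] x by (simp add: power2_eq_square)
    thus ?thesis using False quot_norm_nonneg[OF x] by simp
  qed
  have adj_eq: "quot_norm (adj x) = quot_norm x" if "x \<in> FX" for x
    using adj_le[of x] adj_le[of "adj x"] that by simp
  have triangle': "quot_norm (x + y) \<le> quot_norm x + quot_norm y" if F: "x \<in> FX" "y \<in> FX" for x y
  proof (rule LIMSEQ_le[OF quot_norm_lim tendsto_add[OF quot_norm_lim[OF F(1)] quot_norm_lim[OF F(2)]]])
    have "N (x + y - (x + y) * e k) \<le> N (x - x * e k) + N (y - y * e k)" for k
    proof -
      have eq: "x + y - (x + y) * e k = (x - x * e k) + (y - y * e k)" by (simp add: algebra_simps)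
      show ?thesis unfolding eq using F by (intro triangle) auto
    qed
    thus "\<exists>k. \<forall>m\<ge>k. N (x + y - (x + y) * e m) \<le> N (x - x * e m) + N (y - y * e m)" by blast
  qed (use F in auto)
  have scale': "quot_norm (scale c x) = cmod c * quot_norm x" if x: "x \<in> FX" for c x
  proof (rule LIMSEQ_unique[OF quot_norm_lim])
    show "(\<lambda>k. N (scale c x - scale c x * e k)) \<longlonglongrightarrow> cmod c * quot_norm x"
      using tendsto_mult_left[OF quot_norm_lim[OF x], of "cmod c"] x
      by (simp add: pmult_scale_left N_scale flip: pscale_diff)
  qed (use x in simp)
  have "quot_norm (adj x * x) = (quot_norm x)\<^sup>2" if x: "x \<in> FX" for x
    using sq[OF x] quot_norm_mult[of "adj x" x] adj_eq[OF x] x by (simp add: power2_eq_square)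
  thus ?thesis
    using quot_norm_nonneg triangle' scale' quot_norm_mult by (simp add: cstar_seminorm_def)
qed

sublocale quot: star_seminorm X quot_norm
  by unfold_locales (rule quot_seminorm)

end

section \<open>The labelled space of the mirror quantum sphere in a ring with involution\<close>

text \<open>The vertex \<open>w_2\<close> is treated as \<open>v_0\<close>. Then every edge labelled
  \<open>g\<close> leads from \<open>vtail k\<close> to \<open>vtail (Suc k)\<close>, and the
  infinite sets of the generating family form a single chain.\<close>

definition vtail :: "nat \<Rightarrow> vert" where
  "vtail k = (if k = 0 then VW2 else VV k)"

definition tail_set :: "nat \<Rightarrow> vert set" where
  "tail_set k = vtail ` {k..}"

definition tail_index :: "vert set \<Rightarrow> nat set" where
  "tail_index A = {k. vtail k \<in> A}"

text \<open>On sets of the labelled space \<open>tail_index\<close> is empty or a final segment, so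
  its least element tells which member of the chain is present.\<close>

definition tail_value :: "(nat \<Rightarrow> 'a::zero) \<Rightarrow> vert set \<Rightarrow> 'a" where
  "tail_value U A = (if tail_index A = {} then 0 else U (LEAST k. k \<in> tail_index A))"

text \<open>Every set of the labelled space is a union of some \<open>{VU i}\<close>, possibly \<open>{VW1}\<close>, and possibly
  one member of the chain \<open>tail_set 0 \<supset> tail_set 1 \<supset> \<dots>\<close>; \<open>mirror_proj\<close> is the projection that
  belongs to it if these are represented by \<open>u i\<close>, \<open>P\<close> and \<open>U k\<close>.\<close>

definition mirror_proj :: "nat \<Rightarrow> (nat \<Rightarrow> 'a::comm_monoid_add) \<Rightarrow> 'a \<Rightarrow> (nat \<Rightarrow> 'a) \<Rightarrow> vert set \<Rightarrow> 'a" where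
  "mirror_proj n u P U A =
     (\<Sum>i | i \<in> {1..n - 1} \<and> VU i \<in> A. u i) + (if VW1 \<in> A then P else 0) + tail_value U A"

definition mirror_iso :: "(nat \<Rightarrow> nat \<Rightarrow> 'a) \<Rightarrow> (nat \<Rightarrow> 'a) \<Rightarrow> 'a \<Rightarrow> 'a \<Rightarrow> label \<Rightarrow> 'a" where
  "mirror_iso e f g h a = (case a of LE i j \<Rightarrow> e i j | LF i \<Rightarrow> f i | LG \<Rightarrow> g | LH \<Rightarrow> h)"

lemma mirror_iso_simps [simp]:
  "mirror_iso e f g h (LE i j) = e i j" "mirror_iso e f g h (LF i) = f i"
  "mirror_iso e f g h LG = g" "mirror_iso e f g h LH = h"
  by (simp_all add: mirror_iso_def)

text \<open>These are the labels of the edges leaving the vertices \<open>VU i\<close>; the words in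
  the approximate unit of \<open>I\<close> use only them.\<close>

definition ulabels :: "nat \<Rightarrow> label set" where
  "ulabels n = (\<Union>i\<in>{1..n - 1}. insert (LF i) (LE i ` {i..n - 1}))"

definition mlabels :: "nat \<Rightarrow> label set" where
  "mlabels n = ulabels n \<union> {LG, LH}"

lemma finite_ulabels [simp]: "finite (ulabels n)"
  and finite_mlabels [simp]: "finite (mlabels n)"
  by (simp_all add: mlabels_def ulabels_def)

lemma ulabels_iff [simp]:
  "LE i j \<in> ulabels n \<longleftrightarrow> 1 \<le> i \<and> i \<le> j \<and> j \<le> n - 1"
  "LF i \<in> ulabels n \<longleftrightarrow> 1 \<le> i \<and> i \<le> n - 1"
  "LG \<notin> ulabels n" "LH \<notin> ulabels n"
proof -
  have "LE i j \<in> LE k ` B \<longleftrightarrow> i = k \<and> j \<in> B" for k B by auto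
  thus "LE i j \<in> ulabels n \<longleftrightarrow> 1 \<le> i \<and> i \<le> j \<and> j \<le> n - 1" by (auto simp: ulabels_def)
qed (auto simp: ulabels_def)

lemma mlabels_iff [simp]:
  "LE i j \<in> mlabels n \<longleftrightarrow> 1 \<le> i \<and> i \<le> j \<and> j \<le> n - 1"
  "LF i \<in> mlabels n \<longleftrightarrow> 1 \<le> i \<and> i \<le> n - 1"
  "LG \<in> mlabels n" "LH \<in> mlabels n"
  by (auto simp: mlabels_def)

lemma mlabels_eq: "mirror_label ` arcs (mirror_graph n) = mlabels n"
proof
  show "mirror_label ` arcs (mirror_graph n) \<subseteq> mlabels n"
    by (auto simp: mirror_sel)
  show "mlabels n \<subseteq> mirror_label ` arcs (mirror_graph n)"
  proof
    fix a assume "a \<in> mlabels n"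
    then consider i j where "a = mirror_label (EE i j)" "1 \<le> i" "i \<le> j" "j \<le> n - 1"
      | i where "a = mirror_label (EF i 1)" "1 \<le> i" "i \<le> n - 1"
      | "a = mirror_label (EG 1)" | "a = mirror_label (EH 1)"
      by (cases a) auto
    thus "a \<in> mirror_label ` arcs (mirror_graph n)"
      by cases (auto simp: mirror_sel simp del: mirror_label.simps intro!: imageI)
  qed
qed

lemma tail_set_sets: "tail_set k \<in> mirror_sets n"
proof (cases "k = 0")
  case True
  have "tail_set 0 = V_from 1 \<union> {VW2}"
    by (auto simp: tail_set_def vtail_def V_from_def image_def)
  thus ?thesis using True mirror_sets.intros(4) by simp
next
  case False
  hence "tail_set k = V_from k" by (auto simp: tail_set_def vtail_def V_from_def image_def)
  thus ?thesis using False mirror_sets.intros(3)[of k] by simp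
qed

lemma V_from_eq: "1 \<le> i \<Longrightarrow> V_from i = tail_set i" "V_from 1 \<union> {VW2} = tail_set 0"
  by (auto simp: tail_set_def vtail_def V_from_def image_def)

lemma vtail_neq [simp]: "vtail k \<noteq> VU i" "vtail k \<noteq> VW1" "VU i \<noteq> vtail k" "VW1 \<noteq> vtail k"
  by (auto simp: vtail_def)

lemma vtail_inject [simp]: "vtail j = vtail k \<longleftrightarrow> j = k"
  by (auto simp: vtail_def)

lemma tail_index_simps [simp]:
  "tail_index {} = {}" "tail_index {VU i} = {}" "tail_index {VW1} = {}"
  "tail_index (tail_set k) = {k..}"
  "tail_index (A \<union> B) = tail_index A \<union> tail_index B"
  "tail_index (A \<inter> B) = tail_index A \<inter> tail_index B"
  "tail_index (insert VW1 A) = tail_index A"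
  by (auto simp: tail_index_def tail_set_def)

lemma tail_set_not_in [simp]: "VU i \<notin> tail_set k" "VW1 \<notin> tail_set k"
  by (auto simp: tail_set_def)

lemma tail_value_empty: "tail_index A = {} \<Longrightarrow> tail_value U A = 0"
  by (simp add: tail_value_def)

lemma tail_value_atLeast: "tail_index A = {k..} \<Longrightarrow> tail_value U A = U k"
  by (auto simp: tail_value_def intro!: arg_cong[of _ _ U] Least_equality)

lemma mirror_sets_cases:
  assumes "A \<in> mirror_sets n"
  obtains "tail_index A = {}" | k where "tail_index A = {k..}"
proof -
  have "(\<exists>k. tail_index A = {k..}) \<or> tail_index A = {}" using assms
  proof induction
    case (3 i) thus ?case by (auto simp: V_from_eq(1))
  next
    case 4 show ?case unfolding V_from_eq(2) by auto
  next
    case (5 A B)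
    have "{k..} \<union> {l..} = {min k l..}" for k l :: nat by auto
    thus ?case using 5 by auto
  next
    case (6 A B)
    have "{k..} \<inter> {l..} = {max k l..}" for k l :: nat by auto
    thus ?case using 6 by auto
  qed auto
  thus ?thesis using that by blast
qed

lemma mirror_proj_simps [simp]:
  "mirror_proj n u P U {} = 0"
  "mirror_proj n u P U {VW1} = P"
  "mirror_proj n u P U (tail_set k) = U k"
  by (simp_all add: mirror_proj_def tail_value_empty tail_value_atLeast)

lemma mirror_proj_VU [simp]: "1 \<le> i \<Longrightarrow> i \<le> n - 1 \<Longrightarrow> mirror_proj n u P U {VU i} = u i"
proof -
  assume "1 \<le> i" "i \<le> n - 1"
  hence "{j. j \<in> {1..n - 1} \<and> VU j \<in> {VU i}} = {i}" by auto
  thus ?thesis by (simp only: mirror_proj_def) (simp add: tail_value_empty)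
qed

lemma mirror_proj_f: "mirror_proj n u P U ({VW1} \<union> tail_set 0) = P + U 0"
  by (simp add: mirror_proj_def tail_value_atLeast[of "insert VW1 (tail_set 0)" 0])

lemma verts_mirror: "verts (mirror_graph n) = VU ` {1..n - 1} \<union> {VW1} \<union> tail_set 0"
  by (force simp: mirror_sel tail_set_def vtail_def image_def)

lemma mirror_proj_verts:
  "mirror_proj n u P U (verts (mirror_graph n)) = (\<Sum>i\<in>{1..n - 1}. u i) + P + U 0"
proof -
  have "tail_index (verts (mirror_graph n)) = {0..}"
    by (auto simp: tail_index_def verts_mirror tail_set_def)
  moreover have "{i. i \<in> {1..n - 1} \<and> VU i \<in> verts (mirror_graph n)} = {1..n - 1}"
    by (auto simp: verts_mirror)
  moreover have "VW1 \<in> verts (mirror_graph n)" by (simp add: verts_mirror)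
  ultimately show ?thesis by (simp only: mirror_proj_def tail_value_atLeast if_True)
qed

text \<open>The carrier \<open>C\<close> makes the rule applicable to \<open>\<iota>\<close>, which
  is additive only on \<open>FX\<close>.\<close>

lemma mirror_proj_hom:
  assumes "h 0 = 0" "\<And>x y. x \<in> C \<Longrightarrow> y \<in> C \<Longrightarrow> h (x + y) = h x + h y" "0 \<in> C"
    "\<And>x y. x \<in> C \<Longrightarrow> y \<in> C \<Longrightarrow> x + y \<in> C"
    and in_C: "\<And>i. i \<in> {1..n - 1} \<Longrightarrow> u i \<in> C" "P \<in> C" "\<And>k. U k \<in> C"
  shows "mirror_proj n u P U A \<in> C"
    and "h (mirror_proj n u P U A) = mirror_proj n (\<lambda>i. h (u i)) (h P) (\<lambda>k. h (U k)) A"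
proof -
  have s: "sum u S \<in> C \<and> h (sum u S) = (\<Sum>i\<in>S. h (u i))" if "S \<subseteq> {1..n - 1}" for S
    using finite_subset[OF that finite_atLeastAtMost] that
    by (induction S rule: finite_induct) (auto simp: assms)
  have "{i. i \<in> {1..n - 1} \<and> VU i \<in> A} \<subseteq> {1..n - 1}" by auto
  note s = s[OF this]
  have t: "tail_value U A \<in> C" "h (tail_value U A) = tail_value (\<lambda>k. h (U k)) A"
    by (auto simp: tail_value_def assms)
  have m: "(if VW1 \<in> A then P else 0) \<in> C" by (simp add: assms)
  show "mirror_proj n u P U A \<in> C" unfolding mirror_proj_def using s t m assms by simp
  show "h (mirror_proj n u P U A) = mirror_proj n (\<lambda>i. h (u i)) (h P) (\<lambda>k. h (U k)) A"
    unfolding mirror_proj_def using s t m assms by simp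
qed

text \<open>A short presentation of the labelled space: projections are given only for singletons
  and the chain of tails, and the summation relation only at the \<open>VU i\<close> and at the
  largest tail. The relations for all other sets of the labelled space are recovered below.\<close>

locale mirror_family =
  fixes n :: nat and u :: "nat \<Rightarrow> 'a::star_ring" and P :: 'a and U :: "nat \<Rightarrow> 'a" and S :: "label \<Rightarrow> 'a"
  assumes proj_u: "i \<in> {1..n - 1} \<Longrightarrow> proj (u i)" and proj_P: "proj P" and proj_U: "proj (U k)"
    and u_u: "i \<in> {1..n - 1} \<Longrightarrow> j \<in> {1..n - 1} \<Longrightarrow> i \<noteq> j \<Longrightarrow> u i * u j = 0"
    and u_P: "i \<in> {1..n - 1} \<Longrightarrow> u i * P = 0" and u_U0: "i \<in> {1..n - 1} \<Longrightarrow> u i * U 0 = 0"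
    and P_U0: "P * U 0 = 0" and U_U: "j \<le> k \<Longrightarrow> U j * U k = U k"
    and S_pi: "a \<in> mlabels n \<Longrightarrow> S a * (S a)\<^sup>\<star> * S a = S a"
    and S_LE: "1 \<le> i \<Longrightarrow> i \<le> j \<Longrightarrow> j \<le> n - 1 \<Longrightarrow> (S (LE i j))\<^sup>\<star> * S (LE i j) = u j"
    and S_LF: "1 \<le> i \<Longrightarrow> i \<le> n - 1 \<Longrightarrow> (S (LF i))\<^sup>\<star> * S (LF i) = P + U 0"
    and S_LG: "(S LG)\<^sup>\<star> * S LG = U 1" and S_LH: "(S LH)\<^sup>\<star> * S LH = P"
    and S_orth: "a \<in> mlabels n \<Longrightarrow> b \<in> mlabels n \<Longrightarrow> a \<noteq> b \<Longrightarrow> (S a)\<^sup>\<star> * S b = 0"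
    and u_sum: "i \<in> {1..n - 1} \<Longrightarrow>
      u i = (\<Sum>j\<in>{i..n - 1}. S (LE i j) * (S (LE i j))\<^sup>\<star>) + S (LF i) * (S (LF i))\<^sup>\<star>"
    and U_sum: "U 0 = S LG * (S LG)\<^sup>\<star> + S LH * (S LH)\<^sup>\<star>"
    and U_G: "U k * S LG = S LG * U (Suc k)" and U_H: "U k * S LH = S LH"
begin

lemma flip_zero: "x * y = 0 \<Longrightarrow> x\<^sup>\<star> = x \<Longrightarrow> y\<^sup>\<star> = y \<Longrightarrow> y * x = 0" for x y :: 'a
  using star_mult[of x y] by simp

lemmas st = projD(1)[OF proj_u] projD(1)[OF proj_P] projD(1)[OF proj_U]

lemma U_U': "U j * U k = U (max j k)"
proof (cases "j \<le> k")
  case False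
  hence "(U k * U j)\<^sup>\<star> = (U j)\<^sup>\<star>" by (simp only: U_U)
  thus ?thesis using False by (simp add: st max_def)
qed (simp add: U_U max_def)

lemma u_U: assumes "i \<in> {1..n - 1}" shows "u i * U k = 0" "U k * u i = 0"
proof -
  have "u i * (U 0 * U k) = 0" using u_U0[OF assms] by (simp flip: mult.assoc)
  thus *: "u i * U k = 0" by (simp add: U_U)
  show "U k * u i = 0" by (rule flip_zero[OF * st(1)[OF assms] st(3)])
qed

lemma P_U: "P * U k = 0" "U k * P = 0"
proof -
  have "P * (U 0 * U k) = 0" using P_U0 by (simp flip: mult.assoc)
  thus *: "P * U k = 0" by (simp add: U_U)
  show "U k * P = 0" by (rule flip_zero[OF * st(2,3)])
qed

lemma P_u: "i \<in> {1..n - 1} \<Longrightarrow> P * u i = 0"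
  using flip_zero[OF u_P] st by auto

lemma u_u': "i \<in> {1..n - 1} \<Longrightarrow> j \<in> {1..n - 1} \<Longrightarrow> u i * u j = (if i = j then u i else 0)"
  using u_u projD(2)[OF proj_u] by auto

lemma S_pi': "a \<in> mlabels n \<Longrightarrow> S a * ((S a)\<^sup>\<star> * S a) = S a"
  using S_pi by (simp add: mult.assoc)

lemma u_LE:
  assumes "i \<in> {1..n - 1}" "1 \<le> k" "k \<le> j" "j \<le> n - 1"
  shows "u i * S (LE k j) = (if i = k then S (LE k j) else 0)"
proof -
  have *: "u k * S (LE k j) = S (LE k j)"
  proof -
    have k: "k \<in> {1..n - 1}" using assms by auto
    have "(S (LE k l))\<^sup>\<star> * S (LE k j) = (if l = j then u j else 0)" if "l \<in> {k..n - 1}" for l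
      using that assms S_orth[of "LE k l" "LE k j"] S_LE[of k j] by auto
    hence "(\<Sum>l\<in>{k..n - 1}. S (LE k l) * ((S (LE k l))\<^sup>\<star> * S (LE k j))) =
        (\<Sum>l\<in>{k..n - 1}. if l = j then S (LE k j) * u j else 0)"
      by (intro sum.cong) auto
    also have "\<dots> = S (LE k j)"
      using S_pi'[of "LE k j"] S_LE[of k j] assms by simp
    finally show ?thesis unfolding u_sum[OF k]
      using S_orth[of "LF k" "LE k j"] assms by (simp add: distrib_right sum_distrib_right mult.assoc)
  qed
  have "u i * S (LE k j) = u i * u k * S (LE k j)" by (simp add: * mult.assoc)
  thus ?thesis using u_u'[of i k] assms * by auto
qed

lemma u_LF:
  assumes "i \<in> {1..n - 1}" "1 \<le> k" "k \<le> n - 1" shows "u i * S (LF k) = (if i = k then S (LF k) else 0)"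
proof -
  have *: "u k * S (LF k) = S (LF k)"
  proof -
    have k: "k \<in> {1..n - 1}" using assms by auto
    have "(S (LE k l))\<^sup>\<star> * S (LF k) = 0" if "l \<in> {k..n - 1}" for l
      using that assms S_orth[of "LE k l" "LF k"] by auto
    thus ?thesis unfolding u_sum[OF k]
      using S_pi[of "LF k"] assms by (simp add: distrib_right sum_distrib_right mult.assoc)
  qed
  have "u i * S (LF k) = u i * u k * S (LF k)" by (simp add: * mult.assoc)
  thus ?thesis using u_u'[of i k] assms * by auto
qed

lemma U0_G: "U 0 * S LG = S LG" and u_G: "i \<in> {1..n - 1} \<Longrightarrow> u i * S LG = 0" and P_G: "P * S LG = 0"
proof -
  show *: "U 0 * S LG = S LG"
    using S_pi'[of LG] S_LG by (simp add: U_G)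
  show "i \<in> {1..n - 1} \<Longrightarrow> u i * S LG = 0" "P * S LG = 0"
    using u_U(1)[of i 0] P_U(1)[of 0] * by (metis mult.assoc mult_zero_left)+
qed

lemma u_H: "i \<in> {1..n - 1} \<Longrightarrow> u i * S LH = 0" and P_H: "P * S LH = 0"
  using u_U(1)[of i 0] P_U(1)[of 0] U_H[of 0] by (metis mult.assoc mult_zero_left)+

lemma S_factor_u: "a \<in> ulabels n \<Longrightarrow> \<exists>i\<in>{1..n - 1}. S a = u i * S a"
  by (cases a) (auto simp: u_LE u_LF)

lemma U_ulabel: "a \<in> ulabels n \<Longrightarrow> U k * S a = 0" and P_ulabel: "a \<in> ulabels n \<Longrightarrow> P * S a = 0"
  using S_factor_u[of a] u_U(2)[of _ k] P_u by (metis mult.assoc mult_zero_left)+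

lemma P_S: "a \<in> mlabels n \<Longrightarrow> P * S a = 0"
  by (auto simp: mlabels_def P_ulabel P_G P_H)

section \<open>The relations for arbitrary sets of the labelled space\<close>

abbreviation "\<rho> \<equiv> mirror_proj n u P U"

lemma proj_Int: assumes "A \<in> mirror_sets n" "B \<in> mirror_sets n" shows "\<rho> A * \<rho> B = \<rho> (A \<inter> B)"
proof -
  let ?I = "\<lambda>A. {i. i \<in> {1..n - 1} \<and> VU i \<in> A}"
  define X where "X C = sum u (?I C)" for C
  define Y where "Y C = (if VW1 \<in> C then P else 0)" for C
  have \<rho>: "\<rho> C = X C + Y C + tail_value U C" for C
    by (simp only: mirror_proj_def X_def Y_def)
  have XX: "X A * X B = X (A \<inter> B)"
  proof -
    have "sum u (?I A) * sum u (?I B) = (\<Sum>i\<in>?I A. \<Sum>j\<in>?I B. if i = j then u i else 0)"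
      unfolding sum_product by (intro sum.cong refl) (auto simp: u_u')
    also have "\<dots> = (\<Sum>i\<in>?I A. if i \<in> ?I B then u i else 0)"
      by (intro sum.cong refl) (auto simp: sum.delta)
    also have "\<dots> = sum u (?I A \<inter> ?I B)" by (subst sum.inter_restrict) auto
    also have "?I A \<inter> ?I B = ?I (A \<inter> B)" by auto
    finally show ?thesis unfolding X_def .
  qed
  have XY: "X C * Y D = 0" "X C * tail_value U D = 0" "Y D * X C = 0" "tail_value U D * X C = 0"
    "Y C * tail_value U D = 0" "tail_value U D * Y C = 0" for C D
    by (auto simp: X_def Y_def P_U sum_distrib_left sum_distrib_right u_P P_u u_U tail_value_def intro!: sum.neutral)
  have YY: "Y A * Y B = Y (A \<inter> B)"
    using projD(2)[OF proj_P] by (simp add: Y_def)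
  have tt: "tail_value U A * tail_value U B = tail_value U (A \<inter> B)"
    using assms(1)
  proof (cases rule: mirror_sets_cases)
    case 1 thus ?thesis by (simp add: tail_value_empty)
  next
    case (2 k)
    show ?thesis using assms(2)
    proof (cases rule: mirror_sets_cases)
      case 1 thus ?thesis by (simp add: tail_value_empty)
    next
      case (2 l)
      have "{k..} \<inter> {l..} = {max k l..}" by auto
      hence "tail_index (A \<inter> B) = {max k l..}" using \<open>tail_index A = _\<close> 2 by simp
      thus ?thesis using \<open>tail_index A = _\<close> 2 by (simp only: tail_value_atLeast U_U')
    qed
  qed
  show ?thesis unfolding \<rho> by (simp add: distrib_left distrib_right XX XY YY tt)
qed

lemma proj_Un:
  assumes "A \<in> mirror_sets n" "B \<in> mirror_sets n" shows "\<rho> (A \<union> B) = \<rho> A + \<rho> B - \<rho> (A \<inter> B)"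
proof -
  let ?I = "\<lambda>A. {i. i \<in> {1..n - 1} \<and> VU i \<in> A}"
  have "?I A \<union> ?I B = ?I (A \<union> B)" "?I A \<inter> ?I B = ?I (A \<inter> B)" by auto
  hence uu: "sum u (?I (A \<union> B)) + sum u (?I (A \<inter> B)) = sum u (?I A) + sum u (?I B)"
    using sum.union_inter[of "?I A" "?I B" u] by simp
  have tt: "tail_value U (A \<union> B) + tail_value U (A \<inter> B) = tail_value U A + tail_value U B"
    using assms(1)
  proof (cases rule: mirror_sets_cases)
    case 1 thus ?thesis by (simp add: tail_value_def)
  next
    case (2 k)
    show ?thesis using assms(2)
    proof (cases rule: mirror_sets_cases)
      case 1 thus ?thesis by (simp add: tail_value_def)
    next
      case (2 l)
      have "{k..} \<inter> {l..} = {max k l..}" "{k..} \<union> {l..} = {min k l..}" by auto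
      hence "tail_index (A \<inter> B) = {max k l..}" "tail_index (A \<union> B) = {min k l..}"
        using \<open>tail_index A = _\<close> 2 by simp_all
      thus ?thesis using \<open>tail_index A = _\<close> 2
        by (simp only: tail_value_atLeast) (auto simp: min_def max_def add.commute)
    qed
  qed
  have pp: "(if VW1 \<in> A \<union> B then P else 0) + (if VW1 \<in> A \<inter> B then P else 0) =
      (if VW1 \<in> A then P else 0) + (if VW1 \<in> B then P else 0)" by auto
  have "\<rho> (A \<union> B) + \<rho> (A \<inter> B) =
      (sum u (?I (A \<union> B)) + sum u (?I (A \<inter> B))) +
      ((if VW1 \<in> A \<union> B then P else 0) + (if VW1 \<in> A \<inter> B then P else 0)) +
      (tail_value U (A \<union> B) + tail_value U (A \<inter> B))"
    unfolding mirror_proj_def by (simp only: ac_simps)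
  also have "\<dots> = \<rho> A + \<rho> B" unfolding uu tt pp mirror_proj_def by (simp only: ac_simps)
  finally show ?thesis by (simp add: eq_diff_eq)
qed

lemma proj_star: "(\<rho> A)\<^sup>\<star> = \<rho> A"
  unfolding mirror_proj_def tail_value_def by (simp add: star_sum st)

lemma proj_LE: assumes "1 \<le> i" "i \<le> j" "j \<le> n - 1"
  shows "\<rho> A * S (LE i j) = (if VU i \<in> A then S (LE i j) else 0)"
proof -
  have "(\<Sum>k | k \<in> {1..n - 1} \<and> VU k \<in> A. u k * S (LE i j)) =
      (\<Sum>k | k \<in> {1..n - 1} \<and> VU k \<in> A. if i = k then S (LE i j) else 0)"
    using assms by (intro sum.cong) (auto simp: u_LE)
  also have "\<dots> = (if VU i \<in> A then S (LE i j) else 0)" using assms by (simp add: sum.delta')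
  finally show ?thesis
    using assms unfolding mirror_proj_def
    by (simp add: distrib_right sum_distrib_right P_ulabel U_ulabel tail_value_def)
qed

lemma proj_LF: assumes "1 \<le> i" "i \<le> n - 1"
  shows "\<rho> A * S (LF i) = (if VU i \<in> A then S (LF i) else 0)"
proof -
  have "(\<Sum>k | k \<in> {1..n - 1} \<and> VU k \<in> A. u k * S (LF i)) =
      (\<Sum>k | k \<in> {1..n - 1} \<and> VU k \<in> A. if i = k then S (LF i) else 0)"
    using assms by (intro sum.cong) (auto simp: u_LF)
  also have "\<dots> = (if VU i \<in> A then S (LF i) else 0)" using assms by (simp add: sum.delta')
  finally show ?thesis
    using assms unfolding mirror_proj_def
    by (simp add: distrib_right sum_distrib_right P_ulabel U_ulabel tail_value_def)
qed

lemma proj_LG: "\<rho> A * S LG = tail_value U A * S LG" and proj_LH: "\<rho> A * S LH = tail_value U A * S LH"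
  unfolding mirror_proj_def by (simp_all add: distrib_right sum_distrib_right u_G u_H P_G P_H)

abbreviation "rr A a \<equiv> rel_range (mirror_graph n) mirror_label A [a]"

lemma range_LF: "1 \<le> i \<Longrightarrow> i \<le> n - 1 \<Longrightarrow> rr A (LF i) = (if VU i \<in> A then {VW1} \<union> tail_set 0 else {})"
  by (simp only: mirror_range_LF V_from_eq(2))

lemma proj_S:
  assumes "A \<in> mirror_sets n" "a \<in> mlabels n"
  shows "\<rho> A * S a = S a * \<rho> (rr A a)"
proof (cases a)
  case (LE i j)
  thus ?thesis using assms(2) S_pi'[of "LE i j"] S_LE[of i j]
    by (auto simp: mirror_range_LE proj_LE)
next
  case (LF i)
  thus ?thesis using assms(2) S_pi'[of "LF i"] S_LF[of i]
    by (auto simp: range_LF proj_LF mirror_proj_f simp del: Un_insert_left Un_insert_right)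
next
  case LG
  have r: "VU i \<notin> rr A LG" "VW1 \<notin> rr A LG" for i by (auto simp: mirror_range_LG)
  have ti: "tail_index (rr A LG) = Suc ` tail_index A"
  proof -
    have "vtail k \<in> rr A LG \<longleftrightarrow> (\<exists>m. k = Suc m \<and> vtail m \<in> A)" for k
      by (cases k) (auto simp: mirror_range_LG vtail_def)
    thus ?thesis unfolding tail_index_def by blast
  qed
  have "tail_value U A * S LG = S LG * tail_value U (rr A LG)"
    using assms(1)
  proof (cases rule: mirror_sets_cases)
    case (2 k)
    have "x \<in> Suc ` {k..}" if "Suc k \<le> x" for x
      using that by (intro image_eqI[of _ _ "x - 1"]) auto
    hence "Suc ` {k..} = {Suc k..}" by (intro equalityI subsetI) auto
    hence "tail_index (rr A LG) = {Suc k..}" using ti 2 by simp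
    thus ?thesis using 2 by (simp only: tail_value_atLeast U_G)
  qed (simp add: ti tail_value_def)
  moreover have "\<rho> (rr A LG) = tail_value U (rr A LG)" unfolding mirror_proj_def using r by simp
  ultimately show ?thesis by (simp only: LG proj_LG)
next
  case LH
  show ?thesis using assms(1)
  proof (cases rule: mirror_sets_cases)
    case 1
    hence "VV i \<notin> A" if "1 \<le> i" for i using that unfolding tail_index_def vtail_def
      by (auto dest!: spec[of _ i] split: if_splits)
    hence "rr A LH = {}" by (auto simp: mirror_range_LH)
    thus ?thesis using 1 by (simp add: LH proj_LH tail_value_empty)
  next
    case (2 k)
    \<comment> \<open>The witness is \<open>VV (Suc k)\<close> and not \<open>vtail k\<close>,
      because for \<open>k = 0\<close> the latter is \<open>VW2\<close>, which emits no edge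
      labelled \<open>h\<close>.\<close>
    have "Suc k \<in> tail_index A" using 2 by simp
    hence "1 \<le> Suc k \<and> VV (Suc k) \<in> A" by (simp add: tail_index_def vtail_def)
    hence "rr A LH = {VW1}" unfolding mirror_range_LH by blast
    thus ?thesis using 2 S_pi'[of LH] S_LH by (simp add: LH proj_LH tail_value_atLeast U_H)
  qed
qed

lemma S_range: assumes "a \<in> mlabels n" shows "(S a)\<^sup>\<star> * S a = \<rho> (path_range (mirror_graph n) mirror_label [a])"
proof (cases a)
  case (LE i j)
  thus ?thesis using assms S_LE[of i j]
    by (auto simp: path_range_def mirror_range_LE verts_mirror)
next
  case (LF i)
  thus ?thesis using assms S_LF[of i]
    by (auto simp: path_range_def range_LF verts_mirror mirror_proj_f simp del: Un_insert_left Un_insert_right)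
next
  case LG
  have "rr (verts (mirror_graph n)) LG = V_from 1"
  proof -
    have "(if i = 1 then VW2 else VV (i - 1)) \<in> verts (mirror_graph n)" if "1 \<le> i" for i
      using that by (simp add: mirror_sel)
    thus ?thesis unfolding mirror_range_LG V_from_def atLeast_def by blast
  qed
  thus ?thesis using S_LG by (simp only: LG path_range_def V_from_eq order_refl mirror_proj_simps)
next
  case LH
  have "rr (verts (mirror_graph n)) LH = {VW1}"
  proof -
    have "1 \<le> Suc 0 \<and> VV (Suc 0) \<in> verts (mirror_graph n)" by (simp add: mirror_sel)
    thus ?thesis unfolding mirror_range_LH by blast
  qed
  thus ?thesis using S_LH by (simp add: LH path_range_def)
qed

lemma sum_ulabels: "(\<Sum>a\<in>ulabels n. S a * (S a)\<^sup>\<star>) = (\<Sum>i\<in>{1..n - 1}. u i)"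
proof -
  have "(\<Sum>a\<in>ulabels n. S a * (S a)\<^sup>\<star>) =
      (\<Sum>i\<in>{1..n - 1}. \<Sum>a\<in>insert (LF i) (LE i ` {i..n - 1}). S a * (S a)\<^sup>\<star>)"
    unfolding ulabels_def by (rule sum.UNION_disjoint) auto
  also have "\<dots> = (\<Sum>i\<in>{1..n - 1}. u i)"
  proof (rule sum.cong[OF refl])
    fix i assume i: "i \<in> {1..n - 1}"
    have "LF i \<notin> LE i ` {i..n - 1}" by auto
    thus "(\<Sum>a\<in>insert (LF i) (LE i ` {i..n - 1}). S a * (S a)\<^sup>\<star>) = u i"
      unfolding u_sum[OF i] by (simp add: sum.reindex inj_on_def add.commute)
  qed
  finally show ?thesis .
qed

lemma sum_mlabels: "(\<Sum>a\<in>mlabels n. S a * (S a)\<^sup>\<star>) = (\<Sum>i\<in>{1..n - 1}. u i) + U 0"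
proof -
  have "(\<Sum>a\<in>mlabels n. S a * (S a)\<^sup>\<star>) = (\<Sum>a\<in>ulabels n. S a * (S a)\<^sup>\<star>) + (\<Sum>a\<in>{LG, LH}. S a * (S a)\<^sup>\<star>)"
    unfolding mlabels_def by (rule sum.union_disjoint) auto
  thus ?thesis by (simp add: sum_ulabels U_sum)
qed

text \<open>Labels not emitted by \<open>A\<close> contribute 0, so the sum may run over all labels.
  There the projection of \<open>A\<close> moves to the front, and what remains is the sum of all
  range projections, which is the projection of all vertices minus that of the only sink
  \<open>VW1\<close>.\<close>

lemma proj_sum:
  assumes A: "A \<in> mirror_sets n"
  shows "\<rho> A = (\<Sum>a\<in>emitted_labels (mirror_graph n) mirror_label A. S a * \<rho> (rr A a) * (S a)\<^sup>\<star>) +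
    (\<Sum>v\<in>{v \<in> A. is_sink (mirror_graph n) v}. \<rho> {v})"
proof -
  let ?E = "emitted_labels (mirror_graph n) mirror_label A"
  have sub: "?E \<subseteq> mlabels n" by (auto simp: emitted_labels_def mlabels_eq)
  have zero: "rr A a = {}" if "a \<in> mlabels n - ?E" for a
    using that by (auto simp: emitted_labels_def mlabels_eq path_source_def rel_range_def)
  have "(\<Sum>a\<in>?E. S a * \<rho> (rr A a) * (S a)\<^sup>\<star>) = (\<Sum>a\<in>mlabels n. S a * \<rho> (rr A a) * (S a)\<^sup>\<star>)"
    by (rule sum.mono_neutral_left) (use sub zero in auto)
  also have "\<dots> = (\<Sum>a\<in>mlabels n. \<rho> A * (S a * (S a)\<^sup>\<star>))"
    using proj_S[OF A] by (intro sum.cong) (auto simp flip: mult.assoc)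
  also have "\<dots> = \<rho> A * ((\<Sum>i\<in>{1..n - 1}. u i) + U 0)"
    by (simp only: sum_mlabels flip: sum_distrib_left)
  also have "\<dots> = \<rho> A * \<rho> (verts (mirror_graph n)) - \<rho> A * \<rho> {VW1}"
    by (simp add: mirror_proj_verts algebra_simps)
  also have "\<dots> = \<rho> A - \<rho> (A \<inter> {VW1})"
    using mirror_sets_verts[OF A] by (simp only: proj_Int[OF A mirror_sets_all] proj_Int[OF A mirror_sets.intros(2)] Int_absorb2)
  finally have "(\<Sum>a\<in>?E. S a * \<rho> (rr A a) * (S a)\<^sup>\<star>) = \<rho> A - \<rho> (A \<inter> {VW1})" .
  moreover have "{v \<in> A. is_sink (mirror_graph n) v} = A \<inter> {VW1}" by (auto simp: mirror_sink)
  moreover have "(\<Sum>v\<in>A \<inter> {VW1}. \<rho> {v}) = \<rho> (A \<inter> {VW1})" by (cases "VW1 \<in> A") auto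
  ultimately show ?thesis by simp
qed

end

section \<open>Approximate units of the two ideals\<close>

text \<open>With \<open>B k\<close> the sum of the first \<open>k\<close> minimal projections below \<open>U 0\<close>, or with \<open>B k = P\<close>, the
  tower sums the projections \<open>w b w\<^sup>*\<close> over the words \<open>w\<close> of length less than \<open>k\<close> and the summands \<open>b\<close>.\<close>

primrec tower :: "('a \<Rightarrow> 'a) \<Rightarrow> (label \<Rightarrow> 'a) \<Rightarrow> label set \<Rightarrow> (nat \<Rightarrow> 'a) \<Rightarrow> nat \<Rightarrow> 'a::semiring_0" where
  "tower st S L B 0 = 0"
| "tower st S L B (Suc k) = B (Suc k) + (\<Sum>a\<in>L. S a * tower st S L B k * st (S a))"

section \<open>Elements commuting with the projections of the labelled space\<close>

context mirror_family
begin

definition diagonal :: "'a \<Rightarrow> bool" where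
  "diagonal x \<longleftrightarrow> (\<forall>i\<in>{1..n - 1}. u i * x = x * u i) \<and> P * x = x * P \<and> (\<forall>k. U k * x = x * U k)"

lemma diagonalD:
  assumes "diagonal x" shows "i \<in> {1..n - 1} \<Longrightarrow> u i * x = x * u i" "P * x = x * P" "U k * x = x * U k"
  using assms by (auto simp: diagonal_def)

lemma diagonal_simps [simp]:
  "diagonal 0" "diagonal P" "diagonal (U k)"
  by (auto simp: diagonal_def u_P P_u P_U u_U U_U' max.commute)

lemma diagonal_add: "diagonal x \<Longrightarrow> diagonal y \<Longrightarrow> diagonal (x + y)"
  and diagonal_diff: "diagonal x \<Longrightarrow> diagonal y \<Longrightarrow> diagonal (x - y)"
  by (auto simp: diagonal_def algebra_simps)

lemma diagonal_sum: "(\<And>i. i \<in> I \<Longrightarrow> diagonal (f i)) \<Longrightarrow> diagonal (sum f I)"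
  by (induction I rule: infinite_finite_induct) (auto intro: diagonal_add)

lemma diagonal_source: assumes "a \<in> mlabels n" "diagonal x" shows "(S a)\<^sup>\<star> * S a * x = x * ((S a)\<^sup>\<star> * S a)"
  using assms diagonalD[OF assms(2)]
  by (cases a) (auto simp: S_LE S_LF S_LG S_LH distrib_left distrib_right)

lemma star_left: "d * S a = S a * d' \<Longrightarrow> d\<^sup>\<star> = d \<Longrightarrow> d'\<^sup>\<star> = d' \<Longrightarrow> (S a)\<^sup>\<star> * d = d' * (S a)\<^sup>\<star>"
  by (metis star_mult)

text \<open>Each of the projections \<open>d\<close> passes through \<open>S a\<close> as another
  one: \<open>d * S a = S a * d'\<close>, where \<open>d'\<close> is 0, the initial projection of
  \<open>S a\<close>, or the next tail when \<open>a\<close> is \<open>LG\<close>. Since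
  \<open>x\<close> commutes with \<open>d'\<close>, the conjugate commutes with
  \<open>d\<close>.\<close>

lemma diagonal_conj:
  assumes a: "a \<in> mlabels n" and x: "diagonal x" shows "diagonal (S a * x * (S a)\<^sup>\<star>)"
proof -
  have key: "d * (S a * x * (S a)\<^sup>\<star>) = S a * x * (S a)\<^sup>\<star> * d"
    if 1: "d * S a = S a * d'" and d: "d\<^sup>\<star> = d" "d'\<^sup>\<star> = d'" and 2: "d' * x = x * d'" for d d'
  proof -
    have "d * (S a * x * (S a)\<^sup>\<star>) = S a * (d' * x) * (S a)\<^sup>\<star>" using 1 by (simp flip: mult.assoc)
    also have "\<dots> = S a * x * (d' * (S a)\<^sup>\<star>)" by (simp add: 2 mult.assoc)
    also have "d' * (S a)\<^sup>\<star> = (S a)\<^sup>\<star> * d" using star_left[OF 1 d] by simp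
    finally show ?thesis by (simp add: mult.assoc)
  qed
  have id: "S a = S a * ((S a)\<^sup>\<star> * S a)" "((S a)\<^sup>\<star> * S a)\<^sup>\<star> = (S a)\<^sup>\<star> * S a"
    "(S a)\<^sup>\<star> * S a * x = x * ((S a)\<^sup>\<star> * S a)"
    using S_pi'[OF a] diagonal_source[OF a x] by simp_all
  have *: "d * (S a * x * (S a)\<^sup>\<star>) = S a * x * (S a)\<^sup>\<star> * d"
    if "d * S a = 0 \<or> d * S a = S a" "d\<^sup>\<star> = d" for d
    using that(1)
  proof
    assume "d * S a = 0" thus ?thesis using that(2) by (intro key[of d 0]) simp_all
  next
    assume "d * S a = S a" thus ?thesis using that(2) id by (intro key[of d "(S a)\<^sup>\<star> * S a"]) simp_all
  qed
  show ?thesis unfolding diagonal_def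
  proof (intro conjI ballI allI)
    fix i assume i: "i \<in> {1..n - 1}"
    have "u i * S a = 0 \<or> u i * S a = S a" using a i by (cases a) (auto simp: u_LE u_LF u_G u_H)
    thus "u i * (S a * x * (S a)\<^sup>\<star>) = S a * x * (S a)\<^sup>\<star> * u i" by (rule *) (rule st(1)[OF i])
  next
    show "P * (S a * x * (S a)\<^sup>\<star>) = S a * x * (S a)\<^sup>\<star> * P" using P_S[OF a] st by (intro *) auto
    fix k
    show "U k * (S a * x * (S a)\<^sup>\<star>) = S a * x * (S a)\<^sup>\<star> * U k"
    proof (cases "a = LG")
      case True
      thus ?thesis using U_G st diagonalD[OF x] by (intro key[of "U k" "U (Suc k)"]) simp_all
    next
      case False
      hence "U k * S a = 0 \<or> U k * S a = S a" using a by (auto simp: mlabels_def U_ulabel U_H)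
      thus ?thesis by (rule *) (rule st(3))
    qed
  qed
qed

text \<open>Only the term \<open>b = a\<close> survives, and there \<open>x\<close> moves past the
  initial projection of \<open>S a\<close>.\<close>

lemma sum_conj_S:
  assumes L: "L \<subseteq> mlabels n" and a: "a \<in> mlabels n" and x: "diagonal x"
  shows "(\<Sum>b\<in>L. S b * x * (S b)\<^sup>\<star>) * S a = (if a \<in> L then S a * x else 0)"
proof -
  have "(\<Sum>b\<in>L. S b * x * (S b)\<^sup>\<star>) * S a = (\<Sum>b\<in>L. if a = b then S a * x else 0)"
    unfolding sum_distrib_right
  proof (rule sum.cong[OF refl])
    fix b assume b: "b \<in> L"
    show "S b * x * (S b)\<^sup>\<star> * S a = (if a = b then S a * x else 0)"
    proof (cases "a = b")
      case True
      have "S a * x * (S a)\<^sup>\<star> * S a = S a * ((S a)\<^sup>\<star> * S a * x)"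
        using diagonal_source[OF a x] by (simp add: mult.assoc)
      also have "\<dots> = S a * x" using S_pi[OF a] by (simp flip: mult.assoc)
      finally show ?thesis using True by simp
    next
      case False
      thus ?thesis using S_orth[of b a] a b L by (auto simp: mult.assoc)
    qed
  qed
  also have "\<dots> = (if a \<in> L then S a * x else 0)"
    using finite_subset[OF L finite_mlabels] by (simp add: sum.delta)
  finally show ?thesis .
qed

end

text \<open>By \<open>B_S\<close> the base projections are orthogonal to the ranges of the letters
  in \<open>L\<close>. This yields \<open>T (Suc k) * S a = S a * T k\<close>, from which
  monotonicity and absorption of the tower follow.\<close>

locale mirror_tower = mirror_family n u P U S
  for n :: nat and u :: "nat \<Rightarrow> 'a::star_ring" and P U S +
  fixes L :: "label set" and B :: "nat \<Rightarrow> 'a"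
  assumes L: "L \<subseteq> mlabels n" and B_diagonal: "diagonal (B k)" and B_star: "(B k)\<^sup>\<star> = B k"
    and B_mono: "j \<le> k \<Longrightarrow> B j * B k = B j" and B_S: "a \<in> L \<Longrightarrow> B k * S a = 0"
begin

abbreviation "T \<equiv> tower star S L B"

lemma T_diagonal: "diagonal (T k)"
proof (induction k)
  case (Suc k)
  thus ?case using L by (auto intro!: diagonal_add B_diagonal diagonal_sum diagonal_conj)
qed simp

lemma T_star: "(T k)\<^sup>\<star> = T k"
  by (induction k) (auto simp: star_sum B_star mult.assoc)

lemma T_S: assumes "a \<in> L" shows "T (Suc k) * S a = S a * T k"
  using assms L by (simp add: distrib_right B_S sum_conj_S T_diagonal subset_iff)

lemma S_T: assumes "a \<in> L" shows "(S a)\<^sup>\<star> * T (Suc k) = T k * (S a)\<^sup>\<star>"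
  using star_left[OF T_S[OF assms] T_star T_star] .

lemma B_T: assumes "j \<le> Suc k" shows "B j * T (Suc k) = B j"
proof -
  have "B j * (S a * T k * (S a)\<^sup>\<star>) = 0" if "a \<in> L" for a
    using B_S[OF that, of j] by (simp flip: mult.assoc)
  thus ?thesis using B_mono[OF assms] by (simp add: distrib_left sum_distrib_left)
qed

lemma T_mono: "j \<le> k \<Longrightarrow> T j * T k = T j"
proof (induction j arbitrary: k)
  case (Suc j)
  then obtain m where k: "k = Suc m" "j \<le> m" by (cases k) auto
  have "(S a * T j * (S a)\<^sup>\<star>) * T (Suc m) = S a * T j * (S a)\<^sup>\<star>" if "a \<in> L" for a
  proof -
    have "(S a * T j * (S a)\<^sup>\<star>) * T (Suc m) = S a * T j * ((S a)\<^sup>\<star> * T (Suc m))" by (simp only: mult.assoc)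
    also have "\<dots> = S a * (T j * T m) * (S a)\<^sup>\<star>" by (simp only: S_T[OF that] mult.assoc)
    finally show ?thesis using Suc.IH[OF k(2)] by simp
  qed
  hence "(\<Sum>a\<in>L. S a * T j * (S a)\<^sup>\<star>) * T (Suc m) = (\<Sum>a\<in>L. S a * T j * (S a)\<^sup>\<star>)"
    by (simp only: sum_distrib_right cong: sum.cong)
  thus ?case using B_T[of "Suc j" m] k by (simp only: tower.simps(2)[of _ _ _ _ j] distrib_right Suc_le_mono)
qed simp

lemma T_proj: "proj (T k)"
  using T_star T_mono[of k k] by (simp add: proj_def)

text \<open>Moving the tower past \<open>S a\<close> lowers the level by one, moving it past the
  adjoint raises the level by one; monotonicity does the rest.\<close>

lemma T_S_absorb: assumes "a \<in> L"
  shows "\<exists>k. T j * S a = T j * S a * T k" "\<exists>k. T j * (S a)\<^sup>\<star> = T j * (S a)\<^sup>\<star> * T k"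
proof -
  show "\<exists>k. T j * S a = T j * S a * T k"
  proof (cases j)
    case (Suc i)
    have "T j * S a * T j = S a * (T i * T j)" unfolding Suc T_S[OF assms] by (rule mult.assoc)
    also have "\<dots> = T j * S a" using T_mono[of i j] by (simp only: Suc T_S[OF assms], simp?)
    finally show ?thesis by metis
  qed simp
  have "T j * (S a)\<^sup>\<star> * T (Suc j) = (S a)\<^sup>\<star> * (T (Suc j) * T (Suc j))"
    by (simp only: S_T[OF assms, symmetric] mult.assoc)
  also have "\<dots> = T j * (S a)\<^sup>\<star>" using T_mono[of "Suc j" "Suc j"] S_T[OF assms] by simp
  finally show "\<exists>k. T j * (S a)\<^sup>\<star> = T j * (S a)\<^sup>\<star> * T k" by metis
qed

lemma T_diagonal_absorb: assumes "T j * x = x * T j" shows "T j * x = T j * x * T j"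
proof -
  have "T j * x * T j = x * (T j * T j)" by (simp only: assms mult.assoc)
  thus ?thesis using T_mono[of j j] assms by simp
qed

end

section \<open>The two towers and their orthogonality\<close>

context mirror_family
begin

text \<open>Words containing \<open>g\<close> need no summands of their own: conjugation by
  \<open>S LG\<close> carries \<open>U (j + 1) - U (j + 2)\<close> to
  \<open>U j - U (j + 1)\<close>, because \<open>U j - U (j + 1)\<close> annihilates
  \<open>S LH\<close>. These differences are already contained in the base
  \<open>U 0 - U k\<close>.\<close>

sublocale E: mirror_tower n u P U S "ulabels n" "\<lambda>k. U 0 - U k"
proof
  show "ulabels n \<subseteq> mlabels n" by (auto simp: mlabels_def)
  show "diagonal (U 0 - U k)" for k by (intro diagonal_diff) simp_all
  show "(U 0 - U k)\<^sup>\<star> = U 0 - U k" for k by (simp add: st)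
  show "(U 0 - U j) * (U 0 - U k) = U 0 - U j" if "j \<le> k" for j k
    using that by (simp add: algebra_simps U_U' max_def)
  show "(U 0 - U k) * S a = 0" if "a \<in> ulabels n" for a k
    using that by (simp add: left_diff_distrib U_ulabel)
qed

text \<open>All letters are allowed here, since \<open>VW1\<close> is a sink and \<open>P\<close>
  annihilates every \<open>S a\<close>.\<close>

sublocale F: mirror_tower n u P U S "mlabels n" "\<lambda>k. P"
  by unfold_locales (simp_all add: st P_S projD[OF proj_P])

lemma ulabel_mlabel: "a \<in> ulabels n \<Longrightarrow> a \<in> mlabels n"
  by (simp add: mlabels_def)

lemma E_S: "E.T k * S LG = S LG * (U 1 - U (Suc k))" "E.T k * S LH = 0"
proof -
  show "E.T k * S LG = S LG * (U 1 - U (Suc k))"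
    by (cases k) (auto simp: distrib_right sum_conj_S E.L E.T_diagonal left_diff_distrib right_diff_distrib U_G)
  show "E.T k * S LH = 0"
    by (cases k) (auto simp: distrib_right sum_conj_S E.L E.T_diagonal left_diff_distrib U_H)
qed

lemma S_star_diag: "U (Suc k) * (S LG)\<^sup>\<star> = (S LG)\<^sup>\<star> * U k" "P * (S LH)\<^sup>\<star> = (S LH)\<^sup>\<star>"
proof -
  show "U (Suc k) * (S LG)\<^sup>\<star> = (S LG)\<^sup>\<star> * U k" using star_left[OF U_G st(3) st(3)] by simp
  have "S LH * P = S LH" using S_pi'[of LH] S_LH by simp
  from arg_cong[OF this, of star] show "P * (S LH)\<^sup>\<star> = (S LH)\<^sup>\<star>" by (simp add: st)
qed

lemma diag_ulabel:
  assumes "a \<in> ulabels n" shows "(S a)\<^sup>\<star> * U k = 0" "(S a)\<^sup>\<star> * P = 0"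
  using star_left[of "U k" a 0] star_left[of P a 0] U_ulabel[OF assms] P_ulabel[OF assms] st by auto

lemma E_U: "E.T (Suc j) * U k = (U 0 - U (Suc j)) * U k" and E_P: "E.T j * P = 0"
proof -
  show "E.T (Suc j) * U k = (U 0 - U (Suc j)) * U k"
    by (simp add: distrib_right sum_distrib_right mult.assoc diag_ulabel)
  show "E.T j * P = 0"
    by (cases j) (simp_all add: distrib_right sum_distrib_right mult.assoc diag_ulabel left_diff_distrib P_U)
qed

text \<open>The labels \<open>LG\<close> and \<open>LH\<close> are not letters of this tower. Past
  \<open>S LG\<close> it becomes \<open>U 1 - U (j + 1)\<close> and past the adjoint, for positive
  \<open>j\<close>, \<open>U 0 - U (j - 1)\<close>; both lie below a tower level. For
  \<open>LH\<close> the products vanish, because the tower annihilates \<open>S LH\<close> and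
  \<open>P\<close>.\<close>

lemma E_absorb:
  assumes "a \<in> mlabels n"
  shows "\<exists>k. E.T j * S a = E.T j * S a * E.T k" "\<exists>k. E.T j * (S a)\<^sup>\<star> = E.T j * (S a)\<^sup>\<star> * E.T k"
proof -
  consider "a \<in> ulabels n" | "a = LG" | "a = LH" using assms by (auto simp: mlabels_def)
  thus "\<exists>k. E.T j * S a = E.T j * S a * E.T k"
  proof cases
    case 2
    have "(U 1 - U (Suc j)) * E.T (Suc j) = E.T (Suc j) * (U 1 - U (Suc j))"
      using diagonalD(3)[OF E.T_diagonal] by (simp only: left_diff_distrib right_diff_distrib)
    also have "\<dots> = U 1 - U (Suc j)"
      by (simp only: right_diff_distrib left_diff_distrib E_U U_U', simp?)
    finally have "E.T j * S a * E.T (Suc j) = E.T j * S a" by (simp only: 2 E_S mult.assoc)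
    thus ?thesis by metis
  qed (auto intro: E.T_S_absorb simp: E_S)
  consider "a \<in> ulabels n" | "a = LG" | "a = LH" using assms by (auto simp: mlabels_def)
  thus "\<exists>k. E.T j * (S a)\<^sup>\<star> = E.T j * (S a)\<^sup>\<star> * E.T k"
  proof cases
    case 2
    show ?thesis
    proof (cases j)
      case (Suc i)
      have G: "(S LG)\<^sup>\<star> = U 1 * (S LG)\<^sup>\<star>" using S_star_diag(1)[of 0] U0_G st
        by (metis One_nat_def star_mult)
      have "E.T j * (S LG)\<^sup>\<star> = E.T j * U 1 * (S LG)\<^sup>\<star>" using G by (simp add: mult.assoc)
      also have "\<dots> = (U 1 - U (Suc i)) * (S LG)\<^sup>\<star>"
        unfolding Suc E_U by (simp only: left_diff_distrib U_U', simp?)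
      also have "\<dots> = (S LG)\<^sup>\<star> * (U 0 - U i)"
        by (simp only: left_diff_distrib right_diff_distrib S_star_diag One_nat_def)
      finally have *: "E.T j * (S LG)\<^sup>\<star> = (S LG)\<^sup>\<star> * (U 0 - U i)" .
      have "(U 0 - U i) * E.T (Suc i) = U 0 - U i" by (rule E.B_T) simp
      hence "E.T j * (S a)\<^sup>\<star> * E.T (Suc i) = E.T j * (S a)\<^sup>\<star>" by (simp only: 2 * mult.assoc)
      thus ?thesis by metis
    qed simp
  next
    case 3
    have "E.T j * (S LH)\<^sup>\<star> = E.T j * P * (S LH)\<^sup>\<star>" by (simp add: mult.assoc S_star_diag)
    thus ?thesis using 3 by (simp add: E_P)
  qed (auto intro: E.T_S_absorb)
qed

text \<open>The projection \<open>U 0 - U m\<close> annihilates \<open>S LH\<close> and the letters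
  of \<open>ulabels n\<close>, and it passes through \<open>S LG\<close> as
  \<open>U 1 - U (m + 1)\<close>. Written as \<open>(U 0 - U (m + 1)) - (U 0 - U 1)\<close>, this is
  covered by the induction hypothesis, which must therefore hold for all \<open>m\<close>.\<close>

lemma U_F: "(U 0 - U m) * F.T k = 0"
proof (induction k arbitrary: m)
  case (Suc k)
  have "(U 0 - U m) * (S a * F.T k * (S a)\<^sup>\<star>) = 0" if "a \<in> mlabels n" for a
  proof -
    have "(U 0 - U m) * S a * F.T k = 0"
    proof -
      consider "a \<in> ulabels n" | "a = LG" | "a = LH" using \<open>a \<in> mlabels n\<close> by (auto simp: mlabels_def)
      thus ?thesis
      proof cases
        case 2
        have "(U 0 - U m) * S a * F.T k = S LG * ((U 0 - U (Suc m)) * F.T k - (U 0 - U 1) * F.T k)"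
          by (simp add: 2 left_diff_distrib right_diff_distrib U_G mult.assoc)
        thus ?thesis by (simp only: Suc, simp?)
      qed (auto simp: left_diff_distrib U_ulabel U_H)
    qed
    thus ?thesis by (metis mult.assoc mult_zero_left)
  qed
  thus ?case by (simp add: distrib_left sum_distrib_left left_diff_distrib P_U)
qed simp

text \<open>The adjoint of a letter passes through the second tower and lowers its level, so the
  words of the first tower are stripped off one letter at a time until \<open>U_F\<close> applies to
  the base.\<close>

lemma E_F: "E.T j * F.T k = 0"
proof (induction j arbitrary: k)
  case (Suc j)
  show ?case
  proof (cases k)
    case (Suc m)
    have "S a * E.T j * (S a)\<^sup>\<star> * F.T (Suc m) = 0" if "a \<in> ulabels n" for a
      using F.S_T[OF ulabel_mlabel[OF that], of m] Suc.IH[of m]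
      by (metis mult.assoc mult_zero_left mult_zero_right)
    thus ?thesis using U_F[of "Suc j" k]
      by (simp only: Suc tower.simps(2)[of _ _ "ulabels n"] distrib_right sum_distrib_right, simp?)
  qed simp
qed simp

text \<open>Level 1 is already a local unit for the generator of each ideal, so these generators
  vanish in the quotients.\<close>

lemma E_one: "(U 0 - U 1) * E.T 1 = U 0 - U 1" and F_one: "P * F.T 1 = P"
  using E.B_T[of 1 0] F.B_T[of 1 0] by simp_all

end

section \<open>The quantum disc in a ring with involution\<close>

locale graph_family =
  fixes H :: "('v, 'e) pre_digraph" and p :: "'v \<Rightarrow> 'a::star_ring" and s :: "'e \<Rightarrow> 'a"
  assumes p_proj: "v \<in> verts H \<Longrightarrow> proj (p v)"
    and p_orth: "v \<in> verts H \<Longrightarrow> w \<in> verts H \<Longrightarrow> v \<noteq> w \<Longrightarrow> p v * p w = 0"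
    and s_pi: "e \<in> arcs H \<Longrightarrow> s e * (s e)\<^sup>\<star> * s e = s e"
    and s_head: "e \<in> arcs H \<Longrightarrow> (s e)\<^sup>\<star> * s e = p (head H e)"
    and p_sum: "v \<in> verts H \<Longrightarrow> out_arcs H v \<noteq> {} \<Longrightarrow> p v = (\<Sum>e\<in>out_arcs H v. s e * (s e)\<^sup>\<star>)"

lemma disc_graph_family_iff:
  "graph_family (disc_graph n) p s \<longleftrightarrow>
    (\<forall>v\<in>{1..n + 1}. proj (p v)) \<and> (\<forall>v\<in>{1..n + 1}. \<forall>w\<in>{1..n + 1}. v \<noteq> w \<longrightarrow> p v * p w = 0) \<and>
    (\<forall>i\<in>{1..n}. \<forall>j\<in>{i..n + 1}. s (i, j) * (s (i, j))\<^sup>\<star> * s (i, j) = s (i, j) \<and>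
      (s (i, j))\<^sup>\<star> * s (i, j) = p j) \<and>
    (\<forall>i\<in>{1..n}. p i = (\<Sum>j\<in>{i..n + 1}. s (i, j) * (s (i, j))\<^sup>\<star>))"
proof -
  have out: "v \<in> verts (disc_graph n) \<and> out_arcs (disc_graph n) v \<noteq> {} \<longleftrightarrow> v \<in> {1..n}" for v
    using out_arcs_disc_last[of n] by (cases "v = n + 1") (auto simp: disc_sel out_arcs_disc)
  have sum: "(\<Sum>e\<in>out_arcs (disc_graph n) v. s e * (s e)\<^sup>\<star>) = (\<Sum>j\<in>{v..n + 1}. s (v, j) * (s (v, j))\<^sup>\<star>)"
    if "v \<in> {1..n}" for v
    using that by (simp add: out_arcs_disc sum.reindex inj_on_def)
  show ?thesis
  proof
    assume "graph_family (disc_graph n) p s"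
    then interpret graph_family "disc_graph n" p s .
    have "p v = (\<Sum>j\<in>{v..n + 1}. s (v, j) * (s (v, j))\<^sup>\<star>)" if "v \<in> {1..n}" for v
      using p_sum[of v] out[of v] sum[OF that] that by simp
    thus "(\<forall>v\<in>{1..n + 1}. proj (p v)) \<and> (\<forall>v\<in>{1..n + 1}. \<forall>w\<in>{1..n + 1}. v \<noteq> w \<longrightarrow> p v * p w = 0) \<and>
      (\<forall>i\<in>{1..n}. \<forall>j\<in>{i..n + 1}. s (i, j) * (s (i, j))\<^sup>\<star> * s (i, j) = s (i, j) \<and>
        (s (i, j))\<^sup>\<star> * s (i, j) = p j) \<and>
      (\<forall>i\<in>{1..n}. p i = (\<Sum>j\<in>{i..n + 1}. s (i, j) * (s (i, j))\<^sup>\<star>))"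
      using p_proj p_orth s_pi s_head by (auto simp: disc_sel simp del: sum.cl_ivl_Suc)
  next
    assume a: "(\<forall>v\<in>{1..n + 1}. proj (p v)) \<and> (\<forall>v\<in>{1..n + 1}. \<forall>w\<in>{1..n + 1}. v \<noteq> w \<longrightarrow> p v * p w = 0) \<and>
      (\<forall>i\<in>{1..n}. \<forall>j\<in>{i..n + 1}. s (i, j) * (s (i, j))\<^sup>\<star> * s (i, j) = s (i, j) \<and>
        (s (i, j))\<^sup>\<star> * s (i, j) = p j) \<and>
      (\<forall>i\<in>{1..n}. p i = (\<Sum>j\<in>{i..n + 1}. s (i, j) * (s (i, j))\<^sup>\<star>))"
    show "graph_family (disc_graph n) p s"
    proof
      show "p v = (\<Sum>e\<in>out_arcs (disc_graph n) v. s e * (s e)\<^sup>\<star>)"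
        if "v \<in> verts (disc_graph n)" "out_arcs (disc_graph n) v \<noteq> {}" for v
        using a that out[of v] sum[of v] by simp
    qed (use a in \<open>auto simp: disc_sel\<close>)
  qed
qed

lemma sphere_graph_family:
  assumes "graph_family (disc_graph n) p s" and zero: "\<And>i. i \<in> {1..n} \<Longrightarrow> s (i, n + 1) = 0"
  shows "graph_family (sphere_graph n) p s"
proof -
  interpret D: graph_family "disc_graph n" p s by fact
  show ?thesis
  proof
    fix v assume v: "v \<in> verts (sphere_graph n)"
    hence vn: "v \<in> {1..n}" by (simp add: sphere_sel)
    have "{v..n + 1} = insert (n + 1) {v..n}" using vn by auto
    moreover have "p v = (\<Sum>j\<in>{v..n + 1}. s (v, j) * (s (v, j))\<^sup>\<star>)"
      using assms(1) vn by (simp add: disc_graph_family_iff)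
    ultimately have "p v = (\<Sum>j\<in>{v..n}. s (v, j) * (s (v, j))\<^sup>\<star>)" using zero[OF vn] by simp
    thus "p v = (\<Sum>e\<in>out_arcs (sphere_graph n) v. s e * (s e)\<^sup>\<star>)"
      using vn by (simp add: out_arcs_sphere sum.reindex inj_on_def)
  qed (use D.p_proj D.p_orth D.s_pi D.s_head in \<open>auto simp: sphere_sel disc_sel\<close>)
qed

text \<open>The relations of a graph do not list \<open>s_orth\<close>; for quotients by a
  C*-seminorm it is supplied by \<open>sum_proj_orthogonal\<close>.\<close>

locale disc_family = graph_family "disc_graph n" p s
  for n :: nat and p :: "nat \<Rightarrow> 'a::star_ring" and s +
  assumes n: "1 \<le> n"
    and s_orth: "i \<in> {1..n} \<Longrightarrow> j \<in> {i..n + 1} \<Longrightarrow> k \<in> {i..n + 1} \<Longrightarrow> j \<noteq> k \<Longrightarrow>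
      (s (i, j))\<^sup>\<star> * s (i, k) = 0"
begin

abbreviation "edge i j \<equiv> 1 \<le> i \<and> i \<le> n \<and> i \<le> j \<and> j \<le> n + 1"

lemma p_star: "v \<in> {1..n + 1} \<Longrightarrow> (p v)\<^sup>\<star> = p v"
  and p_p: "v \<in> {1..n + 1} \<Longrightarrow> w \<in> {1..n + 1} \<Longrightarrow> p v * p w = (if v = w then p v else 0)"
  using p_proj p_orth by (auto simp: disc_sel proj_def)

lemma s_pi': "edge i j \<Longrightarrow> s (i, j) * (s (i, j))\<^sup>\<star> * s (i, j) = s (i, j)"
  and s_head': "edge i j \<Longrightarrow> (s (i, j))\<^sup>\<star> * s (i, j) = p j"
  using s_pi s_head by (auto simp: disc_sel)

lemma p_sum': "i \<in> {1..n} \<Longrightarrow> p i = (\<Sum>j\<in>{i..n + 1}. s (i, j) * (s (i, j))\<^sup>\<star>)"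
  using graph_family_axioms by (simp add: disc_graph_family_iff)

lemma s_p: "edge i j \<Longrightarrow> v \<in> {1..n + 1} \<Longrightarrow> s (i, j) * p v = (if v = j then s (i, j) else 0)"
proof -
  assume a: "edge i j" "v \<in> {1..n + 1}"
  have *: "s (i, j) * p j = s (i, j)" using s_pi'[OF a(1)] s_head'[OF a(1)] by (simp add: mult.assoc)
  hence "s (i, j) * p v = s (i, j) * (p j * p v)" by (simp flip: mult.assoc)
  thus ?thesis using a * by (simp add: p_p)
qed

lemma p_s: "edge i j \<Longrightarrow> v \<in> {1..n + 1} \<Longrightarrow> p v * s (i, j) = (if v = i then s (i, j) else 0)"
proof -
  assume a: "edge i j" "v \<in> {1..n + 1}"
  have *: "p i * s (i, j) = s (i, j)"
  proof -
    have "(s (i, k) * (s (i, k))\<^sup>\<star>) * s (i, j) = (if k = j then s (i, j) else 0)" if "k \<in> {i..n + 1}" for k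
      using that a s_orth[of i k j] s_pi'[of i j] by (auto simp: mult.assoc)
    moreover have "p i = (\<Sum>j\<in>{i..n + 1}. s (i, j) * (s (i, j))\<^sup>\<star>)" using a by (intro p_sum') simp
    ultimately have "p i * s (i, j) = (\<Sum>k\<in>{i..n + 1}. if k = j then s (i, j) else 0)"
      by (simp only: sum_distrib_right cong: sum.cong)
    thus ?thesis using a by (simp del: sum.cl_ivl_Suc)
  qed
  hence "p v * s (i, j) = p v * p i * s (i, j)" by (simp add: mult.assoc)
  thus ?thesis using a * by (simp add: p_p)
qed

lemma s_p_star: "edge i j \<Longrightarrow> v \<in> {1..n + 1} \<Longrightarrow> (s (i, j))\<^sup>\<star> * p v = (if v = i then (s (i, j))\<^sup>\<star> else 0)"
  and p_s_star: "edge i j \<Longrightarrow> v \<in> {1..n + 1} \<Longrightarrow> p v * (s (i, j))\<^sup>\<star> = (if v = j then (s (i, j))\<^sup>\<star> else 0)"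
  using arg_cong[OF p_s[of i j v], of star] arg_cong[OF s_p[of i j v], of star] by (auto simp: p_star)

lemma s_s: "edge i j \<Longrightarrow> edge k l \<Longrightarrow> j \<noteq> k \<Longrightarrow> s (i, j) * s (k, l) = 0"
  and s_s_star: "edge i j \<Longrightarrow> edge k l \<Longrightarrow> j \<noteq> l \<Longrightarrow> s (i, j) * (s (k, l))\<^sup>\<star> = 0"
  and star_star_s: "edge i j \<Longrightarrow> edge k l \<Longrightarrow> i \<noteq> l \<Longrightarrow> (s (i, j))\<^sup>\<star> * (s (k, l))\<^sup>\<star> = 0"
proof -
  show "s (i, j) * s (k, l) = 0" if "edge i j" "edge k l" "j \<noteq> k"
  proof -
    have "s (i, j) * s (k, l) = s (i, j) * p j * s (k, l)" using that s_p[of i j j] by simp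
    thus ?thesis using that p_s[of k l j] by (simp add: mult.assoc)
  qed
  show "s (i, j) * (s (k, l))\<^sup>\<star> = 0" if "edge i j" "edge k l" "j \<noteq> l"
  proof -
    have "s (i, j) * (s (k, l))\<^sup>\<star> = s (i, j) * p j * (s (k, l))\<^sup>\<star>" using that s_p[of i j j] by simp
    thus ?thesis using that p_s_star[of k l j] by (simp add: mult.assoc)
  qed
  show "(s (i, j))\<^sup>\<star> * (s (k, l))\<^sup>\<star> = 0" if "edge i j" "edge k l" "i \<noteq> l"
  proof -
    have "(s (i, j))\<^sup>\<star> * (s (k, l))\<^sup>\<star> = (s (i, j))\<^sup>\<star> * p i * (s (k, l))\<^sup>\<star>"
      using that s_p_star[of i j i] by simp
    thus ?thesis using that p_s_star[of k l i] by (simp add: mult.assoc)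
  qed
qed

lemma star_s_s: "edge i j \<Longrightarrow> edge k l \<Longrightarrow> (s (i, j))\<^sup>\<star> * s (k, l) = (if (i, j) = (k, l) then p j else 0)"
proof (cases "i = k")
  case True
  assume "edge i j" "edge k l"
  thus ?thesis using True s_orth[of i j l] s_head'[of i j] by auto
next
  case False
  assume a: "edge i j" "edge k l"
  have "(s (i, j))\<^sup>\<star> * s (k, l) = (s (i, j))\<^sup>\<star> * p i * s (k, l)"
    using a s_p_star[of i j i] by simp
  thus ?thesis using a False p_s[of k l i] by (simp add: mult.assoc)
qed

lemma p_sum_u: "i \<in> {1..n - 1} \<Longrightarrow> p i = (\<Sum>j\<in>{i..n - 1}. s (i, j) * (s (i, j))\<^sup>\<star>) +
    (s (i, n) + s (i, n + 1)) * (s (i, n) + s (i, n + 1))\<^sup>\<star>"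
proof -
  assume i: "i \<in> {1..n - 1}"
  have "{i..n + 1} = {i..n - 1} \<union> {n, n + 1}" using i by auto
  moreover have "(\<Sum>j\<in>{i..n - 1} \<union> {n, n + 1}. s (i, j) * (s (i, j))\<^sup>\<star>) =
      (\<Sum>j\<in>{i..n - 1}. s (i, j) * (s (i, j))\<^sup>\<star>) + (\<Sum>j\<in>{n, n + 1}. s (i, j) * (s (i, j))\<^sup>\<star>)"
    using n by (intro sum.union_disjoint) auto
  ultimately have "p i = (\<Sum>j\<in>{i..n - 1}. s (i, j) * (s (i, j))\<^sup>\<star>) +
      (s (i, n) * (s (i, n))\<^sup>\<star> + s (i, n + 1) * (s (i, n + 1))\<^sup>\<star>)"
    using p_sum'[of i] i by (simp only:) auto
  moreover have "(s (i, n) + s (i, n + 1)) * (s (i, n) + s (i, n + 1))\<^sup>\<star> =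
      s (i, n) * (s (i, n))\<^sup>\<star> + s (i, n + 1) * (s (i, n + 1))\<^sup>\<star>"
  proof -
    have "edge i n" "edge i (n + 1)" using i by auto
    hence "s (i, n) * (s (i, n + 1))\<^sup>\<star> = 0" "s (i, n + 1) * (s (i, n))\<^sup>\<star> = 0"
      using s_s_star[of i n i "n + 1"] s_s_star[of i "n + 1" i n] by auto
    thus ?thesis by (simp add: distrib_left distrib_right)
  qed
  ultimately show ?thesis by simp
qed

lemma p_n: "p n = s (n, n) * (s (n, n))\<^sup>\<star> + s (n, n + 1) * (s (n, n + 1))\<^sup>\<star>"
proof -
  have "{n..n + 1} = {n, n + 1}" by auto
  thus ?thesis using p_sum'[of n] n by simp
qed

abbreviation "f i \<equiv> s (i, n) + s (i, n + 1)"

lemma f_rules: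
  assumes "1 \<le> i" "i \<le> n"
  shows "(f i)\<^sup>\<star> * f i = p n + p (n + 1)" "f i * (p n + p (n + 1)) = f i"
    "f i * (f i)\<^sup>\<star> * f i = f i"
proof -
  have e: "edge i n" "edge i (n + 1)" using assms n by auto
  note r = s_p[OF e(1)] s_p[OF e(2)] star_s_s[OF e(1) e(1)] star_s_s[OF e(1) e(2)] star_s_s[OF e(2) e(1)]
    star_s_s[OF e(2) e(2)]
  show *: "(f i)\<^sup>\<star> * f i = p n + p (n + 1)" using r by (simp add: distrib_left distrib_right)
  show **: "f i * (p n + p (n + 1)) = f i" using r n by (simp add: distrib_left distrib_right)
  show "f i * (f i)\<^sup>\<star> * f i = f i" by (simp only: mult.assoc * **)
qed

text \<open>All tails share the projection \<open>p n\<close>, since the differences of successive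
  tails are to vanish, and \<open>p (n + 1)\<close> takes the place of \<open>{w_1}\<close>. The
  label \<open>f_i\<close> collects the two edges from \<open>i\<close> to \<open>n\<close> and
  \<open>n + 1\<close>, just as its range collects \<open>w_1\<close> and the whole tail.\<close>

lemma mirror_family_left:
  "mirror_family n p (p (n + 1)) (\<lambda>_. p n) (mirror_iso (\<lambda>i j. s (i, j)) f (s (n, n)) (s (n, n + 1)))"
proof
  obtain m where m: "n = Suc m" using n by (cases n) auto
  let ?S = "mirror_iso (\<lambda>i j. s (i, j)) f (s (n, n)) (s (n, n + 1))"
  show "?S a * (?S a)\<^sup>\<star> * ?S a = ?S a" if "a \<in> mlabels n" for a
  proof (cases a)
    case (LE i j)
    hence "edge i j" using that n by auto
    thus ?thesis by (simp add: LE s_pi')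
  qed (use that n s_pi' f_rules(3) in auto)
  show "(?S a)\<^sup>\<star> * ?S b = 0" if "a \<in> mlabels n" "b \<in> mlabels n" "a \<noteq> b" for a b
    using that n by (cases a; cases b) (auto simp: m distrib_left distrib_right star_s_s)
  show "proj (p i)" if "i \<in> {1..n - 1}" for i using that p_proj[of i] by (auto simp: disc_sel)
  show "p i * p j = 0" if "i \<in> {1..n - 1}" "j \<in> {1..n - 1}" "i \<noteq> j" for i j
    using that by (subst p_p) auto
  show "(?S (LE i j))\<^sup>\<star> * ?S (LE i j) = p j" if "1 \<le> i" "i \<le> j" "j \<le> n - 1" for i j
  proof -
    have "edge i j" using that n by auto
    thus ?thesis using s_head' by simp
  qed
  show "p i = (\<Sum>j\<in>{i..n - 1}. ?S (LE i j) * (?S (LE i j))\<^sup>\<star>) + ?S (LF i) * (?S (LF i))\<^sup>\<star>"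
    if "i \<in> {1..n - 1}" for i unfolding mirror_iso_simps by (rule p_sum_u[OF that])
  show "proj (p (n + 1))" "proj (p n)" using n p_proj by (auto simp: disc_sel)
  show "p i * p (n + 1) = 0" "p i * p n = 0" if "i \<in> {1..n - 1}" for i
    using that n by (auto simp: p_p)
  show "p (n + 1) * p n = 0" "p n * p n = p n" using n by (auto simp: p_p)
  show "(?S (LF i))\<^sup>\<star> * ?S (LF i) = p (n + 1) + p n" if "1 \<le> i" "i \<le> n - 1" for i
    using f_rules(1)[of i] that by (simp add: add.commute)
  show "(?S LG)\<^sup>\<star> * ?S LG = p n" "(?S LH)\<^sup>\<star> * ?S LH = p (n + 1)"
    using s_head'[of n n] s_head'[of n "n + 1"] n by simp_all
  show "p n = ?S LG * (?S LG)\<^sup>\<star> + ?S LH * (?S LH)\<^sup>\<star>" unfolding mirror_iso_simps by (rule p_n)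
  show "p n * ?S LG = ?S LG * p n" "p n * ?S LH = ?S LH" using n by (simp_all add: p_s s_p)
qed

definition t :: 'a where "t = s (n, n) + s (n, n + 1)"

text \<open>The range projection of the \<open>k\<close>-th power of \<open>t\<close>, an isometry
  of the corner \<open>p n + p (n + 1)\<close> with range projection \<open>p n\<close>.\<close>

primrec U2 :: "nat \<Rightarrow> 'a" where
  "U2 0 = p n + p (n + 1)"
| "U2 (Suc k) = t * U2 k * t\<^sup>\<star>"

lemma t_star: "t\<^sup>\<star> * t = U2 0" "t * U2 0 = t" "t * t\<^sup>\<star> = p n" "U2 0 * t = t" "U2 0 * t\<^sup>\<star> = t\<^sup>\<star>" "t\<^sup>\<star> * U2 0 = t\<^sup>\<star>"
proof -
  have e: "edge n n" "edge n (n + 1)" using n by auto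
  show "t\<^sup>\<star> * t = U2 0" "t * U2 0 = t" using f_rules[of n] n by (simp_all add: t_def)
  show "t * t\<^sup>\<star> = p n" using p_n s_s_star[OF e(1) e(2)] s_s_star[OF e(2) e(1)]
    by (simp add: t_def distrib_left distrib_right)
  show *: "U2 0 * t = t" "U2 0 * t\<^sup>\<star> = t\<^sup>\<star>" "t\<^sup>\<star> * U2 0 = t\<^sup>\<star>"
    using p_s[OF e(1)] p_s[OF e(2)] p_s_star[OF e(1)] p_s_star[OF e(2)] s_p_star[OF e(1)] s_p_star[OF e(2)] n
    by (simp_all add: t_def distrib_left distrib_right)
qed

lemma U2_zero: "U2 0 * U2 k = U2 k" "U2 k * U2 0 = U2 k"
proof -
  have "U2 0 * U2 0 = U2 0" using n by (simp add: distrib_left distrib_right p_p)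
  thus "U2 0 * U2 k = U2 k" "U2 k * U2 0 = U2 k"
    by (cases k; simp add: t_star mult.assoc t_star(4)[THEN mult_ext] del: U2.simps(1))+
qed

lemma U2_mult: "j \<le> k \<Longrightarrow> U2 j * U2 k = U2 k"
proof (induction j arbitrary: k)
  case (Suc j)
  then obtain m where k: "k = Suc m" "j \<le> m" by (cases k) auto
  have "U2 (Suc j) * U2 k = t * (U2 j * U2 0) * U2 m * t\<^sup>\<star>"
    by (simp add: k mult.assoc t_star(1)[THEN mult_ext] del: U2.simps(1))
  also have "\<dots> = t * (U2 j * U2 m) * t\<^sup>\<star>" by (simp only: U2_zero mult.assoc)
  finally show ?case using Suc.IH[OF k(2)] k by simp
qed (simp only: U2_zero)

lemma U2_star: "(U2 k)\<^sup>\<star> = U2 k"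
  using n by (induction k) (auto simp: p_star mult.assoc)

lemma U2_one: "U2 1 = p n"
  using t_star by (simp add: mult.assoc del: U2.simps(1))

text \<open>For \<open>g\<close> sent to the adjoint of \<open>t\<close>, the range projection
  \<open>t^* t\<close> is all of \<open>U2 0\<close>, so nothing is left for \<open>h\<close>, while
  the initial projection is \<open>U2 1\<close>. The shift relation \<open>U_G\<close> is built into
  the recursion of \<open>U2\<close>.\<close>

lemma mirror_family_right:
  "mirror_family n p 0 U2 (mirror_iso (\<lambda>i j. s (i, j)) f (t\<^sup>\<star>) 0)"
proof
  obtain m where m: "n = Suc m" using n by (cases n) auto
  let ?S = "mirror_iso (\<lambda>i j. s (i, j)) f (t\<^sup>\<star>) 0"
  show "?S a * (?S a)\<^sup>\<star> * ?S a = ?S a" if "a \<in> mlabels n" for a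
  proof (cases a)
    case LG
    have "t\<^sup>\<star> * t * t\<^sup>\<star> = t\<^sup>\<star>" using t_star by (simp only:)
    thus ?thesis using LG by simp
  next
    case (LE i j)
    hence "edge i j" using that n by auto
    thus ?thesis by (simp add: LE s_pi')
  qed (use that n f_rules(3) in auto)
  show "(?S a)\<^sup>\<star> * ?S b = 0" if "a \<in> mlabels n" "b \<in> mlabels n" "a \<noteq> b" for a b
    using that n unfolding t_def by (cases a; cases b)
      (auto simp: m distrib_left distrib_right star_s_s s_s star_star_s)
  show "p i * U2 0 = 0" if "i \<in> {1..n - 1}" for i using that n by (auto simp: distrib_left p_p)
  show "U2 0 = ?S LG * (?S LG)\<^sup>\<star> + ?S LH * (?S LH)\<^sup>\<star>" using t_star by simp
  show "(?S LG)\<^sup>\<star> * ?S LG = U2 1" using t_star(3) by (simp only: U2_one mirror_iso_simps star_star)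
  show "U2 k * ?S LG = ?S LG * U2 (Suc k)" for k
    using U2_zero(1)[of k] t_star(1) by (simp add: mult.assoc t_star(1)[THEN mult_ext] U2_zero(1)[THEN mult_ext] del: U2.simps(1))
  show "proj (U2 k)" for k by (simp add: proj_def U2_star U2_mult)
  show "U2 j * U2 k = U2 k" if "j \<le> k" for j k using U2_mult[OF that] .
  show "(?S (LF i))\<^sup>\<star> * ?S (LF i) = 0 + U2 0" if "1 \<le> i" "i \<le> n - 1" for i
    using f_rules(1)[of i] that by simp
  show "proj (p i)" if "i \<in> {1..n - 1}" for i using that p_proj[of i] by (auto simp: disc_sel)
  show "p i * p j = 0" if "i \<in> {1..n - 1}" "j \<in> {1..n - 1}" "i \<noteq> j" for i j
    using that by (subst p_p) auto
  show "(?S (LE i j))\<^sup>\<star> * ?S (LE i j) = p j" if "1 \<le> i" "i \<le> j" "j \<le> n - 1" for i j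
  proof -
    have "edge i j" using that n by auto
    thus ?thesis using s_head' by simp
  qed
  show "p i = (\<Sum>j\<in>{i..n - 1}. ?S (LE i j) * (?S (LE i j))\<^sup>\<star>) + ?S (LF i) * (?S (LF i))\<^sup>\<star>"
    if "i \<in> {1..n - 1}" for i unfolding mirror_iso_simps by (rule p_sum_u[OF that])
qed (simp_all add: proj_def)

end

section \<open>Disc families inside the quotients of a labelled family\<close>

context mirror_family
begin

text \<open>The disc inside the quotient by one of the two ideals: \<open>A\<close> and \<open>B\<close> play the roles of
  the vertex projections \<open>n\<close> and \<open>n + 1\<close>, \<open>G\<close> and \<open>H\<close> those of the edges from \<open>n\<close> to \<open>n\<close> and \<open>n + 1\<close>.\<close>

lemma disc_graph_family:
  assumes n: "1 \<le> n" and AB: "proj A" "proj B" "A * B = 0" "A + B = P + U 0"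
    and uAB: "\<And>i. i \<in> {1..n - 1} \<Longrightarrow> u i * A = 0 \<and> u i * B = 0"
    and G: "G * G\<^sup>\<star> * G = G" "G\<^sup>\<star> * G = A" and H: "H * H\<^sup>\<star> * H = H" "H\<^sup>\<star> * H = B"
    and A: "A = G * G\<^sup>\<star> + H * H\<^sup>\<star>"
  shows "graph_family (disc_graph n) (\<lambda>v. if v < n then u v else if v = n then A else B)
    (\<lambda>(i, j). if i < n then (if j < n then S (LE i j) else if j = n then S (LF i) * A else S (LF i) * B)
      else if j = n then G else H)"
proof -
  let ?p = "\<lambda>v. if v < n then u v else if v = n then A else B"
  let ?s = "\<lambda>(i, j). if i < n then (if j < n then S (LE i j) else if j = n then S (LF i) * A else S (LF i) * B)
      else if j = n then G else H"
  have stAB: "A\<^sup>\<star> = A" "B\<^sup>\<star> = B" "A * A = A" "B * B = B" using AB by (auto simp: proj_def)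
  have BA: "B * A = 0" using flip_zero[OF AB(3)] stAB by simp
  have Au: "A * u i = 0" "B * u i = 0" if "i \<in> {1..n - 1}" for i
    using uAB[OF that] flip_zero st(1)[OF that] stAB by auto
  have LF: "(S (LF i))\<^sup>\<star> * S (LF i) = A + B" "S (LF i) * (A + B) = S (LF i)"
    if "1 \<le> i" "i < n" for i
    using that S_LF[of i] S_pi'[of "LF i"] AB(4) by auto
  have LFA: "(S (LF i))\<^sup>\<star> * (S (LF i) * A) = A" "(S (LF i))\<^sup>\<star> * (S (LF i) * B) = B"
    if "1 \<le> i" "i < n" for i
    using mult_ext[OF LF(1)[OF that]] by (simp_all add: distrib_right stAB BA AB(3))
  show ?thesis unfolding disc_graph_family_iff
  proof (intro conjI ballI impI)
    show "proj (?p v)" if "v \<in> {1..n + 1}" for v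
      using that AB proj_u by auto
    show "?p v * ?p w = 0" if "v \<in> {1..n + 1}" "w \<in> {1..n + 1}" "v \<noteq> w" for v w
    proof -
      have "v < n \<Longrightarrow> v \<in> {1..n - 1}" "w < n \<Longrightarrow> w \<in> {1..n - 1}" using that by auto
      thus ?thesis using that uAB Au AB(3) BA u_u by auto
    qed
    fix i j assume ij: "i \<in> {1..n}" "j \<in> {i..n + 1}"
    show "?s (i, j) * (?s (i, j))\<^sup>\<star> * ?s (i, j) = ?s (i, j)"
      using ij S_pi[of "LE i j"] G H LFA[of i] by (auto simp: mult.assoc stAB)
    show "(?s (i, j))\<^sup>\<star> * ?s (i, j) = ?p j"
      using ij S_LE[of i j] G H LFA[of i] by (auto simp: mult.assoc stAB)
  next
    fix i assume i: "i \<in> {1..n}"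
    show "?p i = (\<Sum>j\<in>{i..n + 1}. ?s (i, j) * (?s (i, j))\<^sup>\<star>)"
    proof (cases "i = n")
      case True
      have "{n..n + 1} = {n, n + 1}" by auto
      thus ?thesis using True A by simp
    next
      case False
      hence i': "1 \<le> i" "i < n" using i by auto
      have "{i..n + 1} = {i..n - 1} \<union> {n, n + 1}" using i' by auto
      moreover have "(\<Sum>j\<in>{i..n - 1} \<union> {n, n + 1}. ?s (i, j) * (?s (i, j))\<^sup>\<star>) =
          (\<Sum>j\<in>{i..n - 1}. ?s (i, j) * (?s (i, j))\<^sup>\<star>) + (\<Sum>j\<in>{n, n + 1}. ?s (i, j) * (?s (i, j))\<^sup>\<star>)"
        using i' by (intro sum.union_disjoint) auto
      moreover have "(\<Sum>j\<in>{i..n - 1}. ?s (i, j) * (?s (i, j))\<^sup>\<star>) =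
          (\<Sum>j\<in>{i..n - 1}. S (LE i j) * (S (LE i j))\<^sup>\<star>)"
        using i' by (intro sum.cong) auto
      moreover have "(\<Sum>j\<in>{n, n + 1}. ?s (i, j) * (?s (i, j))\<^sup>\<star>) = S (LF i) * (A + B) * (S (LF i))\<^sup>\<star>"
        using i' by (simp add: stAB mult.assoc stAB(3,4)[THEN mult_ext] distrib_left distrib_right)
      ultimately show ?thesis using u_sum[of i] LF(2)[OF i'] i' by simp
    qed
  qed
qed

abbreviation "left_p \<equiv> (\<lambda>v. if v < n then u v else if v = n then U 1 else P)"
abbreviation "left_s \<equiv> (\<lambda>(i, j). if i < n then
    (if j < n then S (LE i j) else if j = n then S (LF i) * U 1 else S (LF i) * P)
  else if j = n then S LG else S LH)"

lemma left_disc: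
  assumes n: "1 \<le> n" and W: "U 0 = U 1"
  shows "graph_family (disc_graph n) left_p left_s"
  by (rule disc_graph_family[OF n])
    (use W U_sum S_pi[of LG] S_pi[of LH] S_LG S_LH proj_U proj_P u_U u_P in \<open>auto simp: P_U add.commute\<close>)

text \<open>Compression by \<open>S LG\<close> shifts the index of a tail by one, so equality of the
  first two propagates along the chain.\<close>

lemma U_const: assumes W: "U 0 = U 1" shows "U k = U 1"
proof (induction k)
  case (Suc k)
  have "(S LG)\<^sup>\<star> * (U j * S LG) = U (Suc j)" for j
    using mult_ext[OF S_LG, of "U (Suc j)"] by (simp add: U_G U_U')
  thus ?case using Suc W by (metis One_nat_def)
qed (rule W)

lemma left_sphere:
  assumes n: "1 \<le> n" and W: "U 0 = U 1" and P: "P = 0"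
  shows "graph_family (sphere_graph n) left_p left_s"
proof (rule sphere_graph_family[OF left_disc[OF n W]])
  have "S LH = 0" using S_pi'[of LH] S_LH P by simp
  thus "left_s (i, n + 1) = 0" if "i \<in> {1..n}" for i using P by simp
qed

text \<open>The vertex \<open>n + 1\<close> receives the stand-in for \<open>{w_2}\<close>, and the
  two edges leaving \<open>n\<close> are the adjoint of \<open>S LG\<close> cut by the projections
  of \<open>n\<close> and \<open>n + 1\<close>; they add up to the whole isometry.\<close>

abbreviation "right_p \<equiv> (\<lambda>v. if v < n then u v else if v = n then U 1 else U 0 - U 1)"
abbreviation "right_s \<equiv> (\<lambda>(i, j). if i < n then
    (if j < n then S (LE i j) else if j = n then S (LF i) * U 1 else S (LF i) * (U 0 - U 1))
  else if j = n then (S LG)\<^sup>\<star> * U 1 else (S LG)\<^sup>\<star> * (U 0 - U 1))"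

lemma S_LH_zero: "P = 0 \<Longrightarrow> S LH = 0"
  using S_pi'[of LH] S_LH by simp

lemma right_disc:
  assumes n: "1 \<le> n" and P: "P = 0"
  shows "graph_family (disc_graph n) right_p right_s"
proof (rule disc_graph_family[OF n])
  have GG: "S LG * (S LG)\<^sup>\<star> = U 0" using U_sum S_LH_zero[OF P] by simp
  note GG' = GG[THEN mult_ext]
  have UU: "U 1 * U 0 = U 1" "U 0 * U 1 = U 1" "U 1 * U 1 = U 1" "U 0 * U 0 = U 0" by (simp_all add: U_U')
  note UU' = UU[THEN mult_ext]
  have G0: "(S LG)\<^sup>\<star> * U 0 = (S LG)\<^sup>\<star>" using arg_cong[OF U0_G, of star] st by simp
  show "proj (U 1)" "proj (U 0 - U 1)" by (auto simp: proj_def st UU[unfolded One_nat_def] algebra_simps)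
  show "U 1 * (U 0 - U 1) = 0" "U 1 + (U 0 - U 1) = P + U 0" using P by (simp_all add: right_diff_distrib UU[unfolded One_nat_def])
  show "(S LG)\<^sup>\<star> * U 1 * ((S LG)\<^sup>\<star> * U 1)\<^sup>\<star> * ((S LG)\<^sup>\<star> * U 1) = (S LG)\<^sup>\<star> * U 1"
    "((S LG)\<^sup>\<star> * U 1)\<^sup>\<star> * ((S LG)\<^sup>\<star> * U 1) = U 1"
    by (simp_all only: star_mult star_star st mult.assoc UU UU' GG GG')
  show "((S LG)\<^sup>\<star> * (U 0 - U 1))\<^sup>\<star> * ((S LG)\<^sup>\<star> * (U 0 - U 1)) = U 0 - U 1"
    by (simp only: star_mult star_star star_diff st mult.assoc UU UU' GG GG' left_diff_distrib right_diff_distrib) simp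
  show "(S LG)\<^sup>\<star> * (U 0 - U 1) * ((S LG)\<^sup>\<star> * (U 0 - U 1))\<^sup>\<star> * ((S LG)\<^sup>\<star> * (U 0 - U 1)) = (S LG)\<^sup>\<star> * (U 0 - U 1)"
    by (simp only: star_mult star_star star_diff st mult.assoc UU UU' GG GG' left_diff_distrib right_diff_distrib) simp
  have "(S LG)\<^sup>\<star> * S LG = (S LG)\<^sup>\<star> * (U 1 + (U 0 - U 1)) * S LG" using G0 by simp
  also have "\<dots> = (S LG)\<^sup>\<star> * U 1 * ((S LG)\<^sup>\<star> * U 1)\<^sup>\<star> + (S LG)\<^sup>\<star> * (U 0 - U 1) * ((S LG)\<^sup>\<star> * (U 0 - U 1))\<^sup>\<star>"
    by (simp only: star_mult star_star star_diff st mult.assoc UU UU' left_diff_distrib right_diff_distrib distrib_left distrib_right) simp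
  finally show "U 1 = (S LG)\<^sup>\<star> * U 1 * ((S LG)\<^sup>\<star> * U 1)\<^sup>\<star> + (S LG)\<^sup>\<star> * (U 0 - U 1) * ((S LG)\<^sup>\<star> * (U 0 - U 1))\<^sup>\<star>"
    by (simp only: S_LG)
  show "u i * U 1 = 0 \<and> u i * (U 0 - U 1) = 0" if "i \<in> {1..n - 1}" for i
    using u_U[OF that] by (simp add: right_diff_distrib)
qed

end

section \<open>Relations modulo a C*-seminorm\<close>

context star_seminorm
begin

lemma proj_iff: "x \<in> FX \<Longrightarrow> proj (\<iota> x) \<longleftrightarrow> N (adj x - x) = 0 \<and> N (x * x - x) = 0"
  by (simp add: proj_def flip: \<iota>_adj \<iota>_mult) (simp add: \<iota>_eq_iff)

text \<open>This passes from equations in \<open>sq\<close> to vanishing relations, as the universal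
  property demands; \<open>graph_family_of_null\<close> goes the other way.\<close>

lemma graph_rels_null:
  assumes H: "wf_digraph H" and F: "\<And>g. g \<in> graph_gens H \<Longrightarrow> \<theta> g \<in> FX"
    and fam: "graph_family H (\<lambda>v. \<iota> (\<theta> (GProj v))) (\<lambda>e. \<iota> (\<theta> (GIso e)))"
    and r: "r \<in> graph_rels H"
  shows "N (poly_subst \<theta> r) = 0"
proof -
  interpret graph_family H "\<lambda>v. \<iota> (\<theta> (GProj v))" "\<lambda>e. \<iota> (\<theta> (GIso e))" by fact
  have P: "\<theta> (GProj v) \<in> FX" if "v \<in> verts H" for v using F that by simp
  have S: "\<theta> (GIso e) \<in> FX" if "e \<in> arcs H" for e using F that by simp
  have h: "head H e \<in> verts H" if "e \<in> arcs H" for e using wf_digraph.head_in_verts[OF H that] .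
  have "poly_subst \<theta> r \<in> FX \<and> \<iota> (poly_subst \<theta> r) = 0"
    using r[unfolded graph_rels_def]
  proof (elim UnE)
    assume "r \<in> {adj (gp v) - gp v |v. v \<in> verts H}"
    then obtain v where "r = adj (gp v) - gp v" "v \<in> verts H" by blast
    thus ?thesis using P p_proj[of v] by (simp add: \<iota>_simps proj_def)
  next
    assume "r \<in> {gp v * gp v - gp v |v. v \<in> verts H}"
    then obtain v where "r = gp v * gp v - gp v" "v \<in> verts H" by blast
    thus ?thesis using P p_proj[of v] by (simp add: \<iota>_simps proj_def)
  next
    assume "r \<in> {gp v * gp w |v w. v \<in> verts H \<and> w \<in> verts H \<and> v \<noteq> w}"
    then obtain v w where "r = gp v * gp w" "v \<in> verts H" "w \<in> verts H" "v \<noteq> w" by blast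
    thus ?thesis using P p_orth[of v w] by (simp add: \<iota>_simps)
  next
    assume "r \<in> {gs e * adj (gs e) * gs e - gs e |e. e \<in> arcs H}"
    then obtain e where "r = gs e * adj (gs e) * gs e - gs e" "e \<in> arcs H" by blast
    thus ?thesis using S s_pi[of e] by (simp add: \<iota>_simps)
  next
    assume "r \<in> {adj (gs e) * gs e - gp (head H e) |e. e \<in> arcs H}"
    then obtain e where "r = adj (gs e) * gs e - gp (head H e)" "e \<in> arcs H" by blast
    thus ?thesis using S P h s_head[of e] by (simp add: \<iota>_simps)
  next
    assume "r \<in> {gp v - (\<Sum>e\<in>out_arcs H v. gs e * adj (gs e)) |v. v \<in> verts H \<and> out_arcs H v \<noteq> {}}"
    then obtain v where v: "r = gp v - (\<Sum>e\<in>out_arcs H v. gs e * adj (gs e))" "v \<in> verts H"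
      "out_arcs H v \<noteq> {}" by blast
    have S': "\<theta> (GIso e) \<in> FX" if "e \<in> out_arcs H v" for e using that S by simp
    hence F': "\<theta> (GIso e) * adj (\<theta> (GIso e)) \<in> FX" if "e \<in> out_arcs H v" for e using that by simp
    have "\<iota> (\<Sum>e\<in>out_arcs H v. \<theta> (GIso e) * adj (\<theta> (GIso e))) =
        (\<Sum>e\<in>out_arcs H v. \<iota> (\<theta> (GIso e) * adj (\<theta> (GIso e))))"
      by (rule \<iota>_sum[OF F'])
    also have "\<dots> = \<iota> (\<theta> (GProj v))"
      unfolding p_sum[OF v(2,3)] using S' by (intro sum.cong) (simp_all add: \<iota>_simps)
    finally show ?thesis using v(1,2) P free_star_sum[of "out_arcs H v", OF F']
      by (simp add: \<iota>_diff poly_subst_sum)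
  qed
  thus ?thesis using \<iota>_eq_0_iff by blast
qed

end

lemma graph_family_of_null:
  assumes sn: "star_seminorm (graph_gens H) N" and H: "wf_digraph H"
    and null: "\<And>r. r \<in> graph_rels H \<Longrightarrow> N r = 0"
  shows "graph_family H (\<lambda>v. star_seminorm.\<iota> (graph_gens H) N (gp v)) (\<lambda>e. star_seminorm.\<iota> (graph_gens H) N (gs e))"
proof -
  interpret star_seminorm "graph_gens H" N by fact
  have h: "head H e \<in> verts H" if "e \<in> arcs H" for e using wf_digraph.head_in_verts[OF H that] .
  show ?thesis
  proof
    show "proj (\<iota> (gp v))" if "v \<in> verts H" for v
      using that null graph_relsI(1,2)[OF that] by (simp add: proj_iff)
    show "\<iota> (gp v) * \<iota> (gp w) = 0" if "v \<in> verts H" "w \<in> verts H" "v \<noteq> w" for v w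
      using that null[OF graph_relsI(3)[OF that]] by (simp add: \<iota>_eq_0_iff flip: \<iota>_mult)
    show "\<iota> (gs e) * (\<iota> (gs e))\<^sup>\<star> * \<iota> (gs e) = \<iota> (gs e)" if "e \<in> arcs H" for e
      using that null[OF graph_relsI(4)[OF that]] by (simp add: \<iota>_eq_iff flip: \<iota>_mult \<iota>_adj)
    show "(\<iota> (gs e))\<^sup>\<star> * \<iota> (gs e) = \<iota> (gp (head H e))" if "e \<in> arcs H" for e
      using that h[OF that] null[OF graph_relsI(5)[OF that]] by (simp add: \<iota>_eq_iff flip: \<iota>_mult \<iota>_adj)
    show "\<iota> (gp v) = (\<Sum>e\<in>out_arcs H v. \<iota> (gs e) * (\<iota> (gs e))\<^sup>\<star>)"
      if "v \<in> verts H" "out_arcs H v \<noteq> {}" for v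
    proof -
      have F: "gs e * adj (gs e) \<in> FX" if "e \<in> out_arcs H v" for e using that by (simp add: out_arcs_def)
      have "\<iota> (gp v) = \<iota> (\<Sum>e\<in>out_arcs H v. gs e * adj (gs e))"
        using that null[OF graph_relsI(6)[OF that]] free_star_sum[of "out_arcs H v", OF F]
        by (subst \<iota>_eq_iff) auto
      also have "\<dots> = (\<Sum>e\<in>out_arcs H v. \<iota> (gs e * adj (gs e)))" using F by (rule \<iota>_sum)
      also have "\<dots> = (\<Sum>e\<in>out_arcs H v. \<iota> (gs e) * (\<iota> (gs e))\<^sup>\<star>)"
        by (intro sum.cong) (auto simp: \<iota>_simps out_arcs_def)
      finally show ?thesis .
    qed
  qed
qed

section \<open>The relations of the labelled space as polynomials\<close>

abbreviation "mgens n \<equiv> labelled_gens (mirror_graph n) mirror_label (mirror_sets n)"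
abbreviation "mrels n \<equiv> labelled_rels (mirror_graph n) mirror_label (mirror_sets n)"
abbreviation "mrange n A a \<equiv> rel_range (mirror_graph n) mirror_label A [a]"

lemma mgens_iff [simp]: "LProj A \<in> mgens n \<longleftrightarrow> A \<in> mirror_sets n" "LIso a \<in> mgens n \<longleftrightarrow> a \<in> mlabels n"
  by (auto simp: labelled_gens_def image_image simp flip: mlabels_eq)

lemma mirror_sets_closed:
  "A \<in> mirror_sets n \<Longrightarrow> a \<in> mlabels n \<Longrightarrow> mrange n A a \<in> mirror_sets n"
  "a \<in> mlabels n \<Longrightarrow> path_range (mirror_graph n) mirror_label [a] \<in> mirror_sets n"
  using mirror_range_closed mirror_sets_all by (auto simp: path_range_def mlabels_eq)

lemma emitted_mirror: "emitted_labels (mirror_graph n) mirror_label A = {a \<in> mlabels n. mrange n A a \<noteq> {}}"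
  unfolding emitted_labels_def mlabels_eq path_source_def rel_range_def by blast

lemma mrels_cases:
  assumes "r \<in> mrels n"
  obtains A where "r = adj (lp A) - lp A" "A \<in> mirror_sets n"
  | A where "r = lp A * lp A - lp A" "A \<in> mirror_sets n"
  | a where "r = ls a * adj (ls a) * ls a - ls a" "a \<in> mlabels n"
  | A B where "r = lp A * lp B - lp (A \<inter> B)" "A \<in> mirror_sets n" "B \<in> mirror_sets n"
  | A B where "r = lp (A \<union> B) - (lp A + lp B - lp (A \<inter> B))" "A \<in> mirror_sets n" "B \<in> mirror_sets n"
  | "r = lp {}"
  | A a where "r = lp A * ls a - ls a * lp (mrange n A a)" "A \<in> mirror_sets n" "a \<in> mlabels n"
  | a where "r = adj (ls a) * ls a - lp (path_range (mirror_graph n) mirror_label [a])" "a \<in> mlabels n"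
  | a b where "r = adj (ls a) * ls b" "a \<in> mlabels n" "b \<in> mlabels n" "a \<noteq> b"
  | A where "r = lp A - ((\<Sum>a\<in>emitted_labels (mirror_graph n) mirror_label A. ls a * lp (mrange n A a) * adj (ls a)) +
      (\<Sum>v\<in>{v \<in> A. is_sink (mirror_graph n) v}. lp {v}))" "A \<in> mirror_sets n"
      "emitted_labels (mirror_graph n) mirror_label A \<noteq> {}"
  using assms[unfolded labelled_rels_def mlabels_eq]
  by (elim UnE) blast+

lemma mrels:
  shows "A \<in> mirror_sets n \<Longrightarrow> adj (lp A) - lp A \<in> mrels n"
    and "A \<in> mirror_sets n \<Longrightarrow> lp A * lp A - lp A \<in> mrels n"
    and "a \<in> mlabels n \<Longrightarrow> ls a * adj (ls a) * ls a - ls a \<in> mrels n"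
    and "A \<in> mirror_sets n \<Longrightarrow> B \<in> mirror_sets n \<Longrightarrow> lp A * lp B - lp (A \<inter> B) \<in> mrels n"
    and "A \<in> mirror_sets n \<Longrightarrow> B \<in> mirror_sets n \<Longrightarrow> lp (A \<union> B) - (lp A + lp B - lp (A \<inter> B)) \<in> mrels n"
    and "lp {} \<in> mrels n"
    and "A \<in> mirror_sets n \<Longrightarrow> a \<in> mlabels n \<Longrightarrow> lp A * ls a - ls a * lp (mrange n A a) \<in> mrels n"
    and "a \<in> mlabels n \<Longrightarrow> adj (ls a) * ls a - lp (path_range (mirror_graph n) mirror_label [a]) \<in> mrels n"
    and "a \<in> mlabels n \<Longrightarrow> b \<in> mlabels n \<Longrightarrow> a \<noteq> b \<Longrightarrow> adj (ls a) * ls b \<in> mrels n"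
    and "A \<in> mirror_sets n \<Longrightarrow> emitted_labels (mirror_graph n) mirror_label A \<noteq> {} \<Longrightarrow>
      lp A - ((\<Sum>a\<in>emitted_labels (mirror_graph n) mirror_label A. ls a * lp (mrange n A a) * adj (ls a)) +
      (\<Sum>v\<in>{v \<in> A. is_sink (mirror_graph n) v}. lp {v})) \<in> mrels n"
  unfolding labelled_rels_def mlabels_eq
  subgoal by (intro UnI1) blast
  subgoal by (rule UnI1, rule UnI1, rule UnI1, rule UnI1, rule UnI1, rule UnI1, rule UnI1, rule UnI1, rule UnI2, blast)
  subgoal by (rule UnI1, rule UnI1, rule UnI1, rule UnI1, rule UnI1, rule UnI1, rule UnI1, rule UnI2, blast)
  subgoal by (rule UnI1, rule UnI1, rule UnI1, rule UnI1, rule UnI1, rule UnI1, rule UnI2, blast)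
  subgoal by (rule UnI1, rule UnI1, rule UnI1, rule UnI1, rule UnI1, rule UnI2, blast)
  subgoal by (rule UnI1, rule UnI1, rule UnI1, rule UnI1, rule UnI2, blast)
  subgoal by (rule UnI1, rule UnI1, rule UnI1, rule UnI2, blast)
  subgoal by (rule UnI1, rule UnI1, rule UnI2, blast)
  subgoal by (rule UnI1, rule UnI2, blast)
  subgoal by (rule UnI2) (auto simp: emitted_mirror)
  done

lemma (in star_seminorm) mirror_rels_null:
  assumes F: "\<And>g. g \<in> mgens n \<Longrightarrow> \<theta> g \<in> FX" and fam: "mirror_family n u P U S"
    and th: "\<And>A. A \<in> mirror_sets n \<Longrightarrow> \<iota> (\<theta> (LProj A)) = mirror_proj n u P U A"
      "\<And>a. a \<in> mlabels n \<Longrightarrow> \<iota> (\<theta> (LIso a)) = S a"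
    and r: "r \<in> mrels n"
  shows "N (poly_subst \<theta> r) = 0"
proof -
  interpret mirror_family n u P U S by fact
  have LP: "\<theta> (LProj A) \<in> FX" if "A \<in> mirror_sets n" for A using F that by simp
  have LS: "\<theta> (LIso a) \<in> FX" if "a \<in> mlabels n" for a using F that by simp
  note sets = mirror_sets.intros(5,6) mirror_sets_closed mirror_sets_empty
  have "poly_subst \<theta> r \<in> FX \<and> \<iota> (poly_subst \<theta> r) = 0" using r
  proof (cases rule: mrels_cases)
    case (1 A) thus ?thesis using LP by (simp add: \<iota>_simps th proj_star)
  next
    case (2 A) thus ?thesis using LP by (simp add: \<iota>_simps th proj_Int)
  next
    case (3 a) thus ?thesis using LS by (simp add: \<iota>_simps th S_pi)
  next
    case (4 A B) thus ?thesis using LP sets by (simp add: \<iota>_simps th proj_Int)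
  next
    case (5 A B) thus ?thesis using LP sets by (simp add: \<iota>_simps th proj_Un)
  next
    case 6 thus ?thesis using LP sets by (simp add: th)
  next
    case (7 A a) thus ?thesis using LP LS sets by (simp add: \<iota>_simps th proj_S)
  next
    case (8 a) thus ?thesis using LP LS sets by (simp add: \<iota>_simps th S_range)
  next
    case (9 a b) thus ?thesis using LS by (simp add: \<iota>_simps th S_orth)
  next
    case (10 A)
    let ?E = "emitted_labels (mirror_graph n) mirror_label A"
    let ?Z = "{v \<in> A. is_sink (mirror_graph n) v}"
    have E: "\<And>a. a \<in> ?E \<Longrightarrow> a \<in> mlabels n" by (simp add: emitted_mirror)
    have Z: "\<And>v. v \<in> ?Z \<Longrightarrow> {v} \<in> mirror_sets n" by (auto simp: mirror_sink mirror_sets.intros)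
    have ps: "poly_subst \<theta> r = \<theta> (LProj A) - ((\<Sum>a\<in>?E. \<theta> (LIso a) * \<theta> (LProj (mrange n A a)) * adj (\<theta> (LIso a))) +
        (\<Sum>v\<in>?Z. \<theta> (LProj {v})))"
      using 10(1) by (simp add: poly_subst_sum)
    have F1: "\<theta> (LIso a) * \<theta> (LProj (mrange n A a)) * adj (\<theta> (LIso a)) \<in> FX" if "a \<in> ?E" for a
      using LP LS E[OF that] sets 10(2) by simp
    have F2: "\<theta> (LProj {v}) \<in> FX" if "v \<in> ?Z" for v using LP Z[OF that] by simp
    have S1: "\<iota> (\<Sum>a\<in>?E. \<theta> (LIso a) * \<theta> (LProj (mrange n A a)) * adj (\<theta> (LIso a))) =
        (\<Sum>a\<in>?E. S a * \<rho> (mrange n A a) * (S a)\<^sup>\<star>)"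
    proof -
      have "\<iota> (\<Sum>a\<in>?E. \<theta> (LIso a) * \<theta> (LProj (mrange n A a)) * adj (\<theta> (LIso a))) =
          (\<Sum>a\<in>?E. \<iota> (\<theta> (LIso a) * \<theta> (LProj (mrange n A a)) * adj (\<theta> (LIso a))))"
        by (rule \<iota>_sum[OF F1])
      thus ?thesis using LP LS E sets 10(2) by (simp add: \<iota>_simps th cong: sum.cong)
    qed
    have S2: "\<iota> (\<Sum>v\<in>?Z. \<theta> (LProj {v})) = (\<Sum>v\<in>?Z. \<rho> {v})"
    proof -
      have "\<iota> (\<Sum>v\<in>?Z. \<theta> (LProj {v})) = (\<Sum>v\<in>?Z. \<iota> (\<theta> (LProj {v})))" by (rule \<iota>_sum[OF F2])
      also have "\<dots> = (\<Sum>v\<in>?Z. \<rho> {v})" using th(1) Z by (intro sum.cong refl) blast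
      finally show ?thesis .
    qed
    show ?thesis unfolding ps
      using proj_sum[OF 10(2)] LP[OF 10(2)] free_star_sum[of ?E, OF F1] free_star_sum[of ?Z, OF F2]
      by (simp only: \<iota>_diff \<iota>_add S1 S2 th(1)[OF 10(2)] free_star_add free_star_diff) simp
  qed
  thus ?thesis using \<iota>_eq_0_iff by blast
qed

lemma mrange_tail:
  "mrange n (tail_set k) LG = tail_set (Suc k)" "mrange n (tail_set k) LH = {VW1}"
proof -
  have vt: "VV i \<in> tail_set k \<longleftrightarrow> 1 \<le> i \<and> k \<le> i" for i
    by (auto simp: tail_set_def vtail_def image_iff)
  have "(if i = 1 then VW2 else VV (i - 1)) \<in> tail_set k \<longleftrightarrow> Suc k \<le> i" if "1 \<le> i" for i
    using that by (auto simp: tail_set_def vtail_def image_iff)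
  hence "mrange n (tail_set k) LG = {VV i |i. 1 \<le> i \<and> Suc k \<le> i}"
    unfolding mirror_range_LG by blast
  also have "\<dots> = tail_set (Suc k)" by (force simp: tail_set_def vtail_def)
  finally show "mrange n (tail_set k) LG = tail_set (Suc k)" .
  have "1 \<le> Suc k \<and> VV (Suc k) \<in> tail_set k" by (simp add: vt)
  thus "mrange n (tail_set k) LH = {VW1}" unfolding mirror_range_LH by blast
qed

text \<open>This leads from the full list of relations to the short presentation. The summation
  relation is evaluated only at \<open>{VU i}\<close> and \<open>tail_set 0\<close>, which avoid the
  sink; the remaining projections are determined by induction over unions and intersections.\<close>

lemma mirror_family_of_null:
  assumes sn: "star_seminorm (mgens n) N" and null: "\<And>r. r \<in> mrels n \<Longrightarrow> N r = 0"
  defines "j \<equiv> star_seminorm.\<iota> (mgens n) N"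
  shows "mirror_family n (\<lambda>i. j (lp {VU i})) (j (lp {VW1})) (\<lambda>k. j (lp (tail_set k))) (\<lambda>a. j (ls a))" (is ?fam)
    and "A \<in> mirror_sets n \<Longrightarrow>
      j (lp A) = mirror_proj n (\<lambda>i. j (lp {VU i})) (j (lp {VW1})) (\<lambda>k. j (lp (tail_set k))) A"
proof -
  interpret star_seminorm "mgens n" N by fact
  note sets = mirror_sets.intros(5,6) mirror_sets_closed mirror_sets_empty tail_set_sets mirror_sets.intros(1,2)
  have Int: "\<iota> (lp A) * \<iota> (lp B) = \<iota> (lp (A \<inter> B))" if "A \<in> mirror_sets n" "B \<in> mirror_sets n" for A B
    using that null[OF mrels(4)[OF that]] sets by (simp add: \<iota>_eq_iff flip: \<iota>_mult)
  have Un: "\<iota> (lp (A \<union> B)) = \<iota> (lp A) + \<iota> (lp B) - \<iota> (lp (A \<inter> B))"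
    if "A \<in> mirror_sets n" "B \<in> mirror_sets n" for A B
    using that null[OF mrels(5)[OF that]] sets by (simp add: \<iota>_eq_iff flip: \<iota>_add \<iota>_diff)
  have empty: "\<iota> (lp {}) = 0" using null[OF mrels(6)] sets by (simp add: \<iota>_eq_0_iff)
  have pr: "proj (\<iota> (lp A))" if "A \<in> mirror_sets n" for A
    using that null[OF mrels(1)[OF that]] null[OF mrels(2)[OF that]] by (simp add: proj_iff)
  have pi: "\<iota> (ls a) * (\<iota> (ls a))\<^sup>\<star> * \<iota> (ls a) = \<iota> (ls a)" if "a \<in> mlabels n" for a
    using that null[OF mrels(3)[OF that]] by (simp add: \<iota>_eq_iff flip: \<iota>_mult \<iota>_adj)
  have range: "\<iota> (lp A) * \<iota> (ls a) = \<iota> (ls a) * \<iota> (lp (mrange n A a))"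
    if "A \<in> mirror_sets n" "a \<in> mlabels n" for A a
    using that null[OF mrels(7)[OF that]] sets by (simp add: \<iota>_eq_iff flip: \<iota>_mult)
  have init: "(\<iota> (ls a))\<^sup>\<star> * \<iota> (ls a) = \<iota> (lp (path_range (mirror_graph n) mirror_label [a]))"
    if "a \<in> mlabels n" for a
    using that null[OF mrels(8)[OF that]] sets by (simp add: \<iota>_eq_iff flip: \<iota>_mult \<iota>_adj)
  have orth: "(\<iota> (ls a))\<^sup>\<star> * \<iota> (ls b) = 0" if "a \<in> mlabels n" "b \<in> mlabels n" "a \<noteq> b" for a b
    using that null[OF mrels(9)[OF that]] by (simp add: \<iota>_eq_0_iff flip: \<iota>_mult \<iota>_adj)
  have total: "\<iota> (lp A) = (\<Sum>a\<in>E. \<iota> (ls a) * \<iota> (lp (mrange n A a)) * (\<iota> (ls a))\<^sup>\<star>)"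
    if A: "A \<in> mirror_sets n" "VW1 \<notin> A" and E: "emitted_labels (mirror_graph n) mirror_label A = E" "E \<noteq> {}" for A E
  proof -
    have Em: "a \<in> mlabels n" if "a \<in> E" for a using that E(1) by (auto simp: emitted_mirror)
    have Z: "{v \<in> A. is_sink (mirror_graph n) v} = {}" using A(2) by (auto simp: mirror_sink)
    have F: "ls a * lp (mrange n A a) * adj (ls a) \<in> FX" if "a \<in> E" for a
      using Em[OF that] A(1) sets by simp
    have "N (lp A - (\<Sum>a\<in>E. ls a * lp (mrange n A a) * adj (ls a))) = 0"
      using null[OF mrels(10)[OF A(1)]] E by (simp add: Z)
    hence "\<iota> (lp A) = \<iota> (\<Sum>a\<in>E. ls a * lp (mrange n A a) * adj (ls a))"
      using A(1) free_star_sum[of E, OF F] by (subst \<iota>_eq_iff) auto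
    also have "\<dots> = (\<Sum>a\<in>E. \<iota> (ls a * lp (mrange n A a) * adj (ls a)))" using F by (rule \<iota>_sum)
    also have "\<dots> = (\<Sum>a\<in>E. \<iota> (ls a) * \<iota> (lp (mrange n A a)) * (\<iota> (ls a))\<^sup>\<star>)"
      using Em A(1) sets by (intro sum.cong) (auto simp: \<iota>_simps)
    finally show ?thesis .
  qed
  have f: "\<iota> (lp ({VW1} \<union> tail_set 0)) = \<iota> (lp {VW1}) + \<iota> (lp (tail_set 0))"
  proof -
    have "{VW1} \<inter> tail_set 0 = {}" by auto
    thus ?thesis using Un[of "{VW1}" "tail_set 0"] sets empty by simp
  qed
  have rF: "mrange n A (LF i) = (if VU i \<in> A then {VW1} \<union> tail_set 0 else {})" if "1 \<le> i" "i \<le> n - 1" for A i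
    using that by (simp only: mirror_range_LF V_from_eq(2))
  have Pi: "path_range (mirror_graph n) mirror_label [LG] = tail_set 1"
    "path_range (mirror_graph n) mirror_label [LH] = {VW1}"
  proof -
    have "(if i = 1 then VW2 else VV (i - 1)) \<in> verts (mirror_graph n)" if "1 \<le> i" for i
      using that by (simp add: mirror_sel)
    hence "mrange n (verts (mirror_graph n)) LG = {VV i |i. 1 \<le> i}"
      unfolding mirror_range_LG by blast
    also have "\<dots> = tail_set 1" by (force simp: tail_set_def vtail_def)
    finally show "path_range (mirror_graph n) mirror_label [LG] = tail_set 1" by (simp add: path_range_def)
    have "1 \<le> Suc 0 \<and> VV (Suc 0) \<in> verts (mirror_graph n)" by (simp add: mirror_sel)
    hence "mrange n (verts (mirror_graph n)) LH = {VW1}" unfolding mirror_range_LH by blast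
    thus "path_range (mirror_graph n) mirror_label [LH] = {VW1}" by (simp add: path_range_def)
  qed
  have cut: "\<iota> (ls a) * \<iota> (lp (path_range (mirror_graph n) mirror_label [a])) = \<iota> (ls a)"
    if "a \<in> mlabels n" for a using pi[OF that] init[OF that] by (simp add: mult.assoc)
  have fam: "mirror_family n (\<lambda>i. \<iota> (lp {VU i})) (\<iota> (lp {VW1})) (\<lambda>k. \<iota> (lp (tail_set k))) (\<lambda>a. \<iota> (ls a))"
  proof
    show "proj (\<iota> (lp {VU i}))" if "i \<in> {1..n - 1}" for i using that sets by (intro pr) auto
    show "proj (\<iota> (lp {VW1}))" "proj (\<iota> (lp (tail_set k)))" for k using sets by (auto intro: pr)
    show "\<iota> (lp {VU i}) * \<iota> (lp {VU k}) = 0" if "i \<in> {1..n - 1}" "k \<in> {1..n - 1}" "i \<noteq> k" for i k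
      using that sets Int[of "{VU i}" "{VU k}"] empty by simp
    show "\<iota> (lp {VU i}) * \<iota> (lp {VW1}) = 0" "\<iota> (lp {VU i}) * \<iota> (lp (tail_set 0)) = 0" if "i \<in> {1..n - 1}" for i
      using that sets Int[of "{VU i}" "{VW1}"] Int[of "{VU i}" "tail_set 0"] empty by simp_all
    show "\<iota> (lp {VW1}) * \<iota> (lp (tail_set 0)) = 0"
      using sets Int[of "{VW1}" "tail_set 0"] empty by simp
    show "\<iota> (lp (tail_set i)) * \<iota> (lp (tail_set k)) = \<iota> (lp (tail_set k))" if "i \<le> k" for i k
    proof -
      have "tail_set i \<inter> tail_set k = tail_set k" using that by (auto simp: tail_set_def)
      thus ?thesis using Int[of "tail_set i" "tail_set k"] sets by simp
    qed
    show "\<iota> (ls a) * (\<iota> (ls a))\<^sup>\<star> * \<iota> (ls a) = \<iota> (ls a)" if "a \<in> mlabels n" for a by (rule pi[OF that])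
    show "(\<iota> (ls (LE i k)))\<^sup>\<star> * \<iota> (ls (LE i k)) = \<iota> (lp {VU k})" if "1 \<le> i" "i \<le> k" "k \<le> n - 1" for i k
    proof -
      have "VU i \<in> verts (mirror_graph n)" using that by (auto simp: verts_mirror)
      thus ?thesis using that init[of "LE i k"] by (simp add: path_range_def mirror_range_LE)
    qed
    show "(\<iota> (ls (LF i)))\<^sup>\<star> * \<iota> (ls (LF i)) = \<iota> (lp {VW1}) + \<iota> (lp (tail_set 0))" if "1 \<le> i" "i \<le> n - 1" for i
    proof -
      have "VU i \<in> verts (mirror_graph n)" using that by (auto simp: verts_mirror)
      thus ?thesis using that init[of "LF i"] f by (simp only: path_range_def rF if_True) simp
    qed
    show "(\<iota> (ls LG))\<^sup>\<star> * \<iota> (ls LG) = \<iota> (lp (tail_set 1))" "(\<iota> (ls LH))\<^sup>\<star> * \<iota> (ls LH) = \<iota> (lp {VW1})"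
      using init[of LG] init[of LH] Pi by simp_all
    show "(\<iota> (ls a))\<^sup>\<star> * \<iota> (ls b) = 0" if "a \<in> mlabels n" "b \<in> mlabels n" "a \<noteq> b" for a b
      by (rule orth[OF that])
    show "\<iota> (lp (tail_set k)) * \<iota> (ls LG) = \<iota> (ls LG) * \<iota> (lp (tail_set (Suc k)))" for k
      using range[of "tail_set k" LG] sets by (simp add: mrange_tail)
    show "\<iota> (lp (tail_set k)) * \<iota> (ls LH) = \<iota> (ls LH)" for k
      using range[of "tail_set k" LH] sets cut[of LH] by (simp add: mrange_tail Pi)
    show "\<iota> (lp (tail_set 0)) = \<iota> (ls LG) * (\<iota> (ls LG))\<^sup>\<star> + \<iota> (ls LH) * (\<iota> (ls LH))\<^sup>\<star>"
    proof -
      have "mrange n (tail_set 0) a = {}" if "a \<in> ulabels n" for a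
        using that by (cases a) (auto simp: mirror_range_LE rF)
      moreover have "tail_set k \<noteq> {}" for k by (auto simp: tail_set_def)
      ultimately have "emitted_labels (mirror_graph n) mirror_label (tail_set 0) = {LG, LH}"
        by (auto simp: emitted_mirror mlabels_def mrange_tail)
      from total[OF tail_set_sets _ this] show ?thesis
        using cut[of LG] cut[of LH] by (simp add: mrange_tail Pi)
    qed
    show "\<iota> (lp {VU i}) = (\<Sum>k\<in>{i..n - 1}. \<iota> (ls (LE i k)) * (\<iota> (ls (LE i k)))\<^sup>\<star>) +
        \<iota> (ls (LF i)) * (\<iota> (ls (LF i)))\<^sup>\<star>" if i: "i \<in> {1..n - 1}" for i
    proof -
      have E: "emitted_labels (mirror_graph n) mirror_label {VU i} = insert (LF i) (LE i ` {i..n - 1})"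
      proof (intro set_eqI)
        show "a \<in> emitted_labels (mirror_graph n) mirror_label {VU i} \<longleftrightarrow> a \<in> insert (LF i) (LE i ` {i..n - 1})" for a
          using i by (cases a) (auto simp: emitted_mirror mirror_range_LE rF mirror_range_LG mirror_range_LH split: if_splits)
      qed
      have r1: "\<iota> (ls (LF i)) * \<iota> (lp (mrange n {VU i} (LF i))) * (\<iota> (ls (LF i)))\<^sup>\<star> = \<iota> (ls (LF i)) * (\<iota> (ls (LF i)))\<^sup>\<star>"
      proof -
        have "path_range (mirror_graph n) mirror_label [LF i] = mrange n {VU i} (LF i)"
          using i by (simp add: path_range_def rF verts_mirror del: Un_insert_left)
        thus ?thesis using cut[of "LF i"] i by simp
      qed
      have r2: "\<iota> (ls (LE i k)) * \<iota> (lp (mrange n {VU i} (LE i k))) * (\<iota> (ls (LE i k)))\<^sup>\<star> = \<iota> (ls (LE i k)) * (\<iota> (ls (LE i k)))\<^sup>\<star>"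
        if k: "k \<in> {i..n - 1}" for k
      proof -
        have "path_range (mirror_graph n) mirror_label [LE i k] = mrange n {VU i} (LE i k)"
          using i k by (auto simp: path_range_def mirror_range_LE verts_mirror)
        thus ?thesis using cut[of "LE i k"] i k by simp
      qed
      have "\<iota> (lp {VU i}) = (\<Sum>a\<in>insert (LF i) (LE i ` {i..n - 1}).
          \<iota> (ls a) * \<iota> (lp (mrange n {VU i} a)) * (\<iota> (ls a))\<^sup>\<star>)"
        using total[OF _ _ E] i sets by simp
      also have "\<dots> = (\<Sum>a\<in>insert (LF i) (LE i ` {i..n - 1}). \<iota> (ls a) * (\<iota> (ls a))\<^sup>\<star>)"
        using r1 r2 by (intro sum.cong) auto
      also have "\<dots> = \<iota> (ls (LF i)) * (\<iota> (ls (LF i)))\<^sup>\<star> + (\<Sum>k\<in>{i..n - 1}. \<iota> (ls (LE i k)) * (\<iota> (ls (LE i k)))\<^sup>\<star>)"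
      proof -
        have "LF i \<notin> LE i ` {i..n - 1}" by auto
        thus ?thesis by (simp add: sum.reindex inj_on_def)
      qed
      finally show ?thesis by (simp add: add.commute)
    qed
  qed
  thus ?fam by (simp only: j_def)
  interpret M: mirror_family n "\<lambda>i. \<iota> (lp {VU i})" "\<iota> (lp {VW1})" "\<lambda>k. \<iota> (lp (tail_set k))" "\<lambda>a. \<iota> (ls a)"
    by (rule fam)
  show "j (lp A) = mirror_proj n (\<lambda>i. j (lp {VU i})) (j (lp {VW1})) (\<lambda>k. j (lp (tail_set k))) A"
    if "A \<in> mirror_sets n"
    unfolding j_def using that
  proof induction
    case (3 i) thus ?case by (simp add: V_from_eq(1))
  next
    case 4 show ?case unfolding V_from_eq(2) by simp
  next
    case (5 A B)
    thus ?case using Un[of A B] Int[of A B] by (simp add: M.proj_Un M.proj_Int[symmetric])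
  next
    case (6 A B)
    thus ?case using Int[of A B] by (simp add: M.proj_Int[symmetric])
  qed simp_all
qed

text \<open>The quotient seminorm pulled back along \<open>r\<close> is admissible for
  \<open>Q\<close>, hence bounded by the universal norm; \<open>r\<close> after \<open>t\<close> is
  the identity modulo the ideal. So the map induced by \<open>t\<close> has its kernel inside the
  ideal.\<close>

lemma (in approx_unit) quot_norm_bound:
  assumes YQ: "univ_rels Y Q" and r: "\<And>g. g \<in> Y \<Longrightarrow> r g \<in> FX"
    and null: "\<And>z. z \<in> Q \<Longrightarrow> quot_norm (poly_subst r z) = 0"
    and t: "\<And>g. g \<in> X \<Longrightarrow> t g \<in> free_star Y"
    and inv: "\<And>g. g \<in> X \<Longrightarrow> quot.\<iota> (poly_subst r (t g)) = quot.\<iota> (gen g)"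
    and x: "x \<in> FX"
  shows "quot_norm x \<le> univ_norm Y Q (poly_subst t x)"
proof -
  interpret Y: univ_rels Y Q by fact
  have rF: "poly_subst r y \<in> FX" if "y \<in> free_star Y" for y using r that by (rule poly_subst_free)
  have tF: "poly_subst t y \<in> free_star Y" if "y \<in> FX" for y using t that by (rule poly_subst_free)
  have "cstar_seminorm Y (\<lambda>y. quot_norm (poly_subst r y))"
    using quot.nonneg quot.triangle quot.N_scale quot.N_mult quot.N_cstar
    by (simp add: cstar_seminorm_def rF)
  hence "quot_norm (poly_subst r (poly_subst t x)) \<le> univ_norm Y Q (poly_subst t x)"
    using null by (intro Y.admissible_le tF x) (simp add: admissible_def)
  moreover have "quot.\<iota> (poly_subst r (poly_subst t x)) = quot.\<iota> x" using x
  proof (induction x rule: free_star_induct)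
    case (scale c x)
    thus ?case using quot.\<iota>_scale_cong[of "poly_subst r (poly_subst t x)" x c] rF tF by simp
  qed (use rF tF inv in \<open>auto simp: quot.\<iota>_simps\<close>)
  ultimately show ?thesis using quot.N_cong[of "poly_subst r (poly_subst t x)" x] x rF tF by simp
qed

section \<open>The two projections onto the quantum disc\<close>

primrec disc_corner :: "nat \<Rightarrow> nat \<Rightarrow> (nat, nat \<times> nat) ggen star_poly" where
  "disc_corner n 0 = gp n + gp (n + 1)"
| "disc_corner n (Suc k) = (gs (n, n) + gs (n, n + 1)) * disc_corner n k * adj (gs (n, n) + gs (n, n + 1))"

definition left_subst :: "nat \<Rightarrow> (vert, label) lgen \<Rightarrow> (nat, nat \<times> nat) ggen star_poly" where
  "left_subst n g = (case g of LProj A \<Rightarrow> mirror_proj n gp (gp (n + 1)) (\<lambda>_. gp n) A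
     | LIso a \<Rightarrow> mirror_iso (\<lambda>i j. gs (i, j)) (\<lambda>i. gs (i, n) + gs (i, n + 1)) (gs (n, n)) (gs (n, n + 1)) a)"

text \<open>\<open>S_{n,n} + S_{n,n+1}\<close> is an isometry \<open>T\<close> of the corner at \<open>n\<close> and \<open>n + 1\<close>, and
  \<open>disc_corner n k\<close> is \<open>T\<^sup>k (T\<^sup>*)\<^sup>k\<close>.\<close>

definition right_subst :: "nat \<Rightarrow> (vert, label) lgen \<Rightarrow> (nat, nat \<times> nat) ggen star_poly" where
  "right_subst n g = (case g of LProj A \<Rightarrow> mirror_proj n gp 0 (disc_corner n) A
     | LIso a \<Rightarrow> mirror_iso (\<lambda>i j. gs (i, j)) (\<lambda>i. gs (i, n) + gs (i, n + 1))
         (adj (gs (n, n) + gs (n, n + 1))) 0 a)"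

text \<open>The candidate inverse of \<open>left_subst\<close>; restricted to the generators of the
  sphere it also serves for the quotient by both ideals.\<close>

definition left_back :: "nat \<Rightarrow> (nat, nat \<times> nat) ggen \<Rightarrow> (vert, label) lgen star_poly" where
  "left_back n g = (case g of
     GProj v \<Rightarrow> if v < n then lp {VU v} else if v = n then lp (tail_set 1) else lp {VW1}
   | GIso (i, j) \<Rightarrow> if i < n then
        (if j < n then ls (LE i j) else if j = n then ls (LF i) * lp (tail_set 1) else ls (LF i) * lp {VW1})
      else if j = n then ls LG else ls LH)"

definition right_back :: "nat \<Rightarrow> (nat, nat \<times> nat) ggen \<Rightarrow> (vert, label) lgen star_poly" where
  "right_back n g = (case g of
     GProj v \<Rightarrow> if v < n then lp {VU v} else if v = n then lp (tail_set 1) else lp (tail_set 0) - lp (tail_set 1)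
   | GIso (i, j) \<Rightarrow> if i < n then
        (if j < n then ls (LE i j) else if j = n then ls (LF i) * lp (tail_set 1)
         else ls (LF i) * (lp (tail_set 0) - lp (tail_set 1)))
      else if j = n then adj (ls LG) * lp (tail_set 1) else adj (ls LG) * (lp (tail_set 0) - lp (tail_set 1)))"

text \<open>The polynomial counterpart of the quotient map, as \<open>flip_subst\<close> is that of
  the flip.\<close>

definition sphere_subst :: "nat \<Rightarrow> (nat, nat \<times> nat) ggen \<Rightarrow> (nat, nat \<times> nat) ggen star_poly" where
  "sphere_subst n g = (case g of GProj v \<Rightarrow> if v \<le> n then gp v else 0
     | GIso e \<Rightarrow> if snd e \<le> n then gs e else 0)"

definition flip_subst :: "nat \<Rightarrow> (nat, nat \<times> nat) ggen \<Rightarrow> (nat, nat \<times> nat) ggen star_poly" where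
  "flip_subst n g = (if g = GIso (n, n) then adj (gen g) else gen g)"

lemma mirror_proj_cong:
  assumes "\<And>i. 1 \<le> i \<Longrightarrow> i < n \<Longrightarrow> u i = u' i" "P = P'" "\<And>k. U k = U' k"
  shows "mirror_proj n u P U A = mirror_proj n u' P' U' A"
proof -
  have "sum u {i. i \<in> {1..n - 1} \<and> VU i \<in> A} = sum u' {i. i \<in> {1..n - 1} \<and> VU i \<in> A}"
    using assms(1) by (intro sum.cong) auto
  moreover have "U = U'" using assms(3) by auto
  ultimately show ?thesis using assms(2) by (simp only: mirror_proj_def)
qed

lemma poly_subst_mirror_proj:
  "poly_subst \<theta> (mirror_proj n u P U A) =
    mirror_proj n (\<lambda>i. poly_subst \<theta> (u i)) (poly_subst \<theta> P) (\<lambda>k. poly_subst \<theta> (U k)) A"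
  by (rule mirror_proj_hom(2)[where C = UNIV]) auto

lemma (in star_seminorm)
  assumes "\<And>i. 1 \<le> i \<Longrightarrow> i < n \<Longrightarrow> u i \<in> FX" "P \<in> FX" "\<And>k. U k \<in> FX"
  shows mirror_proj_free: "mirror_proj n u P U A \<in> FX"
    and \<iota>_mirror_proj: "\<iota> (mirror_proj n u P U A) = mirror_proj n (\<lambda>i. \<iota> (u i)) (\<iota> P) (\<lambda>k. \<iota> (U k)) A"
proof -
  have u: "u i \<in> FX" if "i \<in> {1..n - 1}" for i using assms(1)[of i] that by auto
  show "mirror_proj n u P U A \<in> FX"
    by (rule mirror_proj_hom(1)[where h = \<iota>]) (use assms u in \<open>auto simp: \<iota>_add\<close>)
  show "\<iota> (mirror_proj n u P U A) = mirror_proj n (\<lambda>i. \<iota> (u i)) (\<iota> P) (\<lambda>k. \<iota> (U k)) A"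
    by (rule mirror_proj_hom(2)[where C = FX]) (use assms u in \<open>auto simp: \<iota>_add\<close>)
qed

lemma graph_family_cong:
  assumes "graph_family H p s" "wf_digraph H"
    and eq: "\<And>v. v \<in> verts H \<Longrightarrow> p' v = p v" "\<And>e. e \<in> arcs H \<Longrightarrow> s' e = s e"
  shows "graph_family H p' s'"
proof -
  interpret graph_family H p s by fact
  have h: "head H e \<in> verts H" if "e \<in> arcs H" for e using wf_digraph.head_in_verts[OF assms(2) that] .
  show ?thesis
  proof
    show "p' v = (\<Sum>e\<in>out_arcs H v. s' e * (s' e)\<^sup>\<star>)" if "v \<in> verts H" "out_arcs H v \<noteq> {}" for v
      unfolding eq(1)[OF that(1)] p_sum[OF that] using eq(2) by (intro sum.cong) auto
  qed (use p_proj p_orth s_pi s_head eq h in auto)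
qed

lemma (in star_seminorm)
  assumes S: "\<And>a. a \<in> L \<Longrightarrow> S a \<in> FX" and B: "\<And>k. B k \<in> FX"
  shows tower_free: "tower adj S L B k \<in> FX"
    and \<iota>_tower: "\<iota> (tower adj S L B k) = tower star (\<lambda>a. \<iota> (S a)) L (\<lambda>k. \<iota> (B k)) k"
proof (induction k)
  case (Suc k)
  have F: "S a * tower adj S L B k * adj (S a) \<in> FX" if "a \<in> L" for a using S[OF that] Suc(1) by simp
  have sF: "(\<Sum>a\<in>L. S a * tower adj S L B k * adj (S a)) \<in> FX" using F by (rule free_star_sum)
  show "tower adj S L B (Suc k) \<in> FX" using sF B by simp
  have "\<iota> (\<Sum>a\<in>L. S a * tower adj S L B k * adj (S a)) = (\<Sum>a\<in>L. \<iota> (S a * tower adj S L B k * adj (S a)))"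
    by (rule \<iota>_sum[OF F])
  also have "\<dots> = (\<Sum>a\<in>L. \<iota> (S a) * tower star (\<lambda>a. \<iota> (S a)) L (\<lambda>k. \<iota> (B k)) k * (\<iota> (S a))\<^sup>\<star>)"
    using S Suc by (intro sum.cong) (simp_all add: \<iota>_simps)
  finally show "\<iota> (tower adj S L B (Suc k)) = tower star (\<lambda>a. \<iota> (S a)) L (\<lambda>k. \<iota> (B k)) (Suc k)"
    using sF B by (simp add: \<iota>_add)
qed simp_all

section \<open>The substitutions into the disc respect the relations\<close>

locale mirror_setting =
  fixes n :: nat
  assumes n: "1 \<le> n"
begin

sublocale L: univ_rels "mgens n" "mrels n"
  by (rule mirror_univ_rels)

sublocale D: univ_rels "graph_gens (disc_graph n)" "graph_rels (disc_graph n)"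
  by (rule graph_univ_rels[OF wf_disc])

sublocale S: univ_rels "graph_gens (sphere_graph n)" "graph_rels (sphere_graph n)"
  by (rule graph_univ_rels[OF wf_sphere])

lemma mlabels_n:
  "LE i j \<in> mlabels n \<longleftrightarrow> 1 \<le> i \<and> i \<le> j \<and> j < n" "LF i \<in> mlabels n \<longleftrightarrow> 1 \<le> i \<and> i < n"
    "LG \<in> mlabels n" "LH \<in> mlabels n"
  using n by auto

lemma disc_gens:
  "gp v \<in> D.FX \<longleftrightarrow> 1 \<le> v \<and> v \<le> n + 1"
  "gs (i, j) \<in> D.FX \<longleftrightarrow> 1 \<le> i \<and> i \<le> n \<and> i \<le> j \<and> j \<le> n + 1"
  by (auto simp: disc_sel)

lemma sphere_gens:
  "gp v \<in> S.FX \<longleftrightarrow> 1 \<le> v \<and> v \<le> n" "gs (i, j) \<in> S.FX \<longleftrightarrow> 1 \<le> i \<and> i \<le> j \<and> j \<le> n"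
  by (auto simp: sphere_sel)

lemma mirror_gens:
  "lp A \<in> L.FX \<longleftrightarrow> A \<in> mirror_sets n" "ls a \<in> L.FX \<longleftrightarrow> a \<in> mlabels n"
  by simp_all

text \<open>Only orthogonality needs an argument: the range projections of the edges at
  \<open>i\<close> add up to the projection of \<open>i\<close>, so they are mutually orthogonal,
  and multiplying their product by the adjoint of one edge on the left and by the other edge on the
  right isolates the product asked for.\<close>

sublocale DF: disc_family n "\<lambda>v. D.\<iota> (gp v)" "\<lambda>e. D.\<iota> (gs e)"
proof -
  interpret G: graph_family "disc_graph n" "\<lambda>v. D.\<iota> (gp v)" "\<lambda>e. D.\<iota> (gs e)"
    by (rule graph_family_of_null[OF D.star_seminorm_axioms wf_disc D.univ_norm_R])
  show "disc_family n (\<lambda>v. D.\<iota> (gp v)) (\<lambda>e. D.\<iota> (gs e))"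
  proof
    fix i j k assume i: "i \<in> {1..n}" and jk: "j \<in> {i..n + 1}" "k \<in> {i..n + 1}" "j \<noteq> k"
    let ?s = "\<lambda>j. gs (i, j)"
    have F: "?s l \<in> D.FX" "(i, l) \<in> arcs (disc_graph n)" if "l \<in> {i..n + 1}" for l
      using that i by (auto simp: disc_sel)
    have pr: "proj (D.\<iota> (?s l * adj (?s l)))" if "l \<in> {i..n + 1}" for l
      using F[OF that] G.s_pi[OF F(2)[OF that]] by (simp add: D.\<iota>_simps proj_def flip: mult.assoc)
    have i': "i \<in> verts (disc_graph n)" "out_arcs (disc_graph n) i \<noteq> {}"
      using i by (auto simp: disc_sel out_arcs_disc)
    have "(\<Sum>l\<in>{i..n + 1}. D.\<iota> (?s l * adj (?s l))) = (\<Sum>l\<in>{i..n + 1}. D.\<iota> (?s l) * (D.\<iota> (?s l))\<^sup>\<star>)"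
      using F by (intro sum.cong refl) (simp add: D.\<iota>_simps)
    also have "\<dots> = D.\<iota> (gp i)"
      using graph_family.p_sum[OF G.graph_family_axioms i'] i by (simp add: out_arcs_disc sum.reindex inj_on_def)
    finally have sum: "(\<Sum>l\<in>{i..n + 1}. D.\<iota> (?s l * adj (?s l))) = D.\<iota> (gp i)" .
    have "D.\<iota> (?s j * adj (?s j)) * D.\<iota> (?s k * adj (?s k)) = 0"
      by (rule D.sum_proj_orthogonal[OF _ _ _ pr G.p_proj[OF i'(1)] sum])
        (use F i jk in \<open>auto simp: disc_sel\<close>)
    hence z: "D.\<iota> (?s j) * ((D.\<iota> (?s j))\<^sup>\<star> * D.\<iota> (?s k)) * (D.\<iota> (?s k))\<^sup>\<star> = 0"
      using F jk by (simp add: D.\<iota>_simps mult.assoc)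
    have "(D.\<iota> (?s j))\<^sup>\<star> * D.\<iota> (?s j) * (D.\<iota> (?s j))\<^sup>\<star> = (D.\<iota> (?s j))\<^sup>\<star>"
      using arg_cong[OF G.s_pi[OF F(2)[OF jk(1)]], of star] by (simp add: mult.assoc)
    hence "(D.\<iota> (?s j))\<^sup>\<star> * D.\<iota> (?s k) =
        (D.\<iota> (?s j))\<^sup>\<star> * D.\<iota> (?s j) * (D.\<iota> (?s j))\<^sup>\<star> * (D.\<iota> (?s k) * (D.\<iota> (?s k))\<^sup>\<star> * D.\<iota> (?s k))"
      using G.s_pi[OF F(2)[OF jk(2)]] by simp
    also have "\<dots> = (D.\<iota> (?s j))\<^sup>\<star> * (D.\<iota> (?s j) * ((D.\<iota> (?s j))\<^sup>\<star> * D.\<iota> (?s k)) * (D.\<iota> (?s k))\<^sup>\<star>) * D.\<iota> (?s k)"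
      by (simp only: mult.assoc)
    finally show "(D.\<iota> (?s j))\<^sup>\<star> * D.\<iota> (?s k) = 0" by (simp only: z) simp
  qed (rule n)
qed

lemma disc_corner_free: "disc_corner n k \<in> D.FX"
  using n by (induction k) (simp_all add: disc_gens del: free_star_gen)

lemma \<iota>_disc_corner: "D.\<iota> (disc_corner n k) = DF.U2 k"
  using n disc_corner_free
  by (induction k) (simp_all add: disc_gens D.\<iota>_simps DF.t_def del: free_star_gen)

lemma left_subst_free: "g \<in> mgens n \<Longrightarrow> left_subst n g \<in> D.FX"
  and right_subst_free: "g \<in> mgens n \<Longrightarrow> right_subst n g \<in> D.FX"
proof -
  assume g: "g \<in> mgens n"
  show "left_subst n g \<in> D.FX"
  proof (cases g)
    case (LProj A)
    thus ?thesis using n by (auto simp: left_subst_def disc_gens simp del: free_star_gen intro!: D.mirror_proj_free)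
  next
    case (LIso a)
    hence "a \<in> mlabels n" using g by simp
    thus ?thesis using n LIso by (cases a) (auto simp: mlabels_n left_subst_def disc_gens simp del: free_star_gen mlabels_iff)
  qed
  show "right_subst n g \<in> D.FX"
  proof (cases g)
    case (LProj A)
    thus ?thesis using n
      by (auto simp: right_subst_def disc_gens disc_corner_free simp del: free_star_gen intro!: D.mirror_proj_free)
  next
    case (LIso a)
    hence "a \<in> mlabels n" using g by simp
    thus ?thesis using n LIso by (cases a) (auto simp: mlabels_n right_subst_def disc_gens simp del: free_star_gen mlabels_iff)
  qed
qed

lemma left_rels: "r \<in> mrels n \<Longrightarrow> univ_norm (graph_gens (disc_graph n)) (graph_rels (disc_graph n)) (poly_subst (left_subst n) r) = 0"
proof (rule D.mirror_rels_null[OF left_subst_free DF.mirror_family_left])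
  show "D.\<iota> (left_subst n (LProj A)) = mirror_proj n (\<lambda>v. D.\<iota> (gp v)) (D.\<iota> (gp (n + 1))) (\<lambda>_. D.\<iota> (gp n)) A" for A
    unfolding left_subst_def lgen.case
    by (rule D.\<iota>_mirror_proj) (use n in \<open>auto simp: disc_gens simp del: free_star_gen\<close>)
  show "D.\<iota> (left_subst n (LIso a)) = mirror_iso (\<lambda>i j. D.\<iota> (gs (i, j))) DF.f (D.\<iota> (gs (n, n))) (D.\<iota> (gs (n, n + 1))) a"
    if "a \<in> mlabels n" for a
    using that n by (cases a) (auto simp: mlabels_n left_subst_def disc_gens D.\<iota>_simps simp del: free_star_gen mlabels_iff)
qed

lemma right_rels: "r \<in> mrels n \<Longrightarrow> univ_norm (graph_gens (disc_graph n)) (graph_rels (disc_graph n)) (poly_subst (right_subst n) r) = 0"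
proof (rule D.mirror_rels_null[OF right_subst_free DF.mirror_family_right])
  show "D.\<iota> (right_subst n (LProj A)) = mirror_proj n (\<lambda>v. D.\<iota> (gp v)) 0 DF.U2 A" for A
    using D.\<iota>_mirror_proj[of n gp 0 "disc_corner n" A] n
    by (simp add: right_subst_def disc_gens disc_corner_free \<iota>_disc_corner del: free_star_gen)
  show "D.\<iota> (right_subst n (LIso a)) = mirror_iso (\<lambda>i j. D.\<iota> (gs (i, j))) DF.f (DF.t\<^sup>\<star>) 0 a"
    if "a \<in> mlabels n" for a
    using that n by (cases a) (auto simp: mlabels_n right_subst_def DF.t_def disc_gens D.\<iota>_simps simp del: free_star_gen mlabels_iff)
qed

section \<open>The two ideals of the labelled space\<close>

sublocale LM: mirror_family n "\<lambda>i. L.\<iota> (lp {VU i})" "L.\<iota> (lp {VW1})" "\<lambda>k. L.\<iota> (lp (tail_set k))" "\<lambda>a. L.\<iota> (ls a)"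
  by (rule mirror_family_of_null[OF L.star_seminorm_axioms L.univ_norm_R])

lemma L_\<iota>_lp: "A \<in> mirror_sets n \<Longrightarrow> L.\<iota> (lp A) = LM.\<rho> A"
  by (rule mirror_family_of_null[OF L.star_seminorm_axioms L.univ_norm_R])

definition e :: "nat \<Rightarrow> (vert, label) lgen star_poly" where
  "e = tower adj ls (ulabels n) (\<lambda>k. lp (tail_set 0) - lp (tail_set k))"

definition f :: "nat \<Rightarrow> (vert, label) lgen star_poly" where
  "f = tower adj ls (mlabels n) (\<lambda>_. lp {VW1})"

lemma ef_free: "e k \<in> L.FX" "f k \<in> L.FX"
  unfolding e_def f_def
  by (rule L.tower_free; simp add: tail_set_sets mirror_sets.intros LM.ulabel_mlabel)+

lemma \<iota>_ef: "L.\<iota> (e k) = LM.E.T k" "L.\<iota> (f k) = LM.F.T k"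
proof -
  have "L.\<iota> (e k) = tower star (\<lambda>a. L.\<iota> (ls a)) (ulabels n) (\<lambda>k. L.\<iota> (lp (tail_set 0) - lp (tail_set k))) k"
    unfolding e_def by (rule L.\<iota>_tower) (simp_all add: tail_set_sets LM.ulabel_mlabel)
  thus "L.\<iota> (e k) = LM.E.T k" by (simp add: L.\<iota>_diff tail_set_sets)
  show "L.\<iota> (f k) = LM.F.T k"
    unfolding f_def by (rule L.\<iota>_tower) (simp_all add: mirror_sets.intros)
qed

lemma diagonal_lp: assumes "LM.diagonal x" shows "x * LM.\<rho> A = LM.\<rho> A * x"
proof -
  let ?u = "\<lambda>i. L.\<iota> (lp {VU i})" and ?I = "{i. i \<in> {1..n - 1} \<and> VU i \<in> A}"
  have "sum ?u ?I * x = x * sum ?u ?I"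
    unfolding sum_distrib_left sum_distrib_right using LM.diagonalD(1)[OF assms] by (intro sum.cong) auto
  moreover have "(if VW1 \<in> A then L.\<iota> (lp {VW1}) else 0) * x = x * (if VW1 \<in> A then L.\<iota> (lp {VW1}) else 0)"
    using LM.diagonalD(2)[OF assms] by simp
  moreover have "tail_value (\<lambda>k. L.\<iota> (lp (tail_set k))) A * x = x * tail_value (\<lambda>k. L.\<iota> (lp (tail_set k))) A"
    using LM.diagonalD(3)[OF assms] by (simp add: tail_value_def)
  ultimately show ?thesis unfolding mirror_proj_def by (simp only: distrib_left distrib_right)
qed

lemma approx_unit_E: "approx_unit (mgens n) (univ_norm (mgens n) (mrels n)) e"
proof
  show "e k \<in> L.FX" for k by (rule ef_free)
  show "proj (L.\<iota> (e k))" for k unfolding \<iota>_ef by (rule LM.E.T_proj)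
  show "L.\<iota> (e j) * L.\<iota> (e k) = L.\<iota> (e j)" if "j \<le> k" for j k
    unfolding \<iota>_ef using that by (rule LM.E.T_mono)
  fix g j assume g: "g \<in> mgens n"
  show "\<exists>k. L.\<iota> (e j) * L.\<iota> (gen g) = L.\<iota> (e j) * L.\<iota> (gen g) * L.\<iota> (e k)"
    "\<exists>k. L.\<iota> (e j) * (L.\<iota> (gen g))\<^sup>\<star> = L.\<iota> (e j) * (L.\<iota> (gen g))\<^sup>\<star> * L.\<iota> (e k)"
    using g LM.E.T_diagonal_absorb[OF diagonal_lp[OF LM.E.T_diagonal]] LM.E_absorb
    unfolding \<iota>_ef by (cases g; auto simp: L_\<iota>_lp LM.proj_star)+
qed

lemma approx_unit_F: "approx_unit (mgens n) (univ_norm (mgens n) (mrels n)) f"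
proof
  show "f k \<in> L.FX" for k by (rule ef_free)
  show "proj (L.\<iota> (f k))" for k unfolding \<iota>_ef by (rule LM.F.T_proj)
  show "L.\<iota> (f j) * L.\<iota> (f k) = L.\<iota> (f j)" if "j \<le> k" for j k
    unfolding \<iota>_ef using that by (rule LM.F.T_mono)
  fix g j assume g: "g \<in> mgens n"
  show "\<exists>k. L.\<iota> (f j) * L.\<iota> (gen g) = L.\<iota> (f j) * L.\<iota> (gen g) * L.\<iota> (f k)"
    "\<exists>k. L.\<iota> (f j) * (L.\<iota> (gen g))\<^sup>\<star> = L.\<iota> (f j) * (L.\<iota> (gen g))\<^sup>\<star> * L.\<iota> (f k)"
    using g LM.F.T_diagonal_absorb[OF diagonal_lp[OF LM.F.T_diagonal]] LM.F.T_S_absorb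
    unfolding \<iota>_ef by (cases g; auto simp: L_\<iota>_lp LM.proj_star)+
qed

sublocale E: approx_unit "mgens n" "univ_norm (mgens n) (mrels n)" e by (rule approx_unit_E)
sublocale F: approx_unit "mgens n" "univ_norm (mgens n) (mrels n)" f by (rule approx_unit_F)

lemma ef_orth: "L.\<iota> (e j) * L.\<iota> (f k) = 0" "L.\<iota> (f k) * L.\<iota> (e j) = 0"
proof -
  show *: "L.\<iota> (e j) * L.\<iota> (f k) = 0" unfolding \<iota>_ef by (rule LM.E_F)
  show "L.\<iota> (f k) * L.\<iota> (e j) = 0"
    using LM.flip_zero[OF *] E.e_proj F.e_proj by (simp add: proj_def)
qed

text \<open>The first ideal absorbs \<open>y\<close> before it meets the second:
  \<open>e_j y = e_j y e_m\<close> for some \<open>m\<close>, and \<open>e_m f_k = 0\<close>;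
  likewise with the roles exchanged.\<close>

lemma ef_cross: assumes "y \<in> L.FX" shows "L.\<iota> (e j) * L.\<iota> y * L.\<iota> (f k) = 0" "L.\<iota> (f j) * L.\<iota> y * L.\<iota> (e k) = 0"
proof -
  obtain m where m: "L.\<iota> (e j) * L.\<iota> y * L.\<iota> (e m) = L.\<iota> (e j) * L.\<iota> y"
    using E.absorbed[OF assms] unfolding E.absorbed_def by blast
  have "L.\<iota> (e j) * L.\<iota> y * L.\<iota> (f k) = L.\<iota> (e j) * L.\<iota> y * L.\<iota> (e m) * L.\<iota> (f k)" by (simp only: m)
  thus "L.\<iota> (e j) * L.\<iota> y * L.\<iota> (f k) = 0" by (simp add: mult.assoc ef_orth)
  obtain l where l: "L.\<iota> (f j) * L.\<iota> y * L.\<iota> (f l) = L.\<iota> (f j) * L.\<iota> y"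
    using F.absorbed[OF assms] unfolding F.absorbed_def by blast
  have "L.\<iota> (f j) * L.\<iota> y * L.\<iota> (e k) = L.\<iota> (f j) * L.\<iota> y * L.\<iota> (f l) * L.\<iota> (e k)" by (simp only: l)
  thus "L.\<iota> (f j) * L.\<iota> y * L.\<iota> (e k) = 0" by (simp add: mult.assoc ef_orth)
qed

text \<open>Because all cross terms vanish, the sums form an approximate unit of
  \<open>I + J\<close>, which makes the quotient by both ideals accessible by the same limit
  formula.\<close>

lemma approx_unit_EF: "approx_unit (mgens n) (univ_norm (mgens n) (mrels n)) (\<lambda>k. e k + f k)"
proof
  have \<iota>: "L.\<iota> (e k + f k) = L.\<iota> (e k) + L.\<iota> (f k)" for k by (rule L.\<iota>_add[OF ef_free])
  show "e k + f k \<in> L.FX" for k using ef_free by simp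
  show "proj (L.\<iota> (e k + f k))" for k
    using projD[OF E.e_proj] projD[OF F.e_proj] by (simp add: proj_def \<iota> distrib_left distrib_right ef_orth)
  show "L.\<iota> (e j + f j) * L.\<iota> (e k + f k) = L.\<iota> (e j + f j)" if "j \<le> k" for j k
    using E.e_mono[OF that] F.e_mono[OF that] by (simp add: \<iota> distrib_left distrib_right ef_orth)
  have ab: "\<exists>k. L.\<iota> (e j + f j) * L.\<iota> y = L.\<iota> (e j + f j) * L.\<iota> y * L.\<iota> (e k + f k)" if y: "y \<in> L.FX" for y j
  proof -
    obtain k l where "\<forall>m\<ge>k. L.\<iota> (e j) * L.\<iota> y * L.\<iota> (e m) = L.\<iota> (e j) * L.\<iota> y"
      "\<forall>m\<ge>l. L.\<iota> (f j) * L.\<iota> y * L.\<iota> (f m) = L.\<iota> (f j) * L.\<iota> y"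
      using E.absorbed[OF y] F.absorbed[OF y] unfolding E.absorbed_def F.absorbed_def by blast
    hence "L.\<iota> (e j + f j) * L.\<iota> y = L.\<iota> (e j + f j) * L.\<iota> y * L.\<iota> (e (max k l) + f (max k l))"
      by (simp add: \<iota> distrib_left distrib_right ef_cross[OF y])
    thus ?thesis by blast
  qed
  fix g j assume g: "g \<in> mgens n"
  show "\<exists>k. L.\<iota> (e j + f j) * L.\<iota> (gen g) = L.\<iota> (e j + f j) * L.\<iota> (gen g) * L.\<iota> (e k + f k)"
    using ab[of "gen g"] g by simp
  show "\<exists>k. L.\<iota> (e j + f j) * (L.\<iota> (gen g))\<^sup>\<star> = L.\<iota> (e j + f j) * (L.\<iota> (gen g))\<^sup>\<star> * L.\<iota> (e k + f k)"
    using ab[of "adj (gen g)"] g by (simp add: L.\<iota>_adj)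
qed

sublocale EF: approx_unit "mgens n" "univ_norm (mgens n) (mrels n)" "\<lambda>k. e k + f k" by (rule approx_unit_EF)

lemma quot_rels:
  assumes r: "r \<in> mrels n" shows "E.quot_norm r = 0" "F.quot_norm r = 0" "EF.quot_norm r = 0"
proof -
  have F: "r \<in> L.FX" using r L.R_free by blast
  have z: "univ_norm (mgens n) (mrels n) r = 0" by (rule L.univ_norm_R[OF r])
  show "E.quot_norm r = 0" "F.quot_norm r = 0" "EF.quot_norm r = 0"
    using E.quot_norm_le[OF F] E.quot_norm_nonneg[OF F] F.quot_norm_le[OF F] F.quot_norm_nonneg[OF F]
      EF.quot_norm_le[OF F] EF.quot_norm_nonneg[OF F] z by auto
qed

sublocale EM: mirror_family n "\<lambda>i. E.quot.\<iota> (lp {VU i})" "E.quot.\<iota> (lp {VW1})" "\<lambda>k. E.quot.\<iota> (lp (tail_set k))" "\<lambda>a. E.quot.\<iota> (ls a)"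
  by (rule mirror_family_of_null[OF E.quot.star_seminorm_axioms quot_rels(1)])

sublocale FM: mirror_family n "\<lambda>i. F.quot.\<iota> (lp {VU i})" "F.quot.\<iota> (lp {VW1})" "\<lambda>k. F.quot.\<iota> (lp (tail_set k))" "\<lambda>a. F.quot.\<iota> (ls a)"
  by (rule mirror_family_of_null[OF F.quot.star_seminorm_axioms quot_rels(2)])

sublocale EFM: mirror_family n "\<lambda>i. EF.quot.\<iota> (lp {VU i})" "EF.quot.\<iota> (lp {VW1})" "\<lambda>k. EF.quot.\<iota> (lp (tail_set k))" "\<lambda>a. EF.quot.\<iota> (ls a)"
  by (rule mirror_family_of_null[OF EF.quot.star_seminorm_axioms quot_rels(3)])

end

lemma poly_subst_tower:
  "poly_subst \<theta> (tower adj S L B k) = tower adj (\<lambda>a. poly_subst \<theta> (S a)) L (\<lambda>k. poly_subst \<theta> (B k)) k"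
  by (induction k) (simp_all add: poly_subst_sum)

lemma tower_zero: "(\<And>k. B k = 0) \<Longrightarrow> tower st S L B k = 0"
  by (induction k) simp_all

lemma poly_subst_poly_subst:
  "x \<in> free_star X \<Longrightarrow> poly_subst \<eta> (poly_subst \<theta> x) = poly_subst (\<lambda>g. poly_subst \<eta> (\<theta> g)) x"
  by (induction x rule: free_star_induct) simp_all

section \<open>The reverse substitutions and the resulting norm bounds\<close>

context mirror_setting
begin

lemma E_W: "E.quot.\<iota> (lp (tail_set 0)) = E.quot.\<iota> (lp (tail_set 1))"
proof -
  have "E.quot_norm (lp (tail_set 0) - lp (tail_set 1)) = 0"
    using LM.E_one by (intro E.quot_norm_eq_0[of _ 1]) (simp_all only: tail_set_sets free_star_diff mirror_gens L.\<iota>_diff \<iota>_ef)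
  thus ?thesis by (simp add: E.quot.\<iota>_eq_iff tail_set_sets)
qed

lemma F_P: "F.quot.\<iota> (lp {VW1}) = 0"
proof -
  have "F.quot_norm (lp {VW1}) = 0"
    using LM.F_one by (intro F.quot_norm_eq_0[of _ 1]) (simp_all only: mirror_sets.intros mirror_gens \<iota>_ef)
  thus ?thesis by (simp add: F.quot.\<iota>_eq_0_iff mirror_sets.intros)
qed

lemma EF_W: "EF.quot.\<iota> (lp (tail_set 0)) = EF.quot.\<iota> (lp (tail_set 1))" and EF_P: "EF.quot.\<iota> (lp {VW1}) = 0"
proof -
  have "L.\<iota> (lp (tail_set 0) - lp (tail_set 1)) * L.\<iota> (e 1 + f 1) = L.\<iota> (lp (tail_set 0) - lp (tail_set 1))"
    using LM.E_one LM.U_F[of 1 1]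
    by (simp only: tail_set_sets mirror_gens L.\<iota>_diff L.\<iota>_add[OF ef_free] \<iota>_ef distrib_left) simp
  hence "EF.quot_norm (lp (tail_set 0) - lp (tail_set 1)) = 0"
    by (intro EF.quot_norm_eq_0[of _ 1]) (simp_all add: tail_set_sets)
  thus "EF.quot.\<iota> (lp (tail_set 0)) = EF.quot.\<iota> (lp (tail_set 1))" by (simp add: EF.quot.\<iota>_eq_iff tail_set_sets)
  have "L.\<iota> (lp {VW1}) * LM.E.T 1 = 0"
    using LM.E_P[of 1] LM.diagonalD(2)[OF LM.E.T_diagonal[of 1]] by (simp only:)
  hence "L.\<iota> (lp {VW1}) * L.\<iota> (e 1 + f 1) = L.\<iota> (lp {VW1})"
    using LM.F_one by (simp only: L.\<iota>_add[OF ef_free] \<iota>_ef distrib_left) simp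
  hence "EF.quot_norm (lp {VW1}) = 0"
    by (intro EF.quot_norm_eq_0[of _ 1]) (simp_all add: mirror_sets.intros)
  thus "EF.quot.\<iota> (lp {VW1}) = 0" by (simp add: EF.quot.\<iota>_eq_0_iff mirror_sets.intros)
qed

lemma back_free: "g \<in> graph_gens (disc_graph n) \<Longrightarrow> left_back n g \<in> L.FX \<and> right_back n g \<in> L.FX"
  by (cases g) (auto simp: left_back_def right_back_def disc_sel tail_set_sets mirror_sets.intros mlabels_n
      simp del: mlabels_iff split: prod.splits)

lemma sphere_in_disc: "g \<in> graph_gens (sphere_graph n) \<Longrightarrow> g \<in> graph_gens (disc_graph n)"
  by (cases g) (auto simp: disc_sel sphere_sel)

lemmas lab = mirror_gens tail_set_sets mirror_sets.intros mlabels_n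

lemma E_rels:
  assumes "z \<in> graph_rels (disc_graph n)" shows "E.quot_norm (poly_subst (left_back n) z) = 0"
proof (rule E.quot.graph_rels_null[OF wf_disc _ _ assms])
  show "graph_family (disc_graph n) (\<lambda>v. E.quot.\<iota> (left_back n (GProj v))) (\<lambda>e. E.quot.\<iota> (left_back n (GIso e)))"
    by (rule graph_family_cong[OF EM.left_disc[OF n E_W] wf_disc])
      (auto simp: left_back_def disc_sel E.quot.\<iota>_simps lab simp del: mlabels_iff)
qed (use back_free in blast)

lemma F_rels:
  assumes "z \<in> graph_rels (disc_graph n)" shows "F.quot_norm (poly_subst (right_back n) z) = 0"
proof (rule F.quot.graph_rels_null[OF wf_disc _ _ assms])
  show "graph_family (disc_graph n) (\<lambda>v. F.quot.\<iota> (right_back n (GProj v))) (\<lambda>e. F.quot.\<iota> (right_back n (GIso e)))"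
    by (rule graph_family_cong[OF FM.right_disc[OF n F_P] wf_disc])
      (auto simp: right_back_def disc_sel F.quot.\<iota>_simps lab simp del: mlabels_iff)
qed (use back_free in blast)

lemma EF_rels:
  assumes "z \<in> graph_rels (sphere_graph n)" shows "EF.quot_norm (poly_subst (left_back n) z) = 0"
proof (rule EF.quot.graph_rels_null[OF wf_sphere _ _ assms])
  show "graph_family (sphere_graph n) (\<lambda>v. EF.quot.\<iota> (left_back n (GProj v))) (\<lambda>e. EF.quot.\<iota> (left_back n (GIso e)))"
    by (rule graph_family_cong[OF EFM.left_sphere[OF n EF_W EF_P] wf_sphere])
      (auto simp: left_back_def sphere_sel EF.quot.\<iota>_simps lab simp del: mlabels_iff)
qed (use back_free sphere_in_disc in blast)

lemma left_back_LProj: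
  "poly_subst (left_back n) (left_subst n (LProj A)) =
    mirror_proj n (\<lambda>i. lp {VU i}) (lp {VW1}) (\<lambda>_. lp (tail_set 1)) A"
  using n unfolding left_subst_def lgen.case poly_subst_mirror_proj
  by (intro mirror_proj_cong) (auto simp: left_back_def)

text \<open>The substitutions are inverse only modulo the ideal: \<open>left_subst\<close> sends
  every tail to \<open>gp n\<close>, which returns as \<open>tail_set 1\<close>, and in the quotient
  all tails coincide. A label \<open>f_i\<close> returns cut by two projections whose sum is its
  initial projection there.\<close>

lemma E_inverse:
  assumes "g \<in> mgens n"
  shows "E.quot.\<iota> (poly_subst (left_back n) (left_subst n g)) = E.quot.\<iota> (gen g)"
proof (cases g)
  case (LProj A)
  hence A: "A \<in> mirror_sets n" using assms by simp
  have "E.quot.\<iota> (poly_subst (left_back n) (left_subst n g)) =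
      mirror_proj n (\<lambda>i. E.quot.\<iota> (lp {VU i})) (E.quot.\<iota> (lp {VW1})) (\<lambda>_. E.quot.\<iota> (lp (tail_set 1))) A"
    unfolding LProj left_back_LProj by (rule E.quot.\<iota>_mirror_proj) (auto simp: lab simp del: free_star_gen)
  also have "\<dots> = EM.\<rho> A" by (intro mirror_proj_cong refl EM.U_const[OF E_W, symmetric])
  also have "\<dots> = E.quot.\<iota> (gen g)"
    using mirror_family_of_null(2)[OF E.quot.star_seminorm_axioms quot_rels(1) A] LProj by simp
  finally show ?thesis .
next
  case (LIso a)
  hence a: "a \<in> mlabels n" using assms by simp
  show ?thesis
  proof (cases a)
    case (LF i)
    hence i: "1 \<le> i" "i < n" using a by (simp_all add: mlabels_n del: mlabels_iff)
    have "E.quot.\<iota> (ls (LF i)) * (E.quot.\<iota> (lp {VW1}) + E.quot.\<iota> (lp (tail_set 0))) = E.quot.\<iota> (ls (LF i))"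
      using EM.S_pi'[of "LF i"] EM.S_LF[of i] i by (simp add: mlabels_n del: mlabels_iff)
    thus ?thesis using i E_W
      by (simp add: LIso LF left_subst_def left_back_def E.quot.\<iota>_simps lab distrib_left add.commute del: mlabels_iff)
  qed (use a n in \<open>auto simp: LIso left_subst_def left_back_def mlabels_n simp del: mlabels_iff\<close>)
qed

lemma EF_inverse:
  assumes "g \<in> mgens n"
  shows "EF.quot.\<iota> (poly_subst (left_back n) (poly_subst (sphere_subst n) (left_subst n g))) = EF.quot.\<iota> (gen g)"
proof (cases g)
  case (LProj A)
  hence A: "A \<in> mirror_sets n" using assms by simp
  have "poly_subst (left_back n) (poly_subst (sphere_subst n) (left_subst n g)) =
      mirror_proj n (\<lambda>i. lp {VU i}) 0 (\<lambda>_. lp (tail_set 1)) A"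
    using n unfolding LProj left_subst_def lgen.case poly_subst_mirror_proj
    by (intro mirror_proj_cong) (auto simp: left_back_def sphere_subst_def)
  hence "EF.quot.\<iota> (poly_subst (left_back n) (poly_subst (sphere_subst n) (left_subst n g))) =
      mirror_proj n (\<lambda>i. EF.quot.\<iota> (lp {VU i})) (EF.quot.\<iota> 0) (\<lambda>_. EF.quot.\<iota> (lp (tail_set 1))) A"
    by (simp only:) (rule EF.quot.\<iota>_mirror_proj, auto simp: lab simp del: free_star_gen)
  also have "\<dots> = EFM.\<rho> A" by (intro mirror_proj_cong refl EFM.U_const[OF EF_W, symmetric]) (simp add: EF_P)
  also have "\<dots> = EF.quot.\<iota> (gen g)"
    using mirror_family_of_null(2)[OF EF.quot.star_seminorm_axioms quot_rels(3) A] LProj by simp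
  finally show ?thesis .
next
  case (LIso a)
  hence a: "a \<in> mlabels n" using assms by simp
  show ?thesis
  proof (cases a)
    case (LF i)
    hence i: "1 \<le> i" "i < n" using a by (simp_all add: mlabels_n del: mlabels_iff)
    have "EF.quot.\<iota> (ls (LF i)) * (EF.quot.\<iota> (lp {VW1}) + EF.quot.\<iota> (lp (tail_set 0))) = EF.quot.\<iota> (ls (LF i))"
      using EFM.S_pi'[of "LF i"] EFM.S_LF[of i] i by (simp add: mlabels_n del: mlabels_iff)
    thus ?thesis using i EF_W EF_P
      by (simp add: LIso LF left_subst_def left_back_def sphere_subst_def EF.quot.\<iota>_simps lab del: mlabels_iff)
  next
    case LH
    thus ?thesis using EFM.S_LH_zero[OF EF_P] by (simp add: LIso left_subst_def sphere_subst_def)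
  qed (use a n in \<open>auto simp: LIso left_subst_def left_back_def sphere_subst_def mlabels_n simp del: mlabels_iff\<close>)
qed

text \<open>The isometry of the disc returns as the adjoint of \<open>S LG\<close>, and compressing
  by \<open>S LG\<close> turns the projection of one tail into that of the next. Membership is
  carried along because multiplicativity of \<open>\<iota>\<close> requires it.\<close>

lemma right_back_corner: "F.quot.\<iota> (poly_subst (right_back n) (disc_corner n k)) = F.quot.\<iota> (lp (tail_set k)) \<and>
    poly_subst (right_back n) (disc_corner n k) \<in> L.FX"
proof (induction k)
  case 0
  show ?case using n by (simp add: right_back_def F.quot.\<iota>_simps lab)
next
  case (Suc k)
  let ?U = "\<lambda>k. F.quot.\<iota> (lp (tail_set k))" and ?G = "F.quot.\<iota> (ls LG)"
  let ?t = "adj (ls LG) * lp (tail_set 1) + adj (ls LG) * (lp (tail_set 0) - lp (tail_set 1))"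
  have t: "F.quot.\<iota> ?t = ?G\<^sup>\<star>" "?t \<in> L.FX"
  proof -
    have "?G\<^sup>\<star> * ?U 0 = ?G\<^sup>\<star>" using arg_cong[OF FM.U0_G, of star] FM.st by simp
    thus "F.quot.\<iota> ?t = ?G\<^sup>\<star>" by (simp add: F.quot.\<iota>_simps lab right_diff_distrib)
    show "?t \<in> L.FX" by (simp add: lab)
  qed
  have eq: "poly_subst (right_back n) (disc_corner n (Suc k)) = ?t * poly_subst (right_back n) (disc_corner n k) * adj ?t"
    using n by (simp add: right_back_def)
  have "?G\<^sup>\<star> * ?U k * ?G = ?U (Suc k)"
    using mult_ext[OF FM.S_LG, of "?U (Suc k)"] FM.U_U'[of 1 "Suc k"] by (simp add: mult.assoc FM.U_G)
  thus ?case unfolding eq using Suc t by (simp add: F.quot.\<iota>_mult F.quot.\<iota>_adj del: adj_add)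
qed

lemma F_inverse:
  assumes "g \<in> mgens n"
  shows "F.quot.\<iota> (poly_subst (right_back n) (right_subst n g)) = F.quot.\<iota> (gen g)"
proof (cases g)
  case (LProj A)
  hence A: "A \<in> mirror_sets n" using assms by simp
  have "poly_subst (right_back n) (right_subst n g) =
      mirror_proj n (\<lambda>i. lp {VU i}) 0 (\<lambda>k. poly_subst (right_back n) (disc_corner n k)) A"
    using n unfolding LProj right_subst_def lgen.case poly_subst_mirror_proj
    by (intro mirror_proj_cong) (auto simp: right_back_def)
  hence "F.quot.\<iota> (poly_subst (right_back n) (right_subst n g)) =
      mirror_proj n (\<lambda>i. F.quot.\<iota> (lp {VU i})) (F.quot.\<iota> 0) (\<lambda>k. F.quot.\<iota> (poly_subst (right_back n) (disc_corner n k))) A"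
    by (simp only:) (rule F.quot.\<iota>_mirror_proj, use right_back_corner in \<open>auto simp: lab simp del: free_star_gen\<close>)
  also have "\<dots> = FM.\<rho> A" using F_P right_back_corner by (intro mirror_proj_cong) simp_all
  also have "\<dots> = F.quot.\<iota> (gen g)"
    using mirror_family_of_null(2)[OF F.quot.star_seminorm_axioms quot_rels(2) A] LProj by simp
  finally show ?thesis .
next
  case (LIso a)
  hence a: "a \<in> mlabels n" using assms by simp
  show ?thesis
  proof (cases a)
    case (LF i)
    hence i: "1 \<le> i" "i < n" using a by (simp_all add: mlabels_n del: mlabels_iff)
    have "F.quot.\<iota> (ls (LF i)) * (F.quot.\<iota> (lp {VW1}) + F.quot.\<iota> (lp (tail_set 0))) = F.quot.\<iota> (ls (LF i))"
      using FM.S_pi'[of "LF i"] FM.S_LF[of i] i by (simp add: mlabels_n del: mlabels_iff)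
    thus ?thesis using i F_P
      by (simp add: LIso LF right_subst_def right_back_def F.quot.\<iota>_simps lab right_diff_distrib del: mlabels_iff)
  next
    case LG
    have "F.quot.\<iota> (lp (tail_set 0)) * F.quot.\<iota> (ls LG) = F.quot.\<iota> (ls LG)" by (rule FM.U0_G)
    thus ?thesis using n FM.st
      by (simp add: LIso LG right_subst_def right_back_def F.quot.\<iota>_simps lab left_diff_distrib)
  next
    case LH
    thus ?thesis using FM.S_LH_zero[OF F_P] by (simp add: LIso right_subst_def)
  qed (use a n in \<open>auto simp: LIso right_subst_def right_back_def mlabels_n simp del: mlabels_iff\<close>)
qed

lemma sphere_subst_free: "y \<in> D.FX \<Longrightarrow> poly_subst (sphere_subst n) y \<in> S.FX"
proof (erule poly_subst_free[rotated])
  show "sphere_subst n g \<in> S.FX" if "g \<in> graph_gens (disc_graph n)" for g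
    using that by (cases g) (auto simp: sphere_subst_def disc_sel sphere_sel)
qed

text \<open>An element killed by the map to the disc therefore lies in the closure of the ideal of
  the \<open>e k\<close>; \<open>left_e\<close> gives the other inclusion.\<close>

lemma E_bound: "x \<in> L.FX \<Longrightarrow> E.quot_norm x \<le>
    univ_norm (graph_gens (disc_graph n)) (graph_rels (disc_graph n)) (poly_subst (left_subst n) x)"
  using back_free by (intro E.quot_norm_bound[OF D.univ_rels_axioms _ E_rels left_subst_free E_inverse]) auto

lemma F_bound: "x \<in> L.FX \<Longrightarrow> F.quot_norm x \<le>
    univ_norm (graph_gens (disc_graph n)) (graph_rels (disc_graph n)) (poly_subst (right_subst n) x)"
  using back_free by (intro F.quot_norm_bound[OF D.univ_rels_axioms _ F_rels right_subst_free F_inverse]) auto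

lemma EF_bound:
  assumes x: "x \<in> L.FX"
  shows "EF.quot_norm x \<le> univ_norm (graph_gens (sphere_graph n)) (graph_rels (sphere_graph n))
      (poly_subst (sphere_subst n) (poly_subst (left_subst n) x))"
  unfolding poly_subst_poly_subst[OF x]
  by (rule EF.quot_norm_bound[OF S.univ_rels_axioms _ EF_rels _ EF_inverse x])
    (use back_free sphere_in_disc sphere_subst_free left_subst_free in auto)

text \<open>The two ideals intersect trivially, because \<open>f k * e k = 0\<close>.\<close>

lemma norm_le_quot_norms:
  assumes x: "x \<in> L.FX" shows "univ_norm (mgens n) (mrels n) x \<le> E.quot_norm x + F.quot_norm x"
proof -
  let ?N = "univ_norm (mgens n) (mrels n)"
  have "?N x \<le> ?N (x - x * e k) + ?N (x - x * f k)" for k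
  proof -
    have "?N (x * e k) = ?N ((x - x * f k) * e k)"
      using x ef_free ef_orth by (intro L.N_cong) (auto simp: L.\<iota>_simps algebra_simps)
    also have "\<dots> \<le> ?N (x - x * f k) * ?N (e k)" using x ef_free by (intro L.N_mult) auto
    also have "\<dots> \<le> ?N (x - x * f k) * 1"
      using x ef_free L.N_proj_le_1[OF ef_free(1) E.e_proj] by (intro mult_left_mono L.nonneg) auto
    finally have "?N (x * e k) \<le> ?N (x - x * f k)" by simp
    thus ?thesis using L.triangle[of "x - x * e k" "x * e k"] x ef_free by simp
  qed
  thus ?thesis
    by (intro LIMSEQ_le_const[OF tendsto_add[OF E.quot_norm_lim[OF x] F.quot_norm_lim[OF x]]]) auto
qed

text \<open>The base polynomials of the towers are sent to 0 exactly: \<open>left_subst\<close>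
  identifies all tails, and \<open>right_subst\<close> sends \<open>{VW1}\<close> to 0.\<close>

lemma left_e: "poly_subst (left_subst n) (e k) = 0" and right_f: "poly_subst (right_subst n) (f k) = 0"
  unfolding e_def f_def poly_subst_tower
  by (rule tower_zero; simp add: left_subst_def right_subst_def)+

lemma left_inverse:
  assumes "g \<in> graph_gens (disc_graph n)"
  shows "D.\<iota> (poly_subst (left_subst n) (left_back n g)) = D.\<iota> (gen g)"
proof (cases g)
  case (GProj v)
  hence "v < n \<or> v = n \<or> v = n + 1" using assms by (auto simp: disc_sel)
  thus ?thesis using assms n GProj by (auto simp: left_back_def left_subst_def disc_sel)
next
  case (GIso e)
  obtain i j where e: "e = (i, j)" by fastforce
  hence ij: "DF.edge i j" using assms GIso by (simp add: disc_sel)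
  show ?thesis
  proof (cases "i < n")
    case True
    have "j < n \<or> j = n \<or> j = n + 1" using ij by auto
    thus ?thesis using True ij n
      by (auto simp: GIso e left_back_def left_subst_def D.\<iota>_simps disc_gens DF.s_p distrib_right simp del: free_star_gen)
  next
    case False
    hence "i = n" "j = n \<or> j = n + 1" using ij by auto
    thus ?thesis by (auto simp: GIso e left_back_def left_subst_def)
  qed
qed

text \<open>Each edge into \<open>n\<close> or \<open>n + 1\<close> comes back as the sum of both
  edges from the same source, multiplied by the projection of its own range; that projection selects
  the edge.\<close>

lemma right_inverse:
  assumes "g \<in> graph_gens (disc_graph n)"
  shows "D.\<iota> (poly_subst (right_subst n) (right_back n g)) = D.\<iota> (gen g)"
proof -
  have tail: "poly_subst (right_subst n) (lp (tail_set k)) = disc_corner n k" for k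
    by (simp add: right_subst_def)
  have U: "D.\<iota> (disc_corner n 1) = D.\<iota> (gp n)" "D.\<iota> (disc_corner n 0 - disc_corner n 1) = D.\<iota> (gp (n + 1))"
    using DF.U2_one by (simp_all only: D.\<iota>_diff[OF disc_corner_free disc_corner_free] \<iota>_disc_corner) simp_all
  have C: "disc_corner n 1 \<in> D.FX" "disc_corner n 0 - disc_corner n 1 \<in> D.FX"
    using disc_corner_free by (simp_all del: disc_corner.simps)
  show ?thesis
  proof (cases g)
    case (GProj v)
    have "v < n \<or> v = n \<or> v = n + 1" using assms GProj by (auto simp: disc_sel)
    thus ?thesis
    proof (elim disjE)
      assume "v < n"
      thus ?thesis using assms n GProj by (auto simp: right_back_def right_subst_def disc_sel)
    next
      assume "v = n"
      hence "right_back n g = lp (tail_set 1)" by (simp add: GProj right_back_def)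
      thus ?thesis using U(1) \<open>v = n\<close> by (simp only: GProj tail)
    next
      assume "v = n + 1"
      hence "right_back n g = lp (tail_set 0) - lp (tail_set 1)" by (simp add: GProj right_back_def)
      thus ?thesis using U(2) \<open>v = n + 1\<close> by (simp only: GProj poly_subst_diff tail)
    qed
  next
    case (GIso e)
    obtain i j where e: "e = (i, j)" by fastforce
    hence ij: "DF.edge i j" using assms GIso by (simp add: disc_sel)
    let ?f = "gs (i, n) + gs (i, n + 1)"
    show ?thesis
    proof (cases "j < n")
      case True
      thus ?thesis using ij by (simp add: GIso e right_back_def right_subst_def)
    next
      case False
      hence j: "j = n \<or> j = n + 1" using ij by auto
      have f: "?f \<in> D.FX" using ij n by (simp add: disc_gens del: free_star_gen)
      have val: "poly_subst (right_subst n) (right_back n g) =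
          ?f * (if j = n then disc_corner n 1 else disc_corner n 0 - disc_corner n 1)"
      proof (cases "i < n")
        case True
        have "poly_subst (right_subst n) (ls (LF i)) = ?f" by (simp add: right_subst_def)
        thus ?thesis using True False
          by (simp only: GIso e right_back_def ggen.case prod.case if_True if_False poly_subst_mult poly_subst_diff tail
              split: if_split) simp
      next
        case i: False
        hence "i = n" using ij by simp
        have "poly_subst (right_subst n) (adj (ls LG)) = gs (n, n) + gs (n, n + 1)" by (simp add: right_subst_def)
        thus ?thesis using \<open>i = n\<close>
          by (simp only: GIso e right_back_def ggen.case prod.case less_irrefl if_True if_False poly_subst_mult poly_subst_diff tail
              split: if_split) simp
      qed
      have "D.\<iota> (poly_subst (right_subst n) (right_back n g)) = D.\<iota> ?f * D.\<iota> (gp j)"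
        unfolding val using j f C U by (elim disjE) (simp_all only: D.\<iota>_mult if_True if_False refl Suc_n_not_n Suc_eq_plus1[symmetric])
      also have "\<dots> = D.\<iota> (gs (i, j))"
        using j ij n by (auto simp: D.\<iota>_add disc_gens DF.s_p distrib_right simp del: free_star_gen)
      finally show ?thesis by (simp add: GIso e)
    qed
  qed
qed

end

section \<open>The isomorphism\<close>

lemma (in univ_rels) univ_elem_cong:
  "x \<in> free_star X \<Longrightarrow> y \<in> free_star X \<Longrightarrow> \<iota> x = \<iota> y \<Longrightarrow> univ_elem X R x = univ_elem X R y"
  by (simp add: univ_elem_cls cls_eq_iff NR_iff \<iota>_eq_iff)

text \<open>The quotient map and the flip are specified on generators only; this computes them on
  all polynomials.\<close>

lemma hom_univ_elem:
  assumes XR: "univ_rels X R" and YQ: "univ_rels Y Q" and h: "star_hom (univ_cstar X R) (univ_cstar Y Q) h"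
    and th: "\<And>g. g \<in> X \<Longrightarrow> \<theta> g \<in> free_star Y"
    and gen: "\<And>g. g \<in> X \<Longrightarrow> h (univ_elem X R (gen g)) = univ_elem Y Q (\<theta> g)"
    and x: "x \<in> free_star X"
  shows "h (univ_elem X R x) = univ_elem Y Q (poly_subst \<theta> x)"
proof -
  interpret X: univ_rels X R by fact
  interpret Y: univ_rels Y Q by fact
  interpret B: cstar_algebra "univ_cstar Y Q" by (rule Y.univ_cstar_algebra)
  note el = X.univ_elem_hom Y.univ_elem_hom
  have F: "poly_subst \<theta> y \<in> free_star Y" if "y \<in> free_star X" for y using th that by (rule poly_subst_free)
  have c: "univ_elem X R y \<in> car (univ_cstar X R)" if "y \<in> free_star X" for y
    using el(1) that by (simp add: poly_hom_def)
  show ?thesis using x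
  proof (induction x rule: free_star_induct)
    case zero
    have "univ_elem X R 0 = cscale (univ_cstar X R) 0 (univ_elem X R 0)"
      using el(1) free_star_0[of X] pscale_zero[of 0] unfolding poly_hom_def by metis
    hence "h (univ_elem X R 0) = cscale (univ_cstar Y Q) 0 (h (univ_elem X R 0))"
      using h c[OF free_star_0] unfolding star_hom_def by metis
    also have "\<dots> = czero (univ_cstar Y Q)"
      using h c[OF free_star_0] by (intro B.scale_zero_left) (simp add: star_hom_def)
    finally show ?case using poly_hom_zero[OF Y.univ_cstar_algebra el(2)] by simp
  qed (use el h c F gen in \<open>simp_all add: poly_hom_def star_hom_def\<close>)
qed

lemma (in cstar_algebra) norm_le_diff:
  assumes "x \<in> car A" "y \<in> car A" shows "cnorm A x \<le> cnorm A (cdiff A x y) + cnorm A y"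
  using norm_triangle[of "cdiff A x y" "cdiff A y (czero A)"] diff_trans[of x y "czero A"] assms
  by (simp add: diff_zero closed)

lemma (in cstar_algebra) norm_diff_trans:
  assumes "x \<in> car A" "y \<in> car A" "z \<in> car A"
  shows "cnorm A (cdiff A x z) \<le> cnorm A (cdiff A x y) + cnorm A (cdiff A y z)"
  using norm_triangle[of "cdiff A x y" "cdiff A y z"] diff_trans[OF assms] assms by (simp add: closed)

lemma star_hom_diff:
  "cstar_algebra A \<Longrightarrow> star_hom A B h \<Longrightarrow> x \<in> car A \<Longrightarrow> y \<in> car A \<Longrightarrow> h (cdiff A x y) = cdiff B (h x) (h y)"
  by (simp add: star_hom_def cdiff_def cstar_algebra.scale_closed)

context mirror_setting
begin

lemma left_back_inverse: "y \<in> D.FX \<Longrightarrow> D.\<iota> (poly_subst (left_subst n) (poly_subst (left_back n) y)) = D.\<iota> y"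
  and right_back_inverse: "y \<in> D.FX \<Longrightarrow> D.\<iota> (poly_subst (right_subst n) (poly_subst (right_back n) y)) = D.\<iota> y"
proof -
  have *: "D.\<iota> (poly_subst \<theta> y) = D.\<iota> y"
    if th: "\<And>g. g \<in> graph_gens (disc_graph n) \<Longrightarrow> \<theta> g \<in> D.FX"
      "\<And>g. g \<in> graph_gens (disc_graph n) \<Longrightarrow> D.\<iota> (\<theta> g) = D.\<iota> (gen g)" and y: "y \<in> D.FX" for \<theta> y
  proof -
    have F: "poly_subst \<theta> x \<in> D.FX" if "x \<in> D.FX" for x using th(1) that by (rule poly_subst_free)
    show ?thesis using y
    proof (induction y rule: free_star_induct)
      case (scale c x)
      thus ?case using D.\<iota>_scale_cong[OF F[of x], of x c] by simp
    qed (use th(2) F in \<open>simp_all add: D.\<iota>_simps\<close>)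
  qed
  have FL: "poly_subst (left_subst n) x \<in> D.FX" "poly_subst (right_subst n) x \<in> D.FX" if "x \<in> L.FX" for x
    using left_subst_free right_subst_free that by (auto intro: poly_subst_free)
  show "D.\<iota> (poly_subst (left_subst n) (poly_subst (left_back n) y)) = D.\<iota> y" if y: "y \<in> D.FX"
    unfolding poly_subst_poly_subst[OF y] using FL back_free left_inverse by (intro * y) auto
  show "D.\<iota> (poly_subst (right_subst n) (poly_subst (right_back n) y)) = D.\<iota> y" if y: "y \<in> D.FX"
    unfolding poly_subst_poly_subst[OF y] using FL back_free right_inverse by (intro * y) auto
qed

interpretation SG: graph_family "sphere_graph n" "\<lambda>v. S.\<iota> (gp v)" "\<lambda>e. S.\<iota> (gs e)"
  by (rule graph_family_of_null[OF S.star_seminorm_axioms wf_sphere S.univ_norm_R])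

lemma flip_subst_free: "z \<in> S.FX \<Longrightarrow> poly_subst (flip_subst n) z \<in> S.FX"
proof (erule poly_subst_free[rotated])
  show "flip_subst n g \<in> S.FX" if "g \<in> graph_gens (sphere_graph n)" for g
    using that free_star_adj[of "gen g" "graph_gens (sphere_graph n)"] by (auto simp: flip_subst_def)
qed

text \<open>In the sphere \<open>S_{n,n}\<close> is a unitary of the corner at \<open>n\<close>, so
  every \<open>disc_corner\<close> collapses to \<open>gp n\<close>. The label \<open>g\<close>
  arrives as \<open>S_{n,n}\<close> on one side and as its adjoint on the other, and the flip
  reconciles the two.\<close>

lemma sphere_compatible:
  assumes "g \<in> mgens n"
  shows "S.\<iota> (poly_subst (sphere_subst n) (left_subst n g)) =
    S.\<iota> (poly_subst (flip_subst n) (poly_subst (sphere_subst n) (right_subst n g)))"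
proof (cases g)
  case (LProj A)
  let ?c = "\<lambda>k. poly_subst (flip_subst n) (poly_subst (sphere_subst n) (disc_corner n k))"
  have nn: "n \<in> verts (sphere_graph n)" "(n, n) \<in> arcs (sphere_graph n)" "out_arcs (sphere_graph n) n = {(n, n)}"
    using n by (auto simp: sphere_sel out_arcs_sphere)
  have c: "?c k \<in> S.FX" for k
    using disc_corner_free by (intro flip_subst_free sphere_subst_free)
  have corner: "S.\<iota> (?c k) = S.\<iota> (gp n)" for k
  proof (induction k)
    case 0 thus ?case by (simp add: sphere_subst_def flip_subst_def)
  next
    case (Suc k)
    have "?c (Suc k) = adj (gs (n, n)) * ?c k * gs (n, n)"
      by (simp add: sphere_subst_def flip_subst_def)
    hence "S.\<iota> (?c (Suc k)) = (S.\<iota> (gs (n, n)))\<^sup>\<star> * S.\<iota> (gp n) * S.\<iota> (gs (n, n))"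
      using nn c Suc by (simp add: S.\<iota>_mult S.\<iota>_adj)
    also have "\<dots> = ((S.\<iota> (gs (n, n)))\<^sup>\<star> * S.\<iota> (gs (n, n))) * ((S.\<iota> (gs (n, n)))\<^sup>\<star> * S.\<iota> (gs (n, n)))"
    proof -
      have "S.\<iota> (gp n) = S.\<iota> (gs (n, n)) * (S.\<iota> (gs (n, n)))\<^sup>\<star>" using SG.p_sum[OF nn(1)] nn(3) by simp
      thus ?thesis by (simp only: mult.assoc)
    qed
    also have "\<dots> = S.\<iota> (gp n) * S.\<iota> (gp n)" using SG.s_head[OF nn(2)] by (simp add: sphere_sel)
    also have "\<dots> = S.\<iota> (gp n)" using SG.p_proj[OF nn(1)] by (simp add: proj_def)
    finally show ?case .
  qed
  have "poly_subst (sphere_subst n) (left_subst n g) = mirror_proj n gp 0 (\<lambda>_. gp n) A"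
    unfolding LProj left_subst_def lgen.case poly_subst_mirror_proj
    by (intro mirror_proj_cong) (auto simp: sphere_subst_def)
  hence 1: "S.\<iota> (poly_subst (sphere_subst n) (left_subst n g)) =
      mirror_proj n (\<lambda>i. S.\<iota> (gp i)) (S.\<iota> 0) (\<lambda>_. S.\<iota> (gp n)) A"
    using n by (simp only:) (rule S.\<iota>_mirror_proj, auto simp: sphere_gens simp del: free_star_gen)
  have "poly_subst (flip_subst n) (poly_subst (sphere_subst n) (right_subst n g)) = mirror_proj n gp 0 ?c A"
    unfolding LProj right_subst_def lgen.case poly_subst_mirror_proj
    by (intro mirror_proj_cong) (auto simp: sphere_subst_def flip_subst_def)
  hence 2: "S.\<iota> (poly_subst (flip_subst n) (poly_subst (sphere_subst n) (right_subst n g))) =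
      mirror_proj n (\<lambda>i. S.\<iota> (gp i)) (S.\<iota> 0) (\<lambda>k. S.\<iota> (?c k)) A"
    by (simp only:) (rule S.\<iota>_mirror_proj, use c in \<open>auto simp: sphere_gens simp del: free_star_gen\<close>)
  show ?thesis unfolding 1 2 corner ..
next
  case (LIso a)
  hence a: "a \<in> mlabels n" using assms by simp
  thus ?thesis using n by (cases a)
    (auto simp: LIso left_subst_def right_subst_def sphere_subst_def flip_subst_def mlabels_n simp del: mlabels_iff)
qed

theorem labelled_cstar_mirror_sphere:
  "labelled_cstar (mirror_graph n) mirror_label (mirror_sets n) \<cong>\<^sub>C\<^sub>* mirror_sphere q n"
proof -
  let ?A = "univ_cstar (mgens n) (mrels n)" and ?D = "quantum_disc q n" and ?S = "quantum_sphere q n"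
  let ?el = "univ_elem (mgens n) (mrels n)" and ?del = "disc_elem n" and ?sel = "sphere_elem n"
  let ?N = "univ_norm (mgens n) (mrels n)"
  have Deq: "?D = univ_cstar (graph_gens (disc_graph n)) (graph_rels (disc_graph n))"
    "?S = univ_cstar (graph_gens (sphere_graph n)) (graph_rels (sphere_graph n))"
    by (simp_all add: quantum_disc_def quantum_sphere_def graph_cstar_def)
  interpret A: cstar_algebra ?A by (rule L.univ_cstar_algebra)
  interpret DA: cstar_algebra ?D unfolding Deq by (rule D.univ_cstar_algebra)
  interpret SA: cstar_algebra ?S unfolding Deq by (rule S.univ_cstar_algebra)
  \<comment> \<open>Both maps are choices; they enter only through their specifications, which hold
    because such maps exist.\<close>
  let ?\<pi> = "disc_to_sphere q n" and ?\<beta> = "flip q n"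
  have \<pi>: "is_disc_to_sphere q n ?\<pi>"
    unfolding disc_to_sphere_def using disc_to_sphere_exists[of q n] by (rule someI_ex)
  have \<beta>: "is_flip q n ?\<beta>"
    unfolding flip_def using flip_exists[OF n, of q] by (rule someI_ex)
  have \<pi>_hom: "star_hom ?D ?S ?\<pi>" "contractive ?D ?S ?\<pi>" using \<pi> by (simp_all add: is_disc_to_sphere_def)
  have \<beta>_hom: "star_hom ?S ?S ?\<beta>" "contractive ?S ?S ?\<beta>" using \<beta> by (simp_all add: is_flip_def star_iso_def)
  have Lfree: "poly_subst (left_subst n) x \<in> D.FX" "poly_subst (right_subst n) x \<in> D.FX" if "x \<in> L.FX" for x
    using left_subst_free right_subst_free that by (auto intro: poly_subst_free)
  have Bfree: "poly_subst (left_back n) y \<in> L.FX" "poly_subst (right_back n) y \<in> L.FX" if "y \<in> D.FX" for y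
    using back_free that by (auto intro: poly_subst_free)
  have \<pi>_elem: "?\<pi> (?del y) = ?sel (poly_subst (sphere_subst n) y)" if "y \<in> D.FX" for y
    unfolding disc_elem_def sphere_elem_def
  proof (rule hom_univ_elem[OF D.univ_rels_axioms S.univ_rels_axioms _ _ _ that])
    show "star_hom (univ_cstar (graph_gens (disc_graph n)) (graph_rels (disc_graph n)))
        (univ_cstar (graph_gens (sphere_graph n)) (graph_rels (sphere_graph n))) ?\<pi>"
      using \<pi>_hom(1) by (simp only: Deq)
    have zero: "?sel 0 = czero ?S"
      unfolding sphere_elem_def Deq by (rule poly_hom_zero[OF S.univ_cstar_algebra S.univ_elem_hom])
    fix g assume g: "g \<in> graph_gens (disc_graph n)"
    show "sphere_subst n g \<in> S.FX" using sphere_subst_free[of "gen g"] g by simp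
    have "?\<pi> (?del (gen g)) = ?sel (sphere_subst n g)"
    proof (cases g)
      case (GProj v)
      hence "v \<in> {1..n} \<or> v = n + 1" using g by (auto simp: disc_sel)
      thus ?thesis using \<pi> zero GProj by (auto simp: is_disc_to_sphere_def sphere_subst_def)
    next
      case (GIso e)
      obtain i j where e: "e = (i, j)" by fastforce
      hence "1 \<le> i \<and> i \<le> n \<and> i \<le> j \<and> (j \<le> n \<or> j = n + 1)" using g GIso by (auto simp: disc_sel)
      thus ?thesis using \<pi> zero GIso e by (auto simp: is_disc_to_sphere_def sphere_subst_def)
    qed
    thus "?\<pi> (univ_elem (graph_gens (disc_graph n)) (graph_rels (disc_graph n)) (gen g)) =
        univ_elem (graph_gens (sphere_graph n)) (graph_rels (sphere_graph n)) (sphere_subst n g)"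
      by (simp only: disc_elem_def sphere_elem_def)
  qed
  have \<beta>_elem: "?\<beta> (?sel z) = ?sel (poly_subst (flip_subst n) z)" if "z \<in> S.FX" for z
    unfolding sphere_elem_def
  proof (rule hom_univ_elem[OF S.univ_rels_axioms S.univ_rels_axioms _ _ _ that])
    show "star_hom (univ_cstar (graph_gens (sphere_graph n)) (graph_rels (sphere_graph n)))
        (univ_cstar (graph_gens (sphere_graph n)) (graph_rels (sphere_graph n))) ?\<beta>"
      using \<beta>_hom(1) by (simp only: Deq)
    have adj: "?sel (adj (gs (n, n))) = cadj ?S (?sel (gs (n, n)))"
      using S.univ_elem_hom n by (simp add: poly_hom_def sphere_elem_def Deq sphere_sel)
    fix g assume g: "g \<in> graph_gens (sphere_graph n)"
    show "flip_subst n g \<in> S.FX" using flip_subst_free[of "gen g"] g by simp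
    have "?\<beta> (?sel (gen g)) = ?sel (flip_subst n g)"
    proof (cases g)
      case (GProj v)
      thus ?thesis using \<beta> g by (auto simp: is_flip_def flip_subst_def sphere_sel)
    next
      case (GIso e)
      obtain i j where e: "e = (i, j)" by fastforce
      show ?thesis using \<beta> g GIso e adj by (auto simp: is_flip_def flip_subst_def sphere_sel)
    qed
    thus "?\<beta> (univ_elem (graph_gens (sphere_graph n)) (graph_rels (sphere_graph n)) (gen g)) =
        univ_elem (graph_gens (sphere_graph n)) (graph_rels (sphere_graph n)) (flip_subst n g)"
      by (simp only: sphere_elem_def)
  qed
  obtain \<phi>1 where \<phi>1: "star_hom ?A ?D \<phi>1" "contractive ?A ?D \<phi>1"
      "\<And>x. x \<in> L.FX \<Longrightarrow> \<phi>1 (?el x) = ?del (poly_subst (left_subst n) x)"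
    using univ_cstar_map[OF L.univ_rels_axioms D.univ_rels_axioms left_subst_free left_rels]
    unfolding Deq disc_elem_def by blast
  obtain \<phi>2 where \<phi>2: "star_hom ?A ?D \<phi>2" "contractive ?A ?D \<phi>2"
      "\<And>x. x \<in> L.FX \<Longrightarrow> \<phi>2 (?el x) = ?del (poly_subst (right_subst n) x)"
    using univ_cstar_map[OF L.univ_rels_axioms D.univ_rels_axioms right_subst_free right_rels]
    unfolding Deq disc_elem_def by blast
  have el: "?el x \<in> car ?A" "cnorm ?A (?el x) = ?N x" if "x \<in> L.FX" for x
    using L.univ_elem_hom L.univ_elem_norm that by (auto simp: poly_hom_def)
  have del: "?del y \<in> car ?D" "cnorm ?D (?del y) = univ_norm (graph_gens (disc_graph n)) (graph_rels (disc_graph n)) y"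
    if "y \<in> D.FX" for y
    using D.univ_elem_hom D.univ_elem_norm that by (auto simp: poly_hom_def disc_elem_def Deq)
  have sel: "cnorm ?S (?sel z) = univ_norm (graph_gens (sphere_graph n)) (graph_rels (sphere_graph n)) z"
    if "z \<in> S.FX" for z
    using S.univ_elem_norm that by (auto simp: sphere_elem_def Deq)
  have closed: "\<phi>1 a \<in> car ?D" "\<phi>2 a \<in> car ?D" if "a \<in> car ?A" for a
    using \<phi>1(1) \<phi>2(1) that by (simp_all add: star_hom_def)
  have closed': "?\<pi> a \<in> car ?S" if "a \<in> car ?D" for a using \<pi>_hom(1) that by (simp add: star_hom_def)
  have closed'': "?\<beta> a \<in> car ?S" if "a \<in> car ?S" for a using \<beta>_hom(1) that by (simp add: star_hom_def)
  note diff = star_hom_diff[OF A.cstar_algebra_axioms \<phi>1(1)] star_hom_diff[OF A.cstar_algebra_axioms \<phi>2(1)]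
    star_hom_diff[OF DA.cstar_algebra_axioms \<pi>_hom(1)] star_hom_diff[OF SA.cstar_algebra_axioms \<beta>_hom(1)]
  \<comment> \<open>The pair of maps takes values in the pullback. Both composites are contractive
    homomorphisms, so comparing them on generators is enough.\<close>
  have compat: "?\<pi> (\<phi>1 a) = ?\<beta> (?\<pi> (\<phi>2 a))" if a: "a \<in> car ?A" for a
  proof (rule L.univ_cstar_unique[OF SA.cstar_algebra_axioms _ _ _ _ _ a])
    show "star_hom ?A ?S (\<lambda>a. ?\<pi> (\<phi>1 a))" using \<phi>1(1) \<pi>_hom(1) by (simp add: star_hom_def)
    show "star_hom ?A ?S (\<lambda>a. ?\<beta> (?\<pi> (\<phi>2 a)))" using \<phi>2(1) \<pi>_hom(1) \<beta>_hom(1) by (simp add: star_hom_def)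
    show "contractive ?A ?S (\<lambda>a. ?\<pi> (\<phi>1 a))"
      unfolding contractive_def
    proof
      fix a assume a: "a \<in> car ?A"
      have "cnorm ?S (?\<pi> (\<phi>1 a)) \<le> cnorm ?D (\<phi>1 a)"
        using \<pi>_hom(2) closed[OF a] unfolding contractive_def by blast
      also have "\<dots> \<le> cnorm ?A a" using \<phi>1(2) a unfolding contractive_def by blast
      finally show "cnorm ?S (?\<pi> (\<phi>1 a)) \<le> cnorm ?A a" .
    qed
    show "contractive ?A ?S (\<lambda>a. ?\<beta> (?\<pi> (\<phi>2 a)))"
      unfolding contractive_def
    proof
      fix a assume a: "a \<in> car ?A"
      have "cnorm ?S (?\<beta> (?\<pi> (\<phi>2 a))) \<le> cnorm ?S (?\<pi> (\<phi>2 a))"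
        using \<beta>_hom(2) closed'[OF closed(2)[OF a]] unfolding contractive_def by blast
      also have "\<dots> \<le> cnorm ?D (\<phi>2 a)" using \<pi>_hom(2) closed[OF a] unfolding contractive_def by blast
      also have "\<dots> \<le> cnorm ?A a" using \<phi>2(2) a unfolding contractive_def by blast
      finally show "cnorm ?S (?\<beta> (?\<pi> (\<phi>2 a))) \<le> cnorm ?A a" .
    qed
    fix g assume g: "g \<in> mgens n"
    have F: "gen g \<in> L.FX" using g by simp
    note LF = left_subst_free[OF g] right_subst_free[OF g]
    have "?\<pi> (\<phi>1 (?el (gen g))) = ?sel (poly_subst (sphere_subst n) (left_subst n g))"
      using \<phi>1(3)[OF F] \<pi>_elem[OF LF(1)] by simp
    also have "\<dots> = ?sel (poly_subst (flip_subst n) (poly_subst (sphere_subst n) (right_subst n g)))"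
      unfolding sphere_elem_def
      by (rule S.univ_elem_cong[OF _ _ sphere_compatible[OF g]])
        (use LF in \<open>auto intro: sphere_subst_free flip_subst_free\<close>)
    also have "\<dots> = ?\<beta> (?\<pi> (\<phi>2 (?el (gen g))))"
      using \<phi>2(3)[OF F] \<pi>_elem[OF LF(2)] \<beta>_elem[OF sphere_subst_free[OF LF(2)]] by simp
    finally show "?\<pi> (\<phi>1 (?el (gen g))) = ?\<beta> (?\<pi> (\<phi>2 (?el (gen g))))" .
  qed
  have dense: "\<exists>x\<in>L.FX. cnorm ?A (cdiff ?A a (?el x)) < r" if "a \<in> car ?A" "r > 0" for a r
    using L.C_dense[of a r] that by (auto simp: L.C_univ L.univ_elem_cls)
  have dense': "\<exists>y\<in>D.FX. cnorm ?D (cdiff ?D a (?del y)) < r" if "a \<in> car ?D" "r > 0" for a r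
    using D.C_dense[of a r] that by (auto simp: D.C_univ D.univ_elem_cls disc_elem_def Deq)
  \<comment> \<open>The pair of maps is bounded below, which yields injectivity and lets preimages
    of a convergent sequence converge.\<close>
  have below: "cnorm ?A a \<le> cnorm ?D (\<phi>1 a) + cnorm ?D (\<phi>2 a)" if a: "a \<in> car ?A" for a
  proof (rule field_le_epsilon)
    fix r :: real assume "r > 0"
    then obtain x where x: "x \<in> L.FX" "cnorm ?A (cdiff ?A a (?el x)) < r / 3"
      using dense[OF a, of "r / 3"] by auto
    note ex = el[OF x(1)]
    have 1: "cnorm ?A a \<le> r / 3 + ?N x" using A.norm_le_diff[OF a ex(1)] x(2) ex(2) by simp
    have 2: "?N x \<le> cnorm ?D (\<phi>1 (?el x)) + cnorm ?D (\<phi>2 (?el x))"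
      using norm_le_quot_norms[OF x(1)] E_bound[OF x(1)] F_bound[OF x(1)] \<phi>1(3)[OF x(1)] \<phi>2(3)[OF x(1)]
        del(2)[OF Lfree(1)[OF x(1)]] del(2)[OF Lfree(2)[OF x(1)]] by simp
    have 3: "cnorm ?D (\<phi> (?el x)) \<le> r / 3 + cnorm ?D (\<phi> a)"
      if \<phi>: "star_hom ?A ?D \<phi>" "contractive ?A ?D \<phi>" for \<phi>
    proof -
      have c: "\<phi> a \<in> car ?D" "\<phi> (?el x) \<in> car ?D" using \<phi>(1) a ex(1) by (simp_all add: star_hom_def)
      have "cnorm ?D (cdiff ?D (\<phi> (?el x)) (\<phi> a)) \<le> cnorm ?A (cdiff ?A (?el x) a)"
        using \<phi>(2) A.diff_closed[OF ex(1) a] star_hom_diff[OF A.cstar_algebra_axioms \<phi>(1) ex(1) a]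
        unfolding contractive_def by metis
      thus ?thesis using DA.norm_le_diff[OF c(2,1)] x(2) A.norm_diff_commute[OF a ex(1)] by simp
    qed
    show "cnorm ?A a \<le> cnorm ?D (\<phi>1 a) + cnorm ?D (\<phi>2 a) + r"
      using 1 2 3[OF \<phi>1(1,2)] 3[OF \<phi>2(1,2)] by simp
  qed
  \<comment> \<open>Density of the range in the pullback. The error is split into thirds: one for
    each of the two approximations by polynomials, and their sum enters again as a distance in the
    sphere.\<close>
  have approx: "\<exists>d\<in>car ?A. cnorm ?D (cdiff ?D (\<phi>1 d) x) < r \<and> cnorm ?D (cdiff ?D (\<phi>2 d) y) < r"
    if x: "x \<in> car ?D" and y: "y \<in> car ?D" and xy: "?\<pi> x = ?\<beta> (?\<pi> y)" and r: "r > 0" for x y r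
  proof -
    obtain v where v: "v \<in> D.FX" "cnorm ?D (cdiff ?D x (?del v)) < r / 3" using dense'[OF x, of "r / 3"] r by auto
    obtain w where w: "w \<in> D.FX" "cnorm ?D (cdiff ?D y (?del w)) < r / 3" using dense'[OF y, of "r / 3"] r by auto
    \<comment> \<open>The element \<open>a\<close> lifts an approximant of \<open>x\<close> along
      the left map, \<open>b\<close> one of \<open>y\<close> along the right map; so far they are
      related only by having nearly equal images in the sphere.\<close>
    define a where "a = poly_subst (left_back n) v"
    define b where "b = poly_subst (right_back n) w"
    have ab: "a \<in> L.FX" "b \<in> L.FX" "a - b \<in> L.FX" using Bfree v w by (auto simp: a_def b_def)
    have \<phi>a: "\<phi>1 (?el a) = ?del v"
      unfolding \<phi>1(3)[OF ab(1)] disc_elem_def using left_back_inverse[OF v(1)] Lfree(1)[OF ab(1)] v(1)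
      by (intro D.univ_elem_cong) (simp_all add: a_def)
    have \<phi>b: "\<phi>2 (?el b) = ?del w"
      unfolding \<phi>2(3)[OF ab(2)] disc_elem_def using right_back_inverse[OF w(1)] Lfree(2)[OF ab(2)] w(1)
      by (intro D.univ_elem_cong) (simp_all add: b_def)
    have eld: "?el (s - t) = cdiff ?A (?el s) (?el t)" if "s \<in> L.FX" "t \<in> L.FX" for s t
      by (rule poly_hom_diff[OF L.univ_elem_hom that])
    note dv = del(1)[OF v(1)] and dw = del(1)[OF w(1)]
    have "?\<pi> (\<phi>1 (?el (a - b))) = cdiff ?S (?\<pi> (?del v)) (?\<beta> (?\<pi> (?del w)))"
    proof -
      have "?\<pi> (\<phi>1 (?el b)) = ?\<beta> (?\<pi> (?del w))" using compat[OF el(1)[OF ab(2)]] \<phi>b by simp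
      moreover have "\<phi>1 (?el (a - b)) = cdiff ?D (?del v) (\<phi>1 (?el b))"
        using ab el(1) \<phi>a by (simp add: eld diff)
      ultimately show ?thesis using diff(3)[OF dv closed(1)[OF el(1)[OF ab(2)]]] by simp
    qed
    moreover have "cnorm ?S (cdiff ?S (?\<pi> (?del v)) (?\<beta> (?\<pi> (?del w)))) < 2 * (r / 3)"
    proof -
      have cx: "?\<pi> x \<in> car ?S" "?\<pi> y \<in> car ?S" "?\<pi> (?del v) \<in> car ?S" "?\<pi> (?del w) \<in> car ?S"
        using closed' x y dv dw by auto
      have "cnorm ?S (cdiff ?S (?\<pi> (?del v)) (?\<pi> x)) \<le> cnorm ?D (cdiff ?D (?del v) x)"
        using \<pi>_hom(2) DA.diff_closed[OF dv x] diff(3)[OF dv x] unfolding contractive_def by metis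
      moreover have "cnorm ?S (cdiff ?S (?\<beta> (?\<pi> y)) (?\<beta> (?\<pi> (?del w)))) \<le> cnorm ?D (cdiff ?D y (?del w))"
      proof -
        have "cnorm ?S (cdiff ?S (?\<beta> (?\<pi> y)) (?\<beta> (?\<pi> (?del w)))) \<le> cnorm ?S (cdiff ?S (?\<pi> y) (?\<pi> (?del w)))"
          using \<beta>_hom(2) SA.diff_closed[OF cx(2,4)] diff(4)[OF cx(2,4)] unfolding contractive_def by metis
        also have "\<dots> \<le> cnorm ?D (cdiff ?D y (?del w))"
          using \<pi>_hom(2) DA.diff_closed[OF y dw] diff(3)[OF y dw] unfolding contractive_def by metis
        finally show ?thesis .
      qed
      moreover have "cnorm ?S (cdiff ?S (?\<pi> (?del v)) (?\<beta> (?\<pi> (?del w)))) \<le>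
          cnorm ?S (cdiff ?S (?\<pi> (?del v)) (?\<pi> x)) + cnorm ?S (cdiff ?S (?\<beta> (?\<pi> y)) (?\<beta> (?\<pi> (?del w))))"
        using SA.norm_diff_trans[OF cx(3) cx(1) closed''[OF cx(4)]] xy by simp
      ultimately show ?thesis using v(2) w(2) DA.norm_diff_commute[OF x dv] by simp
    qed
    moreover have "EF.quot_norm (a - b) \<le> cnorm ?S (?\<pi> (\<phi>1 (?el (a - b))))"
      using EF_bound[OF ab(3)] sel[OF sphere_subst_free[OF Lfree(1)[OF ab(3)]]]
      by (simp only: \<phi>1(3)[OF ab(3)] \<pi>_elem[OF Lfree(1)[OF ab(3)]])
    \<comment> \<open>Since \<open>a - b\<close> is small in the sphere, it lies in the sum of the
      two ideals up to an error of \<open>2 * (r / 3)\<close>.\<close>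
    ultimately have "EF.quot_norm (a - b) < 2 * (r / 3)" by simp
    from EF.quot_norm_less[OF ab(3) this] obtain k
      where "\<And>m. m \<ge> k \<Longrightarrow> ?N ((a - b) - (a - b) * (e m + f m)) < 2 * (r / 3)" by blast
    hence k: "?N ((a - b) - (a - b) * (e k + f k)) < 2 * (r / 3)" by this (rule order_refl)
    define c where "c = (a - b) - (a - b) * (e k + f k)"
    \<comment> \<open>Only the part of \<open>a - b\<close> in the first ideal is removed from
      \<open>a\<close>, so the left image stays the same. On the other hand
      \<open>d = b + c + (a - b) f_k\<close>, and the right map kills the last term, so the right
      image of \<open>d\<close> differs from that of \<open>b\<close> by the image of the small
      \<open>c\<close>.\<close>
    define d where "d = a - (a - b) * e k"
    have F: "c \<in> L.FX" "d \<in> L.FX" "(a - b) * f k \<in> L.FX" using ab ef_free by (simp_all add: c_def d_def)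
    have "poly_subst (left_subst n) d = poly_subst (left_subst n) a" by (simp add: d_def left_e)
    hence \<phi>1d: "\<phi>1 (?el d) = ?del v" using \<phi>1(3)[OF F(2)] \<phi>1(3)[OF ab(1)] \<phi>a by simp
    have "d = b + c + (a - b) * f k" by (simp add: d_def c_def algebra_simps)
    hence "poly_subst (right_subst n) (d - b) = poly_subst (right_subst n) c" by (simp add: right_f)
    hence "\<phi>2 (?el (d - b)) = \<phi>2 (?el c)" using \<phi>2(3)[of "d - b"] \<phi>2(3)[OF F(1)] F ab by simp
    moreover have "\<phi>2 (?el (d - b)) = cdiff ?D (\<phi>2 (?el d)) (?del w)"
      using F ab el(1) \<phi>b by (simp add: eld diff)
    moreover have "cnorm ?D (\<phi>2 (?el c)) \<le> ?N c"
      using \<phi>2(2) el[OF F(1)] unfolding contractive_def by metis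
    ultimately have "cnorm ?D (cdiff ?D (\<phi>2 (?el d)) (?del w)) < 2 * (r / 3)" using k by (simp add: c_def)
    hence "cnorm ?D (cdiff ?D (\<phi>2 (?el d)) y) < r"
      using DA.norm_diff_trans[OF closed(2)[OF el(1)[OF F(2)]] dw y] DA.norm_diff_commute[OF y dw] w(2) by simp
    moreover have "cnorm ?D (cdiff ?D (\<phi>1 (?el d)) x) < r"
      using \<phi>1d v(2) DA.norm_diff_commute[OF x dv] r by simp
    ultimately show ?thesis using el(1)[OF F(2)] by blast
  qed
  let ?\<Phi> = "\<lambda>a. (\<phi>1 a, \<phi>2 a)"
  have M: "car (mirror_sphere q n) = {(x, y). x \<in> car ?D \<and> y \<in> car ?D \<and> ?\<pi> x = ?\<beta> (?\<pi> y)}"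
    by (simp add: mirror_sphere_def)
  have "star_hom ?A (mirror_sphere q n) ?\<Phi>"
    using \<phi>1(1) \<phi>2(1) closed compat
    unfolding star_hom_def M by (simp add: mirror_sphere_def direct_sum_def)
  moreover have "inj_on ?\<Phi> (car ?A)"
  proof (rule inj_onI)
    fix a b assume ab: "a \<in> car ?A" "b \<in> car ?A" and eq: "?\<Phi> a = ?\<Phi> b"
    have "\<phi>1 (cdiff ?A a b) = czero ?D" "\<phi>2 (cdiff ?A a b) = czero ?D"
      using ab eq closed DA.add_inverse by (simp_all add: diff)
    hence "cnorm ?A (cdiff ?A a b) \<le> 0" using below[OF A.diff_closed[OF ab]] DA.norm_zero by simp
    hence "cnorm ?A (cdiff ?A a b) = 0" using A.norm_nonneg[OF A.diff_closed[OF ab]] by simp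
    hence "cdiff ?A a b = czero ?A" using A.norm_eq_zero[OF A.diff_closed[OF ab]] by blast
    thus "a = b" by (rule A.diff_eq_zero[OF ab])
  qed
  moreover have "(x, y) \<in> ?\<Phi> ` car ?A" if "(x, y) \<in> car (mirror_sphere q n)" for x y
  proof -
    have xy: "x \<in> car ?D" "y \<in> car ?D" "?\<pi> x = ?\<beta> (?\<pi> y)" using that by (auto simp: M)
    have "\<exists>d. d \<in> car ?A \<and> cnorm ?D (cdiff ?D (\<phi>1 d) x) < inverse (Suc k) \<and>
        cnorm ?D (cdiff ?D (\<phi>2 d) y) < inverse (Suc k)" for k
      using approx[OF xy, of "inverse (Suc k)"] by auto
    then obtain d where d: "\<And>k. d k \<in> car ?A" "\<And>k. cnorm ?D (cdiff ?D (\<phi>1 (d k)) x) < inverse (Suc k)"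
        "\<And>k. cnorm ?D (cdiff ?D (\<phi>2 (d k)) y) < inverse (Suc k)" by metis
    \<comment> \<open>The factor 2 arises because \<open>below\<close> adds the errors of the two
      components.\<close>
    have cauchy: "cnorm ?A (cdiff ?A (d i) (d j)) < 2 * (inverse (Suc i) + inverse (Suc j))" for i j
    proof -
      have "cnorm ?D (cdiff ?D (\<phi> (d i)) (\<phi> (d j))) < inverse (Suc i) + inverse (Suc j)"
        if "\<And>k. \<phi> (d k) \<in> car ?D" "z \<in> car ?D" "\<And>k. cnorm ?D (cdiff ?D (\<phi> (d k)) z) < inverse (Suc k)" for \<phi> z
        using DA.norm_diff_trans[OF that(1)[of i] that(2) that(1)[of j]] that(3)[of i] that(3)[of j]
          DA.norm_diff_commute[OF that(1)[of j] that(2)] by simp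
      from this[of \<phi>1 x] this[of \<phi>2 y] show ?thesis
        using below[OF A.diff_closed[OF d(1) d(1)], of i j] d closed xy by (simp add: diff)
    qed
    have "\<exists>a\<in>car ?A. (\<lambda>k. cnorm ?A (cdiff ?A (d k) a)) \<longlonglongrightarrow> 0"
    proof (rule A.norm_complete[OF d(1)])
      fix r :: real assume "r > 0"
      then obtain m where m: "inverse (real (Suc m)) < r / 4" using reals_Archimedean[of "r / 4"] by auto
      have inv: "inverse (real (Suc k)) < r / 4" if "k \<ge> m" for k
        using m that le_imp_inverse_le[of "real (Suc m)" "real (Suc k)"] by linarith
      have "cnorm ?A (cdiff ?A (d i) (d j)) < r" if "i \<ge> m" "j \<ge> m" for i j
        using cauchy[of i j] inv[OF that(1)] inv[OF that(2)] by simp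
      thus "\<exists>M. \<forall>i\<ge>M. \<forall>j\<ge>M. cnorm ?A (cdiff ?A (d i) (d j)) < r" by blast
    qed
    then obtain a where a: "a \<in> car ?A" "(\<lambda>k. cnorm ?A (cdiff ?A (d k) a)) \<longlonglongrightarrow> 0" by blast
    have lim: "\<phi> a = z" if \<phi>: "star_hom ?A ?D \<phi>" "contractive ?A ?D \<phi>" and z: "z \<in> car ?D"
      "\<And>k. cnorm ?D (cdiff ?D (\<phi> (d k)) z) < inverse (Suc k)" for \<phi> z
    proof (rule DA.lims_unique)
      have c: "\<phi> b \<in> car ?D" if "b \<in> car ?A" for b using \<phi>(1) that by (simp add: star_hom_def)
      show "DA.lims (\<lambda>k. \<phi> (d k)) (\<phi> a)"
      proof (rule DA.lims_I[OF _ _ _ a(2)])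
        show "cnorm ?D (cdiff ?D (\<phi> (d k)) (\<phi> a)) \<le> cnorm ?A (cdiff ?A (d k) a)" for k
          using \<phi>(2) A.diff_closed[OF d(1) a(1)] star_hom_diff[OF A.cstar_algebra_axioms \<phi>(1) d(1) a(1)]
          unfolding contractive_def by metis
      qed (use c d a in auto)
      show "DA.lims (\<lambda>k. \<phi> (d k)) z"
      proof (rule DA.lims_I)
        show "cnorm ?D (cdiff ?D (\<phi> (d k)) z) \<le> inverse (Suc k)" for k using z(2)[of k] by simp
        show "(\<lambda>k. inverse (real (Suc k))) \<longlonglongrightarrow> 0" by (rule LIMSEQ_inverse_real_of_nat)
      qed (use c d z in auto)
    qed
    have "?\<Phi> a = (x, y)" using lim[OF \<phi>1(1,2) xy(1) d(2)] lim[OF \<phi>2(1,2) xy(2) d(3)] by simp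
    thus ?thesis using a(1) by force
  qed
  ultimately have "star_iso ?A (mirror_sphere q n) ?\<Phi>"
    unfolding star_iso_def bij_betw_def by (auto simp: star_hom_def)
  thus ?thesis unfolding cstar_isomorphic_def labelled_cstar_def by blast
qed

end

theorem theorem5p12:
  fixes n :: nat and q :: real
  assumes "n \<ge> 1" and "0 < q" and "q < 1"
  shows "labelled_cstar (mirror_graph n) mirror_label (mirror_sets n) \<cong>\<^sub>C\<^sub>* mirror_sphere q n"
proof -
  interpret mirror_setting n by unfold_locales fact
  show ?thesis by (rule labelled_cstar_mirror_sphere)
qed

end
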